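(* Fix $n\ge 1$ and $t\in(0,1)$, and let $f$ be a bounded measurable function of $n$ replicas $(\vec\sigma^1,\dots,\vec\sigma^n)\in S_N^n$. Then \begin{align*} \nu_t'(f) &= \frac{h}{2}\sum_{l\le n}\nu_t\big(f a_l(\hat R_l-r)\big) - n\frac{h}{2}\nu_t\big(f a_{n+1}(\hat R_{n+1}-r)\big)\\ &\quad + 2\beta^2\sum_{1\le l<l'\le n}\nu_t\big(f a_{l,l'}(\hat R_{l,l'}-q)\big) - 2n\beta^2\sum_{l\le n}\nu_t\big(f a_{l,n+1}(\hat R_{l,n+1}-q)\big)\\ &\quad + n(n+1)\beta^2\,\nu_t\big(f a_{n+1,n+2}(\hat R_{n+1,n+2}-q)\big) + \nu_t(f\mathcal R), \end{align*} where $\nu_t'(f)=\frac{d}{dt}\nu_t(f)$ and the remainder $\mathcal R$ is a function of the replicas $\vec\sigma^1,\dots,\vec\sigma^{n+2}$ satisfying $$|\mathcal R|\le \frac{L}{N}(\beta^2+h)\Big(1+\sum_{l\le n+2}\varepsilon_l^4\Big) + L\beta^2\sum_{1\le l\ne l'\le n+2}(1+\varepsilon_l^2)(\hat R_{l,l'}-q)^2,$$ with $L$ a constant not depending on $N$ or $t$.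
   Context: Let $N\ge2$, $S_N=\{\vec\sigma\in\mathbb R^N:|\vec\sigma|=\sqrt N\}$ and $\lambda_N$ the uniform probability measure on $S_N$. Let $\xi$ be three times continuously differentiable, and $H_N$ a centered Gaussian process on $S_N$ with $\frac1N\mathbb E H_N(\vec\sigma^1)H_N(\vec\sigma^2)=\xi(R_{1,2})$, $R_{1,2}=N^{-1}\sum_{i\le N}\sigma^1_i\sigma^2_i$. Let $\beta>0$, $h\ne0$, and let $q\in[0,1)$ be the (assumed unique) solution of $h^2+\beta^2\xi'(q)=q/(1-q)^2$ (with $\xi'(q)\ge0$). Put $r=h(1-q)$, $b=h^2(1-q)+\beta^2(1-q)\xi'(q)$. Let $z$ be a standard Gaussian variable. For $\vec\sigma\in S_N$ write $\varepsilon=\sigma_N$ and $\hat\sigma_i=\sigma_i/\sqrt{(N-\varepsilon^2)/(N-1)}$ for $i\le N-1$, so $\hat{\vec\sigma}=(\hat\sigma_1,\dots,\hat\sigma_{N-1})\in S_{N-1}$. Let $H_{N-1}$ be a centered Gaussian process on $S_{N-1}$ with $\frac1{N-1}\mathbb E H_{N-1}(\hat{\vec\sigma}^1)H_{N-1}(\hat{\vec\sigma}^2)=\xi(\hat R_{1,2})$, $\hat R_{1,2}=(N-1)^{-1}\sum_{i\le N-1}\hat\sigma^1_i\hat\sigma^2_i$; $H_N,H_{N-1},z$ are independent. For $t\in[0,1]$ define $$H_t(\vec\sigma)=\sqrt t\beta H_N(\vec\sigma)+\sqrt{1-t}\beta H_{N-1}(\hat{\vec\sigma})+h\sum_{i\le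 N-1}\hat\sigma_i\Big(1+t\Big(\sqrt{\tfrac{N-\varepsilon^2}{N-1}}-1\Big)\Big)+h\varepsilon+\sqrt{1-t}\,\varepsilon z\beta\sqrt{\xi'(q)}-\tfrac12(1-t)\varepsilon^2 b.$$ For a function $f$ of $n$ replicas, $\langle f\rangle_t=Z_t^{-n}\int_{S_N^n}f\exp\sum_{l\le n}H_t(\vec\sigma^l)\,d\lambda_N^n$ with $Z_t=\int_{S_N}\exp H_t\,d\lambda_N$, and $\nu_t(f)=\mathbb E\langle f\rangle_t$ (expectation over $H_N,H_{N-1},z$). For replica $l$: $\varepsilon_l=\sigma^l_N$, $\hat R_l=(N-1)^{-1}\sum_{i\le N-1}\hat\sigma^l_i$, $\hat R_{l,l'}=(N-1)^{-1}\sum_{i\le N-1}\hat\sigma^l_i\hat\sigma^{l'}_i$, $a_l=1-\varepsilon_l^2$, and $2a_{l,l'}=\xi'(q)-\frac12(\varepsilon_l^2+\varepsilon_{l'}^2)(q\xi''(q)+\xi'(q))+\varepsilon_l\varepsilon_{l'}\xi''(q)$.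
   Formalization: In the bound on the remainder, the factor β²+h is replaced by β²+|h|, because h may be negative and for h < −β² the stated bound would be negative; for h > 0 the two agree, and for −β² < h < 0 they agree after enlarging L. *)

theory Defs
  imports "HOL-Probability.Probability"
begin

text \<open>A point of R^N is represented as a function nat => real whose coordinates
  0,...,N-1 are the paper's coordinates 1,...,N (coordinates >= N are 0).\<close>

definition vec_space :: "(nat \<Rightarrow> real) measure" where
  "vec_space = Pi\<^sub>M UNIV (\<lambda>_. borel)"

definition sphere_set :: "nat \<Rightarrow> (nat \<Rightarrow> real) set" where
  "sphere_set N = {\<sigma>. (\<forall>i\<ge>N. \<sigma> i = 0) \<and> (\<Sum>i<N. (\<sigma> i)\<^sup>2) = real N}"

text \<open>Uniform probability measure lambda_N on S_N: the law of sqrt N * g/|g| for a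
  standard Gaussian vector g in R^N (rotation invariant probability on S_N).\<close>
definition sphere_measure :: "nat \<Rightarrow> (nat \<Rightarrow> real) measure" where
  "sphere_measure N =
     distr (Pi\<^sub>M {..<N} (\<lambda>_. density lborel (\<lambda>x. ennreal (std_normal_density x)))) vec_space
       (\<lambda>g i. if i < N then sqrt (real N) * g i / sqrt (\<Sum>j<N. (g j)\<^sup>2) else 0)"

definition overlap :: "nat \<Rightarrow> (nat \<Rightarrow> real) \<Rightarrow> (nat \<Rightarrow> real) \<Rightarrow> real" where
  "overlap N \<sigma> \<tau> = (\<Sum>i<N. \<sigma> i * \<tau> i) / real N"

text \<open>epsilon = sigma_N (stored at index N-1), and the rescaled vector hat sigma in S_{N-1}.\<close>
definition eps :: "nat \<Rightarrow> (nat \<Rightarrow> real) \<Rightarrow> real" where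
  "eps N \<sigma> = \<sigma> (N - 1)"

definition hat :: "nat \<Rightarrow> (nat \<Rightarrow> real) \<Rightarrow> (nat \<Rightarrow> real)" where
  "hat N \<sigma> = (\<lambda>i. if i < N - 1
      then \<sigma> i / sqrt ((real N - (eps N \<sigma>)\<^sup>2) / (real N - 1)) else 0)"

definition hatR1 :: "nat \<Rightarrow> (nat \<Rightarrow> real) \<Rightarrow> real" where
  "hatR1 N \<sigma> = (\<Sum>i<N - 1. hat N \<sigma> i) / (real N - 1)"

definition hatR2 :: "nat \<Rightarrow> (nat \<Rightarrow> real) \<Rightarrow> (nat \<Rightarrow> real) \<Rightarrow> real" where
  "hatR2 N \<sigma> \<tau> = overlap (N - 1) (hat N \<sigma>) (hat N \<tau>)"

definition normal_rv :: "'w measure \<Rightarrow> ('w \<Rightarrow> real) \<Rightarrow> real \<Rightarrow> real \<Rightarrow> bool" where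
  "normal_rv M X m v \<longleftrightarrow> X \<in> borel_measurable M \<and>
     (if v = 0 then (AE w in M. X w = m)
      else v > 0 \<and> distributed M lborel X (\<lambda>x. ennreal (normal_density m (sqrt v) x)))"

definition centered_gaussian_process ::
  "'w measure \<Rightarrow> ('w \<Rightarrow> 'a \<Rightarrow> real) \<Rightarrow> 'a set \<Rightarrow> ('a \<Rightarrow> 'a \<Rightarrow> real) \<Rightarrow> bool" where
  "centered_gaussian_process M X S C \<longleftrightarrow>
     (\<forall>F c. finite F \<and> F \<subseteq> S \<longrightarrow>
        normal_rv M (\<lambda>w. \<Sum>x\<in>F. c x * X w x) 0 (\<Sum>x\<in>F. \<Sum>y\<in>F. c x * c y * C x y))"

text \<open>Mutual independence of three random elements with values in different spaces
  (the definition of indep_vars, specialised to three variables of different types).\<close>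
definition indep3 :: "'w measure \<Rightarrow> 'a measure \<Rightarrow> ('w \<Rightarrow> 'a) \<Rightarrow> 'b measure \<Rightarrow> ('w \<Rightarrow> 'b)
    \<Rightarrow> 'c measure \<Rightarrow> ('w \<Rightarrow> 'c) \<Rightarrow> bool" where
  "indep3 M MX X MY Y MZ Z \<longleftrightarrow>
     X \<in> measurable M MX \<and> Y \<in> measurable M MY \<and> Z \<in> measurable M MZ \<and>
     prob_space.indep_sets M
       (\<lambda>i::nat. if i = 0 then {X -` A \<inter> space M | A. A \<in> sets MX}
                 else if i = 1 then {Y -` A \<inter> space M | A. A \<in> sets MY}
                 else {Z -` A \<inter> space M | A. A \<in> sets MZ}) {0, 1, 2}"

definition bconst :: "real \<Rightarrow> real \<Rightarrow> (real \<Rightarrow> real) \<Rightarrow> real \<Rightarrow> real" where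
  "bconst \<beta> h \<xi>' q = h\<^sup>2 * (1 - q) + \<beta>\<^sup>2 * (1 - q) * \<xi>' q"

definition Ht :: "nat \<Rightarrow> real \<Rightarrow> real \<Rightarrow> (real \<Rightarrow> real) \<Rightarrow> real
    \<Rightarrow> ('w \<Rightarrow> (nat \<Rightarrow> real) \<Rightarrow> real) \<Rightarrow> ('w \<Rightarrow> (nat \<Rightarrow> real) \<Rightarrow> real) \<Rightarrow> ('w \<Rightarrow> real)
    \<Rightarrow> real \<Rightarrow> 'w \<Rightarrow> (nat \<Rightarrow> real) \<Rightarrow> real" where
  "Ht N \<beta> h \<xi>' q HN HN1 z t w \<sigma> =
     sqrt t * \<beta> * HN w \<sigma> + sqrt (1 - t) * \<beta> * HN1 w (hat N \<sigma>)
     + h * (\<Sum>i<N - 1. hat N \<sigma> i)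
         * (1 + t * (sqrt ((real N - (eps N \<sigma>)\<^sup>2) / (real N - 1)) - 1))
     + h * eps N \<sigma> + sqrt (1 - t) * eps N \<sigma> * z w * \<beta> * sqrt (\<xi>' q)
     - (1 / 2) * (1 - t) * (eps N \<sigma>)\<^sup>2 * bconst \<beta> h \<xi>' q"

definition gibbs :: "nat \<Rightarrow> ((nat \<Rightarrow> real) \<Rightarrow> real) \<Rightarrow> nat \<Rightarrow> ((nat \<Rightarrow> nat \<Rightarrow> real) \<Rightarrow> real) \<Rightarrow> real" where
  "gibbs N H k g =
     (\<integral>\<sigma>. g \<sigma> * exp (\<Sum>l\<in>{1..k}. H (\<sigma> l)) \<partial>(Pi\<^sub>M {1..k} (\<lambda>_. sphere_measure N)))
     / (\<integral>x. exp (H x) \<partial>sphere_measure N) ^ k"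

definition nu :: "'w measure \<Rightarrow> nat \<Rightarrow> ('w \<Rightarrow> (nat \<Rightarrow> real) \<Rightarrow> real) \<Rightarrow> nat
    \<Rightarrow> ((nat \<Rightarrow> nat \<Rightarrow> real) \<Rightarrow> real) \<Rightarrow> real" where
  "nu M N H k g = (\<integral>w. gibbs N (H w) k g \<partial>M)"

definition a1 :: "nat \<Rightarrow> (nat \<Rightarrow> real) \<Rightarrow> real" where
  "a1 N \<sigma> = 1 - (eps N \<sigma>)\<^sup>2"

definition a2 :: "(real \<Rightarrow> real) \<Rightarrow> (real \<Rightarrow> real) \<Rightarrow> real \<Rightarrow> nat
    \<Rightarrow> (nat \<Rightarrow> real) \<Rightarrow> (nat \<Rightarrow> real) \<Rightarrow> real" where
  "a2 \<xi>' \<xi>'' q N \<sigma> \<tau> =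
     (\<xi>' q - (1 / 2) * ((eps N \<sigma>)\<^sup>2 + (eps N \<tau>)\<^sup>2) * (q * \<xi>'' q + \<xi>' q)
      + eps N \<sigma> * eps N \<tau> * \<xi>'' q) / 2"

end

theory Submission
  imports Defs
begin

text \<open>
  Write the Hamiltonian as \<open>sqrt t U + sqrt (1 - t) V + D0 + t D1\<close> with \<open>U\<close>, \<open>V\<close> independent and jointly
  Gaussian. Differentiating the Gibbs average brings down \<open>U / (2 sqrt t) - V / (2 sqrt (1 - t)) + D1\<close>,
  and Gaussian integration by parts turns its Gaussian part into sums over pairs of replicas of
  \<open>\<Gamma> = (Cov U - Cov V) / 2\<close>. A second order Taylor expansion of \<open>\<xi>\<close> around \<open>q\<close> gives
  \<open>\<Gamma>(\<sigma>, \<tau>) = const + \<phi>(\<sigma>) + \<phi>(\<tau>) + \<beta>\<^sup>2 a (R - q) + error\<close>, and the drift together with the diagonal of \<open>\<Gamma>\<close>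
  expands as \<open>const + 2 \<phi>(\<sigma>)\<close>, the term in \<open>R - r\<close> and an error; the value of \<open>b\<close> is what makes the two \<open>\<phi>\<close>
  agree. In the derivative the constants and \<open>\<phi>\<close> then cancel, up to a function that is antisymmetric
  in the replicas \<open>n + 1\<close> and \<open>n + 2\<close> and hence has mean zero.

  The processes are only jointly measurable, so the partition function need not be a limit of
  functions of finitely many values of the process and integration by parts cannot be reduced to
  finite dimensions directly. Instead, for a standard Gaussian \<open>g\<close> of the Gaussian space, the process
  \<open>H + Cov(g, H) (s - g)\<close> on \<open>\<real> \<times> \<Omega>\<close>, together with the coordinate \<open>s\<close>, has the same finite-dimensional
  distributions under the law of \<open>(g, \<omega>)\<close> and under the product of the normal law with \<open>P\<close>. Parametric
  integrals agree almost surely, under both laws, with functions measurable for the generated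
  sigma-algebra, so expectations may be computed under the product, where integration by parts is
  one-dimensional in \<open>s\<close>.
\<close>

section \<open>Normal laws and measures agreeing on a sub-sigma-algebra\<close>

text \<open>Where the error of order 1/N comes from: let \<open>\<rho>\<close> be the rescaled
  overlap and \<open>R\<close> the original one. \<open>N (R - \<rho>)\<close> is of order
  \<open>e^2 + e'^2\<close>, so the Taylor remainder of \<xi> between \<open>\<rho>\<close> and
  \<open>R\<close> costs \<open>N (R - \<rho>)^2\<close>, that is \<open>(e^4 + e'^4) / N\<close>.
  The first order term contains \<open>e e' \<xi>1(\<rho>)\<close>; the variable \<open>z\<close> is
  in the Hamiltonian to remove its value at \<open>q\<close>. Expanding what is left at
  \<open>q\<close> yields the factor \<open>a2\<close> and an error quadratic in
  \<open>\<rho> - q\<close>. In the drift, the large sum of the rescaled spins has the coefficient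
  \<open>scale - 1\<close>, which is about \<open>(1 - e^2) / (2 (N - 1))\<close>. The analytic
  obstacle is that nothing is assumed about the supremum of the processes over the sphere. Every
  domination therefore goes through exponential moments that are uniform in the configuration, and
  \<open>1 / Z\<close> is controlled by Jensen's inequality instead of by a lower bound on the
  Hamiltonian. Exchanging expectation, replica integral and derivative rests on these
  moments.\<close>

lemma normal_mgf:
  assumes "0 < s"
  shows "integrable lborel (\<lambda>x. normal_density 0 s x * exp x)"
    and "(\<integral>x. normal_density 0 s x * exp x \<partial>lborel) = exp (s\<^sup>2 / 2)"
proof -
  have "normal_density 0 s x * exp x = exp (s\<^sup>2/2) * normal_density (s\<^sup>2) s x" for x
  proof -
    have "- ((x - 0)\<^sup>2) / (2 * s\<^sup>2) + x = s\<^sup>2/2 + (- ((x - s\<^sup>2)\<^sup>2) / (2 * s\<^sup>2))"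
      using assms by (simp add: field_simps power2_eq_square)
    then show ?thesis
      unfolding normal_density_def by (simp add: exp_add[symmetric] mult_ac)
  qed
  then show "integrable lborel (\<lambda>x. normal_density 0 s x * exp x)"
    and "(\<integral>x. normal_density 0 s x * exp x \<partial>lborel) = exp (s\<^sup>2 / 2)"
    using assms by simp_all
qed

text \<open>The case distinction follows \<open>normal_rv\<close>, where variance 0 means a point
  mass without density. The resulting formulas are uniform in \<open>v\<close>, so later arguments
  never have to separate degenerate variables.\<close>

lemma (in prob_space)
  assumes X: "normal_rv M X 0 v"
  shows normal_rv_integrable_exp: "integrable M (\<lambda>w. exp (X w))"
    and normal_rv_exp: "expectation (\<lambda>w. exp (X w)) = exp (v / 2)"
    and normal_rv_integrable_power2: "integrable M (\<lambda>w. (X w)\<^sup>2)"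
    and normal_rv_power2: "expectation (\<lambda>w. (X w)\<^sup>2) = v"
    and normal_rv_iexp: "(CLINT w|M. iexp (X w)) = complex_of_real (exp (- v / 2))"
    and normal_rv_var_nonneg: "0 \<le> v"
    and normal_rv_measurable: "X \<in> borel_measurable M"
proof -
  show [measurable]: "X \<in> borel_measurable M" using X by (simp add: normal_rv_def)
  show "0 \<le> v" using X by (auto simp: normal_rv_def split: if_splits)
  have "integrable M (\<lambda>w. exp (X w)) \<and> expectation (\<lambda>w. exp (X w)) = exp (v / 2)
    \<and> integrable M (\<lambda>w. (X w)\<^sup>2) \<and> expectation (\<lambda>w. (X w)\<^sup>2) = v
    \<and> (CLINT w|M. iexp (X w)) = complex_of_real (exp (- v / 2))"
  proof (cases "v = 0")
    case True
    then have ae: "AE w in M. X w = 0" using X by (simp add: normal_rv_def)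
    have "integrable M (\<lambda>w. exp (X w)) \<longleftrightarrow> integrable M (\<lambda>w. 1::real)"
      by (rule integrable_cong_AE) (use ae in auto)
    moreover have "expectation (\<lambda>w. exp (X w)) = expectation (\<lambda>w. 1)"
      by (rule integral_cong_AE) (use ae in auto)
    moreover have "integrable M (\<lambda>w. (X w)\<^sup>2) \<longleftrightarrow> integrable M (\<lambda>w. 0::real)"
      by (rule integrable_cong_AE) (use ae in auto)
    moreover have "expectation (\<lambda>w. (X w)\<^sup>2) = expectation (\<lambda>w. 0)"
      by (rule integral_cong_AE) (use ae in auto)
    moreover have "(CLINT w|M. iexp (X w)) = (CLINT w|M. 1)"
      by (rule integral_cong_AE) (use ae in auto)
    ultimately show ?thesis using True by (simp add: prob_space)
  next
    case False
    then have v: "0 < v" and D: "distributed M lborel X (\<lambda>x. ennreal (normal_density 0 (sqrt v) x))"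
      using X by (auto simp: normal_rv_def)
    have s: "0 < sqrt v" "(sqrt v)\<^sup>2 = v" using v by auto
    have 1: "integrable M (\<lambda>w. exp (X w))"
      using distributed_integrable[OF D, of exp] normal_mgf(1)[OF s(1)] by simp
    have 2: "expectation (\<lambda>w. exp (X w)) = exp (v / 2)"
      using distributed_integral[OF D, of exp] normal_mgf(2)[OF s(1)] s by simp
    have 3: "integrable M (\<lambda>w. (X w)\<^sup>2)"
      using distributed_integrable[OF D, of "\<lambda>x. x\<^sup>2"] integrable_normal_moment[OF s(1), of 0 2] by simp
    have 4: "expectation (\<lambda>w. (X w)\<^sup>2) = v"
      using distributed_integral[OF D, of "\<lambda>x. x\<^sup>2"] integral_normal_moment_even[OF s(1), of 0 1] s
      by simp
    have D': "distributed M lborel (\<lambda>x. (X x - 0) / sqrt v) (\<lambda>x. ennreal (std_normal_density x))"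
      using normal_standard_normal_convert[OF s(1), of X 0] D by simp
    have DD: "distr M lborel (\<lambda>w. X w / sqrt v) = std_normal_distribution"
      using distributed_distr_eq_density[OF D'] by simp
    have "(CLINT w|M. iexp (X w)) = (CLINT w|M. iexp (sqrt v * (X w / sqrt v)))"
      using s by simp
    also have "\<dots> = (CLINT x|distr M lborel (\<lambda>w. X w / sqrt v). iexp (sqrt v * x))"
      by (subst integral_distr) auto
    also have "\<dots> = char std_normal_distribution (sqrt v)"
      by (simp add: DD char_def)
    also have "\<dots> = complex_of_real (exp (- v / 2))"
      using v by (simp add: char_std_normal_distribution)
    finally show ?thesis using 1 2 3 4 by blast
  qed
  then show "integrable M (\<lambda>w. exp (X w))" "expectation (\<lambda>w. exp (X w)) = exp (v / 2)"
    "integrable M (\<lambda>w. (X w)\<^sup>2)" "expectation (\<lambda>w. (X w)\<^sup>2) = v"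
    "(CLINT w|M. iexp (X w)) = complex_of_real (exp (- v / 2))" by blast+
qed

section \<open>Laws determined by their finite linear combinations\<close>

text \<open>Normalizing \<open>k\<close> to a probability density turns both sides into laws of
  \<open>X\<close> on the line, and equality of their characteristic functions gives equality of the
  laws. The phase \<open>\<theta>\<close> keeps everything real: shifting it yields the sine as well
  as the cosine. If \<open>k\<close> has total mass 0, it vanishes almost everywhere under both
  measures.\<close>

lemma char_density_unique:
  fixes k X :: "'o \<Rightarrow> real"
  assumes "finite_measure P" "finite_measure Q" and sets: "sets Q = sets P"
    and [measurable]: "k \<in> borel_measurable P" "X \<in> borel_measurable P"
    and k: "\<And>x. 0 \<le> k x" "\<And>x. k x \<le> K"
    and eq: "\<And>s \<theta>. (\<integral>x. k x * cos (s * X x + \<theta>) \<partial>P) = (\<integral>x. k x * cos (s * X x + \<theta>) \<partial>Q)"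
    and B: "B \<in> sets borel"
  shows "(\<integral>x. k x * indicator B (X x) \<partial>P) = (\<integral>x. k x * indicator B (X x) \<partial>Q)"
proof -
  interpret P: finite_measure P by fact
  interpret Q: finite_measure Q by fact
  note sets[measurable_cong] B[measurable]
  have kg: "\<bar>k x * g x\<bar> \<le> K" if "\<And>x. \<bar>g x\<bar> \<le> 1" for g :: "'o \<Rightarrow> real" and x
    using mult_mono[of "k x" K "\<bar>g x\<bar>" 1] k[of x] that[of x] by (simp add: abs_mult)
  have intP: "integrable P (\<lambda>x. k x * g x)" if [measurable]: "g \<in> borel_measurable P" and "\<And>x. \<bar>g x\<bar> \<le> 1" for g
    by (rule P.integrable_const_bound[of _ K]) (use kg[of g] that in auto)
  have intQ: "integrable Q (\<lambda>x. k x * g x)" if [measurable]: "g \<in> borel_measurable P" and "\<And>x. \<bar>g x\<bar> \<le> 1" for g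
    by (rule Q.integrable_const_bound[of _ K]) (use kg[of g] that in auto)
  have kP: "integrable P k" "integrable Q k"
    using intP[of "\<lambda>_. 1"] intQ[of "\<lambda>_. 1"] by auto
  define m where "m = (\<integral>x. k x \<partial>P)"
  have mQ: "m = (\<integral>x. k x \<partial>Q)" using eq[of 0 0] by (simp add: m_def)
  have m0: "0 \<le> m" unfolding m_def by (rule Bochner_Integration.integral_nonneg) (use k in auto)
  show ?thesis
  proof (cases "m = 0")
    case True
    have "AE x in P. k x = 0"
      using integral_nonneg_eq_0_iff_AE[OF kP(1)] True k by (simp add: m_def)
    moreover have "AE x in Q. k x = 0"
      using integral_nonneg_eq_0_iff_AE[OF kP(2)] True k mQ by (simp)
    ultimately have "(\<integral>x. k x * indicator B (X x) \<partial>P) = 0" "(\<integral>x. k x * indicator B (X x) \<partial>Q) = 0"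
      by (auto intro!: integral_eq_zero_AE)
    then show ?thesis by simp
  next
    case False
    then have m: "0 < m" using m0 by simp
    define D where "D R = distr (density R (\<lambda>x. ennreal (k x / m))) borel X" for R
    have intD: "(\<integral>x. g x \<partial>D P) = (\<integral>x. k x * g (X x) \<partial>P) / m"
      "(\<integral>x. g x \<partial>D Q) = (\<integral>x. k x * g (X x) \<partial>Q) / m"
      if [measurable]: "g \<in> borel_measurable borel" for g :: "real \<Rightarrow> real"
      using m k by (simp_all add: D_def integral_distr integral_density)
    have one: "emeasure (D R) (space (D R)) = ennreal ((\<integral>x. k x \<partial>R) / m)" if "R = P \<or> R = Q" for R
    proof -
      have "sets R = sets P" using that sets by auto
      then have [measurable]: "k \<in> borel_measurable R" "X \<in> borel_measurable R"
        using assms(4,5) by (simp_all cong: measurable_cong_sets)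
      have i: "integrable R (\<lambda>x. k x / m)" using that kP by (elim disjE) simp_all
      have "emeasure (D R) (space (D R)) = emeasure (density R (\<lambda>x. ennreal (k x / m))) (space R)"
        by (simp add: D_def emeasure_distr)
      also have "\<dots> = (\<integral>\<^sup>+x. ennreal (k x / m) * indicator (space R) x \<partial>R)"
        by (subst emeasure_density) auto
      also have "\<dots> = (\<integral>\<^sup>+x. ennreal (k x / m) \<partial>R)"
        by (intro nn_integral_cong) simp
      also have "\<dots> = ennreal (\<integral>x. k x / m \<partial>R)"
        using nn_integral_eq_integral[OF i] k m by simp
      finally show ?thesis by simp
    qed
    have pP: "prob_space (D P)" "prob_space (D Q)"
      using one[of P] one[of Q] m by (auto intro!: prob_spaceI simp: m_def[symmetric] mQ[symmetric])
    have rd: "real_distribution (D P)" "real_distribution (D Q)"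
      using pP by (simp_all add: real_distribution_def real_distribution_axioms_def D_def)
    have "char (D P) = char (D Q)"
    proof
      fix s
      have fin: "finite_measure (D P)" "finite_measure (D Q)"
        using pP by (simp_all add: prob_space.finite_measure)
      \<comment> \<open>The phase \<open>- pi/2\<close> turns the cosine into the sine, so the
        hypothesis at two phases gives both parts of the characteristic function.\<close>
      have *: "char (D R) s = Complex (\<integral>x. cos (s * x + 0) \<partial>D R) (\<integral>x. cos (s * x + - pi/2) \<partial>D R)"
        if R: "R = P \<or> R = Q" for R
      proof -
        interpret R: real_distribution "D R" using rd R by auto
        have i: "integrable (D R) (\<lambda>x. iexp (s * x))" by (rule R.integrable_iexp) auto
        have ii: "integrable (D R) (\<lambda>x. cos (s * x))" "integrable (D R) (\<lambda>x. sin (s * x))"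
          by (rule R.integrable_const_bound[of _ 1]; simp)+
        have "iexp (s * x) = complex_of_real (cos (s * x)) + \<i> * complex_of_real (sin (s * x))" for x
          by (metis cis_conv_exp complex_eq cis.sel)
        then have "char (D R) s = complex_of_real (\<integral>x. cos (s * x) \<partial>D R) + \<i> * complex_of_real (\<integral>x. sin (s * x) \<partial>D R)"
          unfolding char_def using ii by simp
        moreover have "cos (s * x + - pi/2) = sin (s * x)" for x by (simp add: cos_diff)
        ultimately show ?thesis by (simp add: complex_eq_iff)
      qed
      have "(\<integral>x. cos (s * x + \<theta>) \<partial>D P) = (\<integral>x. cos (s * x + \<theta>) \<partial>D Q)" for \<theta>
        by (simp add: intD eq)
      from this[of 0] this[of "- pi/2"] show "char (D P) s = char (D Q) s"
        using *[of P] *[of Q] by simp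
    qed
    then have "D P = D Q" using rd by (intro Levy_uniqueness)
    then have "(\<integral>x. indicator B x \<partial>D P) = (\<integral>x. (indicator B x :: real) \<partial>D Q)" by simp
    then show ?thesis using m intD(1)[of "indicator B"] intD(2)[of "indicator B"] by simp
  qed
qed

text \<open>Only the one-dimensional uniqueness theorem is used. The class \<open>good\<close> of
  weights \<open>u\<close> for which all means of \<open>u\<close> times a cosine of a linear
  combination agree contains 1 and is stable under multiplication by the indicator of one
  coordinate. Hence it contains the indicators of all finite-dimensional cylinders, which determine
  a law on the infinite product.\<close>

theorem Cramer_Wold_distr:
  fixes X :: "'i \<Rightarrow> 'o \<Rightarrow> real"
  assumes "prob_space P" "prob_space Q" and sets: "sets Q = sets P"
    and X[measurable]: "\<And>i. X i \<in> borel_measurable P"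
    and eq: "\<And>F c. finite F \<Longrightarrow>
      (CLINT x|P. iexp (\<Sum>i\<in>F. c i * X i x)) = (CLINT x|Q. iexp (\<Sum>i\<in>F. c i * X i x))"
  shows "distr P (Pi\<^sub>M UNIV (\<lambda>_. borel)) (\<lambda>x i. X i x) = distr Q (Pi\<^sub>M UNIV (\<lambda>_. borel)) (\<lambda>x i. X i x)"
proof -
  interpret P: prob_space P by fact
  interpret Q: prob_space Q by fact
  note sets[measurable_cong]
  define good where "good u \<longleftrightarrow> (\<forall>F c \<theta>. finite F \<longrightarrow>
     (\<integral>x. u x * cos ((\<Sum>i\<in>F. c i * X i x) + \<theta>) \<partial>P) = (\<integral>x. u x * cos ((\<Sum>i\<in>F. c i * X i x) + \<theta>) \<partial>Q))"
    for u :: "'o \<Rightarrow> real"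
  have good1: "good (\<lambda>_. 1)"
    unfolding good_def
  proof (intro allI impI)
    fix F :: "'i set" and c \<theta> assume F: "finite F"
    have *: "(\<integral>x. 1 * cos ((\<Sum>i\<in>F. c i * X i x) + \<theta>) \<partial>R) = Re (cis \<theta> * (CLINT x|R. iexp (\<Sum>i\<in>F. c i * X i x)))"
      if R: "R = P \<or> R = Q" for R
    proof -
      interpret R: prob_space R using that P.prob_space_axioms Q.prob_space_axioms by auto
      have [measurable_cong]: "sets R = sets P" using that sets by auto
      have i: "integrable R (\<lambda>x. iexp (\<Sum>i\<in>F. c i * X i x))"
        by (rule R.integrable_const_bound[of _ 1]) auto
      have "Re (cis \<theta> * (CLINT x|R. iexp (\<Sum>i\<in>F. c i * X i x))) = Re (CLINT x|R. cis \<theta> * iexp (\<Sum>i\<in>F. c i * X i x))"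
        using i by simp
      also have "\<dots> = (\<integral>x. Re (cis \<theta> * iexp (\<Sum>i\<in>F. c i * X i x)) \<partial>R)"
        using i by (subst integral_Re) auto
      also have "\<dots> = (\<integral>x. cos ((\<Sum>i\<in>F. c i * X i x) + \<theta>) \<partial>R)"
        by (intro Bochner_Integration.integral_cong refl)
          (simp only: cis_conv_exp[symmetric] cis_mult cis.sel add.commute)
      finally show ?thesis by simp
    qed
    show "(\<integral>x. 1 * cos ((\<Sum>i\<in>F. c i * X i x) + \<theta>) \<partial>P) = (\<integral>x. 1 * cos ((\<Sum>i\<in>F. c i * X i x) + \<theta>) \<partial>Q)"
      using *[of P] *[of Q] eq[OF F, of c] by simp
  qed
  have step: "good (\<lambda>x. u x * indicator B (X j x))"
    if u: "good u" and [measurable]: "u \<in> borel_measurable P" and u01: "\<And>x. 0 \<le> u x" "\<And>x. u x \<le> 1"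
      and B[measurable]: "B \<in> sets borel" for u j B
    unfolding good_def
  proof (intro allI impI)
    fix F :: "'i set" and c \<theta> assume F: "finite F"
    define L where "L x = (\<Sum>i\<in>F. c i * X i x)" for x
    have [measurable]: "L \<in> borel_measurable P" unfolding L_def by measurable
    have comb: "(\<integral>x. u x * cos (a * L x + s * X j x + \<phi>) \<partial>P) = (\<integral>x. u x * cos (a * L x + s * X j x + \<phi>) \<partial>Q)" for a s \<phi>
    proof -
      \<comment> \<open>The index \<open>j\<close> may already occur in \<open>F\<close>, so the two
        coefficients are added rather than one replacing the other.\<close>
      let ?c = "\<lambda>i. (if i \<in> F then a * c i else 0) + (if i = j then s else 0)"
      have "(\<Sum>i\<in>insert j F. ?c i * X i x) = a * L x + s * X j x" for x
      proof -
        have "(\<Sum>i\<in>insert j F. ?c i * X i x) =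
          (\<Sum>i\<in>insert j F. (if i \<in> F then a * c i * X i x else 0)) + (\<Sum>i\<in>insert j F. (if i = j then s * X i x else 0))"
          by (auto simp: sum.distrib[symmetric] algebra_simps intro!: sum.cong)
        also have "(\<Sum>i\<in>insert j F. (if i \<in> F then a * c i * X i x else 0)) = (\<Sum>i\<in>F. a * c i * X i x)"
          using F by (intro sum.mono_neutral_cong_right) auto
        also have "(\<Sum>i\<in>insert j F. (if i = j then s * X i x else 0)) = s * X j x"
          using F by (simp add: sum.delta)
        finally show ?thesis by (simp add: L_def sum_distrib_left mult.assoc)
      qed
      then show ?thesis
        using u[unfolded good_def, rule_format, of "insert j F" ?c \<phi>] F by simp
    qed
    have bnd: "integrable R (\<lambda>x. u x * g x)" if "R = P \<or> R = Q" and [measurable]: "g \<in> borel_measurable P" and "\<And>x. \<bar>g x\<bar> \<le> 1" for R g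
    proof -
      interpret R: prob_space R using that P.prob_space_axioms Q.prob_space_axioms by auto
      have [measurable_cong]: "sets R = sets P" using that sets by auto
      show ?thesis
        by (rule R.integrable_const_bound[of _ 1]) (use that u01 in \<open>auto simp: abs_mult intro!: mult_le_one\<close>)
    qed
    have A: "(\<integral>x. u x * indicator B (X j x) \<partial>P) = (\<integral>x. u x * indicator B (X j x) \<partial>Q)"
    proof (rule char_density_unique[OF P.finite_measure_axioms Q.finite_measure_axioms sets _ _ u01 _ B])
      fix s \<phi> show "(\<integral>x. u x * cos (s * X j x + \<phi>) \<partial>P) = (\<integral>x. u x * cos (s * X j x + \<phi>) \<partial>Q)"
        using comb[of 0 s \<phi>] by simp
    qed auto
    \<comment> \<open>A density must be nonnegative, hence \<open>1 + cos\<close> in place of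
      \<open>cos\<close>. Product-to-sum formulas reduce it to the linear combinations covered by
      \<open>comb\<close>, and \<open>A\<close> subtracts the summand 1 again.\<close>
    have B': "(\<integral>x. (u x * (1 + cos (L x + \<theta>))) * indicator B (X j x) \<partial>P)
      = (\<integral>x. (u x * (1 + cos (L x + \<theta>))) * indicator B (X j x) \<partial>Q)"
    proof (rule char_density_unique[OF P.finite_measure_axioms Q.finite_measure_axioms sets _ _ _ _ _ B, where K=2])
      fix s \<phi>
      have id: "u x * (1 + cos (L x + \<theta>)) * cos (s * X j x + \<phi>) = u x * cos (0 * L x + s * X j x + \<phi>)
         + (u x * cos (1 * L x + s * X j x + (\<theta> + \<phi>)) + u x * cos (1 * L x + (- s) * X j x + (\<theta> - \<phi>))) / 2" for x
      proof -
        have e: "cos (L x + \<theta>) * cos (s * X j x + \<phi>) = (cos (L x + \<theta> - (s * X j x + \<phi>)) + cos (L x + \<theta> + (s * X j x + \<phi>))) / 2"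
          by (rule cos_times_cos)
        have e2: "L x + \<theta> - (s * X j x + \<phi>) = L x + (- s) * X j x + (\<theta> - \<phi>)"
         "L x + \<theta> + (s * X j x + \<phi>) = L x + s * X j x + (\<theta> + \<phi>)" by (simp_all add: algebra_simps)
        have "u x * (1 + cos (L x + \<theta>)) * cos (s * X j x + \<phi>) = u x * cos (s * X j x + \<phi>) + u x * (cos (L x + \<theta>) * cos (s * X j x + \<phi>))"
          by (simp add: algebra_simps)
        also have "\<dots> = u x * cos (s * X j x + \<phi>) + (u x * cos (L x + s * X j x + (\<theta> + \<phi>)) + u x * cos (L x + (- s) * X j x + (\<theta> - \<phi>))) / 2"
          unfolding e e2 by (simp add: algebra_simps)
        finally show ?thesis by simp
      qed
      have int: "(\<integral>x. u x * (1 + cos (L x + \<theta>)) * cos (s * X j x + \<phi>) \<partial>R)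
        = (\<integral>x. u x * cos (0 * L x + s * X j x + \<phi>) \<partial>R)
         + ((\<integral>x. u x * cos (1 * L x + s * X j x + (\<theta> + \<phi>)) \<partial>R) + (\<integral>x. u x * cos (1 * L x + (- s) * X j x + (\<theta> - \<phi>)) \<partial>R)) / 2"
        if "R = P \<or> R = Q" for R
        unfolding id using that by (simp add: bnd)
      show "(\<integral>x. u x * (1 + cos (L x + \<theta>)) * cos (s * X j x + \<phi>) \<partial>P) = (\<integral>x. u x * (1 + cos (L x + \<theta>)) * cos (s * X j x + \<phi>) \<partial>Q)"
        using int[of P] int[of Q] by (simp only: comb simp_thms)
    next
      fix x
      have c: "0 \<le> 1 + cos (L x + \<theta>)" "1 + cos (L x + \<theta>) \<le> 2"
        using cos_ge_minus_one[of "L x + \<theta>"] cos_le_one[of "L x + \<theta>"] by linarith+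
      then show "0 \<le> u x * (1 + cos (L x + \<theta>))" "u x * (1 + cos (L x + \<theta>)) \<le> 2"
        using u01[of x] mult_mono[of "u x" 1 "1 + cos (L x + \<theta>)" 2] by auto
    qed auto
    have split: "(\<integral>x. u x * indicator B (X j x) * cos (L x + \<theta>) \<partial>R)
       = (\<integral>x. (u x * (1 + cos (L x + \<theta>))) * indicator B (X j x) \<partial>R) - (\<integral>x. u x * indicator B (X j x) \<partial>R)"
      if R: "R = P \<or> R = Q" for R
    proof -
      have "integrable R (\<lambda>x. u x * (indicator B (X j x) * cos (L x + \<theta>)))"
        by (rule bnd[OF R]) (auto split: split_indicator)
      moreover have "integrable R (\<lambda>x. u x * indicator B (X j x))"
        by (rule bnd[OF R]) (auto split: split_indicator)
      ultimately show ?thesis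
        by (subst Bochner_Integration.integral_diff[symmetric])
          (auto simp: algebra_simps intro!: Bochner_Integration.integral_cong)
    qed
    show "(\<integral>x. u x * indicator B (X j x) * cos ((\<Sum>i\<in>F. c i * X i x) + \<theta>) \<partial>P)
      = (\<integral>x. u x * indicator B (X j x) * cos ((\<Sum>i\<in>F. c i * X i x) + \<theta>) \<partial>Q)"
      using split[of P] split[of Q] A B' by (simp add: L_def)
  qed
  have prods: "good (\<lambda>x. \<Prod>i\<in>J. indicator (A i) (X i x))"
    if "finite J" "\<And>i. i \<in> J \<Longrightarrow> A i \<in> sets borel" for J and A :: "'i \<Rightarrow> real set"
    using that
  proof (induction J rule: finite_induct)
    case empty then show ?case using good1 by simp
  next
    case (insert j J)
    have "good (\<lambda>x. (\<Prod>i\<in>J. indicator (A i) (X i x)) * indicator (A j) (X j x))"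
    proof (rule step)
      show "good (\<lambda>x. \<Prod>i\<in>J. indicator (A i) (X i x))" using insert by auto
      show "(\<lambda>x. \<Prod>i\<in>J. indicator (A i) (X i x) :: real) \<in> borel_measurable P"
        using insert.prems by (intro borel_measurable_prod) auto
    qed (use insert.prems in \<open>auto intro!: prod_nonneg prod_le_1\<close>)
    then show ?case using insert by (simp add: mult.commute)
  qed
  have meas[measurable]: "(\<lambda>x i. X i x) \<in> measurable P (Pi\<^sub>M UNIV (\<lambda>_. borel))"
    "(\<lambda>x i. X i x) \<in> measurable Q (Pi\<^sub>M UNIV (\<lambda>_. borel))"
    by (auto intro!: measurable_PiM_single')
  show ?thesis
  proof (rule measure_eqI_PiM_infinite)
    show "finite_measure (distr P (Pi\<^sub>M UNIV (\<lambda>_. borel)) (\<lambda>x i. X i x))"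
      by (intro P.finite_measure_distr) auto
    fix A :: "'i \<Rightarrow> real set" and J assume J: "finite J" and A: "\<And>i. i \<in> J \<Longrightarrow> A i \<in> sets borel"
    let ?E = "prod_emb UNIV (\<lambda>_. borel) J (Pi\<^sub>E J A)"
    have E[measurable]: "?E \<in> sets (Pi\<^sub>M UNIV (\<lambda>_. borel))"
      using J A by (intro sets_PiM_I) auto
    have Eq: "indicator ?E (\<lambda>i. X i x) = (\<Prod>i\<in>J. indicator (A i) (X i x) :: real)" for x
      using J by (auto simp: prod_emb_def indicator_def prod_zero_iff PiE_def Pi_def extensional_def restrict_def)
    have m: "measure (distr R (Pi\<^sub>M UNIV (\<lambda>_. borel)) (\<lambda>x i. X i x)) ?E = (\<integral>x. (\<Prod>i\<in>J. indicator (A i) (X i x) :: real) \<partial>R)"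
      if R: "R = P \<or> R = Q" for R
    proof -
      interpret R: prob_space R using that P.prob_space_axioms Q.prob_space_axioms by auto
      have [measurable]: "(\<lambda>x i. X i x) \<in> measurable R (Pi\<^sub>M UNIV (\<lambda>_. borel))" using R meas by auto
      interpret D: prob_space "distr R (Pi\<^sub>M UNIV (\<lambda>_. borel)) (\<lambda>x i. X i x)" by (rule R.prob_space_distr) measurable
      have "measure (distr R (Pi\<^sub>M UNIV (\<lambda>_. borel)) (\<lambda>x i. X i x)) ?E
        = (\<integral>x. indicator ?E x \<partial>distr R (Pi\<^sub>M UNIV (\<lambda>_. borel)) (\<lambda>x i. X i x))" by simp
      also have "\<dots> = (\<integral>x. indicator ?E (\<lambda>i. X i x) \<partial>R)" by (subst integral_distr) auto
      finally show ?thesis by (simp add: Eq)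
    qed
    have "(\<integral>x. (\<Prod>i\<in>J. indicator (A i) (X i x)) \<partial>P) = (\<integral>x. (\<Prod>i\<in>J. indicator (A i) (X i x) :: real) \<partial>Q)"
      using prods[of J A] J A unfolding good_def by (auto dest!: spec[of _ "{}"] spec[of _ "0::real"])
    then have "measure (distr P (Pi\<^sub>M UNIV (\<lambda>_. borel)) (\<lambda>x i. X i x)) ?E = measure (distr Q (Pi\<^sub>M UNIV (\<lambda>_. borel)) (\<lambda>x i. X i x)) ?E"
      using m by simp
    then show "emeasure (distr P (Pi\<^sub>M UNIV (\<lambda>_. borel)) (\<lambda>x i. X i x)) ?E = emeasure (distr Q (Pi\<^sub>M UNIV (\<lambda>_. borel)) (\<lambda>x i. X i x)) ?E"
      using P.finite_measure_distr[OF meas(1)] Q.finite_measure_distr[OF meas(2)]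
      by (simp add: finite_measure.emeasure_eq_measure)
  qed auto
qed

section \<open>Measures that agree on a sub-sigma-algebra\<close>

lemma restr_to_subalg_eqI:
  assumes "subalgebra P F" "subalgebra Q F" "\<And>A. A \<in> sets F \<Longrightarrow> emeasure P A = emeasure Q A"
  shows "restr_to_subalg P F = restr_to_subalg Q F"
  using assms by (intro measure_eqI) (auto simp: sets_restr_to_subalg emeasure_restr_to_subalg)

text \<open>The function \<open>f\<close> itself may be measurable only for the large sigma-algebra.
  It is enough that one and the same \<open>F\<close>-measurable \<open>g\<close> equals it almost
  everywhere under both measures, which may have different null sets.\<close>

lemma
  fixes f :: "'o \<Rightarrow> real"
  assumes P: "subalgebra P F" and Q: "subalgebra Q F"
    and agree: "\<And>A. A \<in> sets F \<Longrightarrow> emeasure P A = emeasure Q A"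
    and g: "g \<in> borel_measurable F"
    and f: "f \<in> borel_measurable P" "f \<in> borel_measurable Q"
    and ae: "AE x in P. f x = g x" "AE x in Q. f x = g x"
  shows integral_eq_if_agree: "(\<integral>x. f x \<partial>P) = (\<integral>x. f x \<partial>Q)"
    and integrable_iff_if_agree: "integrable P f \<longleftrightarrow> integrable Q f"
proof -
  have gm: "g \<in> borel_measurable P" "g \<in> borel_measurable Q"
    using measurable_from_subalg P Q g by blast+
  note eq = restr_to_subalg_eqI[OF P Q agree]
  have "(\<integral>x. f x \<partial>P) = (\<integral>x. g x \<partial>P)" "(\<integral>x. f x \<partial>Q) = (\<integral>x. g x \<partial>Q)"
    using f gm ae by (auto intro!: integral_cong_AE)
  then show "(\<integral>x. f x \<partial>P) = (\<integral>x. f x \<partial>Q)"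
    using integral_subalgebra2[OF P g] integral_subalgebra2[OF Q g] eq by simp
  have "integrable P f \<longleftrightarrow> integrable P g" "integrable Q f \<longleftrightarrow> integrable Q g"
    by (rule integrable_cong_AE; use f gm ae in simp)+
  then show "integrable P f \<longleftrightarrow> integrable Q f"
    using integrable_in_subalg[OF P g] integrable_in_subalg[OF Q g]
      integrable_from_subalg[OF P, of g] integrable_from_subalg[OF Q, of g] eq by metis
qed

text \<open>The mean of \<open>(W - V)^2\<close> is \<open>c - 2 c + c\<close>.\<close>

lemma AE_eq_if_square_expansion:
  fixes W V :: "'o \<Rightarrow> real"
  assumes "prob_space R" and [measurable]: "W \<in> borel_measurable R" "V \<in> borel_measurable R"
    and bd: "\<And>x. \<bar>W x\<bar> \<le> K" "\<And>x. \<bar>V x\<bar> \<le> K"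
    and eq: "(\<integral>x. W x * W x \<partial>R) = c" "(\<integral>x. W x * V x \<partial>R) = c" "(\<integral>x. V x * V x \<partial>R) = c"
  shows "AE x in R. W x = V x"
proof -
  interpret R: prob_space R by fact
  have K: "0 \<le> K" using bd(1)[of undefined] by linarith
  have i: "integrable R (\<lambda>x. W x * W x)" "integrable R (\<lambda>x. W x * V x)" "integrable R (\<lambda>x. V x * V x)"
    by (rule R.integrable_const_bound[of _ "K * K"];
        use bd K in \<open>auto simp del: abs_mult_self_eq simp: abs_mult intro!: mult_mono\<close>)+
  have e: "(W x - V x)\<^sup>2 = W x * W x - 2 * (W x * V x) + V x * V x" for x
    by (simp add: power2_eq_square algebra_simps)
  have "integrable R (\<lambda>x. (W x - V x)\<^sup>2)" unfolding e using i by auto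
  moreover have "(\<integral>x. (W x - V x)\<^sup>2 \<partial>R) = 0" unfolding e using i eq by simp
  ultimately have "AE x in R. (W x - V x)\<^sup>2 = 0"
    by (subst (asm) integral_nonneg_eq_0_iff_AE) auto
  then show ?thesis by auto
qed

text \<open>\<open>J\<close> is not assumed to be jointly measurable for \<open>F\<close>, so its integral need not be \<open>F\<close>-measurable. With
  \<open>V\<close> the conditional expectation of the integral \<open>W\<close> given \<open>F\<close>, Fubini shows that \<open>W\<^sup>2\<close>, \<open>W V\<close> and \<open>V\<^sup>2\<close>
  all have the same mean under both measures.\<close>

lemma bounded_parametric_integral_subalgebra:
  fixes J :: "'o \<Rightarrow> 'a \<Rightarrow> real"
  assumes "prob_space P" "prob_space Q" "prob_space S" and sets: "sets Q = sets P"
    and P: "subalgebra P F"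
    and agree: "\<And>A. A \<in> sets F \<Longrightarrow> emeasure P A = emeasure Q A"
    and J[measurable]: "(\<lambda>(x, \<tau>). J x \<tau>) \<in> borel_measurable (P \<Otimes>\<^sub>M S)"
    and JF: "\<And>\<tau>. \<tau> \<in> space S \<Longrightarrow> (\<lambda>x. J x \<tau>) \<in> borel_measurable F"
    and J0: "\<And>x \<tau>. 0 \<le> J x \<tau>" and JK: "\<And>x \<tau>. J x \<tau> \<le> K"
  shows "\<exists>V\<in>borel_measurable F. (AE x in P. (\<integral>\<tau>. J x \<tau> \<partial>S) = V x) \<and> (AE x in Q. (\<integral>\<tau>. J x \<tau> \<partial>S) = V x)"
proof -
  interpret P: prob_space P by fact
  interpret Q: prob_space Q by fact
  interpret S: prob_space S by fact
  have Q: "subalgebra Q F" using P sets sets_eq_imp_space_eq[OF sets] by (simp add: subalgebra_def)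
  note JF' = measurable_from_subalg[OF P JF]
  have JQ[measurable]: "(\<lambda>(x, \<tau>). J x \<tau>) \<in> borel_measurable (Q \<Otimes>\<^sub>M S)"
    using J sets by (simp cong: measurable_cong_sets sets_pair_measure_cong)
  define W where "W x = (\<integral>\<tau>. J x \<tau> \<partial>S)" for x
  have [measurable]: "W \<in> borel_measurable P" "W \<in> borel_measurable Q"
    unfolding W_def by measurable
  have K0: "0 \<le> K" using J0 JK order_trans by blast
  have Ji: "integrable S (J x)" if "x \<in> space P" for x
    by (rule S.integrable_const_bound[of _ K]) (use J0 JK that in auto)
  have W0: "0 \<le> W x" for x unfolding W_def by (rule Bochner_Integration.integral_nonneg) (rule J0)
  \<comment> \<open>Where the section is not integrable the integral is 0 by convention, so the
    bound holds at every point.\<close>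
  have WK: "W x \<le> K" for x
  proof (cases "integrable S (J x)")
    case True
    then have "W x \<le> (\<integral>\<tau>. K \<partial>S)" unfolding W_def by (rule integral_mono) (use JK in auto)
    then show ?thesis by (simp add: S.prob_space)
  next
    case False then show ?thesis using K0 by (simp add: W_def not_integrable_integral_eq)
  qed
  interpret F: finite_measure_subalgebra P F
    by (intro finite_measure_subalgebra.intro P.finite_measure_axioms finite_measure_subalgebra_axioms.intro P)
  have Wint: "integrable P W" by (rule P.integrable_const_bound[of _ K]) (use W0 WK in auto)
  \<comment> \<open>Conditional expectation is bounded only almost surely for \<open>P\<close>.
    Clamping it to \<open>[0, K]\<close> makes the bounds hold everywhere and so under
    \<open>Q\<close> too, whose null sets may differ.\<close>
  define V where "V x = max 0 (min K (real_cond_exp P F W x))" for x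
  have V[measurable]: "V \<in> borel_measurable F" unfolding V_def by measurable
  have [measurable]: "V \<in> borel_measurable P" "V \<in> borel_measurable Q"
    using measurable_from_subalg P Q V by blast+
  have Vb: "0 \<le> V x" "V x \<le> K" for x using K0 by (auto simp: V_def)
  have Vae: "AE x in P. real_cond_exp P F W x = V x"
    using F.real_cond_exp_ge_c[OF Wint, of 0] F.real_cond_exp_le_c[OF Wint, of K] W0 WK
    by (auto simp: V_def)
  have bnd: "\<bar>u x\<bar> \<le> K \<Longrightarrow> \<bar>v x\<bar> \<le> K \<Longrightarrow> \<bar>u x * v x\<bar> \<le> K * K" for u v :: "'o \<Rightarrow> real" and x
    using K0 by (simp add: abs_mult mult_mono)
  have ce: "(\<integral>x. u x * W x \<partial>P) = (\<integral>x. u x * V x \<partial>P)"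
    if u[measurable]: "u \<in> borel_measurable F" and ub: "\<And>x. \<bar>u x\<bar> \<le> K" for u
  proof -
    have [measurable]: "u \<in> borel_measurable P" using measurable_from_subalg[OF P u] .
    have i: "integrable P (\<lambda>x. u x * W x)"
      by (rule P.integrable_const_bound[of _ "K * K"]) (use ub bnd[of u _ W] W0 WK in auto)
    have "(\<integral>x. u x * W x \<partial>P) = (\<integral>x. u x * real_cond_exp P F W x \<partial>P)"
      using F.real_cond_exp_intg(2)[OF i u] by simp
    also have "\<dots> = (\<integral>x. u x * V x \<partial>P)"
      by (rule integral_cong_AE) (use Vae in auto)
    finally show ?thesis .
  qed
  \<comment> \<open>Unfolding one factor \<open>W\<close> by Fubini leaves, for each fixed
    parameter, the \<open>F\<close>-measurable section of \<open>J\<close>. This is how equality on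
    \<open>F\<close> gets hold of \<open>W\<close>.\<close>
  have fub: "(\<integral>x. W x * u x \<partial>R) = (\<integral>\<tau>. (\<integral>x. J x \<tau> * u x \<partial>R) \<partial>S)"
    if R: "R = P \<or> R = Q" and u: "u \<in> borel_measurable P" and ub: "\<And>x. \<bar>u x\<bar> \<le> K" for R u
  proof -
    interpret R: prob_space R using R P.prob_space_axioms Q.prob_space_axioms by auto
    interpret RS: pair_sigma_finite R S ..
    interpret RSp: pair_prob_space R S ..
    have "u \<in> borel_measurable Q" using u sets by (simp cong: measurable_cong_sets)
    then have [measurable]: "u \<in> borel_measurable R" using R u by (elim disjE) simp_all
    have [measurable]: "(\<lambda>(x, \<tau>). J x \<tau>) \<in> borel_measurable (R \<Otimes>\<^sub>M S)"
      using R J JQ by (elim disjE) simp_all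
    have i: "integrable (R \<Otimes>\<^sub>M S) (\<lambda>(x, \<tau>). J x \<tau> * u x)"
      by (rule RSp.integrable_const_bound[of _ "K * K"])
        (auto intro!: AE_I2 mult_mono simp: abs_mult J0 JK ub K0)
    have "(\<integral>x. W x * u x \<partial>R) = (\<integral>x. (\<integral>\<tau>. J x \<tau> * u x \<partial>S) \<partial>R)"
      by (simp add: W_def)
    also have "\<dots> = (\<integral>\<tau>. (\<integral>x. J x \<tau> * u x \<partial>R) \<partial>S)"
      using RS.Fubini_integral[OF i] by simp
    finally show ?thesis .
  qed
  have JJ: "(\<integral>x. J x \<tau> * u x \<partial>P) = (\<integral>x. J x \<tau> * u x \<partial>Q)"
    if \<tau>: "\<tau> \<in> space S" and u[measurable]: "u \<in> borel_measurable F" for \<tau> u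
  proof -
    note JF[OF \<tau>, measurable]
    have m: "(\<lambda>x. J x \<tau> * u x) \<in> borel_measurable F" by measurable
    show ?thesis
      by (rule integral_eq_if_agree[OF P Q agree m measurable_from_subalg[OF P m] measurable_from_subalg[OF Q m]]) simp_all
  qed
  have VV: "(\<integral>x. V x * V x \<partial>P) = (\<integral>x. V x * V x \<partial>Q)"
    by (rule integral_eq_if_agree[OF P Q agree borel_measurable_times[OF V V]]) simp_all
  have bV: "\<bar>V x\<bar> \<le> K" and bW: "\<bar>W x\<bar> \<le> K" and bJ: "\<bar>J x \<tau>\<bar> \<le> K" for x \<tau>
    using Vb[of x] W0[of x] WK[of x] J0[of x \<tau>] JK[of x \<tau>] by auto
  have a1: "(\<integral>x. W x * V x \<partial>P) = (\<integral>x. V x * V x \<partial>P)"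
    using ce[OF V bV] by (simp add: mult.commute)
  have a2: "(\<integral>x. W x * W x \<partial>P) = (\<integral>x. W x * V x \<partial>P)"
    unfolding fub[OF disjI1[OF refl] \<open>W \<in> borel_measurable P\<close> bW]
      fub[OF disjI1[OF refl] \<open>V \<in> borel_measurable P\<close> bV]
    by (intro Bochner_Integration.integral_cong refl ce JF bJ)
  have b1: "(\<integral>x. W x * V x \<partial>Q) = (\<integral>x. W x * V x \<partial>P)"
    unfolding fub[OF disjI1[OF refl] \<open>V \<in> borel_measurable P\<close> bV]
      fub[OF disjI2[OF refl] \<open>V \<in> borel_measurable P\<close> bV]
    by (intro Bochner_Integration.integral_cong refl JJ[symmetric] V)
  \<comment> \<open>The other factor \<open>W\<close> is unfolded as well, with an independent
    second parameter; what remains is a product of two sections of \<open>J\<close>, which is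
    \<open>F\<close>-measurable.\<close>
  have b2: "(\<integral>x. J x \<tau> * W x \<partial>Q) = (\<integral>x. J x \<tau> * W x \<partial>P)" if \<tau>: "\<tau> \<in> space S" for \<tau>
  proof -
    have "(\<integral>x. W x * J x \<tau> \<partial>Q) = (\<integral>x. W x * J x \<tau> \<partial>P)"
      unfolding fub[OF disjI1[OF refl] JF'[OF \<tau>] bJ] fub[OF disjI2[OF refl] JF'[OF \<tau>] bJ]
      by (intro Bochner_Integration.integral_cong refl JJ[symmetric] JF \<tau>)
    then show ?thesis by (simp add: mult.commute)
  qed
  have b3: "(\<integral>x. W x * W x \<partial>Q) = (\<integral>x. W x * W x \<partial>P)"
    unfolding fub[OF disjI1[OF refl] \<open>W \<in> borel_measurable P\<close> bW]
      fub[OF disjI2[OF refl] \<open>W \<in> borel_measurable P\<close> bW]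
    by (intro Bochner_Integration.integral_cong refl b2)
  have "AE x in P. W x = V x"
    by (rule AE_eq_if_square_expansion[OF P.prob_space_axioms _ _ bW bV]) (use a1 a2 in auto)
  moreover have "AE x in Q. W x = V x"
    by (rule AE_eq_if_square_expansion[OF Q.prob_space_axioms _ _ bW bV]) (use a1 a2 b1 b3 VV in auto)
  ultimately show ?thesis using V unfolding W_def by blast
qed

text \<open>The bounded case is applied to the truncations of \<open>J\<close> at the integers, and
  \<open>V\<close> is the limit of the resulting functions. Integrability of the section is a
  premise inside the almost-everywhere statement because otherwise the integral is 0 by convention
  and need not be the limit.\<close>

lemma parametric_integral_subalgebra:
  fixes J :: "'o \<Rightarrow> 'a \<Rightarrow> real"
  assumes "prob_space P" "prob_space Q" "prob_space S" and sets: "sets Q = sets P"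
    and P: "subalgebra P F"
    and agree: "\<And>A. A \<in> sets F \<Longrightarrow> emeasure P A = emeasure Q A"
    and J[measurable]: "(\<lambda>(x, \<tau>). J x \<tau>) \<in> borel_measurable (P \<Otimes>\<^sub>M S)"
    and JF: "\<And>\<tau>. \<tau> \<in> space S \<Longrightarrow> (\<lambda>x. J x \<tau>) \<in> borel_measurable F"
    and J0: "\<And>x \<tau>. 0 \<le> J x \<tau>"
  obtains V where "V \<in> borel_measurable F"
    "AE x in P. integrable S (J x) \<longrightarrow> (\<integral>\<tau>. J x \<tau> \<partial>S) = V x"
    "AE x in Q. integrable S (J x) \<longrightarrow> (\<integral>\<tau>. J x \<tau> \<partial>S) = V x"
proof -
  have ex: "\<exists>V\<in>borel_measurable F. (AE x in P. (\<integral>\<tau>. min (J x \<tau>) (real k) \<partial>S) = V x)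
      \<and> (AE x in Q. (\<integral>\<tau>. min (J x \<tau>) (real k) \<partial>S) = V x)" for k
  proof (rule bounded_parametric_integral_subalgebra[OF assms(1-6), where K="real k"])
    show "(\<lambda>(x, \<tau>). min (J x \<tau>) (real k)) \<in> borel_measurable (P \<Otimes>\<^sub>M S)"
      by measurable
    show "(\<lambda>x. min (J x \<tau>) (real k)) \<in> borel_measurable F" if "\<tau> \<in> space S" for \<tau>
      using JF[OF that] by (intro borel_measurable_min) simp_all
  qed (simp_all add: J0)
  have "\<forall>k. \<exists>V. V \<in> borel_measurable F \<and> (AE x in P. (\<integral>\<tau>. min (J x \<tau>) (real k) \<partial>S) = V x)
      \<and> (AE x in Q. (\<integral>\<tau>. min (J x \<tau>) (real k) \<partial>S) = V x)"
    using ex unfolding Bex_def by (rule allI)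
  from choice[OF this] obtain V where V: "\<And>k. V k \<in> borel_measurable F"
    "\<And>k. AE x in P. (\<integral>\<tau>. min (J x \<tau>) (real k) \<partial>S) = V k x"
    "\<And>k. AE x in Q. (\<integral>\<tau>. min (J x \<tau>) (real k) \<partial>S) = V k x"
    by blast
  have lim: "(\<lambda>k. \<integral>\<tau>. min (J x \<tau>) (real k) \<partial>S) \<longlonglongrightarrow> (\<integral>\<tau>. J x \<tau> \<partial>S)" if i: "integrable S (J x)" for x
  proof (rule integral_dominated_convergence[where w="J x"])
    have [measurable]: "J x \<in> borel_measurable S" using i by auto
    show "J x \<in> borel_measurable S" "\<And>k. (\<lambda>\<tau>. min (J x \<tau>) (real k)) \<in> borel_measurable S" by measurable
    show "AE \<tau> in S. (\<lambda>k. min (J x \<tau>) (real k)) \<longlonglongrightarrow> J x \<tau>"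
    proof (intro AE_I2 tendsto_eventually)
      fix \<tau>
      obtain k0 :: nat where "J x \<tau> \<le> real k0" using real_arch_simple by blast
      then show "\<forall>\<^sub>F k in sequentially. min (J x \<tau>) (real k) = J x \<tau>"
        by (intro eventually_sequentiallyI[of k0]) (auto simp: min_def)
    qed
  qed (use i J0 in auto)
  have conc: "AE x in R. integrable S (J x) \<longrightarrow> (\<integral>\<tau>. J x \<tau> \<partial>S) = lim (\<lambda>k. V k x)"
    if "\<And>k. AE x in R. (\<integral>\<tau>. min (J x \<tau>) (real k) \<partial>S) = V k x" for R
  proof -
    have "AE x in R. \<forall>k. (\<integral>\<tau>. min (J x \<tau>) (real k) \<partial>S) = V k x"
      using that by (simp add: AE_all_countable)
    then show ?thesis
    proof eventually_elim
      case (elim x)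
      show ?case using lim[of x] limI[of "\<lambda>k. V k x"] by (auto simp: elim)
    qed
  qed
  have m: "(\<lambda>x. lim (\<lambda>k. V k x)) \<in> borel_measurable F"
    using V(1) by (intro borel_measurable_lim_metric)
  show ?thesis
    by (rule that[OF m conc conc]) (use V in auto)
qed

section \<open>Differentiation under the integral sign\<close>

text \<open>By the mean value inequality \<open>D\<close> dominates the difference quotients, and
  dominated convergence applies along every sequence tending to \<open>t\<close>. The exceptional
  null set must not depend on \<open>s\<close>, so the quantifier over the interval stands inside
  \<open>AE\<close>. The interval is a parameter since the derivative of the Hamiltonian blows up at
  0 and 1.\<close>

lemma has_real_derivative_integral:
  fixes g g' :: "real \<Rightarrow> 'o \<Rightarrow> real"
  assumes t: "t \<in> {a<..<b}"
    and int: "\<And>s. s \<in> {a<..<b} \<Longrightarrow> integrable M (g s)"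
    and meas: "g' t \<in> borel_measurable M"
    and D: "integrable M D"
    and der: "AE x in M. \<forall>s\<in>{a<..<b}. ((\<lambda>s. g s x) has_real_derivative g' s x) (at s) \<and> \<bar>g' s x\<bar> \<le> D x"
  shows "((\<lambda>s. \<integral>x. g s x \<partial>M) has_real_derivative (\<integral>x. g' t x \<partial>M)) (at t)"
  unfolding has_field_derivative_iff
proof (subst tendsto_at_iff_sequentially, intro allI impI)
  fix X :: "nat \<Rightarrow> real" assume X: "\<forall>i. X i \<in> UNIV - {t}" and lim: "X \<longlonglongrightarrow> t"
  have "\<forall>\<^sub>F i in sequentially. X i \<in> {a<..<b}"
    using lim t by (intro topological_tendstoD) auto
  then obtain N where N: "\<And>i. N \<le> i \<Longrightarrow> X i \<in> {a<..<b}" by (auto simp: eventually_sequentially)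
  \<comment> \<open>Dropping the first \<open>N\<close> terms keeps the whole sequence inside the
    interval where the hypotheses hold.\<close>
  define Y where "Y i = X (i + N)" for i
  have Y: "Y \<longlonglongrightarrow> t" "\<And>i. Y i \<in> {a<..<b}" "\<And>i. Y i \<noteq> t"
    using lim N X unfolding Y_def by (auto intro: LIMSEQ_ignore_initial_segment)
  have "(\<lambda>i. \<integral>x. (g (Y i) x - g t x) / (Y i - t) \<partial>M) \<longlonglongrightarrow> (\<integral>x. g' t x \<partial>M)"
  proof (rule integral_dominated_convergence[OF meas _ D])
    show "(\<lambda>x. (g (Y i) x - g t x) / (Y i - t)) \<in> borel_measurable M" for i
      using int[OF Y(2)] int[OF t] by measurable
    show "AE x in M. (\<lambda>i. (g (Y i) x - g t x) / (Y i - t)) \<longlonglongrightarrow> g' t x"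
      using der
    proof eventually_elim
      case (elim x)
      then have "((\<lambda>s. (g s x - g t x) / (s - t)) \<longlongrightarrow> g' t x) (at t)"
        using t by (auto simp: has_field_derivative_iff)
      then show ?case
        using Y by (auto simp: tendsto_at_iff_sequentially comp_def)
    qed
    show "AE x in M. norm ((g (Y i) x - g t x) / (Y i - t)) \<le> D x" for i
      using der
    proof eventually_elim
      case (elim x)
      have "\<bar>g (Y i) x - g t x\<bar> \<le> D x * \<bar>Y i - t\<bar>"
        using field_differentiable_bound[of "{a<..<b}" "\<lambda>s. g s x" "\<lambda>s. g' s x" "D x" "Y i" t] elim Y(2)[of i] t
        by (auto simp: has_field_derivative_at_within)
      then show ?case using Y(3)[of i] by (simp add: divide_le_eq)
    qed
  qed
  moreover have "(\<integral>x. (g (Y i) x - g t x) / (Y i - t) \<partial>M) = ((\<integral>x. g (Y i) x \<partial>M) - (\<integral>x. g t x \<partial>M)) / (Y i - t)" for i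
    using int[OF Y(2)[of i]] int[OF t] Y(3)[of i] by simp
  ultimately have "(\<lambda>i. ((\<integral>x. g (X (i + N)) x \<partial>M) - (\<integral>x. g t x \<partial>M)) / (X (i + N) - t)) \<longlonglongrightarrow> (\<integral>x. g' t x \<partial>M)"
    by (simp only: Y_def)
  then show "((\<lambda>y. ((\<integral>x. g y x \<partial>M) - (\<integral>x. g t x \<partial>M)) / (y - t)) \<circ> X) \<longlonglongrightarrow> (\<integral>x. g' t x \<partial>M)"
    unfolding comp_def by (rule LIMSEQ_offset)
qed

section \<open>Gaussian integration by parts\<close>

lemma AE_pair_snd:
  assumes "sigma_finite_measure B" and P: "AE x in B. P x"
  shows "AE z in A \<Otimes>\<^sub>M B. P (snd z)"
proof -
  interpret B: sigma_finite_measure B by fact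
  obtain N where N: "N \<in> null_sets B" "{x\<in>space B. \<not> P x} \<subseteq> N"
    using P by (auto simp: eventually_ae_filter)
  have "space A \<times> N \<in> null_sets (A \<Otimes>\<^sub>M B)"
    using N(1) by (auto simp: null_sets_def B.emeasure_pair_measure_Times)
  then show ?thesis
    by (rule AE_I') (use N in \<open>auto simp: space_pair_measure\<close>)
qed

lemma integrable_std_normal_exp_mult: "integrable lborel (\<lambda>x. std_normal_density x * exp (b * x))"
proof -
  have "std_normal_density x * exp (b * x) = exp (b\<^sup>2/2) * normal_density b 1 x" for x
  proof -
    have "- (x\<^sup>2) / 2 + b * x = b\<^sup>2/2 + (- ((x - b)\<^sup>2) / 2)"
      by (simp add: field_simps power2_eq_square)
    then show ?thesis
      unfolding normal_density_def by (simp add: exp_add[symmetric] mult_ac)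
  qed
  then show ?thesis by simp
qed

lemma integrable_std_normal_exp_abs: "integrable lborel (\<lambda>x. std_normal_density x * exp (b * \<bar>x\<bar>))"
proof (rule Bochner_Integration.integrable_bound)
  show "integrable lborel (\<lambda>x. std_normal_density x * exp (b * x) + std_normal_density x * exp ((- b) * x))"
    by (intro Bochner_Integration.integrable_add integrable_std_normal_exp_mult)
  have "exp (b * \<bar>x\<bar>) \<le> exp (b * x) + exp ((- b) * x)" for x :: real
    by (cases "0 \<le> x") auto
  then have "std_normal_density x * exp (b * \<bar>x\<bar>) \<le> std_normal_density x * (exp (b * x) + exp ((- b) * x))" for x
    by (intro mult_left_mono) auto
  then show "AE x in lborel. norm (std_normal_density x * exp (b * \<bar>x\<bar>))
     \<le> norm (std_normal_density x * exp (b * x) + std_normal_density x * exp ((- b) * x))"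
    by (intro AE_I2) (simp add: distrib_left)
qed simp

text \<open>The negative of density times \<open>\<phi>\<close> is a primitive of the difference of
  the two integrands. Growth of at most exponential order makes it vanish at both infinities, so the
  integral of that difference is 0.\<close>

lemma std_normal_ibp:
  fixes \<phi> \<phi>' :: "real \<Rightarrow> real"
  assumes der: "\<And>s. (\<phi> has_real_derivative \<phi>' s) (at s)" and cont: "\<And>s. isCont \<phi>' s"
    and bd: "\<And>s. \<bar>\<phi> s\<bar> \<le> K * exp (a * \<bar>s\<bar>)" "\<And>s. \<bar>\<phi>' s\<bar> \<le> K * exp (a * \<bar>s\<bar>)"
  shows "(\<integral>s. s * \<phi> s \<partial>std_normal_distribution) = (\<integral>s. \<phi>' s \<partial>std_normal_distribution)"
proof -
  have K: "0 \<le> K" using bd(1)[of 0] by simp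
  have c\<phi>: "isCont \<phi> s" for s using der DERIV_isCont by blast
  have [measurable]: "\<phi> \<in> borel_measurable borel" "\<phi>' \<in> borel_measurable borel"
    using cont c\<phi> by (auto intro!: borel_measurable_continuous_onI simp: continuous_on_eq_continuous_at)
  have dn: "(std_normal_density has_real_derivative - s * std_normal_density s) (at s)" for s
  proof -
    have "((\<lambda>x. c * exp (- x\<^sup>2 / 2)) has_real_derivative - s * (c * exp (- s\<^sup>2 / 2))) (at s)" for c :: real
      by (auto intro!: derivative_eq_intros)
    then show ?thesis unfolding std_normal_density_def[abs_def] .
  qed
  define F where "F s = - (std_normal_density s * \<phi> s)" for s
  define f where "f s = std_normal_density s * (s * \<phi> s) - std_normal_density s * \<phi>' s" for s
  have Fd: "(F has_real_derivative f s) (at s)" for s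
    unfolding F_def[abs_def] f_def
    by (rule derivative_eq_intros refl dn der)+ (simp add: algebra_simps)
  have cn: "isCont std_normal_density s" for s using dn DERIV_isCont by blast
  have fc: "isCont f s" for s
    unfolding f_def[abs_def] by (intro continuous_intros cn cont c\<phi>)
  have E: "integrable lborel (\<lambda>s. K * (std_normal_density s * exp ((a + 1) * \<bar>s\<bar>)))"
    by (intro integrable_mult_right integrable_std_normal_exp_abs)
  have s_le: "\<bar>s\<bar> \<le> exp \<bar>s\<bar>" for s :: real using exp_ge_add_one_self[of "\<bar>s\<bar>"] by linarith
  have i1: "integrable lborel (\<lambda>s. std_normal_density s * (s * \<phi> s))"
  proof (rule Bochner_Integration.integrable_bound[OF E])
    have "\<bar>s * \<phi> s\<bar> \<le> exp \<bar>s\<bar> * (K * exp (a * \<bar>s\<bar>))" for s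
      unfolding abs_mult by (intro mult_mono s_le bd) auto
    moreover have "exp \<bar>s\<bar> * (K * exp (a * \<bar>s\<bar>)) = K * exp ((a + 1) * \<bar>s\<bar>)" for s
      by (simp add: exp_add distrib_right)
    ultimately have "\<bar>s * \<phi> s\<bar> \<le> K * exp ((a + 1) * \<bar>s\<bar>)" for s by metis
    then have "std_normal_density s * \<bar>s * \<phi> s\<bar> \<le> std_normal_density s * (K * exp ((a + 1) * \<bar>s\<bar>))" for s
      by (intro mult_left_mono) auto
    then show "AE s in lborel. norm (std_normal_density s * (s * \<phi> s)) \<le> norm (K * (std_normal_density s * exp ((a + 1) * \<bar>s\<bar>)))"
      using K by (auto simp: abs_mult mult_ac)
  qed auto
  have i2: "integrable lborel (\<lambda>s. std_normal_density s * \<phi>' s)"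
  proof (rule Bochner_Integration.integrable_bound[OF integrable_mult_right[OF integrable_std_normal_exp_abs, of K a]])
    have "std_normal_density s * \<bar>\<phi>' s\<bar> \<le> std_normal_density s * (K * exp (a * \<bar>s\<bar>))" for s
      by (intro mult_left_mono bd) auto
    then show "AE s in lborel. norm (std_normal_density s * \<phi>' s) \<le> norm (K * (std_normal_density s * exp (a * \<bar>s\<bar>)))"
      using K by (auto simp: abs_mult mult_ac)
  qed auto
  have fi: "integrable lborel f" unfolding f_def[abs_def] by (intro Bochner_Integration.integrable_diff i1 i2)
  \<comment> \<open>\<open>(a + 1)^2 / 2\<close> is the maximum of
    \<open>(a + 1) y - y^2 / 2\<close>. Using \<open>a + 1\<close> in place of \<open>a\<close>
    leaves a spare factor \<open>exp (- \<bar>s\<bar>)\<close>, which forces the boundary terms to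
    0.\<close>
  define C where "C = (1 / sqrt (2 * pi)) * (K * exp ((a + 1)\<^sup>2 / 2))"
  have Fb: "\<bar>F s\<bar> \<le> C * exp (- \<bar>s\<bar>)" for s
  proof -
    have "std_normal_density s * exp (a * \<bar>s\<bar>) = (1 / sqrt (2 * pi)) * exp (- s\<^sup>2 / 2 + a * \<bar>s\<bar>)"
      unfolding std_normal_density_def by (simp add: exp_add[symmetric])
    moreover have "- s\<^sup>2 / 2 + a * \<bar>s\<bar> \<le> (a + 1)\<^sup>2 / 2 - \<bar>s\<bar>"
      using zero_le_power2[of "\<bar>s\<bar> - (a + 1)"] by (simp add: power2_eq_square algebra_simps)
    then have "exp (- s\<^sup>2 / 2 + a * \<bar>s\<bar>) \<le> exp ((a + 1)\<^sup>2 / 2) * exp (- \<bar>s\<bar>)"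
      by (simp add: exp_add[symmetric])
    ultimately have "std_normal_density s * exp (a * \<bar>s\<bar>) \<le> (1 / sqrt (2 * pi)) * (exp ((a + 1)\<^sup>2 / 2) * exp (- \<bar>s\<bar>))"
      by (simp add: divide_right_mono)
    then have "K * (std_normal_density s * exp (a * \<bar>s\<bar>)) \<le> K * ((1 / sqrt (2 * pi)) * (exp ((a + 1)\<^sup>2 / 2) * exp (- \<bar>s\<bar>)))"
      using K by (rule mult_left_mono)
    moreover have "std_normal_density s * \<bar>\<phi> s\<bar> \<le> std_normal_density s * (K * exp (a * \<bar>s\<bar>))"
      by (intro mult_left_mono bd) auto
    ultimately show ?thesis by (simp add: F_def C_def abs_mult mult_ac)
  qed
  have exp0: "((\<lambda>s. C * exp (- \<bar>s\<bar>)) \<longlongrightarrow> 0) at_top" "((\<lambda>s. C * exp (- \<bar>s\<bar>)) \<longlongrightarrow> 0) at_bot"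
  proof -
    have "filterlim (\<lambda>s::real. - \<bar>s\<bar>) at_bot at_top"
      by (rule filterlim_compose[OF filterlim_uminus_at_bot_at_top filterlim_abs_real])
    then show "((\<lambda>s. C * exp (- \<bar>s\<bar>)) \<longlongrightarrow> 0) at_top"
      by (intro tendsto_mult_right_zero filterlim_compose[OF exp_at_bot])
    have "filterlim (\<lambda>s::real. - \<bar>s\<bar>) at_bot at_bot"
      by (rule filterlim_at_bot_mono[OF filterlim_ident]) (auto intro: always_eventually)
    then show "((\<lambda>s. C * exp (- \<bar>s\<bar>)) \<longlongrightarrow> 0) at_bot"
      by (intro tendsto_mult_right_zero filterlim_compose[OF exp_at_bot])
  qed
  have FT: "(F \<longlongrightarrow> 0) at_top" "(F \<longlongrightarrow> 0) at_bot"
    by (rule Lim_null_comparison[OF always_eventually exp0(1)], use Fb in simp)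
       (rule Lim_null_comparison[OF always_eventually exp0(2)], use Fb in simp)
  have "(LBINT s=-\<infinity>..\<infinity>. f s) = 0 - 0"
  proof (rule interval_integral_FTC_integrable)
    show "(F has_vector_derivative f x) (at x)" for x
      using Fd by (simp add: has_real_derivative_iff_has_vector_derivative)
    show "set_integrable lborel (einterval (- \<infinity>) \<infinity>) f"
      using fi by (simp add: set_integrable_def einterval_eq_UNIV)
    show "((F \<circ> real_of_ereal) \<longlongrightarrow> 0) (at_right (- \<infinity>))"
      using FT by (simp add: ereal_tendsto_simps)
    show "((F \<circ> real_of_ereal) \<longlongrightarrow> 0) (at_left \<infinity>)"
      using FT by (simp add: ereal_tendsto_simps)
  qed (use fc in auto)
  then have "(\<integral>s. f s \<partial>lborel) = 0"
    by (simp add: interval_lebesgue_integral_def set_lebesgue_integral_def einterval_eq_UNIV)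
  then have "(\<integral>s. std_normal_density s * (s * \<phi> s) \<partial>lborel) = (\<integral>s. std_normal_density s * \<phi>' s \<partial>lborel)"
    unfolding f_def using i1 i2 by simp
  then show ?thesis by (simp add: integral_density)
qed

lemma prob_integral_pos:
  fixes f :: "'a \<Rightarrow> real"
  assumes "prob_space S" "integrable S f" "\<And>x. 0 < f x"
  shows "0 < (\<integral>x. f x \<partial>S)"
proof -
  interpret prob_space S by fact
  have "(\<integral>x. f x \<partial>S) \<noteq> 0"
  proof
    assume "(\<integral>x. f x \<partial>S) = 0"
    then have "AE x in S. f x = 0"
      using assms by (subst (asm) integral_nonneg_eq_0_iff_AE) (auto intro: less_imp_le)
    then have "AE x in S. False" by eventually_elim (use assms(3) in \<open>auto simp: less_le\<close>)
    then show False by simp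
  qed
  moreover have "0 \<le> (\<integral>x. f x \<partial>S)"
    by (rule Bochner_Integration.integral_nonneg) (use assms(3) less_imp_le in blast)
  ultimately show ?thesis by simp
qed

text \<open>Since \<open>c\<close> is bounded by \<open>C\<close>, changing \<open>s\<close> costs
  at most the factor \<open>exp (C \<bar>s\<bar>)\<close>. On the window of radius 1 around
  \<open>s\<close> a constant multiple of \<open>exp (y \<tau>)\<close> therefore dominates every
  derivative.\<close>

lemma
  fixes c a y :: "'a \<Rightarrow> real"
  assumes [measurable]: "c \<in> borel_measurable S" "a \<in> borel_measurable S"
    and c: "\<And>\<tau>. \<bar>c \<tau>\<bar> \<le> C" and a: "\<And>\<tau>. \<bar>a \<tau>\<bar> \<le> A"
    and y: "integrable S (\<lambda>\<tau>. exp (y \<tau>))" and ym[measurable]: "y \<in> borel_measurable S"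
  shows integrable_weighted_exp: "integrable S (\<lambda>\<tau>. a \<tau> * exp (c \<tau> * s + y \<tau>))"
    and DERIV_integral_weighted_exp: "((\<lambda>s. \<integral>\<tau>. a \<tau> * exp (c \<tau> * s + y \<tau>) \<partial>S) has_real_derivative
      (\<integral>\<tau>. a \<tau> * c \<tau> * exp (c \<tau> * s + y \<tau>) \<partial>S)) (at s)"
proof -
  have C0: "0 \<le> C" and A0: "0 \<le> A" using c[of undefined] a[of undefined] by linarith+
  have eb: "exp (c \<tau> * r + y \<tau>) \<le> exp (C * \<bar>r\<bar>) * exp (y \<tau>)" for r \<tau>
  proof -
    have "c \<tau> * r \<le> \<bar>c \<tau>\<bar> * \<bar>r\<bar>" by (metis abs_ge_self abs_mult)
    also have "\<dots> \<le> C * \<bar>r\<bar>" using c by (intro mult_right_mono) auto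
    finally show ?thesis by (simp add: exp_add)
  qed
  have int: "integrable S (\<lambda>\<tau>. a \<tau> * exp (c \<tau> * r + y \<tau>))"
    if [measurable]: "a \<in> borel_measurable S" and a: "\<And>\<tau>. \<bar>a \<tau>\<bar> \<le> A" for r a A
  proof (rule Bochner_Integration.integrable_bound[OF integrable_mult_right[OF y, of "A * exp (C * \<bar>r\<bar>)"]])
    have "\<bar>a \<tau>\<bar> * exp (c \<tau> * r + y \<tau>) \<le> A * (exp (C * \<bar>r\<bar>) * exp (y \<tau>))" for \<tau>
      using a[of \<tau>] by (intro mult_mono eb a) auto
    then show "AE \<tau> in S. norm (a \<tau> * exp (c \<tau> * r + y \<tau>)) \<le> norm (A * exp (C * \<bar>r\<bar>) * exp (y \<tau>))"
      using order_trans[OF abs_ge_zero a] by (intro AE_I2) (simp add: abs_mult mult.assoc)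
  qed measurable
  show "integrable S (\<lambda>\<tau>. a \<tau> * exp (c \<tau> * s + y \<tau>))" by (rule int) (use a in auto)
  show "((\<lambda>s. \<integral>\<tau>. a \<tau> * exp (c \<tau> * s + y \<tau>) \<partial>S) has_real_derivative
      (\<integral>\<tau>. a \<tau> * c \<tau> * exp (c \<tau> * s + y \<tau>) \<partial>S)) (at s)"
  proof (rule has_real_derivative_integral[where a="s - 1" and b="s + 1" and D="\<lambda>\<tau>. A * C * exp (C * (\<bar>s\<bar> + 1)) * exp (y \<tau>)"
      and g'="\<lambda>s \<tau>. a \<tau> * c \<tau> * exp (c \<tau> * s + y \<tau>)"])
    show "integrable S (\<lambda>\<tau>. A * C * exp (C * (\<bar>s\<bar> + 1)) * exp (y \<tau>))" using y by (rule integrable_mult_right)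
    show "AE \<tau> in S. \<forall>r\<in>{s - 1<..<s + 1}. ((\<lambda>r. a \<tau> * exp (c \<tau> * r + y \<tau>)) has_real_derivative a \<tau> * c \<tau> * exp (c \<tau> * r + y \<tau>)) (at r)
       \<and> \<bar>a \<tau> * c \<tau> * exp (c \<tau> * r + y \<tau>)\<bar> \<le> A * C * exp (C * (\<bar>s\<bar> + 1)) * exp (y \<tau>)"
    proof (intro AE_I2 ballI conjI)
      fix \<tau> r assume r: "r \<in> {s - 1<..<s + 1}"
      show "((\<lambda>r. a \<tau> * exp (c \<tau> * r + y \<tau>)) has_real_derivative a \<tau> * c \<tau> * exp (c \<tau> * r + y \<tau>)) (at r)"
        by (auto intro!: derivative_eq_intros)
      have "\<bar>r\<bar> \<le> \<bar>s\<bar> + 1" using r by auto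
      then have "exp (C * \<bar>r\<bar>) \<le> exp (C * (\<bar>s\<bar> + 1))" using C0 by (simp add: mult_left_mono)
      then have "exp (C * \<bar>r\<bar>) * exp (y \<tau>) \<le> exp (C * (\<bar>s\<bar> + 1)) * exp (y \<tau>)" by simp
      then have e: "exp (c \<tau> * r + y \<tau>) \<le> exp (C * (\<bar>s\<bar> + 1)) * exp (y \<tau>)" using eb order_trans by blast
      have "\<bar>a \<tau>\<bar> * \<bar>c \<tau>\<bar> * exp (c \<tau> * r + y \<tau>) \<le> A * C * (exp (C * (\<bar>s\<bar> + 1)) * exp (y \<tau>))"
        using a c A0 C0 by (intro mult_mono e) auto
      then show "\<bar>a \<tau> * c \<tau> * exp (c \<tau> * r + y \<tau>)\<bar> \<le> A * C * exp (C * (\<bar>s\<bar> + 1)) * exp (y \<tau>)"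
        by (simp add: abs_mult mult_ac)
    qed
  qed (auto intro!: int a)
qed

text \<open>The one-dimensional identity applied to a Gibbs weight whose exponents are affine in
  \<open>s\<close>. The bound \<open>Z s \<ge> exp (- C \<bar>s\<bar>) * Z 0\<close> keeps the
  growth of the weight exponential despite the power of \<open>Z\<close> in the denominator.\<close>

lemma std_normal_ibp_gibbs:
  fixes c y :: "'a \<Rightarrow> real" and b u :: real
  assumes S: "prob_space S" and cm[measurable]: "c \<in> borel_measurable S"
    and c: "\<And>\<tau>. \<bar>c \<tau>\<bar> \<le> C"
    and y: "integrable S (\<lambda>\<tau>. exp (y \<tau>))" and ym[measurable]: "y \<in> borel_measurable S"
  defines "Z \<equiv> \<lambda>s. \<integral>\<tau>. exp (c \<tau> * s + y \<tau>) \<partial>S"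
  shows "(\<integral>s. s * (exp (b * s + u) / Z s ^ m) \<partial>std_normal_distribution)
    = (\<integral>s. exp (b * s + u) / Z s ^ m * b
        - real m * (exp (b * s + u) / Z s ^ m * (\<integral>\<tau>. c \<tau> * exp (c \<tau> * s + y \<tau>) \<partial>S) / Z s) \<partial>std_normal_distribution)"
    (is "_ = (\<integral>s. ?\<phi>' s \<partial>_)")
proof -
  interpret S: prob_space S by fact
  define W where "W s = (\<integral>\<tau>. c \<tau> * exp (c \<tau> * s + y \<tau>) \<partial>S)" for s
  have C0: "0 \<le> C" using c[of undefined] by linarith
  have Zi: "integrable S (\<lambda>\<tau>. exp (c \<tau> * s + y \<tau>))" for s
    using integrable_weighted_exp[OF cm, of "\<lambda>_. 1" C 1 y s] c y by simp
  have Zp: "0 < Z s" for s unfolding Z_def by (rule prob_integral_pos[OF S Zi]) simp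
  have Zd: "(Z has_real_derivative W s) (at s)" for s
    unfolding Z_def W_def using DERIV_integral_weighted_exp[OF cm, of "\<lambda>_. 1" C 1 y s] c y by simp
  have Wd: "(W has_real_derivative (\<integral>\<tau>. c \<tau> * c \<tau> * exp (c \<tau> * s + y \<tau>) \<partial>S)) (at s)" for s
    unfolding W_def by (rule DERIV_integral_weighted_exp[OF cm cm c c y ym])
  have Zc: "isCont Z s" and Wc: "isCont W s" for s using Zd Wd DERIV_isCont by blast+
  have W_le: "\<bar>W s\<bar> \<le> C * Z s" for s
  proof -
    have "\<bar>W s\<bar> \<le> (\<integral>\<tau>. \<bar>c \<tau> * exp (c \<tau> * s + y \<tau>)\<bar> \<partial>S)" unfolding W_def by (rule integral_abs_bound)
    also have "\<dots> \<le> (\<integral>\<tau>. C * exp (c \<tau> * s + y \<tau>) \<partial>S)"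
      by (intro integral_mono integrable_abs integrable_weighted_exp[OF cm cm c c y ym] integrable_mult_right Zi)
        (simp add: abs_mult c)
    finally show ?thesis by (simp add: Z_def)
  qed
  have Z_ge: "exp (- C * \<bar>s\<bar>) * Z 0 \<le> Z s" for s
  proof -
    have "exp (- C * \<bar>s\<bar>) * exp (c \<tau> * 0 + y \<tau>) \<le> exp (c \<tau> * s + y \<tau>)" for \<tau>
    proof -
      have "- (c \<tau> * s) \<le> \<bar>c \<tau>\<bar> * \<bar>s\<bar>" by (metis abs_ge_minus_self abs_mult)
      also have "\<dots> \<le> C * \<bar>s\<bar>" using c by (intro mult_right_mono) auto
      finally show ?thesis by (simp add: exp_add[symmetric])
    qed
    then have "(\<integral>\<tau>. exp (- C * \<bar>s\<bar>) * exp (c \<tau> * 0 + y \<tau>) \<partial>S) \<le> Z s"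
      unfolding Z_def by (intro integral_mono integrable_mult_right Zi)
    then show ?thesis by (simp add: Z_def)
  qed
  define \<phi> where "\<phi> s = exp (b * s + u) / Z s ^ m" for s
  \<comment> \<open>\<open>K\<close> is the value at \<open>s = 0\<close> of the weight. The rate
    \<open>a\<close> collects the slope of the numerator and the decay rate \<open>C\<close> of each
    of the \<open>m\<close> factors \<open>Z\<close>.\<close>
  define K where "K = exp u / Z 0 ^ m"
  define a where "a = \<bar>b\<bar> + real m * C"
  have K0: "0 \<le> K" using Zp[of 0] by (simp add: K_def)
  have \<phi>b: "0 \<le> \<phi> s" "\<phi> s \<le> K * exp (a * \<bar>s\<bar>)" for s
  proof -
    show "0 \<le> \<phi> s" using Zp[of s] by (simp add: \<phi>_def)
    have "(exp (- C * \<bar>s\<bar>) * Z 0) ^ m \<le> Z s ^ m"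
      using Zp[of 0] by (intro power_mono Z_ge) (simp add: less_imp_le)
    then have 1: "exp (- (real m * C * \<bar>s\<bar>)) * Z 0 ^ m \<le> Z s ^ m"
      by (simp add: power_mult_distrib exp_of_nat_mult[symmetric] mult_ac)
    have "b * s \<le> \<bar>b\<bar> * \<bar>s\<bar>" by (metis abs_ge_self abs_mult)
    then have "exp (b * s + u) \<le> exp (\<bar>b\<bar> * \<bar>s\<bar>) * exp u" by (simp add: exp_add)
    then have "\<phi> s \<le> (exp (\<bar>b\<bar> * \<bar>s\<bar>) * exp u) / (exp (- (real m * C * \<bar>s\<bar>)) * Z 0 ^ m)"
      unfolding \<phi>_def using Zp[of 0] 1 by (intro frac_le) auto
    also have "\<dots> = K * exp (a * \<bar>s\<bar>)"
      by (simp add: K_def a_def exp_add distrib_right exp_minus field_simps)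
    finally show "\<phi> s \<le> K * exp (a * \<bar>s\<bar>)" .
  qed
  define \<phi>' where "\<phi>' s = \<phi> s * b - real m * (\<phi> s * W s / Z s)" for s
  have d: "(\<phi> has_real_derivative \<phi>' s) (at s)" for s
  proof -
    have "((\<lambda>s. Z s ^ m) has_real_derivative real m * Z s ^ (m - 1) * W s) (at s)"
      by (rule derivative_eq_intros refl Zd)+ simp
    then have "(\<phi> has_real_derivative ((exp (b * s + u) * b) * Z s ^ m - exp (b * s + u) * (real m * Z s ^ (m - 1) * W s)) / (Z s ^ m * Z s ^ m)) (at s)"
      unfolding \<phi>_def[abs_def] using Zp[of s] by (intro DERIV_divide) (auto intro!: derivative_eq_intros)
    moreover have "((exp (b * s + u) * b) * Z s ^ m - exp (b * s + u) * (real m * Z s ^ (m - 1) * W s)) / (Z s ^ m * Z s ^ m) = \<phi>' s"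
    proof (cases m)
      case 0 then show ?thesis by (simp add: \<phi>'_def \<phi>_def)
    next
      case (Suc k) then show ?thesis using Zp[of s] by (simp add: \<phi>'_def \<phi>_def field_simps)
    qed
    ultimately show ?thesis by simp
  qed
  have \<phi>c: "isCont \<phi> s" for s using d DERIV_isCont by blast
  have \<phi>'c: "isCont \<phi>' s" for s
    unfolding \<phi>'_def[abs_def] using Zp[of s] by (intro continuous_intros \<phi>c Zc Wc) auto
  \<comment> \<open>The logarithmic derivative is at most \<open>a\<close> in absolute value. The
    factor \<open>a + 1\<close> lets one constant serve the weight and its derivative even when
    \<open>a < 1\<close>.\<close>
  have \<phi>'b: "\<bar>\<phi>' s\<bar> \<le> (a + 1) * K * exp (a * \<bar>s\<bar>)" for s
  proof -
    have "\<bar>W s / Z s\<bar> \<le> C" using W_le[of s] Zp[of s] by (simp add: divide_le_eq)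
    then have "\<phi> s * \<bar>W s / Z s\<bar> \<le> \<phi> s * C" using \<phi>b(1) by (rule mult_left_mono)
    then have "real m * (\<phi> s * \<bar>W s / Z s\<bar>) \<le> real m * (\<phi> s * C)" by (rule mult_left_mono) simp
    moreover have "\<bar>\<phi>' s\<bar> \<le> \<phi> s * \<bar>b\<bar> + real m * (\<phi> s * \<bar>W s / Z s\<bar>)"
      unfolding \<phi>'_def using \<phi>b(1)[of s]
      by (intro order_trans[OF abs_triangle_ineq4]) (simp add: abs_mult)
    ultimately have "\<bar>\<phi>' s\<bar> \<le> a * \<phi> s" by (simp add: a_def algebra_simps)
    also have "\<dots> \<le> a * (K * exp (a * \<bar>s\<bar>))" using \<phi>b C0 by (intro mult_left_mono) (auto simp: a_def)
    also have "\<dots> \<le> (a + 1) * K * exp (a * \<bar>s\<bar>)" using K0 by (simp add: algebra_simps)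
    finally show ?thesis .
  qed
  have \<phi>b': "\<bar>\<phi> s\<bar> \<le> (a + 1) * K * exp (a * \<bar>s\<bar>)" for s
  proof -
    have "1 * (K * exp (a * \<bar>s\<bar>)) \<le> (a + 1) * (K * exp (a * \<bar>s\<bar>))"
      using K0 C0 by (intro mult_right_mono) (auto simp: a_def)
    then show ?thesis using \<phi>b[of s] by simp
  qed
  have "(\<integral>s. s * \<phi> s \<partial>std_normal_distribution) = (\<integral>s. \<phi>' s \<partial>std_normal_distribution)"
    by (rule std_normal_ibp[OF d \<phi>'c \<phi>b' \<phi>'b])
  then show ?thesis unfolding \<phi>'_def \<phi>_def W_def .
qed

section \<open>Gaussian spaces and the resampling of one Gaussian direction\<close>

text \<open>Joint normality without vectors or covariance matrices: a linear space each of whose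
  members is centred normal. The variance is written as the second moment, so that no covariance
  function has to be carried along.\<close>

definition gaussian_space :: "'w measure \<Rightarrow> ('w \<Rightarrow> real) set \<Rightarrow> bool" where
  "gaussian_space M \<V> \<longleftrightarrow> (\<forall>X\<in>\<V>. normal_rv M X 0 (\<integral>w. (X w)\<^sup>2 \<partial>M))
     \<and> (\<forall>X\<in>\<V>. \<forall>Y\<in>\<V>. \<forall>a b. (\<lambda>w. a * X w + b * Y w) \<in> \<V>)"

text \<open>Events generated by \<open>X\<close> are preimages, and their probabilities are those of
  the law of \<open>X\<close>.\<close>

lemma distr_eq_agree:
  assumes X: "X \<in> measurable P N" and sets: "sets Q = sets P" and law: "distr P N X = distr Q N X"
  shows "subalgebra P (vimage_algebra (space P) X N)"
    and "A \<in> sets (vimage_algebra (space P) X N) \<Longrightarrow> emeasure P A = emeasure Q A"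
proof -
  have sp: "space Q = space P" by (rule sets_eq_imp_space_eq[OF sets])
  have XQ: "X \<in> measurable Q N" using X sets by (simp cong: measurable_cong_sets)
  have eq: "sets (vimage_algebra (space P) X N) = {X -` B \<inter> space P | B. B \<in> sets N}"
    using X by (intro sets_vimage_algebra2) (auto dest: measurable_space)
  show "subalgebra P (vimage_algebra (space P) X N)"
    unfolding subalgebra_def eq using X by (auto intro: measurable_sets)
  assume "A \<in> sets (vimage_algebra (space P) X N)"
  then obtain B where B: "B \<in> sets N" "A = X -` B \<inter> space P" unfolding eq by auto
  have "emeasure P A = emeasure (distr P N X) B" using X B by (simp add: emeasure_distr)
  also have "\<dots> = emeasure (distr Q N X) B" by (simp add: law)
  also have "\<dots> = emeasure Q A" using XQ B sp by (simp add: emeasure_distr)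
  finally show "emeasure P A = emeasure Q A" .
qed

context prob_space begin

lemma gaussian_space_lincomb:
  "gaussian_space M \<V> \<Longrightarrow> X \<in> \<V> \<Longrightarrow> Y \<in> \<V> \<Longrightarrow> (\<lambda>w. a * X w + b * Y w) \<in> \<V>"
  by (simp add: gaussian_space_def)

lemma gaussian_space_normal_rv:
  "gaussian_space M \<V> \<Longrightarrow> X \<in> \<V> \<Longrightarrow> normal_rv M X 0 (\<integral>w. (X w)\<^sup>2 \<partial>M)"
  by (simp add: gaussian_space_def)

lemma gaussian_space_sum:
  assumes "gaussian_space M \<V>" "A \<in> \<V>" "finite F" "\<And>i. i \<in> F \<Longrightarrow> X i \<in> \<V>"
  shows "(\<lambda>w. \<Sum>i\<in>F. c i * X i w) \<in> \<V>"
  using assms(3,4)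
proof (induction F rule: finite_induct)
  case empty
  show ?case using gaussian_space_lincomb[OF assms(1,2,2), of 0 0] by simp
next
  case (insert i F)
  then have "(\<lambda>w. c i * X i w + 1 * (\<Sum>i\<in>F. c i * X i w)) \<in> \<V>"
    by (intro gaussian_space_lincomb[OF assms(1)]) auto
  then show ?case using insert by simp
qed

lemma gaussian_space_measurable:
  "gaussian_space M \<V> \<Longrightarrow> X \<in> \<V> \<Longrightarrow> X \<in> borel_measurable M"
  using normal_rv_measurable gaussian_space_normal_rv by blast

lemma gaussian_space_integrable_mult:
  assumes "gaussian_space M \<V>" "X \<in> \<V>" "Y \<in> \<V>"
  shows "integrable M (\<lambda>w. X w * Y w)"
proof (rule Bochner_Integration.integrable_bound)
  note [measurable] = gaussian_space_measurable[OF assms(1,2)] gaussian_space_measurable[OF assms(1,3)]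
  show "integrable M (\<lambda>w. (X w)\<^sup>2 + (Y w)\<^sup>2)"
    using normal_rv_integrable_power2 gaussian_space_normal_rv assms by (intro Bochner_Integration.integrable_add) blast+
  show "AE w in M. norm (X w * Y w) \<le> norm ((X w)\<^sup>2 + (Y w)\<^sup>2)"
  proof (rule AE_I2)
    fix w
    have "2 * (\<bar>X w\<bar> * \<bar>Y w\<bar>) \<le> (X w)\<^sup>2 + (Y w)\<^sup>2"
      using sum_squares_bound[of "\<bar>X w\<bar>" "\<bar>Y w\<bar>"] by simp
    moreover have "0 \<le> \<bar>X w\<bar> * \<bar>Y w\<bar>" by simp
    ultimately have "\<bar>X w\<bar> * \<bar>Y w\<bar> \<le> (X w)\<^sup>2 + (Y w)\<^sup>2" by linarith
    then show "norm (X w * Y w) \<le> norm ((X w)\<^sup>2 + (Y w)\<^sup>2)"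
      by (simp add: abs_mult)
  qed
  show "(\<lambda>w. X w * Y w) \<in> borel_measurable M" by measurable
qed

lemma gaussian_space_lincomb_power2:
  assumes G: "gaussian_space M \<V>" "X \<in> \<V>" "Y \<in> \<V>"
  shows "expectation (\<lambda>w. (a * X w + b * Y w)\<^sup>2)
     = a\<^sup>2 * expectation (\<lambda>w. (X w)\<^sup>2) + 2 * a * b * expectation (\<lambda>w. X w * Y w) + b\<^sup>2 * expectation (\<lambda>w. (Y w)\<^sup>2)"
proof -
  have e: "(a * X w + b * Y w)\<^sup>2 = a\<^sup>2 * (X w * X w) + 2 * a * b * (X w * Y w) + b\<^sup>2 * (Y w * Y w)" for w
    by (simp add: power2_eq_square algebra_simps)
  show ?thesis
    unfolding e using gaussian_space_integrable_mult[OF G(1)] G by (simp add: power2_eq_square)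
qed

lemma gaussian_space_null:
  assumes G: "gaussian_space M \<V>" "A \<in> \<V>" "X \<in> \<V>" and A0: "expectation (\<lambda>w. (A w)\<^sup>2) = 0"
  shows "AE w in M. A w = 0" "expectation (\<lambda>w. A w * X w) = 0"
proof -
  show "AE w in M. A w = 0"
    using gaussian_space_normal_rv[OF G(1,2)] A0 by (simp add: normal_rv_def)
  then show "expectation (\<lambda>w. A w * X w) = 0"
    by (intro integral_eq_zero_AE) auto
qed

lemma gaussian_space_iexp:
  assumes G: "gaussian_space M \<V>" "X \<in> \<V>"
  shows "(CLINT w|M. iexp (X w)) = complex_of_real (exp (- expectation (\<lambda>w. (X w)\<^sup>2) / 2))"
  by (rule normal_rv_iexp[OF gaussian_space_normal_rv[OF G]])

text \<open>Subtracting from \<open>K i\<close> its projection on \<open>g\<close> leaves a variable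
  uncorrelated with \<open>g\<close>, hence independent of it. Adding the projection back with an
  independent normal \<open>s\<close> in place of \<open>g\<close> changes no finite-dimensional
  law. For a linear combination \<open>L\<close> with covariance \<open>k\<close> to
  \<open>g\<close>, the variance splits into \<open>k^2\<close> and the remainder.\<close>

lemma ibp_product_law:
  fixes K :: "'i \<Rightarrow> 'a \<Rightarrow> real" and g :: "'a \<Rightarrow> real"
  assumes G: "gaussian_space M \<V>" and g: "g \<in> \<V>" and g1: "expectation (\<lambda>w. (g w)\<^sup>2) = 1"
    and K: "\<And>i. K i \<in> \<V>"
  defines "\<kappa> \<equiv> \<lambda>i. expectation (\<lambda>w. g w * K i w)"
  defines "X \<equiv> \<lambda>i (s, w). \<kappa> i * (s - g w) + K i w"
  shows "distr (distr M (std_normal_distribution \<Otimes>\<^sub>M M) (\<lambda>w. (g w, w))) (Pi\<^sub>M UNIV (\<lambda>_. borel)) (\<lambda>x i. X i x)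
    = distr (std_normal_distribution \<Otimes>\<^sub>M M) (Pi\<^sub>M UNIV (\<lambda>_. borel)) (\<lambda>x i. X i x)"
proof -
  note [measurable] = gaussian_space_measurable[OF G g] gaussian_space_measurable[OF G K]
  interpret N: prob_space std_normal_distribution by (rule prob_space_normal_density) simp
  interpret NM: pair_prob_space std_normal_distribution M ..
  have Xm[measurable]: "X i \<in> borel_measurable (std_normal_distribution \<Otimes>\<^sub>M M)" for i
    unfolding X_def by measurable
  let ?P1 = "distr M (std_normal_distribution \<Otimes>\<^sub>M M) (\<lambda>w. (g w, w))"
  let ?P2 = "std_normal_distribution \<Otimes>\<^sub>M M"
  have gm[measurable]: "(\<lambda>w. (g w, w)) \<in> measurable M ?P2" by measurable
  show ?thesis
  proof (rule Cramer_Wold_distr)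
    show "prob_space ?P1" by (rule prob_space_distr) measurable
    show "prob_space ?P2" by unfold_locales
    fix F :: "'i set" and c assume F: "finite F"
    define L where "L w = (\<Sum>i\<in>F. c i * K i w)" for w
    define k where "k = expectation (\<lambda>w. g w * L w)"
    have L: "L \<in> \<V>" unfolding L_def[abs_def] by (rule gaussian_space_sum[OF G g F K])
    note [measurable] = gaussian_space_measurable[OF G L]
    have k: "k = (\<Sum>i\<in>F. c i * \<kappa> i)"
    proof -
      have "k = expectation (\<lambda>w. \<Sum>i\<in>F. c i * (g w * K i w))"
        unfolding k_def L_def by (simp add: sum_distrib_left mult_ac)
      also have "\<dots> = (\<Sum>i\<in>F. c i * \<kappa> i)"
        unfolding \<kappa>_def using gaussian_space_integrable_mult[OF G g K] by simp
      finally show ?thesis .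
    qed
    have LX: "(\<Sum>i\<in>F. c i * X i (s, w)) = k * s + (L w - k * g w)" for s w
      by (simp add: X_def k L_def sum.distrib algebra_simps sum_distrib_left sum_distrib_right sum_subtractf)
    have "(CLINT x|?P1. iexp (\<Sum>i\<in>F. c i * X i x)) = (CLINT w|M. iexp (\<Sum>i\<in>F. c i * X i (g w, w)))"
      by (subst integral_distr) auto
    also have "\<dots> = (CLINT w|M. iexp (L w))" by (simp add: LX)
    also have "\<dots> = complex_of_real (exp (- expectation (\<lambda>w. (L w)\<^sup>2) / 2))"
      by (rule gaussian_space_iexp[OF G L])
    finally have 1: "(CLINT x|?P1. iexp (\<Sum>i\<in>F. c i * X i x)) = complex_of_real (exp (- expectation (\<lambda>w. (L w)\<^sup>2) / 2))" .
    have int: "integrable ?P2 (\<lambda>(s, w). iexp (k * s) * iexp (L w - k * g w))"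
      by (rule NM.integrable_const_bound[of _ 1]) (auto simp: norm_mult)
    have "(CLINT x|?P2. iexp (\<Sum>i\<in>F. c i * X i x)) = (CLINT x|?P2. (case x of (s, w) \<Rightarrow> iexp (k * s) * iexp (L w - k * g w)))"
    proof (intro Bochner_Integration.integral_cong refl)
      have "iexp (\<Sum>i\<in>F. c i * X i (s, w)) = iexp (k * s) * iexp (L w - k * g w)" for s w
        unfolding LX by (simp only: of_real_add distrib_left exp_add)
      then show "iexp (\<Sum>i\<in>F. c i * X i x) = (case x of (s, w) \<Rightarrow> iexp (k * s) * iexp (L w - k * g w))" for x
        by (cases x) simp
    qed
    also have "\<dots> = (CLINT s|std_normal_distribution. CLINT w|M. iexp (k * s) * iexp (L w - k * g w))"
      using NM.integral_fst'[OF int] by simp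
    also have "\<dots> = char std_normal_distribution k * (CLINT w|M. iexp (L w - k * g w))"
      by (simp add: char_def)
    also have "(CLINT w|M. iexp (L w - k * g w)) = complex_of_real (exp (- (expectation (\<lambda>w. (L w)\<^sup>2) - k\<^sup>2) / 2))"
    proof -
      have "expectation (\<lambda>w. (1 * L w + (- k) * g w)\<^sup>2) = expectation (\<lambda>w. (L w)\<^sup>2) - k\<^sup>2"
        unfolding gaussian_space_lincomb_power2[OF G L g] g1
        by (simp add: k_def power2_eq_square mult.commute)
      then show ?thesis
        using gaussian_space_iexp[OF G gaussian_space_lincomb[OF G L g, of 1 "- k"]] by simp
    qed
    also have "char std_normal_distribution k = complex_of_real (exp (- k\<^sup>2 / 2))"
      by (simp add: char_std_normal_distribution)
    also have "complex_of_real (exp (- k\<^sup>2 / 2)) * complex_of_real (exp (- (expectation (\<lambda>w. (L w)\<^sup>2) - k\<^sup>2) / 2))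
      = complex_of_real (exp (- expectation (\<lambda>w. (L w)\<^sup>2) / 2))"
      by (simp only: of_real_mult[symmetric] exp_add[symmetric]) (simp add: field_simps)
    finally show "(CLINT x|?P1. iexp (\<Sum>i\<in>F. c i * X i x)) = (CLINT x|?P2. iexp (\<Sum>i\<in>F. c i * X i x))"
      using 1 by simp
  qed auto
qed

section \<open>Integration by parts for Gibbs weights\<close>

text \<open>\<open>P1\<close> lives on the graph \<open>s = g w\<close>, where the resampled process
  is \<open>H\<close> and \<open>\<zeta>\<close> is \<open>Z\<close>. Under the product law,
  \<open>\<Psi>1\<close> and \<open>\<Psi>2\<close> have the same integral in \<open>s\<close> for
  almost every frozen \<open>w\<close>. Both are almost surely functions of the resampled family
  under either law, so the equality of their means moves back to the graph.\<close>

lemma gaussian_ibp_normalized: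
  fixes H :: "'a \<Rightarrow> 't \<Rightarrow> real" and g :: "'a \<Rightarrow> real" and d :: "'t \<Rightarrow> real" and x :: "'l \<Rightarrow> 't" and m :: nat
  assumes G: "gaussian_space M \<V>" and g: "g \<in> \<V>" and g1: "expectation (\<lambda>w. (g w)\<^sup>2) = 1"
    and S: "prob_space S"
    and Hm: "(\<lambda>(w, \<tau>). H w \<tau>) \<in> borel_measurable (M \<Otimes>\<^sub>M S)"
    and HV: "\<And>\<tau>. (\<lambda>w. H w \<tau>) \<in> \<V>"
    and dm: "d \<in> borel_measurable S"
    and C: "\<And>\<tau>. \<bar>expectation (\<lambda>w. g w * H w \<tau>)\<bar> \<le> C"
    and L: "finite L"
    and good: "AE w in M. integrable S (\<lambda>\<tau>. exp (H w \<tau> + d \<tau>))"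
  defines "\<gamma> \<equiv> \<lambda>\<tau>. expectation (\<lambda>w. g w * H w \<tau>)"
  defines "Z \<equiv> \<lambda>w. \<integral>\<tau>. exp (H w \<tau> + d \<tau>) \<partial>S"
  defines "\<Phi> \<equiv> \<lambda>w. exp (\<Sum>l\<in>L. H w (x l) + d (x l)) / Z w ^ m"
  assumes int: "integrable M (\<lambda>w. g w * \<Phi> w)" "integrable M \<Phi>"
  shows "expectation (\<lambda>w. g w * \<Phi> w)
    = expectation (\<lambda>w. \<Phi> w * (\<Sum>l\<in>L. \<gamma> (x l)) - real m * (\<Phi> w * (\<integral>\<tau>. \<gamma> \<tau> * exp (H w \<tau> + d \<tau>) \<partial>S) / Z w))"
proof -
  interpret S: prob_space S by fact
  interpret N: prob_space std_normal_distribution by (rule prob_space_normal_density) simp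
  interpret NM: pair_prob_space std_normal_distribution M ..
  interpret MS: pair_prob_space M S ..
  note [measurable] = gaussian_space_measurable[OF G g] Hm dm
  have Hw[measurable]: "(\<lambda>w. H w \<tau>) \<in> borel_measurable M" for \<tau>
    by (rule gaussian_space_measurable[OF G HV])
  have Hs: "H w \<in> borel_measurable S" if "w \<in> space M" for w
    using measurable_Pair2[OF Hm that] by simp
  have \<gamma>m[measurable]: "\<gamma> \<in> borel_measurable S"
    unfolding \<gamma>_def by measurable
  have C: "\<bar>\<gamma> \<tau>\<bar> \<le> C" for \<tau> using C by (simp add: \<gamma>_def)
  have C0: "0 \<le> C" using C[of undefined] by linarith
  define b where "b = (\<Sum>l\<in>L. \<gamma> (x l))"
  let ?P2 = "std_normal_distribution \<Otimes>\<^sub>M M"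
  define P1 where "P1 = distr M ?P2 (\<lambda>w. (g w, w))"
  have gm[measurable]: "(\<lambda>w. (g w, w)) \<in> measurable M ?P2" by measurable
  have P1: "prob_space P1" unfolding P1_def by (rule prob_space_distr) measurable
  have P2: "prob_space ?P2" by unfold_locales
  have setsP1[measurable_cong]: "sets P1 = sets ?P2" by (simp add: P1_def)
  \<comment> \<open>The index \<open>None\<close> carries \<open>g\<close>, whose resampled version
    is the coordinate \<open>s\<close> itself because its variance is 1. Hence \<open>s\<close> is
    measurable for \<open>F\<close> and the factor \<open>g\<close> can be transferred too.\<close>
  define K where "K i = (case i of None \<Rightarrow> g | Some \<tau> \<Rightarrow> (\<lambda>w. H w \<tau>))" for i
  have KV: "K i \<in> \<V>" for i using g HV by (auto simp: K_def split: option.split)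
  define X where "X i = (\<lambda>(s, w). expectation (\<lambda>w. g w * K i w) * (s - g w) + K i w)" for i
  have XN: "X None (s, w) = s" for s w using g1 by (simp add: X_def K_def power2_eq_square)
  have XS: "X (Some \<tau>) (s, w) = \<gamma> \<tau> * (s - g w) + H w \<tau>" for s w \<tau> by (simp add: X_def K_def \<gamma>_def)
  note [measurable] = gaussian_space_measurable[OF G KV]
  have Xm: "X i \<in> borel_measurable ?P2" for i unfolding X_def by measurable
  have XX: "(\<lambda>x i. X i x) \<in> measurable ?P2 (Pi\<^sub>M UNIV (\<lambda>_. borel))"
    by (rule measurable_PiM_single') (use Xm in auto)
  define F where "F = vimage_algebra (space ?P2) (\<lambda>x i. X i x) (Pi\<^sub>M UNIV (\<lambda>_. borel))"
  have law: "distr ?P2 (Pi\<^sub>M UNIV (\<lambda>_. borel)) (\<lambda>x i. X i x) = distr P1 (Pi\<^sub>M UNIV (\<lambda>_. borel)) (\<lambda>x i. X i x)"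
    unfolding P1_def X_def by (rule ibp_product_law[OF G g g1 KV, symmetric])
  have F2: "subalgebra ?P2 F" and agree: "\<And>A. A \<in> sets F \<Longrightarrow> emeasure ?P2 A = emeasure P1 A"
    unfolding F_def by (rule distr_eq_agree[OF XX setsP1 law])+
  have F1: "subalgebra P1 F"
    using F2 setsP1 sets_eq_imp_space_eq[OF setsP1] by (simp add: subalgebra_def)
  have XF[measurable]: "X i \<in> borel_measurable F" for i
  proof -
    have "(\<lambda>x i. X i x) \<in> measurable F (Pi\<^sub>M UNIV (\<lambda>_. borel))"
      unfolding F_def by (rule measurable_vimage_algebra1) (simp add: space_PiM)
    from measurable_compose[OF this measurable_component_singleton[of i]] show ?thesis by simp
  qed
  have jm: "(\<lambda>(p, \<tau>). exp (X (Some \<tau>) p + d \<tau>)) \<in> borel_measurable (?P2 \<Otimes>\<^sub>M S)"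
  proof -
    have e: "(\<lambda>(p, \<tau>). exp (X (Some \<tau>) p + d \<tau>)) = (\<lambda>(p, \<tau>). exp (\<gamma> \<tau> * (fst p - g (snd p)) + H (snd p) \<tau> + d \<tau>))"
      by (auto simp: fun_eq_iff XS)
    show ?thesis unfolding e by measurable
  qed
  define \<zeta> where "\<zeta> p = (\<integral>\<tau>. exp (X (Some \<tau>) p + d \<tau>) \<partial>S)" for p
  define \<omega> where "\<omega> p = (\<integral>\<tau>. \<gamma> \<tau> * exp (X (Some \<tau>) p + d \<tau>) \<partial>S)" for p
  have \<zeta>m[measurable]: "\<zeta> \<in> borel_measurable ?P2" unfolding \<zeta>_def using jm by measurable
  have \<omega>m[measurable]: "\<omega> \<in> borel_measurable ?P2" unfolding \<omega>_def using jm by measurable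
  have ints: "integrable S (\<lambda>\<tau>. exp (X (Some \<tau>) (s, w) + d \<tau>))"
    "integrable S (\<lambda>\<tau>. \<gamma> \<tau> * exp (X (Some \<tau>) (s, w) + d \<tau>))"
    and y: "integrable S (\<lambda>\<tau>. exp (H w \<tau> + d \<tau> - \<gamma> \<tau> * g w))"
    and ym: "(\<lambda>\<tau>. H w \<tau> + d \<tau> - \<gamma> \<tau> * g w) \<in> borel_measurable S"
    if w: "integrable S (\<lambda>\<tau>. exp (H w \<tau> + d \<tau>))" "w \<in> space M" for s w
  proof -
    have mm: "(\<lambda>\<tau>. H w \<tau> + d \<tau>) \<in> borel_measurable S"
      using Hs[OF w(2)] dm by (rule borel_measurable_add)
    have w1: "integrable S (\<lambda>\<tau>. 1 * exp (\<gamma> \<tau> * r + (H w \<tau> + d \<tau>)))" for r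
      by (rule integrable_weighted_exp[OF \<gamma>m _ C _ w(1) mm, where A=1]) simp_all
    have e: "X (Some \<tau>) (s, w) + d \<tau> = \<gamma> \<tau> * (s - g w) + (H w \<tau> + d \<tau>)" for \<tau> by (simp add: XS)
    show "integrable S (\<lambda>\<tau>. exp (X (Some \<tau>) (s, w) + d \<tau>))"
      unfolding e using w1[of "s - g w"] by (simp only: mult_1_left)
    show "integrable S (\<lambda>\<tau>. \<gamma> \<tau> * exp (X (Some \<tau>) (s, w) + d \<tau>))"
      unfolding e by (rule integrable_weighted_exp[OF \<gamma>m \<gamma>m C C w(1) mm])
    have e': "H w \<tau> + d \<tau> - \<gamma> \<tau> * g w = \<gamma> \<tau> * (- g w) + (H w \<tau> + d \<tau>)" for \<tau> by simp
    show "integrable S (\<lambda>\<tau>. exp (H w \<tau> + d \<tau> - \<gamma> \<tau> * g w))"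
      unfolding e' using w1[of "- g w"] by (simp only: mult_1_left)
    show "(\<lambda>\<tau>. H w \<tau> + d \<tau> - \<gamma> \<tau> * g w) \<in> borel_measurable S"
      by (rule borel_measurable_diff[OF mm borel_measurable_times[OF \<gamma>m borel_measurable_const]])
  qed
  have eF: "(\<lambda>p. exp (X (Some \<tau>) p + d \<tau>)) \<in> borel_measurable F" for \<tau>
    using XF[of "Some \<tau>"] by measurable
  obtain VZ where VZ: "VZ \<in> borel_measurable F"
    "AE p in ?P2. integrable S (\<lambda>\<tau>. exp (X (Some \<tau>) p + d \<tau>)) \<longrightarrow> \<zeta> p = VZ p"
    "AE p in P1. integrable S (\<lambda>\<tau>. exp (X (Some \<tau>) p + d \<tau>)) \<longrightarrow> \<zeta> p = VZ p"
    unfolding \<zeta>_def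
  proof (rule parametric_integral_subalgebra[OF P2 P1 S setsP1 F2 agree jm])
    show "(\<lambda>p. exp (X (Some \<tau>) p + d \<tau>)) \<in> borel_measurable F" for \<tau> by (rule eF)
    show "0 \<le> exp (X (Some \<tau>) p + d \<tau>)" for p \<tau> by (rule exp_ge_zero)
  qed (assumption, rule that[unfolded \<zeta>_def])
  \<comment> \<open>The preceding transfer needs a nonnegative integrand while
    \<open>\<gamma>\<close> may change sign. Shifting by the bound \<open>C\<close> makes it
    nonnegative, and \<open>C\<close> times the version of the partition function is subtracted
    afterwards.\<close>
  obtain VW where VW: "VW \<in> borel_measurable F"
    "AE p in ?P2. integrable S (\<lambda>\<tau>. (\<gamma> \<tau> + C) * exp (X (Some \<tau>) p + d \<tau>)) \<longrightarrow> (\<integral>\<tau>. (\<gamma> \<tau> + C) * exp (X (Some \<tau>) p + d \<tau>) \<partial>S) = VW p"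
    "AE p in P1. integrable S (\<lambda>\<tau>. (\<gamma> \<tau> + C) * exp (X (Some \<tau>) p + d \<tau>)) \<longrightarrow> (\<integral>\<tau>. (\<gamma> \<tau> + C) * exp (X (Some \<tau>) p + d \<tau>) \<partial>S) = VW p"
  proof (rule parametric_integral_subalgebra[OF P2 P1 S setsP1 F2 agree, where J="\<lambda>p \<tau>. (\<gamma> \<tau> + C) * exp (X (Some \<tau>) p + d \<tau>)"])
    show "(\<lambda>(p, \<tau>). (\<gamma> \<tau> + C) * exp (X (Some \<tau>) p + d \<tau>)) \<in> borel_measurable (?P2 \<Otimes>\<^sub>M S)" using jm by measurable
    show "(\<lambda>p. (\<gamma> \<tau> + C) * exp (X (Some \<tau>) p + d \<tau>)) \<in> borel_measurable F" for \<tau>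
      by (rule borel_measurable_times[OF borel_measurable_const eF])
    show "0 \<le> (\<gamma> \<tau> + C) * exp (X (Some \<tau>) p + d \<tau>)" for p \<tau> using C[of \<tau>] by (intro mult_nonneg_nonneg) auto
  qed (assumption, rule that)
  note [measurable] = VZ(1) VW(1)
  have \<omega>_eq: "(\<integral>\<tau>. (\<gamma> \<tau> + C) * exp (X (Some \<tau>) (s, w) + d \<tau>) \<partial>S) = \<omega> (s, w) + C * \<zeta> (s, w)"
    and \<omega>_int: "integrable S (\<lambda>\<tau>. (\<gamma> \<tau> + C) * exp (X (Some \<tau>) (s, w) + d \<tau>))"
    if w: "integrable S (\<lambda>\<tau>. exp (H w \<tau> + d \<tau>))" "w \<in> space M" for s w
    unfolding \<omega>_def \<zeta>_def distrib_right using ints[OF w, of s] by simp_all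
  have ae2: "AE p in ?P2. \<zeta> p = VZ p \<and> \<omega> p = VW p - C * VZ p"
    using VZ(2) VW(2) AE_pair_snd[OF sigma_finite_measure_axioms good, of std_normal_distribution] AE_space
  proof eventually_elim
    case (elim p)
    obtain s w where p: "p = (s, w)" by (cases p)
    have w: "integrable S (\<lambda>\<tau>. exp (H w \<tau> + d \<tau>))" "w \<in> space M"
      using elim by (auto simp: p space_pair_measure)
    show ?case using elim(1,2) ints[OF w, of s] \<omega>_eq[OF w, of s] \<omega>_int[OF w, of s] by (simp add: p)
  qed
  have ae1: "AE w in M. \<zeta> (g w, w) = VZ (g w, w) \<and> \<omega> (g w, w) = VW (g w, w) - C * VZ (g w, w)"
    using AE_distrD[OF gm VZ(3)[unfolded P1_def]] AE_distrD[OF gm VW(3)[unfolded P1_def]] good AE_space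
  proof eventually_elim
    case (elim w)
    note w = elim(3,4)
    show ?case using elim(1,2) ints[OF w, of "g w"] \<omega>_eq[OF w, of "g w"] \<omega>_int[OF w, of "g w"] by simp
  qed
  define e where "e p = exp (\<Sum>l\<in>L. X (Some (x l)) p + d (x l))" for p
  have e'F[measurable]: "e \<in> borel_measurable F" unfolding e_def by measurable
  define \<Psi>1 where "\<Psi>1 p = X None p * (e p / \<zeta> p ^ m)" for p
  define \<Psi>2 where "\<Psi>2 p = e p / \<zeta> p ^ m * b - real m * (e p / \<zeta> p ^ m * \<omega> p / \<zeta> p)" for p
  define V1 where "V1 p = X None p * (e p / VZ p ^ m)" for p
  define V2 where "V2 p = e p / VZ p ^ m * b - real m * (e p / VZ p ^ m * (VW p - C * VZ p) / VZ p)" for p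
  have V1: "V1 \<in> borel_measurable F" and V2: "V2 \<in> borel_measurable F"
    unfolding V1_def V2_def by measurable
  note mP2 = measurable_from_subalg[OF F2] and mP1 = measurable_from_subalg[OF F1]
  note [measurable] = mP2[OF e'F] mP2[OF V1] mP2[OF V2] Xm
  have \<Psi>m[measurable]: "\<Psi>1 \<in> borel_measurable ?P2" "\<Psi>2 \<in> borel_measurable ?P2"
    unfolding \<Psi>1_def \<Psi>2_def by measurable
  have a2: "AE p in ?P2. \<Psi>1 p = V1 p" "AE p in ?P2. \<Psi>2 p = V2 p"
    using ae2 by (eventually_elim, simp add: \<Psi>1_def V1_def \<Psi>2_def V2_def)+
  have a1: "AE w in M. \<Psi>1 (g w, w) = V1 (g w, w)" "AE w in M. \<Psi>2 (g w, w) = V2 (g w, w)"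
    using ae1 by (eventually_elim, simp add: \<Psi>1_def V1_def \<Psi>2_def V2_def)+
  have eg: "X (Some \<tau>) (g w, w) = H w \<tau>" for w \<tau> by (simp add: XS)
  have \<Phi>1: "\<Psi>1 (g w, w) = g w * \<Phi> w" for w
    by (simp add: \<Psi>1_def e_def \<zeta>_def eg XN \<Phi>_def Z_def)
  have \<Phi>2: "\<Psi>2 (g w, w) = \<Phi> w * b - real m * (\<Phi> w * (\<integral>\<tau>. \<gamma> \<tau> * exp (H w \<tau> + d \<tau>) \<partial>S) / Z w)" for w
    by (simp add: \<Psi>2_def e_def \<zeta>_def \<omega>_def eg \<Phi>_def Z_def)
  have tr: "expectation (\<lambda>w. \<Psi> (g w, w)) = (\<integral>p. \<Psi> p \<partial>?P2)"
    "integrable M (\<lambda>w. \<Psi> (g w, w)) \<Longrightarrow> integrable ?P2 \<Psi>"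
    if [measurable]: "\<Psi> \<in> borel_measurable ?P2" and V: "V \<in> borel_measurable F"
      and a1: "AE w in M. \<Psi> (g w, w) = V (g w, w)" and a2: "AE p in ?P2. \<Psi> p = V p" for \<Psi> V :: "real \<times> 'a \<Rightarrow> real"
  proof -
    note [measurable] = mP2[OF V]
    have 1: "expectation (\<lambda>w. \<Psi> (g w, w)) = expectation (\<lambda>w. V (g w, w))"
      by (rule integral_cong_AE) (use a1 in measurable)
    have 2: "expectation (\<lambda>w. V (g w, w)) = (\<integral>p. V p \<partial>P1)"
      unfolding P1_def by (rule integral_distr[OF gm mP2[OF V], symmetric])
    have 3: "(\<integral>p. V p \<partial>P1) = (\<integral>p. V p \<partial>?P2)"
      by (rule integral_eq_if_agree[OF F1 F2 agree[symmetric] V mP1[OF V] mP2[OF V]]) auto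
    have 4: "(\<integral>p. V p \<partial>?P2) = (\<integral>p. \<Psi> p \<partial>?P2)"
      by (rule integral_cong_AE) (use a2 in auto)
    show "expectation (\<lambda>w. \<Psi> (g w, w)) = (\<integral>p. \<Psi> p \<partial>?P2)" using 1 2 3 4 by simp
    assume "integrable M (\<lambda>w. \<Psi> (g w, w))"
    also have "integrable M (\<lambda>w. \<Psi> (g w, w)) \<longleftrightarrow> integrable M (\<lambda>w. V (g w, w))"
      by (rule integrable_cong_AE) (use a1 in measurable)
    also have "\<dots> \<longleftrightarrow> integrable P1 V"
      unfolding P1_def by (rule integrable_distr_eq[OF gm mP2[OF V], symmetric])
    also have "\<dots> \<longleftrightarrow> integrable ?P2 V"
      by (rule integrable_iff_if_agree[OF F1 F2 agree[symmetric] V mP1[OF V] mP2[OF V]]) auto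
    also have "\<dots> \<longleftrightarrow> integrable ?P2 \<Psi>" by (rule integrable_cong_AE) (use a2 in auto)
    finally show "integrable ?P2 \<Psi>" .
  qed
  have Zm[measurable]: "Z \<in> borel_measurable M" unfolding Z_def by measurable
  have \<Phi>m[measurable]: "\<Phi> \<in> borel_measurable M" using int(2) by (rule borel_measurable_integrable)
  have i1: "integrable M (\<lambda>w. \<Psi>1 (g w, w))" unfolding \<Phi>1 by (rule int(1))
  \<comment> \<open>Integrability of \<open>\<Psi>2\<close> is not assumed. It follows from that of
    \<open>\<Phi>\<close> because the Gibbs average of \<open>\<gamma>\<close> is at most
    \<open>C\<close>.\<close>
  have i2: "integrable M (\<lambda>w. \<Psi>2 (g w, w))"
  proof (rule Bochner_Integration.integrable_bound[OF integrable_mult_right[OF int(2), of "\<bar>b\<bar> + real m * C"]])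
    show "(\<lambda>w. \<Psi>2 (g w, w)) \<in> borel_measurable M" by measurable
    show "AE w in M. norm (\<Psi>2 (g w, w)) \<le> norm ((\<bar>b\<bar> + real m * C) * \<Phi> w)"
      using good AE_space
    proof eventually_elim
      case (elim w)
      have Zp: "0 < Z w" unfolding Z_def by (rule prob_integral_pos[OF S elim(1)]) simp
      have \<Phi>p: "0 \<le> \<Phi> w" using Zp by (simp add: \<Phi>_def)
      define W where "W = (\<integral>\<tau>. \<gamma> \<tau> * exp (H w \<tau> + d \<tau>) \<partial>S)"
      have "\<bar>W\<bar> \<le> (\<integral>\<tau>. \<bar>\<gamma> \<tau> * exp (H w \<tau> + d \<tau>)\<bar> \<partial>S)" unfolding W_def by (rule integral_abs_bound)
      also have "\<dots> \<le> (\<integral>\<tau>. C * exp (H w \<tau> + d \<tau>) \<partial>S)"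
        using ints(2)[OF elim, of "g w"] elim(1)
        by (intro integral_mono integrable_abs integrable_mult_right) (auto simp: eg abs_mult C)
      finally have "\<bar>W\<bar> \<le> C * Z w" by (simp add: Z_def)
      then have W: "\<bar>W\<bar> / Z w \<le> C" using Zp by (simp add: divide_le_eq)
      have "\<bar>\<Psi>2 (g w, w)\<bar> \<le> \<bar>\<Phi> w * b\<bar> + \<bar>real m * (\<Phi> w * W / Z w)\<bar>"
        unfolding \<Phi>2 W_def by (rule abs_triangle_ineq4)
      also have "\<dots> = \<Phi> w * \<bar>b\<bar> + real m * (\<Phi> w * (\<bar>W\<bar> / Z w))"
        using \<Phi>p Zp by (simp add: abs_mult)
      also have "\<dots> \<le> \<Phi> w * \<bar>b\<bar> + real m * (\<Phi> w * C)"
        using \<Phi>p W by (intro add_left_mono mult_left_mono) auto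
      also have "\<dots> = (\<bar>b\<bar> + real m * C) * \<Phi> w" by (simp add: algebra_simps)
      finally show ?case by (simp add: order_trans[OF _ abs_ge_self])
    qed
  qed
  note t1 = tr[OF \<Psi>m(1) V1 a1(1) a2(1)] and t2 = tr[OF \<Psi>m(2) V2 a1(2) a2(2)]
  have "expectation (\<lambda>w. g w * \<Phi> w) = (\<integral>p. \<Psi>1 p \<partial>?P2)" using t1(1) by (simp add: \<Phi>1)
  also have "\<dots> = (\<integral>w. (\<integral>s. \<Psi>1 (s, w) \<partial>std_normal_distribution) \<partial>M)"
    using NM.integral_snd[of "\<lambda>s w. \<Psi>1 (s, w)"] t1(2)[OF i1] by simp
  also have "\<dots> = (\<integral>w. (\<integral>s. \<Psi>2 (s, w) \<partial>std_normal_distribution) \<partial>M)"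
  proof (rule integral_cong_AE)
    show "AE w in M. (\<integral>s. \<Psi>1 (s, w) \<partial>std_normal_distribution) = (\<integral>s. \<Psi>2 (s, w) \<partial>std_normal_distribution)"
      using good AE_space
    proof eventually_elim
      case (elim w)
      define u where "u = (\<Sum>l\<in>L. H w (x l) + d (x l) - \<gamma> (x l) * g w)"
      \<comment> \<open>With \<open>w\<close> frozen the exponent is affine in \<open>s\<close> with
        slope \<open>\<gamma> \<tau>\<close>, which is the form required by
        \<open>std_normal_ibp_gibbs\<close>.\<close>
      have r: "X (Some \<tau>) (s, w) + d \<tau> = \<gamma> \<tau> * s + (H w \<tau> + d \<tau> - \<gamma> \<tau> * g w)" for s \<tau>
        by (simp add: XS algebra_simps)
      have "(\<Sum>l\<in>L. X (Some (x l)) (s, w) + d (x l)) = b * s + u" for s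
        by (simp add: r b_def u_def sum.distrib sum_distrib_right)
      then have e: "e (s, w) = exp (b * s + u)" for s by (simp add: e_def)
      show ?case
        unfolding \<Psi>1_def \<Psi>2_def e XN \<zeta>_def \<omega>_def r
        by (rule std_normal_ibp_gibbs[OF S \<gamma>m C y[OF elim] ym[OF elim]])
    qed
  qed measurable
  also have "\<dots> = (\<integral>p. \<Psi>2 p \<partial>?P2)"
    using NM.integral_snd[of "\<lambda>s w. \<Psi>2 (s, w)"] t2(2)[OF i2] by simp
  also have "\<dots> = expectation (\<lambda>w. \<Psi>2 (g w, w))" using t2(1) by simp
  finally show ?thesis by (simp add: \<Phi>2 b_def)
qed

text \<open>Both sides are linear in \<open>A\<close>, so \<open>A\<close> can be divided by its
  standard deviation. If the variance is 0, then \<open>A\<close> vanishes almost surely and so do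
  all its covariances.\<close>

lemma gaussian_ibp:
  fixes H :: "'a \<Rightarrow> 't \<Rightarrow> real" and A :: "'a \<Rightarrow> real" and d :: "'t \<Rightarrow> real" and x :: "'l \<Rightarrow> 't" and m :: nat
  assumes G: "gaussian_space M \<V>" and A: "A \<in> \<V>"
    and S: "prob_space S"
    and Hm: "(\<lambda>(w, \<tau>). H w \<tau>) \<in> borel_measurable (M \<Otimes>\<^sub>M S)"
    and HV: "\<And>\<tau>. (\<lambda>w. H w \<tau>) \<in> \<V>"
    and dm: "d \<in> borel_measurable S"
    and C: "\<And>\<tau>. \<bar>expectation (\<lambda>w. A w * H w \<tau>)\<bar> \<le> C"
    and L: "finite L"
    and good: "AE w in M. integrable S (\<lambda>\<tau>. exp (H w \<tau> + d \<tau>))"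
  defines "\<gamma> \<equiv> \<lambda>\<tau>. expectation (\<lambda>w. A w * H w \<tau>)"
  defines "Z \<equiv> \<lambda>w. \<integral>\<tau>. exp (H w \<tau> + d \<tau>) \<partial>S"
  defines "\<Phi> \<equiv> \<lambda>w. exp (\<Sum>l\<in>L. H w (x l) + d (x l)) / Z w ^ m"
  assumes int: "integrable M (\<lambda>w. A w * \<Phi> w)" "integrable M \<Phi>"
  shows "expectation (\<lambda>w. A w * \<Phi> w)
    = expectation (\<lambda>w. \<Phi> w * (\<Sum>l\<in>L. \<gamma> (x l)) - real m * (\<Phi> w * (\<integral>\<tau>. \<gamma> \<tau> * exp (H w \<tau> + d \<tau>) \<partial>S) / Z w))"
proof (cases "expectation (\<lambda>w. (A w)\<^sup>2) = 0")
  case True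
  have ae: "AE w in M. A w = 0" by (rule gaussian_space_null(1)[OF G A A True])
  have "\<gamma> \<tau> = 0" for \<tau> unfolding \<gamma>_def by (rule gaussian_space_null(2)[OF G A HV True])
  moreover have "expectation (\<lambda>w. A w * \<Phi> w) = 0"
    by (rule integral_eq_zero_AE) (use ae in auto)
  ultimately show ?thesis by simp
next
  case False
  define v where "v = expectation (\<lambda>w. (A w)\<^sup>2)"
  have v: "0 < v" using False unfolding v_def by (intro le_neq_trans) (auto intro!: Bochner_Integration.integral_nonneg)
  define c where "c = 1 / sqrt v"
  have c: "0 < c" "c\<^sup>2 * v = 1" using v by (auto simp: c_def power_divide)
  define g where "g w = c * A w" for w
  have g: "g \<in> \<V>" using gaussian_space_lincomb[OF G A A, of c 0] by (simp add: g_def[abs_def])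
  have g1: "expectation (\<lambda>w. (g w)\<^sup>2) = 1"
    using c by (simp add: g_def power_mult_distrib v_def)
  have gH: "expectation (\<lambda>w. g w * H w \<tau>) = c * \<gamma> \<tau>" for \<tau>
    by (simp add: g_def \<gamma>_def mult.assoc)
  have Cc: "\<bar>expectation (\<lambda>w. g w * H w \<tau>)\<bar> \<le> c * C" for \<tau>
    unfolding gH using C[of \<tau>] c by (simp add: abs_mult \<gamma>_def)
  have i1: "integrable M (\<lambda>w. g w * \<Phi> w)"
    using integrable_mult_right[OF int(1), of c] by (simp add: g_def mult.assoc)
  have "expectation (\<lambda>w. g w * \<Phi> w) = expectation (\<lambda>w. \<Phi> w * (\<Sum>l\<in>L. c * \<gamma> (x l))
      - real m * (\<Phi> w * (\<integral>\<tau>. c * \<gamma> \<tau> * exp (H w \<tau> + d \<tau>) \<partial>S) / Z w))"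
    using gaussian_ibp_normalized[OF G g g1 S Hm HV dm Cc L good, of x m] i1 int(2)
    unfolding gH \<Phi>_def Z_def by blast
  also have "\<dots> = expectation (\<lambda>w. c * (\<Phi> w * (\<Sum>l\<in>L. \<gamma> (x l)) - real m * (\<Phi> w * (\<integral>\<tau>. \<gamma> \<tau> * exp (H w \<tau> + d \<tau>) \<partial>S) / Z w)))"
    by (simp add: sum_distrib_left[symmetric] mult.assoc algebra_simps)
  also have "expectation (\<lambda>w. g w * \<Phi> w) = c * expectation (\<lambda>w. A w * \<Phi> w)"
    by (simp add: g_def mult.assoc)
  finally show ?thesis using c(1) by simp
qed

end

section \<open>Interpolation between Gaussian Hamiltonians\<close>

text \<open>The product is at most the largest factor raised to the number of factors. This coarse
  form replaces Hoelder's inequality for moments of products.\<close>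

lemma prod_le_sum_power:
  fixes f :: "'i \<Rightarrow> real"
  assumes "finite I" "I \<noteq> {}" "\<And>i. i \<in> I \<Longrightarrow> 0 \<le> f i"
  shows "(\<Prod>i\<in>I. f i) \<le> (\<Sum>i\<in>I. f i ^ card I)"
proof -
  have "Max (f ` I) \<in> f ` I" using assms(1,2) by (intro Max_in) auto
  then obtain j where jI: "j \<in> I" and jM: "Max (f ` I) = f j" by auto
  have j: "f i \<le> f j" if "i \<in> I" for i
    unfolding jM[symmetric] using assms(1) that by (intro Max_ge) auto
  have "(\<Prod>i\<in>I. f i) \<le> (\<Prod>i\<in>I. f j)" by (intro prod_mono conjI assms(3) j)
  also have "\<dots> = f j ^ card I" by simp
  also have "\<dots> \<le> (\<Sum>i\<in>I. f i ^ card I)"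
    by (rule member_le_sum[OF jI _ assms(1)]) (simp add: assms(3))
  finally show ?thesis .
qed

text \<open>Jensen's inequality for the power function; Bernoulli's inequality supplies the tangent
  line at the mean.\<close>

lemma (in prob_space) power_expectation_le:
  fixes f :: "'a \<Rightarrow> real"
  assumes f: "integrable M f" "integrable M (\<lambda>x. f x ^ k)" and pos: "\<And>x. 0 < f x"
  shows "(expectation f) ^ k \<le> expectation (\<lambda>x. f x ^ k)"
proof -
  define m where "m = expectation f"
  have m: "0 < m" unfolding m_def by (rule prob_integral_pos[OF prob_space_axioms f(1) pos])
  have "m ^ k * (1 + real k * (f x / m - 1)) \<le> f x ^ k" for x
  proof -
    have "1 + real k * (f x / m - 1) \<le> (1 + (f x / m - 1)) ^ k"
      using pos[of x] m by (intro Bernoulli_inequality) simp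
    then have "m ^ k * (1 + real k * (f x / m - 1)) \<le> m ^ k * (f x / m) ^ k"
      using m by (intro mult_left_mono) simp_all
    then show ?thesis using m by (simp add: power_divide)
  qed
  then have "expectation (\<lambda>x. m ^ k * (1 + real k * (f x / m - 1))) \<le> expectation (\<lambda>x. f x ^ k)"
    using f by (intro integral_mono) auto
  moreover have "expectation (\<lambda>x. 1 + real k * (f x / m - 1)) = 1"
    using f(1) m by (simp add: prob_space m_def)
  ultimately show ?thesis unfolding integral_mult_right_zero by (simp add: m_def)
qed

text \<open>Jensen's inequality for the reciprocal: \<open>2 / m - x / m^2\<close> is the tangent
  line of \<open>1 / x\<close> at the mean \<open>m\<close>. This turns an upper bound on
  \<open>exp (- H)\<close> into an upper bound on \<open>1 / Z\<close>.\<close>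

lemma (in prob_space) inverse_expectation_le:
  fixes f h :: "'a \<Rightarrow> real"
  assumes f: "integrable M f" "integrable M h" and pos: "\<And>x. 0 < f x" and h: "\<And>x. 1 / f x \<le> h x"
  shows "1 / expectation f \<le> expectation h"
proof -
  define m where "m = expectation f"
  have m: "0 < m" unfolding m_def by (rule prob_integral_pos[OF prob_space_axioms f(1) pos])
  have "2 / m - f x / m\<^sup>2 \<le> h x" for x
  proof -
    have "0 \<le> (f x - m)\<^sup>2 / (m\<^sup>2 * f x)" using pos[of x] by (intro divide_nonneg_pos) (use m in auto)
    also have "\<dots> = 1 / f x - (2 / m - f x / m\<^sup>2)"
      using pos[of x] m by (simp add: field_simps power2_eq_square)
    finally show ?thesis using h[of x] by linarith
  qed
  then have "expectation (\<lambda>x. 2 / m - f x / m\<^sup>2) \<le> expectation h"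
    using f by (intro integral_mono) auto
  moreover have "expectation (\<lambda>x. 2 / m - f x / m\<^sup>2) = 2 / m - m / m\<^sup>2"
    using f(1) by (simp add: prob_space m_def)
  ultimately show ?thesis using m by (simp add: m_def power2_eq_square field_simps)
qed

section \<open>The interpolated Hamiltonian and its moment bounds\<close>

text \<open>All bounds hold at every configuration, not just almost every one, because covariances
  are later evaluated at fixed replicas. \<open>U\<close> and \<open>V\<close> need only lie in a
  common Gaussian space here; independence enters later, through their covariances.\<close>

locale gaussian_interpolation = prob_space M + S: prob_space S
  for M :: "'w measure" and S :: "'a measure" +
  fixes \<V> :: "('w \<Rightarrow> real) set" and U V :: "'w \<Rightarrow> 'a \<Rightarrow> real" and D0 D1 :: "'a \<Rightarrow> real" and K :: real
  assumes G: "gaussian_space M \<V>"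
    and UV: "\<And>\<sigma>. (\<lambda>w. U w \<sigma>) \<in> \<V>" "\<And>\<sigma>. (\<lambda>w. V w \<sigma>) \<in> \<V>"
    and Um: "(\<lambda>(w, \<sigma>). U w \<sigma>) \<in> borel_measurable (M \<Otimes>\<^sub>M S)"
    and Vm: "(\<lambda>(w, \<sigma>). V w \<sigma>) \<in> borel_measurable (M \<Otimes>\<^sub>M S)"
    and D0m: "D0 \<in> borel_measurable S" and D1m: "D1 \<in> borel_measurable S"
    and UK: "\<And>\<sigma>. expectation (\<lambda>w. (U w \<sigma>)\<^sup>2) \<le> K" and VK: "\<And>\<sigma>. expectation (\<lambda>w. (V w \<sigma>)\<^sup>2) \<le> K"
    and DK: "\<And>\<sigma>. \<bar>D0 \<sigma>\<bar> \<le> K" "\<And>\<sigma>. \<bar>D1 \<sigma>\<bar> \<le> K"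
begin

definition hamiltonian :: "real \<Rightarrow> 'w \<Rightarrow> 'a \<Rightarrow> real" where
  "hamiltonian s w \<sigma> = sqrt s * U w \<sigma> + sqrt (1 - s) * V w \<sigma> + (D0 \<sigma> + s * D1 \<sigma>)"

definition hamiltonian' :: "real \<Rightarrow> 'w \<Rightarrow> 'a \<Rightarrow> real" where
  "hamiltonian' s w \<sigma> = U w \<sigma> / (2 * sqrt s) - V w \<sigma> / (2 * sqrt (1 - s)) + D1 \<sigma>"

text \<open>It dominates \<open>exp\<close> of the Hamiltonian and its reciprocal, simultaneously
  for all parameters in \<open>[0, 1]\<close>. The summand \<open>2 * K\<close> pays for the two
  drift functions and makes the value at least 1.\<close>

definition envelope :: "'w \<Rightarrow> 'a \<Rightarrow> real" where
  "envelope w \<sigma> = exp (\<bar>U w \<sigma>\<bar> + \<bar>V w \<sigma>\<bar> + 2 * K)"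

definition Z :: "real \<Rightarrow> 'w \<Rightarrow> real" where
  "Z s w = (\<integral>\<sigma>. exp (hamiltonian s w \<sigma>) \<partial>S)"

text \<open>The square is there because the derivative of the Hamiltonian contributes one envelope
  and the exponential another; \<open>J\<close> controls both \<open>1 / Z\<close> and
  \<open>Z'\<close>.\<close>

definition J :: "'w \<Rightarrow> real" where
  "J w = (\<integral>\<sigma>. envelope w \<sigma> ^ 2 \<partial>S)"

text \<open>A single event of full measure, independent of the parameter \<open>s\<close>, on which
  all moments of the envelope are finite. Membership in the space gives measurability of the
  sections.\<close>

definition good :: "'w \<Rightarrow> bool" where
  "good w \<longleftrightarrow> w \<in> space M \<and> (\<forall>p. integrable S (\<lambda>\<sigma>. envelope w \<sigma> ^ p))"

lemma Um_section: "(\<lambda>w. U w \<sigma>) \<in> borel_measurable M" and Vm_section: "(\<lambda>w. V w \<sigma>) \<in> borel_measurable M"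
  using gaussian_space_measurable[OF G] UV by blast+

lemma K_nonneg: "0 \<le> K"
  using DK(1)[of undefined] by linarith

lemma hamiltonian_measurable: "(\<lambda>(w, \<sigma>). hamiltonian s w \<sigma>) \<in> borel_measurable (M \<Otimes>\<^sub>M S)"
  unfolding hamiltonian_def using Um Vm D0m D1m by measurable

lemma hamiltonian'_measurable: "(\<lambda>(w, \<sigma>). hamiltonian' s w \<sigma>) \<in> borel_measurable (M \<Otimes>\<^sub>M S)"
  unfolding hamiltonian'_def using Um Vm D1m by measurable

lemma envelope_measurable: "(\<lambda>(w, \<sigma>). envelope w \<sigma>) \<in> borel_measurable (M \<Otimes>\<^sub>M S)"
  unfolding envelope_def using Um Vm by measurable

lemma section_measurable:
  assumes "(\<lambda>(w, \<sigma>). h w \<sigma>) \<in> borel_measurable (M \<Otimes>\<^sub>M S)" "w \<in> space M"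
  shows "h w \<in> borel_measurable S"
  using measurable_Pair2[OF assms] by simp

lemma hamiltonian_section: "(\<lambda>w. hamiltonian s w \<sigma>) \<in> borel_measurable M"
  and hamiltonian'_section: "(\<lambda>w. hamiltonian' s w \<sigma>) \<in> borel_measurable M"
  and envelope_section: "(\<lambda>w. envelope w \<sigma>) \<in> borel_measurable M"
  unfolding hamiltonian_def hamiltonian'_def envelope_def using Um_section[of \<sigma>] Vm_section[of \<sigma>] by measurable

lemma envelope_ge_1: "1 \<le> envelope w \<sigma>"
  using K_nonneg by (simp add: envelope_def)

lemma abs_hamiltonian_le:
  assumes "s \<in> {0..1}"
  shows "\<bar>hamiltonian s w \<sigma>\<bar> \<le> \<bar>U w \<sigma>\<bar> + \<bar>V w \<sigma>\<bar> + 2 * K"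
proof -
  have "\<bar>sqrt s * U w \<sigma>\<bar> \<le> \<bar>U w \<sigma>\<bar>" "\<bar>sqrt (1 - s) * V w \<sigma>\<bar> \<le> \<bar>V w \<sigma>\<bar>"
    using assms by (auto simp: abs_mult intro!: mult_left_le_one_le)
  moreover have "\<bar>s * D1 \<sigma>\<bar> \<le> \<bar>D1 \<sigma>\<bar>" using assms by (auto simp: abs_mult intro!: mult_left_le_one_le)
  ultimately show ?thesis unfolding hamiltonian_def using DK[of \<sigma>] by linarith
qed

lemma exp_hamiltonian_le:
  assumes "s \<in> {0..1}"
  shows "exp (hamiltonian s w \<sigma>) \<le> envelope w \<sigma>" "1 / exp (hamiltonian s w \<sigma>) \<le> envelope w \<sigma>"
proof -
  have b: "hamiltonian s w \<sigma> \<le> \<bar>U w \<sigma>\<bar> + \<bar>V w \<sigma>\<bar> + 2 * K"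
    "- hamiltonian s w \<sigma> \<le> \<bar>U w \<sigma>\<bar> + \<bar>V w \<sigma>\<bar> + 2 * K"
    using abs_hamiltonian_le[OF assms, of w \<sigma>] by linarith+
  show "exp (hamiltonian s w \<sigma>) \<le> envelope w \<sigma>"
    unfolding envelope_def exp_le_cancel_iff by (rule b(1))
  have "1 / exp (hamiltonian s w \<sigma>) = exp (- hamiltonian s w \<sigma>)" by (simp add: exp_minus inverse_eq_divide)
  then show "1 / exp (hamiltonian s w \<sigma>) \<le> envelope w \<sigma>"
    unfolding envelope_def using b(2) by (simp only: exp_le_cancel_iff)
qed

lemma abs_hamiltonian'_le:
  assumes \<kappa>: "1 \<le> \<kappa>" "1 / (2 * sqrt s) \<le> \<kappa>" "1 / (2 * sqrt (1 - s)) \<le> \<kappa>" and s: "s \<in> {0<..<1}"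
  shows "\<bar>hamiltonian' s w \<sigma>\<bar> \<le> \<kappa> * envelope w \<sigma>"
proof -
  have "\<bar>U w \<sigma> / (2 * sqrt s)\<bar> = \<bar>U w \<sigma>\<bar> * (1 / (2 * sqrt s))"
    "\<bar>V w \<sigma> / (2 * sqrt (1 - s))\<bar> = \<bar>V w \<sigma>\<bar> * (1 / (2 * sqrt (1 - s)))"
    using s by (simp_all add: abs_mult)
  then have 1: "\<bar>U w \<sigma> / (2 * sqrt s)\<bar> \<le> \<bar>U w \<sigma>\<bar> * \<kappa>" "\<bar>V w \<sigma> / (2 * sqrt (1 - s))\<bar> \<le> \<bar>V w \<sigma>\<bar> * \<kappa>"
    using \<kappa> by (auto intro!: mult_left_mono simp del: times_divide_eq_right)
  have "K * 1 \<le> K * \<kappa>" using K_nonneg \<kappa> by (intro mult_left_mono) auto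
  then have 2: "\<bar>D1 \<sigma>\<bar> \<le> K * \<kappa>" using DK(2)[of \<sigma>] by linarith
  have "\<bar>hamiltonian' s w \<sigma>\<bar> \<le> \<bar>U w \<sigma> / (2 * sqrt s)\<bar> + \<bar>V w \<sigma> / (2 * sqrt (1 - s))\<bar> + \<bar>D1 \<sigma>\<bar>"
    unfolding hamiltonian'_def by linarith
  also have "\<dots> \<le> \<kappa> * (\<bar>U w \<sigma>\<bar> + \<bar>V w \<sigma>\<bar> + K)" using 1 2 by (simp add: algebra_simps)
  also have "\<dots> \<le> \<kappa> * envelope w \<sigma>"
  proof (rule mult_left_mono)
    show "\<bar>U w \<sigma>\<bar> + \<bar>V w \<sigma>\<bar> + K \<le> envelope w \<sigma>"
      using exp_ge_add_one_self[of "\<bar>U w \<sigma>\<bar> + \<bar>V w \<sigma>\<bar> + 2 * K"] K_nonneg unfolding envelope_def by linarith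
  qed (use \<kappa> in simp)
  finally show ?thesis .
qed

lemma hamiltonian_DERIV:
  assumes "s \<in> {0<..<1}"
  shows "((\<lambda>s. hamiltonian s w \<sigma>) has_real_derivative hamiltonian' s w \<sigma>) (at s)"
proof -
  have s: "0 < s" "0 < 1 - s" using assms by auto
  have 1: "(sqrt has_real_derivative 1 / (2 * sqrt s)) (at s)"
    using DERIV_real_sqrt[OF s(1)] by (simp add: inverse_eq_divide mult.commute)
  have "((\<lambda>s. sqrt (1 - s)) has_real_derivative inverse (sqrt (1 - s)) / 2 * (0 - 1)) (at s)"
    by (rule DERIV_chain2[where f=sqrt and g="\<lambda>s. 1 - s", OF DERIV_real_sqrt[OF s(2)]])
      (auto intro!: derivative_eq_intros)
  then have 2: "((\<lambda>s. sqrt (1 - s)) has_real_derivative - (1 / (2 * sqrt (1 - s)))) (at s)"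
    by (simp add: inverse_eq_divide mult.commute)
  show ?thesis
    unfolding hamiltonian_def hamiltonian'_def
    by (rule derivative_eq_intros refl 1 2)+ simp
qed

text \<open>\<open>exp (q \<bar>a\<bar>) \<le> exp (q a) + exp (- q a)\<close> reduces absolute
  values to normal exponential moments. Separating \<open>U\<close> from \<open>V\<close> by
  squaring doubles the exponent to \<open>q = 2 p\<close>; the 4 counts the two signs for each of
  \<open>U\<close> and \<open>V\<close>.\<close>

lemma envelope_power_moment:
  shows "integrable M (\<lambda>w. envelope w \<sigma> ^ p)"
    and "expectation (\<lambda>w. envelope w \<sigma> ^ p) \<le> 4 * exp (real p * (2 * K)) * exp ((2 * real p)\<^sup>2 * K / 2)"
proof -
  define q where "q = 2 * real p"
  have mgf: "integrable M (\<lambda>w. exp (c * X w)) \<and> expectation (\<lambda>w. exp (c * X w)) \<le> exp (q\<^sup>2 * K / 2)"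
    if X: "X \<in> \<V>" and XK: "expectation (\<lambda>w. (X w)\<^sup>2) \<le> K" and c: "c\<^sup>2 = q\<^sup>2" for X c
  proof -
    have cX: "(\<lambda>w. c * X w) \<in> \<V>" using gaussian_space_lincomb[OF G X X, of c 0] by simp
    note nv = gaussian_space_normal_rv[OF G cX]
    have "q\<^sup>2 * expectation (\<lambda>w. (X w)\<^sup>2) \<le> q\<^sup>2 * K" using XK by (rule mult_left_mono) simp
    then show ?thesis
      using normal_rv_integrable_exp[OF nv] normal_rv_exp[OF nv] by (simp add: power_mult_distrib c)
  qed
  note mU = mgf[OF UV(1) UK, of q \<sigma>] mgf[OF UV(1) UK, of "- q" \<sigma>]
  note mV = mgf[OF UV(2) VK, of q \<sigma>] mgf[OF UV(2) VK, of "- q" \<sigma>]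
  define R where "R w = exp (q * U w \<sigma>) + exp (- q * U w \<sigma>) + (exp (q * V w \<sigma>) + exp (- q * V w \<sigma>))" for w
  have Ri: "integrable M R" unfolding R_def using mU mV by simp
  have RE: "expectation R \<le> 4 * exp (q\<^sup>2 * K / 2)"
    unfolding R_def using mU mV by simp
  have ee: "exp (q * \<bar>a\<bar>) \<le> exp (q * a) + exp (- q * a)" for a :: real by (cases "0 \<le> a") auto
  have le: "envelope w \<sigma> ^ p \<le> exp (real p * (2 * K)) * R w" for w
  proof -
    have "envelope w \<sigma> ^ p = exp (real p * (2 * K)) * (exp (real p * \<bar>U w \<sigma>\<bar>) * exp (real p * \<bar>V w \<sigma>\<bar>))"
      by (simp add: envelope_def exp_of_nat_mult[symmetric] exp_add[symmetric] algebra_simps)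
    also have "exp (real p * \<bar>U w \<sigma>\<bar>) * exp (real p * \<bar>V w \<sigma>\<bar>)
        \<le> (exp (real p * \<bar>U w \<sigma>\<bar>))\<^sup>2 + (exp (real p * \<bar>V w \<sigma>\<bar>))\<^sup>2"
    proof -
      have "2 * (exp (real p * \<bar>U w \<sigma>\<bar>) * exp (real p * \<bar>V w \<sigma>\<bar>)) \<le> (exp (real p * \<bar>U w \<sigma>\<bar>))\<^sup>2 + (exp (real p * \<bar>V w \<sigma>\<bar>))\<^sup>2"
        using sum_squares_bound[of "exp (real p * \<bar>U w \<sigma>\<bar>)" "exp (real p * \<bar>V w \<sigma>\<bar>)"] by simp
      moreover have "0 \<le> exp (real p * \<bar>U w \<sigma>\<bar>) * exp (real p * \<bar>V w \<sigma>\<bar>)" by simp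
      ultimately show ?thesis by linarith
    qed
    also have "(exp (real p * \<bar>U w \<sigma>\<bar>))\<^sup>2 + (exp (real p * \<bar>V w \<sigma>\<bar>))\<^sup>2 = exp (q * \<bar>U w \<sigma>\<bar>) + exp (q * \<bar>V w \<sigma>\<bar>)"
      by (simp add: q_def exp_double[symmetric] mult_ac)
    also have "\<dots> \<le> R w" unfolding R_def by (intro add_mono ee)
    finally show ?thesis by simp
  qed
  show i: "integrable M (\<lambda>w. envelope w \<sigma> ^ p)"
  proof (rule Bochner_Integration.integrable_bound[OF integrable_mult_right[OF Ri, of "exp (real p * (2 * K))"]])
    show "(\<lambda>w. envelope w \<sigma> ^ p) \<in> borel_measurable M"
      by (rule borel_measurable_power[OF envelope_section])
    show "AE w in M. norm (envelope w \<sigma> ^ p) \<le> norm (exp (real p * (2 * K)) * R w)"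
    proof (rule AE_I2)
      fix w show "norm (envelope w \<sigma> ^ p) \<le> norm (exp (real p * (2 * K)) * R w)"
        using le[of w] by (simp add: envelope_def R_def)
    qed
  qed
  have "expectation (\<lambda>w. envelope w \<sigma> ^ p) \<le> expectation (\<lambda>w. exp (real p * (2 * K)) * R w)"
    by (intro integral_mono i integrable_mult_right Ri le)
  also have "\<dots> \<le> exp (real p * (2 * K)) * (4 * exp (q\<^sup>2 * K / 2))" using RE by simp
  finally show "expectation (\<lambda>w. envelope w \<sigma> ^ p) \<le> 4 * exp (real p * (2 * K)) * exp ((2 * real p)\<^sup>2 * K / 2)"
    by (simp add: q_def mult_ac)
qed

end

text \<open>A bound on the mean of every section that is uniform in the second variable is
  integrable over a probability space, which is the criterion of Tonelli's theorem.\<close>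

lemma integrable_pair_uniform:
  fixes h :: "'w \<Rightarrow> 'x \<Rightarrow> real"
  assumes "prob_space M" "prob_space T"
    and h: "(\<lambda>(w, x). h w x) \<in> borel_measurable (M \<Otimes>\<^sub>M T)"
    and int: "\<And>x. integrable M (\<lambda>w. h w x)" and C: "\<And>x. (\<integral>w. \<bar>h w x\<bar> \<partial>M) \<le> C"
  shows "integrable (M \<Otimes>\<^sub>M T) (\<lambda>(w, x). h w x)"
proof -
  interpret M: prob_space M by fact
  interpret T: prob_space T by fact
  interpret TM: pair_sigma_finite T M ..
  interpret MT: pair_sigma_finite M T ..
  have hm: "(\<lambda>(x, w). h w x) \<in> borel_measurable (T \<Otimes>\<^sub>M M)"
    using measurable_pair_swap[OF h] by (simp add: case_prod_beta')
  have "integrable (T \<Otimes>\<^sub>M M) (\<lambda>(x, w). h w x)"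
  proof (rule TM.Fubini_integrable)
    show "(\<lambda>(x, w). h w x) \<in> borel_measurable (T \<Otimes>\<^sub>M M)" by (rule hm)
    have m: "(\<lambda>x. \<integral>w. norm (case (x, w) of (x, w) \<Rightarrow> h w x) \<partial>M) \<in> borel_measurable T"
      using measurable_compose[OF hm borel_measurable_norm] by (intro M.borel_measurable_lebesgue_integral) (simp add: case_prod_beta')
    show "integrable T (\<lambda>x. \<integral>w. norm (case (x, w) of (x, w) \<Rightarrow> h w x) \<partial>M)"
      by (rule T.integrable_const_bound[OF _ m, of C]) (use C in \<open>auto simp: Bochner_Integration.integral_nonneg\<close>)
    show "AE x in T. integrable M (\<lambda>w. case (x, w) of (x, w) \<Rightarrow> h w x)" using int by simp
  qed
  from TM.integrable_product_swap[OF this] show ?thesis by (simp add: case_prod_beta')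
qed

lemma integral_swap_uniform:
  fixes h :: "'w \<Rightarrow> 'x \<Rightarrow> real"
  assumes "prob_space M" "prob_space T"
    and h: "(\<lambda>(w, x). h w x) \<in> borel_measurable (M \<Otimes>\<^sub>M T)"
    and int: "\<And>x. integrable M (\<lambda>w. h w x)" and C: "\<And>x. (\<integral>w. \<bar>h w x\<bar> \<partial>M) \<le> C"
  shows "(\<integral>w. (\<integral>x. h w x \<partial>T) \<partial>M) = (\<integral>x. (\<integral>w. h w x \<partial>M) \<partial>T)"
proof -
  interpret M: prob_space M by fact
  interpret T: prob_space T by fact
  interpret MT: pair_sigma_finite M T ..
  show ?thesis using MT.Fubini_integral[OF integrable_pair_uniform[OF assms]] by simp
qed

context gaussian_interpolation begin

definition T :: "nat \<Rightarrow> (nat \<Rightarrow> 'a) measure" where "T k = Pi\<^sub>M {1..k} (\<lambda>_. S)"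

lemma prob_space_T: "prob_space (T k)"
  unfolding T_def by (rule prob_space_PiM) (rule S.prob_space_axioms)

lemma coord_measurable:
  fixes h :: "'w \<Rightarrow> 'a \<Rightarrow> real"
  assumes h: "(\<lambda>(w, \<sigma>). h w \<sigma>) \<in> borel_measurable (M \<Otimes>\<^sub>M S)" and l: "l \<in> {1..k}"
  shows "(\<lambda>(w, x). h w (x l)) \<in> borel_measurable (M \<Otimes>\<^sub>M T k)"
proof -
  have "(\<lambda>x. x l) \<in> measurable (T k) S" unfolding T_def using l by (rule measurable_component_singleton)
  then have "(\<lambda>p. (fst p, snd p l)) \<in> measurable (M \<Otimes>\<^sub>M T k) (M \<Otimes>\<^sub>M S)"
    by (intro measurable_Pair measurable_fst measurable_compose[OF measurable_snd])
  from measurable_compose[OF this h] show ?thesis by (simp add: case_prod_beta')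
qed

definition envmom :: "nat \<Rightarrow> real" where
  "envmom p = 4 * exp (real p * (2 * K)) * exp ((2 * real p)\<^sup>2 * K / 2)"

lemma envelope_power_measurable: "(\<lambda>(w, \<sigma>). envelope w \<sigma> ^ p) \<in> borel_measurable (M \<Otimes>\<^sub>M S)"
  using borel_measurable_power[OF envelope_measurable, of p] by (simp add: case_prod_beta')

lemma integrable_envelope_power_pair: "integrable (M \<Otimes>\<^sub>M S) (\<lambda>(w, \<sigma>). envelope w \<sigma> ^ p)"
proof (rule integrable_pair_uniform[OF prob_space_axioms S.prob_space_axioms envelope_power_measurable])
  show "integrable M (\<lambda>w. envelope w \<sigma> ^ p)" for \<sigma> by (rule envelope_power_moment(1))
  show "(\<integral>w. \<bar>envelope w \<sigma> ^ p\<bar> \<partial>M) \<le> envmom p" for \<sigma>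
    using envelope_power_moment(2)[of \<sigma> p] by (simp add: envmom_def envelope_def)
qed

lemma AE_good: "AE w in M. good w"
proof -
  interpret MS: pair_sigma_finite M S ..
  have "AE w in M. \<forall>p. integrable S (\<lambda>\<sigma>. envelope w \<sigma> ^ p)"
    unfolding AE_all_countable
    using MS.AE_integrable_fst'[OF integrable_envelope_power_pair] by simp
  then show ?thesis using AE_space by eventually_elim (simp add: good_def)
qed

lemma integral_envelope_power:
  shows "integrable M (\<lambda>w. \<integral>\<sigma>. envelope w \<sigma> ^ p \<partial>S)"
    and "(\<integral>w. (\<integral>\<sigma>. envelope w \<sigma> ^ p \<partial>S) \<partial>M) \<le> envmom p"
proof -
  interpret MS: pair_sigma_finite M S ..
  show "integrable M (\<lambda>w. \<integral>\<sigma>. envelope w \<sigma> ^ p \<partial>S)"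
    using MS.integrable_fst'[OF integrable_envelope_power_pair] by simp
  have "(\<integral>w. (\<integral>\<sigma>. envelope w \<sigma> ^ p \<partial>S) \<partial>M) = (\<integral>\<sigma>. (\<integral>w. envelope w \<sigma> ^ p \<partial>M) \<partial>S)"
    using MS.Fubini_integral[OF integrable_envelope_power_pair] by simp
  also have "\<dots> \<le> envmom p"
  proof (cases "integrable S (\<lambda>\<sigma>. \<integral>w. envelope w \<sigma> ^ p \<partial>M)")
    case True
    then have "(\<integral>\<sigma>. (\<integral>w. envelope w \<sigma> ^ p \<partial>M) \<partial>S) \<le> (\<integral>\<sigma>. envmom p \<partial>S)"
      by (intro integral_mono) (use envelope_power_moment(2) in \<open>auto simp: envmom_def\<close>)
    then show ?thesis by (simp add: S.prob_space)
  qed (simp add: not_integrable_integral_eq envmom_def)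
  finally show "(\<integral>w. (\<integral>\<sigma>. envelope w \<sigma> ^ p \<partial>S) \<partial>M) \<le> envmom p" .
qed

lemma J_measurable: "J \<in> borel_measurable M"
  unfolding J_def using integral_envelope_power(1)[of 2] by (rule borel_measurable_integrable)

lemma goodD:
  assumes "good w"
  shows "w \<in> space M" "integrable S (\<lambda>\<sigma>. envelope w \<sigma> ^ p)" "integrable S (envelope w)"
proof -
  show "w \<in> space M" and i: "integrable S (\<lambda>\<sigma>. envelope w \<sigma> ^ p)" for p
    using assms unfolding good_def by blast+
  show "integrable S (envelope w)" using i[of 1] by simp
qed

lemma integral_envelope_le_J:
  assumes "good w"
  shows "(\<integral>\<sigma>. envelope w \<sigma> \<partial>S) \<le> J w" "1 \<le> J w"
proof -
  show "(\<integral>\<sigma>. envelope w \<sigma> \<partial>S) \<le> J w"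
    unfolding J_def using envelope_ge_1[of w]
    by (intro integral_mono goodD[OF assms]) (simp add: self_le_power)
  have "(\<integral>\<sigma>. 1 \<partial>S) \<le> J w"
    unfolding J_def using envelope_ge_1[of w]
    by (intro integral_mono goodD[OF assms]) (simp_all add: one_le_power)
  then show "1 \<le> J w" by (simp add: S.prob_space)
qed

text \<open>Common majorant of everything that is integrated: one product of envelopes comes from
  the Gibbs density, the other from the quantity averaged, and the powers of \<open>J\<close> come
  from the partition functions.\<close>

definition bound_fn :: "nat \<Rightarrow> nat \<Rightarrow> 'w \<Rightarrow> (nat \<Rightarrow> 'a) \<Rightarrow> real" where
  "bound_fn n q w x = (\<Prod>l\<in>{1..n}. envelope w (x l)) ^ 2 * J w ^ q"

definition bound_const :: "nat \<Rightarrow> nat \<Rightarrow> real" where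
  "bound_const n q = real n * envmom (4 * n) + envmom (4 * q)"

text \<open>\<open>2 a b \<le> a^2 + b^2\<close> separates the replicas from \<open>J\<close>. The
  fourth powers of the envelopes become moments of order \<open>4 * n\<close>, and Jensen's
  inequality bounds \<open>J^(2 q)\<close> by the moment of order \<open>4 * q\<close>. The
  resulting constant does not depend on the replicas.\<close>

lemma bound_fn_integrable:
  assumes n: "1 \<le> n"
  shows "integrable M (\<lambda>w. bound_fn n q w x)" and "expectation (\<lambda>w. bound_fn n q w x) \<le> bound_const n q"
proof -
  define R where "R w = (\<Sum>l\<in>{1..n}. envelope w (x l) ^ (4 * n)) + (\<integral>\<sigma>. envelope w \<sigma> ^ (4 * q) \<partial>S)" for w
  have Ri: "integrable M R"
    unfolding R_def by (intro Bochner_Integration.integrable_add Bochner_Integration.integrable_sum envelope_power_moment(1) integral_envelope_power(1))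
  have "expectation R = (\<Sum>l\<in>{1..n}. expectation (\<lambda>w. envelope w (x l) ^ (4 * n))) + (\<integral>w. (\<integral>\<sigma>. envelope w \<sigma> ^ (4 * q) \<partial>S) \<partial>M)"
    unfolding R_def
    by (simp only: Bochner_Integration.integral_add Bochner_Integration.integral_sum Bochner_Integration.integrable_sum
        envelope_power_moment(1) integral_envelope_power(1))
  also have "\<dots> \<le> (\<Sum>l\<in>{1..n}. envmom (4 * n)) + envmom (4 * q)"
    by (intro add_mono sum_mono integral_envelope_power(2)) (unfold envmom_def, rule envelope_power_moment(2))
  finally have RE: "expectation R \<le> bound_const n q" by (simp add: bound_const_def)
  have m: "(\<lambda>w. bound_fn n q w x) \<in> borel_measurable M"
    unfolding bound_fn_def
    by (intro borel_measurable_times borel_measurable_power borel_measurable_prod envelope_section J_measurable)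
  have le: "AE w in M. bound_fn n q w x \<le> R w" and pos: "AE w in M. 0 \<le> bound_fn n q w x"
  proof -
    show "AE w in M. bound_fn n q w x \<le> R w"
      using AE_good
    proof eventually_elim
      case (elim w)
      define P where "P = (\<Prod>l\<in>{1..n}. envelope w (x l))"
      have "2 * (P ^ 2 * J w ^ q) \<le> (P ^ 2)\<^sup>2 + (J w ^ q)\<^sup>2"
        using sum_squares_bound[of "P ^ 2" "J w ^ q"] by simp
      moreover have "0 \<le> P ^ 2 * J w ^ q" using integral_envelope_le_J(2)[OF elim] by simp
      moreover have "(P ^ 2)\<^sup>2 \<le> (\<Sum>l\<in>{1..n}. envelope w (x l) ^ (4 * n))"
      proof -
        have "(P ^ 2)\<^sup>2 = (\<Prod>l\<in>{1..n}. envelope w (x l) ^ 4)"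
          by (simp add: P_def prod_power_distrib power_mult[symmetric])
        also have "\<dots> \<le> (\<Sum>l\<in>{1..n}. (envelope w (x l) ^ 4) ^ card {1..n})"
          by (rule prod_le_sum_power) (use n in \<open>auto simp: envelope_def\<close>)
        finally show ?thesis by (simp add: power_mult)
      qed
      moreover have "(J w ^ q)\<^sup>2 \<le> (\<integral>\<sigma>. envelope w \<sigma> ^ (4 * q) \<partial>S)"
      proof -
        have e: "(envelope w \<sigma> ^ 2) ^ (2 * q) = envelope w \<sigma> ^ (4 * q)" for \<sigma>
          by (simp add: power_mult[symmetric])
        have "(J w ^ q)\<^sup>2 = J w ^ (2 * q)" by (simp add: power_mult[symmetric] mult.commute)
        also have "\<dots> \<le> (\<integral>\<sigma>. (envelope w \<sigma> ^ 2) ^ (2 * q) \<partial>S)"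
          unfolding J_def
        proof (rule S.power_expectation_le)
          show "0 < envelope w \<sigma> ^ 2" for \<sigma> by (simp add: envelope_def)
        qed (unfold e, (rule goodD[OF elim])+)
        finally show ?thesis by (simp add: e)
      qed
      ultimately show ?case unfolding bound_fn_def R_def P_def[symmetric] by linarith
    qed
    show "AE w in M. 0 \<le> bound_fn n q w x"
      using AE_good
    proof eventually_elim
      case (elim w) then show ?case
        using integral_envelope_le_J(2)[OF elim] by (simp add: bound_fn_def)
    qed
  qed
  show i: "integrable M (\<lambda>w. bound_fn n q w x)"
  proof (rule Bochner_Integration.integrable_bound[OF Ri m])
    show "AE w in M. norm (bound_fn n q w x) \<le> norm (R w)"
      using le pos by eventually_elim simp
  qed
  have "expectation (\<lambda>w. bound_fn n q w x) \<le> expectation R"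
    by (rule integral_mono_AE[OF i Ri le])
  then show "expectation (\<lambda>w. bound_fn n q w x) \<le> bound_const n q" using RE by simp
qed

text \<open>The form in which the moment bounds are applied: a pointwise estimate on
  \<open>good\<close> gives integrability together with a bound uniform in \<open>x\<close>, as the
  exchange of integrals requires.\<close>

lemma uniformly_dominated:
  fixes h :: "'w \<Rightarrow> (nat \<Rightarrow> 'a) \<Rightarrow> real"
  assumes n: "1 \<le> n" and c: "0 \<le> c" and m: "(\<lambda>w. h w x) \<in> borel_measurable M"
    and le: "\<And>w. good w \<Longrightarrow> \<bar>h w x\<bar> \<le> c * bound_fn n q w x"
  shows "integrable M (\<lambda>w. h w x)" and "(\<integral>w. \<bar>h w x\<bar> \<partial>M) \<le> c * bound_const n q"
proof -
  have ae: "AE w in M. \<bar>h w x\<bar> \<le> c * bound_fn n q w x" using AE_good by eventually_elim (rule le)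
  have Bi: "integrable M (\<lambda>w. c * bound_fn n q w x)" by (rule integrable_mult_right[OF bound_fn_integrable(1)[OF n]])
  show i: "integrable M (\<lambda>w. h w x)"
    by (rule Bochner_Integration.integrable_bound[OF Bi m]) (use ae in \<open>eventually_elim, auto\<close>)
  have "(\<integral>w. \<bar>h w x\<bar> \<partial>M) \<le> (\<integral>w. c * bound_fn n q w x \<partial>M)"
    by (rule integral_mono_AE[OF integrable_abs[OF i] Bi ae])
  also have "\<dots> \<le> c * bound_const n q" using bound_fn_integrable(2)[OF n] c by (simp add: mult_left_mono)
  finally show "(\<integral>w. \<bar>h w x\<bar> \<partial>M) \<le> c * bound_const n q" .
qed

section \<open>Gibbs densities and their derivative in the interpolation parameter\<close>

definition Z' :: "real \<Rightarrow> 'w \<Rightarrow> real" where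
  "Z' s w = (\<integral>\<sigma>. hamiltonian' s w \<sigma> * exp (hamiltonian s w \<sigma>) \<partial>S)"

text \<open>Density of the Gibbs measure on \<open>k\<close> replicas relative to the product of
  reference measures.\<close>

definition \<rho> :: "nat \<Rightarrow> real \<Rightarrow> 'w \<Rightarrow> (nat \<Rightarrow> 'a) \<Rightarrow> real" where
  "\<rho> k s w x = exp (\<Sum>l\<in>{1..k}. hamiltonian s w (x l)) / Z s w ^ k"

definition \<rho>' :: "nat \<Rightarrow> real \<Rightarrow> 'w \<Rightarrow> (nat \<Rightarrow> 'a) \<Rightarrow> real" where
  "\<rho>' k s w x = \<rho> k s w x * ((\<Sum>l\<in>{1..k}. hamiltonian' s w (x l)) - real k * (Z' s w / Z s w))"

text \<open>Bounds the singular coefficients \<open>1 / (2 sqrt s)\<close> and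
  \<open>1 / (2 sqrt (1 - s))\<close> on the window that reaches from \<open>t\<close> halfway to
  each of the endpoints 0 and 1.\<close>

definition \<kappa> :: "real \<Rightarrow> real" where
  "\<kappa> t = 1 + 1 / (2 * sqrt (t / 2)) + 1 / (2 * sqrt ((1 - t) / 2))"

lemma window:
  assumes t: "t \<in> {0<..<1}" and s: "s \<in> {t / 2<..<(1 + t) / 2}"
  shows "s \<in> {0<..<1}" "s \<in> {0..1}" "\<bar>hamiltonian' s w \<sigma>\<bar> \<le> \<kappa> t * envelope w \<sigma>"
proof -
  show s01: "s \<in> {0<..<1}" "s \<in> {0..1}" using t s by auto
  have "1 / (2 * sqrt s) \<le> 1 / (2 * sqrt (t / 2))" "1 / (2 * sqrt (1 - s)) \<le> 1 / (2 * sqrt ((1 - t) / 2))"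
    using t s by (auto intro!: frac_le)
  moreover have "0 \<le> 1 / (2 * sqrt (t / 2))" "0 \<le> 1 / (2 * sqrt ((1 - t) / 2))" using t by auto
  ultimately show "\<bar>hamiltonian' s w \<sigma>\<bar> \<le> \<kappa> t * envelope w \<sigma>"
    by (intro abs_hamiltonian'_le[OF _ _ _ s01(1)]) (unfold \<kappa>_def, linarith+)
qed

lemma \<kappa>_ge_1: "t \<in> {0<..<1} \<Longrightarrow> 1 \<le> \<kappa> t"
  by (simp add: \<kappa>_def)

lemma integrable_exp_hamiltonian:
  assumes w: "good w" and s: "s \<in> {0..1}"
  shows "integrable S (\<lambda>\<sigma>. exp (hamiltonian s w \<sigma>))"
proof (rule Bochner_Integration.integrable_bound[OF goodD(3)[OF w]])
  show "(\<lambda>\<sigma>. exp (hamiltonian s w \<sigma>)) \<in> borel_measurable S"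
    by (rule measurable_compose[OF section_measurable[OF hamiltonian_measurable goodD(1)[OF w]] borel_measurable_exp])
  show "AE \<sigma> in S. norm (exp (hamiltonian s w \<sigma>)) \<le> norm (envelope w \<sigma>)"
    using exp_hamiltonian_le(1)[OF s, of w] by (intro AE_I2) (simp add: order_trans[OF _ abs_ge_self])
qed

lemma Z_pos: "good w \<Longrightarrow> s \<in> {0..1} \<Longrightarrow> 0 < Z s w"
  unfolding Z_def by (rule prob_integral_pos[OF S.prob_space_axioms integrable_exp_hamiltonian]) simp_all

lemma inverse_Z_le:
  assumes w: "good w" and s: "s \<in> {0..1}"
  shows "1 / Z s w \<le> J w"
proof -
  have "1 / Z s w \<le> (\<integral>\<sigma>. envelope w \<sigma> \<partial>S)"
    unfolding Z_def
    by (rule S.inverse_expectation_le[OF integrable_exp_hamiltonian[OF w s] goodD(3)[OF w]]) (auto intro: exp_hamiltonian_le(2)[OF s])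
  then show ?thesis using integral_envelope_le_J(1)[OF w] by linarith
qed

lemma hamiltonian'_exp_le:
  assumes t: "t \<in> {0<..<1}" and s: "s \<in> {t / 2<..<(1 + t) / 2}"
  shows "\<bar>hamiltonian' s w \<sigma> * exp (hamiltonian s w \<sigma>)\<bar> \<le> \<kappa> t * envelope w \<sigma> ^ 2"
proof -
  have "\<bar>hamiltonian' s w \<sigma>\<bar> * exp (hamiltonian s w \<sigma>) \<le> (\<kappa> t * envelope w \<sigma>) * envelope w \<sigma>"
    using window[OF t s] exp_hamiltonian_le(1)[OF window(2)[OF t s]] envelope_ge_1[of w \<sigma>] \<kappa>_ge_1[OF t]
    by (intro mult_mono) auto
  then show ?thesis by (simp add: abs_mult power2_eq_square mult.assoc)
qed

lemma hamiltonian'_exp_section: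
  assumes "w \<in> space M"
  shows "(\<lambda>\<sigma>. hamiltonian' s w \<sigma> * exp (hamiltonian s w \<sigma>)) \<in> borel_measurable S"
  by (intro borel_measurable_times section_measurable[OF hamiltonian'_measurable assms]
      measurable_compose[OF section_measurable[OF hamiltonian_measurable assms] borel_measurable_exp])

lemma integrable_hamiltonian'_exp:
  assumes w: "good w" and t: "t \<in> {0<..<1}" and s: "s \<in> {t / 2<..<(1 + t) / 2}"
  shows "integrable S (\<lambda>\<sigma>. hamiltonian' s w \<sigma> * exp (hamiltonian s w \<sigma>))"
proof (rule Bochner_Integration.integrable_bound[OF integrable_mult_right[OF goodD(2)[OF w, of 2], of "\<kappa> t"]])
  show "(\<lambda>\<sigma>. hamiltonian' s w \<sigma> * exp (hamiltonian s w \<sigma>)) \<in> borel_measurable S"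
    by (rule hamiltonian'_exp_section[OF goodD(1)[OF w]])
  show "AE \<sigma> in S. norm (hamiltonian' s w \<sigma> * exp (hamiltonian s w \<sigma>)) \<le> norm (\<kappa> t * envelope w \<sigma> ^ 2)"
    using hamiltonian'_exp_le[OF t s, of w] by (intro AE_I2) (simp add: order_trans[OF _ abs_ge_self])
qed

lemma abs_Z'_le:
  assumes w: "good w" and t: "t \<in> {0<..<1}" and s: "s \<in> {t / 2<..<(1 + t) / 2}"
  shows "\<bar>Z' s w\<bar> \<le> \<kappa> t * J w"
proof -
  have "\<bar>Z' s w\<bar> \<le> (\<integral>\<sigma>. \<bar>hamiltonian' s w \<sigma> * exp (hamiltonian s w \<sigma>)\<bar> \<partial>S)"
    unfolding Z'_def by (rule integral_abs_bound)
  also have "\<dots> \<le> (\<integral>\<sigma>. \<kappa> t * envelope w \<sigma> ^ 2 \<partial>S)"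
    by (intro integral_mono integrable_abs integrable_hamiltonian'_exp[OF w t s] integrable_mult_right goodD(2)[OF w] hamiltonian'_exp_le[OF t s])
  finally show ?thesis by (simp add: J_def)
qed

lemma Z_DERIV:
  assumes w: "good w" and t: "t \<in> {0<..<1}" and s: "s \<in> {t / 2<..<(1 + t) / 2}"
  shows "((\<lambda>s. Z s w) has_real_derivative Z' s w) (at s)"
  unfolding Z_def Z'_def
proof (rule has_real_derivative_integral[OF s, where D="\<lambda>\<sigma>. \<kappa> t * envelope w \<sigma> ^ 2"
      and g="\<lambda>s \<sigma>. exp (hamiltonian s w \<sigma>)" and g'="\<lambda>s \<sigma>. hamiltonian' s w \<sigma> * exp (hamiltonian s w \<sigma>)"])
  show "integrable S (\<lambda>\<sigma>. exp (hamiltonian s w \<sigma>))" if "s \<in> {t / 2<..<(1 + t) / 2}" for s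
    by (rule integrable_exp_hamiltonian[OF w window(2)[OF t that]])
  show "(\<lambda>\<sigma>. hamiltonian' s w \<sigma> * exp (hamiltonian s w \<sigma>)) \<in> borel_measurable S"
    by (rule hamiltonian'_exp_section[OF goodD(1)[OF w]])
  show "integrable S (\<lambda>\<sigma>. \<kappa> t * envelope w \<sigma> ^ 2)" by (rule integrable_mult_right[OF goodD(2)[OF w]])
  show "AE \<sigma> in S. \<forall>s\<in>{t / 2<..<(1 + t) / 2}.
      ((\<lambda>s. exp (hamiltonian s w \<sigma>)) has_real_derivative hamiltonian' s w \<sigma> * exp (hamiltonian s w \<sigma>)) (at s)
      \<and> \<bar>hamiltonian' s w \<sigma> * exp (hamiltonian s w \<sigma>)\<bar> \<le> \<kappa> t * envelope w \<sigma> ^ 2"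
  proof (intro AE_I2 ballI conjI)
    fix \<sigma> s assume s: "s \<in> {t / 2<..<(1 + t) / 2}"
    show "((\<lambda>s. exp (hamiltonian s w \<sigma>)) has_real_derivative hamiltonian' s w \<sigma> * exp (hamiltonian s w \<sigma>)) (at s)"
      by (rule DERIV_cong[OF DERIV_fun_exp[OF hamiltonian_DERIV[OF window(1)[OF t s]]]]) simp
  qed (rule hamiltonian'_exp_le[OF t])
qed

lemma \<rho>_le:
  assumes w: "good w" and s: "s \<in> {0..1}"
  shows "0 \<le> \<rho> k s w x" "\<rho> k s w x \<le> (\<Prod>l\<in>{1..k}. envelope w (x l)) * J w ^ k"
proof -
  have "\<rho> k s w x = (\<Prod>l\<in>{1..k}. exp (hamiltonian s w (x l))) * (1 / Z s w) ^ k"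
    by (simp add: \<rho>_def exp_sum power_divide)
  moreover have "(\<Prod>l\<in>{1..k}. exp (hamiltonian s w (x l))) \<le> (\<Prod>l\<in>{1..k}. envelope w (x l))"
    by (intro prod_mono) (auto intro: exp_hamiltonian_le(1)[OF s])
  moreover have "(1 / Z s w) ^ k \<le> J w ^ k"
    using Z_pos[OF w s] by (intro power_mono inverse_Z_le[OF w s]) simp
  ultimately show "\<rho> k s w x \<le> (\<Prod>l\<in>{1..k}. envelope w (x l)) * J w ^ k"
    using Z_pos[OF w s] integral_envelope_le_J(2)[OF w]
    by (auto intro!: mult_mono prod_nonneg simp: envelope_def)
  show "0 \<le> \<rho> k s w x" using Z_pos[OF w s] by (simp add: \<rho>_def)
qed

lemma prod_envelope_ge:
  fixes x :: "nat \<Rightarrow> 'a"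
  shows "1 \<le> (\<Prod>l\<in>{1..k}. envelope w (x l))" "l \<in> {1..k} \<Longrightarrow> envelope w (x l) \<le> (\<Prod>l\<in>{1..k}. envelope w (x l))"
proof -
  show "1 \<le> (\<Prod>l\<in>{1..k}. envelope w (x l))" by (rule prod_ge_1) (rule envelope_ge_1)
  assume l: "l \<in> {1..k}"
  have "1 \<le> (\<Prod>l\<in>{1..k} - {l}. envelope w (x l))" by (rule prod_ge_1) (rule envelope_ge_1)
  then have "envelope w (x l) * 1 \<le> envelope w (x l) * (\<Prod>l\<in>{1..k} - {l}. envelope w (x l))"
    using envelope_ge_1[of w "x l"] by (intro mult_left_mono) auto
  also have "\<dots> = (\<Prod>l\<in>{1..k}. envelope w (x l))" by (rule prod.remove[OF finite_atLeastAtMost l, symmetric])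
  finally show "envelope w (x l) \<le> (\<Prod>l\<in>{1..k}. envelope w (x l))" by simp
qed

text \<open>\<open>J^k\<close> comes from the density and \<open>J^2\<close> from a ratio such as
  \<open>Z' / Z\<close>, which explains the exponent \<open>k + 2\<close> throughout.\<close>

lemma \<rho>_weighted_le:
  assumes w: "good w" and s: "s \<in> {0..1}"
    and u: "\<bar>u\<bar> \<le> c * (\<Prod>l\<in>{1..k}. envelope w (x l)) * J w ^ 2" and c: "0 \<le> c"
  shows "\<bar>\<rho> k s w x * u\<bar> \<le> c * bound_fn k (k + 2) w x"
proof -
  define P where "P = (\<Prod>l\<in>{1..k}. envelope w (x l))"
  have P: "1 \<le> P" unfolding P_def by (rule prod_envelope_ge)
  note J1 = integral_envelope_le_J(2)[OF w]
  have "\<bar>\<rho> k s w x * u\<bar> = \<rho> k s w x * \<bar>u\<bar>" using \<rho>_le(1)[OF w s] by (simp add: abs_mult)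
  also have "\<dots> \<le> (P * J w ^ k) * (c * P * J w ^ 2)"
    using \<rho>_le[OF w s, of k x] u P J1 c unfolding P_def[symmetric] by (intro mult_mono) auto
  also have "\<dots> = c * bound_fn k (k + 2) w x"
    unfolding bound_fn_def P_def[symmetric] by (simp add: power2_eq_square power_add mult_ac)
  finally show ?thesis .
qed

lemma \<rho>'_le:
  assumes w: "good w" and t: "t \<in> {0<..<1}" and s: "s \<in> {t / 2<..<(1 + t) / 2}"
  shows "\<bar>\<rho>' k s w x\<bar> \<le> (2 * real k * \<kappa> t) * bound_fn k (k + 2) w x"
  unfolding \<rho>'_def
proof (rule \<rho>_weighted_le[OF w window(2)[OF t s]])
  define P where "P = (\<Prod>l\<in>{1..k}. envelope w (x l))"
  have P: "1 \<le> P" unfolding P_def by (rule prod_envelope_ge)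
  note J1 = integral_envelope_le_J(2)[OF w]
  have k1: "0 \<le> \<kappa> t" using \<kappa>_ge_1[OF t] by simp
  have PJ: "P * 1 \<le> P * J w ^ 2" "1 * J w ^ 2 \<le> P * J w ^ 2"
    using P J1 by (intro mult_left_mono mult_right_mono; simp add: one_le_power)+
  have "\<bar>\<Sum>l\<in>{1..k}. hamiltonian' s w (x l)\<bar> \<le> (\<Sum>l\<in>{1..k}. \<kappa> t * P)"
  proof (intro order_trans[OF sum_abs] sum_mono)
    fix l assume "l \<in> {1..k}"
    then have "\<kappa> t * envelope w (x l) \<le> \<kappa> t * P"
      unfolding P_def using k1 by (intro mult_left_mono prod_envelope_ge)
    then show "\<bar>hamiltonian' s w (x l)\<bar> \<le> \<kappa> t * P" using window(3)[OF t s, of w "x l"] by linarith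
  qed
  also have "\<dots> \<le> real k * \<kappa> t * (P * J w ^ 2)"
    using PJ(1) mult_left_mono[of P "P * J w ^ 2" "real k * \<kappa> t"] k1 by simp
  finally have 1: "\<bar>\<Sum>l\<in>{1..k}. hamiltonian' s w (x l)\<bar> \<le> real k * \<kappa> t * (P * J w ^ 2)" .
  have "\<bar>Z' s w / Z s w\<bar> = \<bar>Z' s w\<bar> * (1 / Z s w)" using Z_pos[OF w window(2)[OF t s]] by simp
  also have "\<dots> \<le> (\<kappa> t * J w) * J w"
    using abs_Z'_le[OF w t s] inverse_Z_le[OF w window(2)[OF t s]] Z_pos[OF w window(2)[OF t s]] k1 J1
    by (intro mult_mono) auto
  also have "\<dots> \<le> \<kappa> t * (P * J w ^ 2)" using PJ(2) mult_left_mono[OF PJ(2) k1] by (simp add: power2_eq_square)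
  finally have "real k * \<bar>Z' s w / Z s w\<bar> \<le> real k * (\<kappa> t * (P * J w ^ 2))" by (rule mult_left_mono) simp
  then have 2: "\<bar>real k * (Z' s w / Z s w)\<bar> \<le> real k * \<kappa> t * (P * J w ^ 2)"
    by (simp add: abs_mult mult.assoc)
  show "\<bar>(\<Sum>l\<in>{1..k}. hamiltonian' s w (x l)) - real k * (Z' s w / Z s w)\<bar> \<le> 2 * real k * \<kappa> t * (\<Prod>l\<in>{1..k}. envelope w (x l)) * J w ^ 2"
  proof -
    have "\<bar>(\<Sum>l\<in>{1..k}. hamiltonian' s w (x l)) - real k * (Z' s w / Z s w)\<bar>
        \<le> \<bar>\<Sum>l\<in>{1..k}. hamiltonian' s w (x l)\<bar> + \<bar>real k * (Z' s w / Z s w)\<bar>"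
      by (rule abs_triangle_ineq4)
    also have "\<dots> \<le> real k * \<kappa> t * (P * J w ^ 2) + real k * \<kappa> t * (P * J w ^ 2)"
      using 1 2 by (rule add_mono)
    also have "\<dots> = 2 * real k * \<kappa> t * (\<Prod>l\<in>{1..k}. envelope w (x l)) * J w ^ 2"
      by (simp only: P_def mult.assoc mult_2[symmetric])
    finally show ?thesis .
  qed
  show "0 \<le> 2 * real k * \<kappa> t" using k1 by simp
qed

lemma \<rho>_DERIV:
  assumes w: "good w" and t: "t \<in> {0<..<1}" and s: "s \<in> {t / 2<..<(1 + t) / 2}"
  shows "((\<lambda>s. \<rho> k s w x) has_real_derivative \<rho>' k s w x) (at s)"
proof -
  note Zp = Z_pos[OF w window(2)[OF t s]]
  define e where "e s = (\<Sum>l\<in>{1..k}. hamiltonian s w (x l))" for s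
  define e' where "e' = (\<Sum>l\<in>{1..k}. hamiltonian' s w (x l))"
  have "(e has_real_derivative e') (at s)"
    unfolding e_def e'_def by (intro DERIV_sum hamiltonian_DERIV[OF window(1)[OF t s]])
  then have 1: "((\<lambda>s. exp (e s)) has_real_derivative exp (e s) * e') (at s)" by (rule DERIV_fun_exp)
  have 2: "((\<lambda>s. Z s w ^ k) has_real_derivative real k * Z s w ^ (k - 1) * Z' s w) (at s)"
    by (rule DERIV_cong[OF DERIV_power[OF Z_DERIV[OF w t s]]]) (simp add: mult_ac)
  have "((\<lambda>s. exp (e s) / Z s w ^ k) has_real_derivative
      (exp (e s) * e' * Z s w ^ k - exp (e s) * (real k * Z s w ^ (k - 1) * Z' s w)) / (Z s w ^ k * Z s w ^ k)) (at s)"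
    by (rule DERIV_divide[OF 1 2]) (use Zp in simp)
  moreover have "(exp (e s) * e' * Z s w ^ k - exp (e s) * (real k * Z s w ^ (k - 1) * Z' s w)) / (Z s w ^ k * Z s w ^ k) = \<rho>' k s w x"
    unfolding \<rho>'_def \<rho>_def e_def[symmetric] e'_def[symmetric] using Zp by (cases k) (simp_all add: field_simps)
  ultimately show ?thesis by (simp add: \<rho>_def e_def)
qed

lemma Z_measurable: "Z s \<in> borel_measurable M"
  unfolding Z_def
  by (rule S.borel_measurable_lebesgue_integral)
     (use measurable_compose[OF hamiltonian_measurable borel_measurable_exp] in \<open>simp add: case_prod_beta'\<close>)

lemma hamiltonian'_exp_measurable:
  "(\<lambda>(w, \<sigma>). hamiltonian' s w \<sigma> * exp (hamiltonian s w \<sigma>)) \<in> borel_measurable (M \<Otimes>\<^sub>M S)"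
  using borel_measurable_times[OF hamiltonian'_measurable[of s] measurable_compose[OF hamiltonian_measurable[of s] borel_measurable_exp]]
  by (simp add: case_prod_beta')

lemma Z'_measurable: "Z' s \<in> borel_measurable M"
  unfolding Z'_def by (rule S.borel_measurable_lebesgue_integral[OF hamiltonian'_exp_measurable])

lemma \<rho>_measurable: "(\<lambda>(w, x). \<rho> k s w x) \<in> borel_measurable (M \<Otimes>\<^sub>M T k)"
proof -
  have "(\<lambda>p. \<Sum>l\<in>{1..k}. hamiltonian s (fst p) (snd p l)) \<in> borel_measurable (M \<Otimes>\<^sub>M T k)"
    using coord_measurable[OF hamiltonian_measurable[of s]] by (intro borel_measurable_sum) (simp add: case_prod_beta')
  then have "(\<lambda>p. exp (\<Sum>l\<in>{1..k}. hamiltonian s (fst p) (snd p l)) / Z s (fst p) ^ k) \<in> borel_measurable (M \<Otimes>\<^sub>M T k)"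
    by (intro borel_measurable_divide borel_measurable_power measurable_compose[OF _ borel_measurable_exp]
        measurable_compose[OF measurable_fst Z_measurable])
  then show ?thesis by (simp add: \<rho>_def case_prod_beta')
qed

lemma \<rho>'_measurable: "(\<lambda>(w, x). \<rho>' k s w x) \<in> borel_measurable (M \<Otimes>\<^sub>M T k)"
proof -
  have 1: "(\<lambda>p. \<Sum>l\<in>{1..k}. hamiltonian' s (fst p) (snd p l)) \<in> borel_measurable (M \<Otimes>\<^sub>M T k)"
    using coord_measurable[OF hamiltonian'_measurable[of s]] by (intro borel_measurable_sum) (simp add: case_prod_beta')
  have 2: "(\<lambda>p. \<rho> k s (fst p) (snd p)) \<in> borel_measurable (M \<Otimes>\<^sub>M T k)"
    using \<rho>_measurable by (simp add: case_prod_beta')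
  have "(\<lambda>p. \<rho> k s (fst p) (snd p) * ((\<Sum>l\<in>{1..k}. hamiltonian' s (fst p) (snd p l)) - real k * (Z' s (fst p) / Z s (fst p)))) \<in> borel_measurable (M \<Otimes>\<^sub>M T k)"
    by (intro borel_measurable_times borel_measurable_diff borel_measurable_divide 1 2 borel_measurable_const
        measurable_compose[OF measurable_fst Z_measurable] measurable_compose[OF measurable_fst Z'_measurable])
  then show ?thesis by (simp add: \<rho>'_def case_prod_beta')
qed

lemma \<rho>_section: "(\<lambda>w. \<rho> k s w x) \<in> borel_measurable M" and \<rho>'_section: "(\<lambda>w. \<rho>' k s w x) \<in> borel_measurable M"
proof -
  show 1: "(\<lambda>w. \<rho> k s w x) \<in> borel_measurable M"
    unfolding \<rho>_def by (intro borel_measurable_divide borel_measurable_power measurable_compose[OF _ borel_measurable_exp]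
        borel_measurable_sum hamiltonian_section Z_measurable)
  show "(\<lambda>w. \<rho>' k s w x) \<in> borel_measurable M"
    unfolding \<rho>'_def by (intro borel_measurable_times borel_measurable_diff borel_measurable_divide 1 borel_measurable_const
        borel_measurable_sum hamiltonian'_section Z'_measurable Z_measurable)
qed

lemma \<rho>_bound_fn:
  assumes w: "good w" and s: "s \<in> {0..1}"
  shows "\<bar>\<rho> k s w x\<bar> \<le> 1 * bound_fn k (k + 2) w x"
proof -
  have J1: "1 \<le> J w ^ 2" using integral_envelope_le_J(2)[OF w] by (simp add: one_le_power)
  have "1 * 1 \<le> (\<Prod>l\<in>{1..k}. envelope w (x l)) * J w ^ 2"
    using prod_envelope_ge(1)[where x=x and w=w and k=k] J1 by (intro mult_mono) auto
  then show ?thesis using \<rho>_weighted_le[OF w s, where u=1 and c=1 and k=k and x=x] by simp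
qed

lemma expectation_\<rho>_DERIV:
  assumes k: "1 \<le> k" and t: "t \<in> {0<..<1}" and s: "s \<in> {t / 2<..<(1 + t) / 2}"
  shows "((\<lambda>s. expectation (\<lambda>w. \<rho> k s w x)) has_real_derivative expectation (\<lambda>w. \<rho>' k s w x)) (at s)"
proof (rule has_real_derivative_integral[OF s])
  show "integrable M (\<lambda>w. \<rho> k s w x)" if "s \<in> {t / 2<..<(1 + t) / 2}" for s
    by (rule uniformly_dominated(1)[OF k _ \<rho>_section \<rho>_bound_fn[OF _ window(2)[OF t that]]]) simp_all
  show "(\<lambda>w. \<rho>' k s w x) \<in> borel_measurable M" by (rule \<rho>'_section)
  show "integrable M (\<lambda>w. 2 * real k * \<kappa> t * bound_fn k (k + 2) w x)"
    by (rule integrable_mult_right[OF bound_fn_integrable(1)[OF k]])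
  show "AE w in M. \<forall>s\<in>{t / 2<..<(1 + t) / 2}. ((\<lambda>s. \<rho> k s w x) has_real_derivative \<rho>' k s w x) (at s)
      \<and> \<bar>\<rho>' k s w x\<bar> \<le> 2 * real k * \<kappa> t * bound_fn k (k + 2) w x"
    using AE_good by eventually_elim (use \<rho>_DERIV[OF _ t] \<rho>'_le[OF _ t] in blast)
qed

lemma expectation_abs_\<rho>'_le:
  assumes k: "1 \<le> k" and t: "t \<in> {0<..<1}" and s: "s \<in> {t / 2<..<(1 + t) / 2}"
  shows "\<bar>expectation (\<lambda>w. \<rho>' k s w x)\<bar> \<le> 2 * real k * \<kappa> t * bound_const k (k + 2)"
proof -
  have "0 \<le> 2 * real k * \<kappa> t" using \<kappa>_ge_1[OF t] by simp
  from uniformly_dominated(2)[where h="\<lambda>w x. \<rho>' k s w x" and x=x, OF k this \<rho>'_section \<rho>'_le[OF _ t s]]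
  have "(\<integral>w. \<bar>\<rho>' k s w x\<bar> \<partial>M) \<le> 2 * real k * \<kappa> t * bound_const k (k + 2)" by blast
  then show ?thesis using integral_abs_bound[of M "\<lambda>w. \<rho>' k s w x"] by linarith
qed

definition average :: "nat \<Rightarrow> real \<Rightarrow> ((nat \<Rightarrow> 'a) \<Rightarrow> real) \<Rightarrow> real" where
  "average k s f = (\<integral>w. (\<integral>x. f x * \<rho> k s w x \<partial>T k) \<partial>M)"

text \<open>Taking the expectation inside leaves a deterministic density, so the expectation and the
  replica integral can be differentiated one after the other.\<close>

lemma average_eq:
  assumes k: "1 \<le> k" and s: "s \<in> {0..1}" and f: "f \<in> borel_measurable (T k)" and B: "\<And>x. \<bar>f x\<bar> \<le> B"
  shows "average k s f = (\<integral>x. f x * expectation (\<lambda>w. \<rho> k s w x) \<partial>T k)"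
proof -
  have B0: "0 \<le> B" using B[of undefined] by linarith
  have le: "\<bar>f x * \<rho> k s w x\<bar> \<le> B * bound_fn k (k + 2) w x" if "good w" for w x
    using mult_mono[OF B \<rho>_bound_fn[OF that s] B0] by (simp add: abs_mult)
  have sec: "(\<lambda>w. f x * \<rho> k s w x) \<in> borel_measurable M" for x
    by (intro borel_measurable_times borel_measurable_const \<rho>_section)
  have "average k s f = (\<integral>x. (\<integral>w. f x * \<rho> k s w x \<partial>M) \<partial>T k)"
    unfolding average_def
  proof (rule integral_swap_uniform[OF prob_space_axioms prob_space_T])
    have "(\<lambda>p. f (snd p) * \<rho> k s (fst p) (snd p)) \<in> borel_measurable (M \<Otimes>\<^sub>M T k)"
      using \<rho>_measurable[of k s]
      by (intro borel_measurable_times measurable_compose[OF measurable_snd f]) (simp add: case_prod_beta')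
    then show "(\<lambda>(w, x). f x * \<rho> k s w x) \<in> borel_measurable (M \<Otimes>\<^sub>M T k)" by (simp add: case_prod_beta')
    show "integrable M (\<lambda>w. f x * \<rho> k s w x)" for x
      by (rule uniformly_dominated(1)[OF k B0 sec le])
    show "(\<integral>w. \<bar>f x * \<rho> k s w x\<bar> \<partial>M) \<le> B * bound_const k (k + 2)" for x
      by (rule uniformly_dominated(2)[OF k B0 sec le])
  qed
  then show ?thesis by simp
qed

lemma expectation_section_measurable:
  fixes h :: "'w \<Rightarrow> (nat \<Rightarrow> 'a) \<Rightarrow> real"
  assumes "(\<lambda>(w, x). h w x) \<in> borel_measurable (M \<Otimes>\<^sub>M T k)"
  shows "(\<lambda>x. expectation (\<lambda>w. h w x)) \<in> borel_measurable (T k)"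
proof (rule borel_measurable_lebesgue_integral)
  show "(\<lambda>(x, w). h w x) \<in> borel_measurable (T k \<Otimes>\<^sub>M M)"
    using measurable_pair_swap[OF assms] by (simp add: case_prod_beta')
qed

lemma average_DERIV:
  assumes k: "1 \<le> k" and t: "t \<in> {0<..<1}" and f: "f \<in> borel_measurable (T k)" and B: "\<And>x. \<bar>f x\<bar> \<le> B"
  shows "((\<lambda>s. average k s f) has_real_derivative (\<integral>x. f x * expectation (\<lambda>w. \<rho>' k t w x) \<partial>T k)) (at t)"
proof -
  interpret Tk: prob_space "T k" by (rule prob_space_T)
  have tw: "t \<in> {t / 2<..<(1 + t) / 2}" using t by auto
  have B0: "0 \<le> B" using B[of undefined] by linarith
  define C where "C = 2 * real k * \<kappa> t * bound_const k (k + 2)"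
  have "((\<lambda>s. \<integral>x. f x * expectation (\<lambda>w. \<rho> k s w x) \<partial>T k) has_real_derivative (\<integral>x. f x * expectation (\<lambda>w. \<rho>' k t w x) \<partial>T k)) (at t)"
  proof (rule has_real_derivative_integral[OF tw, where D="\<lambda>_. B * C"])
    show "integrable (T k) (\<lambda>x. f x * expectation (\<lambda>w. \<rho> k s w x))" if s: "s \<in> {t / 2<..<(1 + t) / 2}" for s
    proof (rule Tk.integrable_const_bound)
      show "(\<lambda>x. f x * expectation (\<lambda>w. \<rho> k s w x)) \<in> borel_measurable (T k)"
        by (intro borel_measurable_times f expectation_section_measurable \<rho>_measurable)
      have "\<bar>expectation (\<lambda>w. \<rho> k s w x)\<bar> \<le> 1 * bound_const k (k + 2)" for x
        using uniformly_dominated(2)[where h="\<lambda>w x. \<rho> k s w x" and x=x, OF k zero_le_one \<rho>_section \<rho>_bound_fn[OF _ window(2)[OF t s]]]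
          integral_abs_bound[of M "\<lambda>w. \<rho> k s w x"] by linarith
      from mult_mono[OF B this B0]
      show "AE x in T k. norm (f x * expectation (\<lambda>w. \<rho> k s w x)) \<le> B * (1 * bound_const k (k + 2))"
        by (simp add: abs_mult)
    qed
    show "(\<lambda>x. f x * expectation (\<lambda>w. \<rho>' k t w x)) \<in> borel_measurable (T k)"
      by (intro borel_measurable_times f expectation_section_measurable \<rho>'_measurable)
    show "AE x in T k. \<forall>s\<in>{t / 2<..<(1 + t) / 2}.
        ((\<lambda>s. f x * expectation (\<lambda>w. \<rho> k s w x)) has_real_derivative f x * expectation (\<lambda>w. \<rho>' k s w x)) (at s)
        \<and> \<bar>f x * expectation (\<lambda>w. \<rho>' k s w x)\<bar> \<le> B * C"
    proof (intro AE_I2 ballI conjI)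
      fix x s assume s: "s \<in> {t / 2<..<(1 + t) / 2}"
      show "((\<lambda>s. f x * expectation (\<lambda>w. \<rho> k s w x)) has_real_derivative f x * expectation (\<lambda>w. \<rho>' k s w x)) (at s)"
        by (rule DERIV_cmult[OF expectation_\<rho>_DERIV[OF k t s]])
      show "\<bar>f x * expectation (\<lambda>w. \<rho>' k s w x)\<bar> \<le> B * C"
        unfolding abs_mult C_def by (intro mult_mono B B0 expectation_abs_\<rho>'_le[OF k t s]) simp
    qed
  qed simp
  \<comment> \<open>The formula for \<open>average\<close> is available only for parameters in
    \<open>[0, 1]\<close>, hence the passage through a neighbourhood of \<open>t\<close>.\<close>
  moreover have "\<forall>\<^sub>F s in nhds t. average k s f = (\<integral>x. f x * expectation (\<lambda>w. \<rho> k s w x) \<partial>T k)"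
    using eventually_nhds_in_open[OF open_greaterThanLessThan tw]
    by eventually_elim (rule average_eq[OF k window(2)[OF t] f B])
  ultimately show ?thesis by (subst DERIV_cong_ev[OF refl _ refl])
qed

section \<open>Covariances and fresh replicas\<close>

lemma gaussian_space_cov_bound:
  assumes G: "gaussian_space M \<V>" "X \<in> \<V>" "Y \<in> \<V>"
  shows "\<bar>expectation (\<lambda>w. X w * Y w)\<bar> \<le> expectation (\<lambda>w. (X w)\<^sup>2) + expectation (\<lambda>w. (Y w)\<^sup>2)"
proof -
  note i = gaussian_space_integrable_mult[OF G(1)]
  have "\<bar>expectation (\<lambda>w. X w * Y w)\<bar> \<le> expectation (\<lambda>w. \<bar>X w * Y w\<bar>)" by (rule integral_abs_bound)
  also have "\<dots> \<le> expectation (\<lambda>w. X w * X w + Y w * Y w)"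
  proof (intro integral_mono integrable_abs Bochner_Integration.integrable_add i G)
    fix w
    have "2 * (\<bar>X w\<bar> * \<bar>Y w\<bar>) \<le> X w * X w + Y w * Y w"
      using sum_squares_bound[of "\<bar>X w\<bar>" "\<bar>Y w\<bar>"] by (simp add: power2_eq_square)
    moreover have "0 \<le> \<bar>X w\<bar> * \<bar>Y w\<bar>" by simp
    ultimately have "\<bar>X w\<bar> * \<bar>Y w\<bar> \<le> X w * X w + Y w * Y w" by linarith
    then show "\<bar>X w * Y w\<bar> \<le> X w * X w + Y w * Y w" by (simp only: abs_mult)
  qed
  also have "\<dots> = expectation (\<lambda>w. X w * X w) + expectation (\<lambda>w. Y w * Y w)"
    by (rule Bochner_Integration.integral_add[OF i[OF G(2,2)] i[OF G(3,3)]])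
  finally show ?thesis by (simp only: power2_eq_square)
qed

lemma gaussian_space_lincomb_bound:
  assumes G: "gaussian_space M \<V>" "X \<in> \<V>" "Y \<in> \<V>"
    and K: "expectation (\<lambda>w. (X w)\<^sup>2) \<le> K" "expectation (\<lambda>w. (Y w)\<^sup>2) \<le> K"
  shows "expectation (\<lambda>w. (a * X w + b * Y w)\<^sup>2) \<le> 2 * (a\<^sup>2 + b\<^sup>2) * K"
proof -
  note i = gaussian_space_integrable_mult[OF G(1)]
  have ii: "integrable M (\<lambda>w. (X w)\<^sup>2)" "integrable M (\<lambda>w. (Y w)\<^sup>2)" "integrable M (\<lambda>w. (a * X w + b * Y w)\<^sup>2)"
    unfolding power2_eq_square by (intro i G gaussian_space_lincomb[OF G])+
  have "expectation (\<lambda>w. (a * X w + b * Y w)\<^sup>2) \<le> expectation (\<lambda>w. 2 * a\<^sup>2 * (X w)\<^sup>2 + 2 * b\<^sup>2 * (Y w)\<^sup>2)"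
  proof (intro integral_mono ii Bochner_Integration.integrable_add integrable_mult_right)
    fix w
    show "(a * X w + b * Y w)\<^sup>2 \<le> 2 * a\<^sup>2 * (X w)\<^sup>2 + 2 * b\<^sup>2 * (Y w)\<^sup>2"
      using zero_le_power2[of "a * X w - b * Y w"] by (simp add: power2_eq_square algebra_simps)
  qed
  also have "\<dots> = 2 * a\<^sup>2 * expectation (\<lambda>w. (X w)\<^sup>2) + 2 * b\<^sup>2 * expectation (\<lambda>w. (Y w)\<^sup>2)"
    using ii by simp
  also have "\<dots> \<le> 2 * a\<^sup>2 * K + 2 * b\<^sup>2 * K" by (intro add_mono mult_left_mono K) auto
  finally show ?thesis by (simp add: algebra_simps)
qed

definition gauss' :: "real \<Rightarrow> 'w \<Rightarrow> 'a \<Rightarrow> real" where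
  "gauss' t w \<sigma> = 1 / (2 * sqrt t) * U w \<sigma> + (- 1 / (2 * sqrt (1 - t))) * V w \<sigma>"

definition gauss :: "real \<Rightarrow> 'w \<Rightarrow> 'a \<Rightarrow> real" where
  "gauss t w \<sigma> = sqrt t * U w \<sigma> + sqrt (1 - t) * V w \<sigma>"

text \<open>The covariance that integration by parts produces. The coefficients of matching
  processes multiply to \<open>1/2\<close> and \<open>- 1/2\<close>, so once the mixed covariances
  vanish the value is half the difference of the covariances and no longer depends on
  \<open>t\<close>.\<close>

definition \<Gamma> :: "real \<Rightarrow> 'a \<Rightarrow> 'a \<Rightarrow> real" where
  "\<Gamma> t \<sigma> \<tau> = expectation (\<lambda>w. gauss' t w \<sigma> * gauss t w \<tau>)"

lemma gauss_space: "(\<lambda>w. gauss' t w \<sigma>) \<in> \<V>" "(\<lambda>w. gauss t w \<sigma>) \<in> \<V>"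
  unfolding gauss'_def gauss_def by (rule gaussian_space_lincomb[OF G UV])+

lemma gauss_measurable: "(\<lambda>(w, \<sigma>). gauss' t w \<sigma>) \<in> borel_measurable (M \<Otimes>\<^sub>M S)"
  "(\<lambda>(w, \<sigma>). gauss t w \<sigma>) \<in> borel_measurable (M \<Otimes>\<^sub>M S)"
  unfolding gauss'_def gauss_def using Um Vm by measurable

lemma gauss_power2_le: "expectation (\<lambda>w. (gauss t w \<sigma>)\<^sup>2) \<le> 2 * ((sqrt t)\<^sup>2 + (sqrt (1 - t))\<^sup>2) * K"
  unfolding gauss_def by (rule gaussian_space_lincomb_bound[OF G UV UK VK])

text \<open>It blows up as \<open>t\<close> approaches 0 or 1, but serves integrability only; the
  final estimate uses the expansion of \<open>\<Gamma>\<close> instead.\<close>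

definition \<Gamma>bound :: "real \<Rightarrow> real" where
  "\<Gamma>bound t = 2 * ((1 / (2 * sqrt t))\<^sup>2 + (- 1 / (2 * sqrt (1 - t)))\<^sup>2) * K + 2 * ((sqrt t)\<^sup>2 + (sqrt (1 - t))\<^sup>2) * K"

lemma abs_\<Gamma>_le: "\<bar>\<Gamma> t \<sigma> \<tau>\<bar> \<le> \<Gamma>bound t"
proof -
  have "\<bar>\<Gamma> t \<sigma> \<tau>\<bar> \<le> expectation (\<lambda>w. (gauss' t w \<sigma>)\<^sup>2) + expectation (\<lambda>w. (gauss t w \<tau>)\<^sup>2)"
    unfolding \<Gamma>_def by (rule gaussian_space_cov_bound[OF G gauss_space])
  also have "\<dots> \<le> \<Gamma>bound t"
    unfolding \<Gamma>bound_def
    by (intro add_mono gauss_power2_le) (unfold gauss'_def, rule gaussian_space_lincomb_bound[OF G UV UK VK])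
  finally show ?thesis .
qed

lemma \<Gamma>_measurable: "(\<lambda>(\<sigma>, \<tau>). \<Gamma> t \<sigma> \<tau>) \<in> borel_measurable (S \<Otimes>\<^sub>M S)"
proof -
  have 1: "(\<lambda>p. (snd p, fst (fst p))) \<in> measurable ((S \<Otimes>\<^sub>M S) \<Otimes>\<^sub>M M) (M \<Otimes>\<^sub>M S)"
    and 2: "(\<lambda>p. (snd p, snd (fst p))) \<in> measurable ((S \<Otimes>\<^sub>M S) \<Otimes>\<^sub>M M) (M \<Otimes>\<^sub>M S)"
    by measurable
  have "(\<lambda>p. gauss' t (snd p) (fst (fst p)) * gauss t (snd p) (snd (fst p))) \<in> borel_measurable ((S \<Otimes>\<^sub>M S) \<Otimes>\<^sub>M M)"
    using measurable_compose[OF 1 gauss_measurable(1)[of t]] measurable_compose[OF 2 gauss_measurable(2)[of t]]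
    by (intro borel_measurable_times) simp_all
  then have "(\<lambda>p. \<integral>w. gauss' t w (fst p) * gauss t w (snd p) \<partial>M) \<in> borel_measurable (S \<Otimes>\<^sub>M S)"
    by (intro borel_measurable_lebesgue_integral) (simp add: case_prod_beta')
  then show ?thesis by (simp add: \<Gamma>_def case_prod_beta')
qed

lemma coord_T: "l \<in> {1..k} \<Longrightarrow> (\<lambda>x. x l) \<in> measurable (T k) S"
  unfolding T_def by (rule measurable_component_singleton)

lemma \<Gamma>_coord_measurable:
  assumes "i \<in> {1..k}" "j \<in> {1..k}"
  shows "(\<lambda>x. \<Gamma> t (x i) (x j)) \<in> borel_measurable (T k)"
  using measurable_compose[OF measurable_Pair[OF coord_T[OF assms(1)] coord_T[OF assms(2)]] \<Gamma>_measurable] by simp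

lemma \<rho>_upd: "\<rho> (Suc k) t w (x(Suc k := y)) = \<rho> k t w x * (exp (hamiltonian t w y) / Z t w)"
proof -
  have "(\<Sum>l\<in>{1..k}. hamiltonian t w ((x(Suc k := y)) l)) = (\<Sum>l\<in>{1..k}. hamiltonian t w (x l))"
    by (intro sum.cong) auto
  then have "(\<Sum>l\<in>{1..Suc k}. hamiltonian t w ((x(Suc k := y)) l)) = (\<Sum>l\<in>{1..k}. hamiltonian t w (x l)) + hamiltonian t w y"
    by simp
  then show ?thesis unfolding \<rho>_def by (simp only: exp_add) (simp add: field_simps)
qed

lemma integral_T_Suc:
  fixes F :: "(nat \<Rightarrow> 'a) \<Rightarrow> real"
  assumes F: "F \<in> borel_measurable (T (Suc k))" and B: "\<And>x. \<bar>F x\<bar> \<le> B"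
  shows "(\<integral>x. F x \<partial>T (Suc k)) = (\<integral>x. (\<integral>y. F (x(Suc k := y)) \<partial>S) \<partial>T k)"
proof -
  interpret P: product_sigma_finite "\<lambda>_::nat. S" by standard
  interpret Tk: prob_space "T (Suc k)" by (rule prob_space_T)
  have ins: "{1..Suc k} = insert (Suc k) {1..k}" by auto
  have i: "integrable (T (Suc k)) F" by (rule Tk.integrable_const_bound[OF _ F, of B]) (use B in simp)
  show ?thesis
    using P.product_integral_insert[of "{1..k}" "Suc k" F] i unfolding T_def ins by simp
qed

text \<open>Integrating the newest replica against its Gibbs density turns it into a ratio of an
  integral to \<open>Z\<close>. Read from right to left, it trades a normalized integral for a fresh
  replica.\<close>

lemma integral_swap_last:
  fixes u :: "'w \<Rightarrow> 'a \<Rightarrow> real"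
  assumes u: "(\<lambda>(w, y). u w y) \<in> borel_measurable (M \<Otimes>\<^sub>M S)" and um: "\<And>y. (\<lambda>w. u w y) \<in> borel_measurable M"
    and c: "0 \<le> c" and le: "\<And>w y. good w \<Longrightarrow> \<bar>\<rho> (Suc k) t w (x(Suc k := y)) * u w y\<bar> \<le> c * bound_fn (Suc k) q w (x(Suc k := y))"
  shows "(\<integral>y. expectation (\<lambda>w. \<rho> (Suc k) t w (x(Suc k := y)) * u w y) \<partial>S)
    = expectation (\<lambda>w. \<rho> k t w x * ((\<integral>y. u w y * exp (hamiltonian t w y) \<partial>S) / Z t w))"
proof -
  have k: "1 \<le> Suc k" by simp
  have sec: "(\<lambda>w. \<rho> (Suc k) t w x' * u w y) \<in> borel_measurable M" for x' y
    by (intro borel_measurable_times \<rho>_section um)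
  have le': "\<bar>\<rho> (Suc k) t w x' * u w (x' (Suc k))\<bar> \<le> c * bound_fn (Suc k) q w x'"
    if "good w" "x' = x(Suc k := y)" for w x' y
    using le[OF that(1), of y] by (simp add: that(2))
  have "(\<integral>y. expectation (\<lambda>w. \<rho> (Suc k) t w (x(Suc k := y)) * u w y) \<partial>S)
    = (\<integral>w. (\<integral>y. \<rho> (Suc k) t w (x(Suc k := y)) * u w y \<partial>S) \<partial>M)"
  proof (rule integral_swap_uniform[OF prob_space_axioms S.prob_space_axioms, symmetric])
    have "(\<lambda>p. \<rho> k t (fst p) x * (exp (hamiltonian t (fst p) (snd p)) / Z t (fst p)) * u (fst p) (snd p)) \<in> borel_measurable (M \<Otimes>\<^sub>M S)"
      using u hamiltonian_measurable[of t]
      by (intro borel_measurable_times borel_measurable_divide measurable_compose[OF measurable_fst \<rho>_section]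
          measurable_compose[OF measurable_fst Z_measurable] measurable_compose[OF _ borel_measurable_exp]) (simp_all add: case_prod_beta')
    then show "(\<lambda>(w, y). \<rho> (Suc k) t w (x(Suc k := y)) * u w y) \<in> borel_measurable (M \<Otimes>\<^sub>M S)"
      by (simp add: \<rho>_upd case_prod_beta')
    fix y
    show "integrable M (\<lambda>w. \<rho> (Suc k) t w (x(Suc k := y)) * u w y)"
      using uniformly_dominated(1)[where h="\<lambda>w x'. \<rho> (Suc k) t w x' * u w (x' (Suc k))" and x="x(Suc k := y)", OF k c sec le'] by simp
    show "(\<integral>w. \<bar>\<rho> (Suc k) t w (x(Suc k := y)) * u w y\<bar> \<partial>M) \<le> c * bound_const (Suc k) q"
      using uniformly_dominated(2)[where h="\<lambda>w x'. \<rho> (Suc k) t w x' * u w (x' (Suc k))" and x="x(Suc k := y)", OF k c sec le'] by simp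
  qed
  also have "\<dots> = (\<integral>w. \<rho> k t w x * ((\<integral>y. u w y * exp (hamiltonian t w y) \<partial>S) / Z t w) \<partial>M)"
  proof (rule Bochner_Integration.integral_cong[OF refl])
    fix w
    have "(\<integral>y. \<rho> (Suc k) t w (x(Suc k := y)) * u w y \<partial>S) = (\<integral>y. (\<rho> k t w x / Z t w) * (u w y * exp (hamiltonian t w y)) \<partial>S)"
      by (rule Bochner_Integration.integral_cong[OF refl]) (simp add: \<rho>_upd)
    then show "(\<integral>y. \<rho> (Suc k) t w (x(Suc k := y)) * u w y \<partial>S) = \<rho> k t w x * ((\<integral>y. u w y * exp (hamiltonian t w y) \<partial>S) / Z t w)"
      by simp
  qed
  finally show ?thesis .
qed

text \<open>The normalization \<open>Z\<close> contributes \<open>- n\<close> times the drift averaged over one fresh replica \<open>n + 1\<close>.\<close>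

definition sgn_coeff :: "nat \<Rightarrow> nat \<Rightarrow> real" where
  "sgn_coeff n l = (if l \<le> n then 1 else - real n)"

definition drift_sum :: "nat \<Rightarrow> real \<Rightarrow> 'w \<Rightarrow> (nat \<Rightarrow> 'a) \<Rightarrow> real" where
  "drift_sum n t w x = (\<Sum>l\<in>{1..Suc n}. sgn_coeff n l * hamiltonian' t w (x l))"

lemma sum_abs_sgn_coeff: "(\<Sum>l\<in>{1..Suc n}. \<bar>sgn_coeff n l\<bar>) = 2 * real n"
proof -
  have "(\<Sum>l\<in>{1..n}. \<bar>sgn_coeff n l\<bar>) = (\<Sum>l\<in>{1..n}. 1)" by (intro sum.cong) (auto simp: sgn_coeff_def)
  then show ?thesis by (simp add: sgn_coeff_def)
qed

lemma drift_sum_upd: "drift_sum n t w (x(Suc n := y)) = (\<Sum>l\<in>{1..n}. hamiltonian' t w (x l)) - real n * hamiltonian' t w y"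
proof -
  have "(\<Sum>l\<in>{1..n}. sgn_coeff n l * hamiltonian' t w ((x(Suc n := y)) l)) = (\<Sum>l\<in>{1..n}. hamiltonian' t w (x l))"
    by (intro sum.cong) (auto simp: sgn_coeff_def)
  then show ?thesis by (simp add: drift_sum_def sgn_coeff_def)
qed

lemma in_window: "t \<in> {0<..<1} \<Longrightarrow> t \<in> {t / 2<..<(1 + t) / 2}" for t :: real
  by auto

lemma \<rho>_drift_sum_le:
  assumes w: "good w" and t: "t \<in> {0<..<1}"
  shows "\<bar>\<rho> (Suc n) t w x * drift_sum n t w x\<bar> \<le> (2 * real n * \<kappa> t) * bound_fn (Suc n) (Suc n + 2) w x"
proof (rule \<rho>_weighted_le[OF w window(2)[OF t in_window[OF t]]])
  define P where "P = (\<Prod>l\<in>{1..Suc n}. envelope w (x l))"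
  have k1: "0 \<le> \<kappa> t" using \<kappa>_ge_1[OF t] by simp
  have P: "1 \<le> P" unfolding P_def by (rule prod_envelope_ge)
  have "\<bar>drift_sum n t w x\<bar> \<le> (\<Sum>l\<in>{1..Suc n}. \<bar>sgn_coeff n l\<bar> * (\<kappa> t * P))"
    unfolding drift_sum_def
  proof (intro order_trans[OF sum_abs] sum_mono)
    fix l assume "l \<in> {1..Suc n}"
    then have "\<kappa> t * envelope w (x l) \<le> \<kappa> t * P"
      unfolding P_def using k1 by (intro mult_left_mono prod_envelope_ge)
    then have "\<bar>hamiltonian' t w (x l)\<bar> \<le> \<kappa> t * P" using window(3)[OF t in_window[OF t], of w "x l"] by linarith
    then show "\<bar>sgn_coeff n l * hamiltonian' t w (x l)\<bar> \<le> \<bar>sgn_coeff n l\<bar> * (\<kappa> t * P)"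
      unfolding abs_mult by (rule mult_left_mono) simp
  qed
  also have "\<dots> = 2 * real n * \<kappa> t * P"
    unfolding sum_distrib_right[symmetric] sum_abs_sgn_coeff by simp
  also have "\<dots> \<le> 2 * real n * \<kappa> t * P * J w ^ 2"
    using mult_left_mono[of 1 "J w ^ 2" "2 * real n * \<kappa> t * P"] k1 P integral_envelope_le_J(2)[OF w] by (simp add: one_le_power)
  finally show "\<bar>drift_sum n t w x\<bar> \<le> 2 * real n * \<kappa> t * (\<Prod>l\<in>{1..Suc n}. envelope w (x l)) * J w ^ 2"
    by (simp only: P_def)
  show "0 \<le> 2 * real n * \<kappa> t" using k1 by simp
qed

lemma drift_sum_measurable: "(\<lambda>(w, x). drift_sum n t w x) \<in> borel_measurable (M \<Otimes>\<^sub>M T (Suc n))"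
proof -
  have "(\<lambda>p. \<Sum>l\<in>{1..Suc n}. sgn_coeff n l * hamiltonian' t (fst p) (snd p l)) \<in> borel_measurable (M \<Otimes>\<^sub>M T (Suc n))"
    using coord_measurable[OF hamiltonian'_measurable[of t]]
    by (intro borel_measurable_sum borel_measurable_times borel_measurable_const) (simp add: case_prod_beta')
  then show ?thesis by (simp add: drift_sum_def case_prod_beta')
qed

lemma drift_sum_section: "(\<lambda>w. drift_sum n t w x) \<in> borel_measurable M"
  unfolding drift_sum_def by (intro borel_measurable_sum borel_measurable_times borel_measurable_const hamiltonian'_section)

text \<open>\<open>Z' / Z\<close> is the Gibbs average of the derivative of the Hamiltonian over a
  fresh replica, and \<open>f\<close> does not see that replica.\<close>

lemma integral_\<rho>'_eq:
  assumes n: "1 \<le> n" and t: "t \<in> {0<..<1}"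
    and f: "f \<in> borel_measurable (T (Suc n))" and B: "\<And>x. \<bar>f x\<bar> \<le> B"
    and inv: "\<And>x y. f (x(Suc n := y)) = f x"
  shows "(\<integral>x. f x * expectation (\<lambda>w. \<rho>' n t w x) \<partial>T n)
    = (\<integral>x. f x * expectation (\<lambda>w. \<rho> (Suc n) t w x * drift_sum n t w x) \<partial>T (Suc n))"
proof -
  have B0: "0 \<le> B" using B[of undefined] by linarith
  have c: "0 \<le> 2 * real n * \<kappa> t" using \<kappa>_ge_1[OF t] by simp
  have sec: "(\<lambda>w. \<rho> (Suc n) t w x * drift_sum n t w x) \<in> borel_measurable M" for x
    by (intro borel_measurable_times \<rho>_section drift_sum_section)
  have k1: "1 \<le> Suc n" by simp
  have Eb: "\<bar>expectation (\<lambda>w. \<rho> (Suc n) t w x * drift_sum n t w x)\<bar> \<le> 2 * real n * \<kappa> t * bound_const (Suc n) (Suc n + 2)" for x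
    using uniformly_dominated(2)[where h="\<lambda>w x. \<rho> (Suc n) t w x * drift_sum n t w x" and x=x, OF k1 c sec \<rho>_drift_sum_le[OF _ t]]
      integral_abs_bound[of M "\<lambda>w. \<rho> (Suc n) t w x * drift_sum n t w x"] by linarith
  have "(\<integral>x. f x * expectation (\<lambda>w. \<rho> (Suc n) t w x * drift_sum n t w x) \<partial>T (Suc n))
    = (\<integral>x. (\<integral>y. f (x(Suc n := y)) * expectation (\<lambda>w. \<rho> (Suc n) t w (x(Suc n := y)) * drift_sum n t w (x(Suc n := y))) \<partial>S) \<partial>T n)"
  proof (rule integral_T_Suc)
    have "(\<lambda>p. \<rho> (Suc n) t (fst p) (snd p) * drift_sum n t (fst p) (snd p)) \<in> borel_measurable (M \<Otimes>\<^sub>M T (Suc n))"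
      using \<rho>_measurable[of "Suc n" t] drift_sum_measurable[of n t] by (intro borel_measurable_times) (simp_all add: case_prod_beta')
    then show "(\<lambda>x. f x * expectation (\<lambda>w. \<rho> (Suc n) t w x * drift_sum n t w x)) \<in> borel_measurable (T (Suc n))"
      by (intro borel_measurable_times f expectation_section_measurable) (simp add: case_prod_beta')
    show "\<bar>f x * expectation (\<lambda>w. \<rho> (Suc n) t w x * drift_sum n t w x)\<bar> \<le> B * (2 * real n * \<kappa> t * bound_const (Suc n) (Suc n + 2))" for x
      unfolding abs_mult by (intro mult_mono B Eb B0) simp
  qed
  also have "\<dots> = (\<integral>x. f x * (\<integral>y. expectation (\<lambda>w. \<rho> (Suc n) t w (x(Suc n := y)) * drift_sum n t w (x(Suc n := y))) \<partial>S) \<partial>T n)"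
    by (simp add: inv)
  also have "\<dots> = (\<integral>x. f x * expectation (\<lambda>w. \<rho>' n t w x) \<partial>T n)"
  proof (rule Bochner_Integration.integral_cong[OF refl])
    fix x
    have "(\<integral>y. expectation (\<lambda>w. \<rho> (Suc n) t w (x(Suc n := y)) * drift_sum n t w (x(Suc n := y))) \<partial>S)
      = expectation (\<lambda>w. \<rho> n t w x * ((\<integral>y. drift_sum n t w (x(Suc n := y)) * exp (hamiltonian t w y) \<partial>S) / Z t w))"
    proof (rule integral_swap_last[OF _ _ c \<rho>_drift_sum_le[OF _ t]])
      have "(\<lambda>p. (\<Sum>l\<in>{1..n}. hamiltonian' t (fst p) (x l)) - real n * hamiltonian' t (fst p) (snd p)) \<in> borel_measurable (M \<Otimes>\<^sub>M S)"
        using hamiltonian'_measurable[of t]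
        by (intro borel_measurable_diff borel_measurable_sum borel_measurable_times borel_measurable_const
            measurable_compose[OF measurable_fst hamiltonian'_section]) (simp add: case_prod_beta')
      then show "(\<lambda>(w, y). drift_sum n t w (x(Suc n := y))) \<in> borel_measurable (M \<Otimes>\<^sub>M S)"
        by (simp add: drift_sum_upd case_prod_beta')
    qed (rule drift_sum_section)
    also have "\<dots> = expectation (\<lambda>w. \<rho>' n t w x)"
    proof (rule integral_cong_AE)
      show "AE w in M. \<rho> n t w x * ((\<integral>y. drift_sum n t w (x(Suc n := y)) * exp (hamiltonian t w y) \<partial>S) / Z t w) = \<rho>' n t w x"
        using AE_good
      proof eventually_elim
        case (elim w)
        define s where "s = (\<Sum>l\<in>{1..n}. hamiltonian' t w (x l))"
        have "(\<integral>y. drift_sum n t w (x(Suc n := y)) * exp (hamiltonian t w y) \<partial>S)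
          = (\<integral>y. s * exp (hamiltonian t w y) - real n * (hamiltonian' t w y * exp (hamiltonian t w y)) \<partial>S)"
          by (rule Bochner_Integration.integral_cong[OF refl]) (simp add: drift_sum_upd s_def algebra_simps)
        also have "\<dots> = s * Z t w - real n * Z' t w"
          using integrable_exp_hamiltonian[OF elim window(2)[OF t in_window[OF t]]] integrable_hamiltonian'_exp[OF elim t in_window[OF t]]
          by (simp add: Z_def Z'_def)
        finally show ?case
          using Z_pos[OF elim window(2)[OF t in_window[OF t]]] by (simp add: \<rho>'_def s_def diff_divide_distrib)
      qed
      have "(\<lambda>(w, y). drift_sum n t w (x(Suc n := y)) * exp (hamiltonian t w y)) \<in> borel_measurable (M \<Otimes>\<^sub>M S)"
      proof -
        have "(\<lambda>p. ((\<Sum>l\<in>{1..n}. hamiltonian' t (fst p) (x l)) - real n * hamiltonian' t (fst p) (snd p)) * exp (hamiltonian t (fst p) (snd p))) \<in> borel_measurable (M \<Otimes>\<^sub>M S)"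
          using hamiltonian'_measurable[of t] hamiltonian_measurable[of t]
          by (intro borel_measurable_times borel_measurable_diff borel_measurable_sum borel_measurable_const
              measurable_compose[OF measurable_fst hamiltonian'_section] measurable_compose[OF _ borel_measurable_exp]) (simp_all add: case_prod_beta')
        then show ?thesis by (simp add: drift_sum_upd case_prod_beta')
      qed
      then show "(\<lambda>w. \<rho> n t w x * ((\<integral>y. drift_sum n t w (x(Suc n := y)) * exp (hamiltonian t w y) \<partial>S) / Z t w)) \<in> borel_measurable M"
        by (intro borel_measurable_times borel_measurable_divide \<rho>_section Z_measurable S.borel_measurable_lebesgue_integral)
    qed (rule \<rho>'_section)
    finally show "f x * (\<integral>y. expectation (\<lambda>w. \<rho> (Suc n) t w (x(Suc n := y)) * drift_sum n t w (x(Suc n := y))) \<partial>S) = f x * expectation (\<lambda>w. \<rho>' n t w x)"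
      by simp
  qed
  finally show ?thesis by simp
qed

definition \<gamma> :: "nat \<Rightarrow> real \<Rightarrow> (nat \<Rightarrow> 'a) \<Rightarrow> 'a \<Rightarrow> real" where
  "\<gamma> n t x \<tau> = (\<Sum>l\<in>{1..Suc n}. sgn_coeff n l * \<Gamma> t (x l) \<tau>)"

text \<open>Integration by parts against a density on \<open>Suc n\<close> replicas: each
  exponential in the numerator contributes \<open>\<gamma>\<close> at its own replica, which gives
  \<open>Q0\<close>. Each of the \<open>Suc n\<close> powers of \<open>Z\<close> subtracts
  \<open>\<gamma>\<close> averaged over another fresh replica, which in \<open>Q\<close> sits at
  index \<open>n + 2\<close>.\<close>

definition Q0 :: "nat \<Rightarrow> real \<Rightarrow> (nat \<Rightarrow> 'a) \<Rightarrow> real" where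
  "Q0 n t x = (\<Sum>l\<in>{1..Suc n}. sgn_coeff n l * D1 (x l)) + (\<Sum>j\<in>{1..Suc n}. \<gamma> n t x (x j))"

definition Q :: "nat \<Rightarrow> real \<Rightarrow> (nat \<Rightarrow> 'a) \<Rightarrow> real" where
  "Q n t x = Q0 n t x - real (Suc n) * \<gamma> n t x (x (Suc (Suc n)))"

definition Qbound :: "nat \<Rightarrow> real \<Rightarrow> real" where
  "Qbound n t = 2 * real n * K + (real (Suc n) + real (Suc n)) * (2 * real n * \<Gamma>bound t)"

lemma abs_sgn_coeff_sum_le:
  assumes "\<And>l. \<bar>a l\<bar> \<le> B"
  shows "\<bar>\<Sum>l\<in>{1..Suc n}. sgn_coeff n l * a l\<bar> \<le> 2 * real n * B"
proof -
  have "\<bar>\<Sum>l\<in>{1..Suc n}. sgn_coeff n l * a l\<bar> \<le> (\<Sum>l\<in>{1..Suc n}. \<bar>sgn_coeff n l\<bar> * B)"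
    by (intro order_trans[OF sum_abs] sum_mono) (simp add: abs_mult assms mult_left_mono)
  also have "\<dots> = 2 * real n * B" unfolding sum_distrib_right[symmetric] sum_abs_sgn_coeff ..
  finally show ?thesis .
qed

lemma abs_\<gamma>_le: "\<bar>\<gamma> n t x \<tau>\<bar> \<le> 2 * real n * \<Gamma>bound t"
  unfolding \<gamma>_def by (rule abs_sgn_coeff_sum_le) (rule abs_\<Gamma>_le)

lemma abs_Q_le: "\<bar>Q0 n t x - real (Suc n) * \<gamma> n t x z\<bar> \<le> Qbound n t"
proof -
  have 1: "\<bar>\<Sum>l\<in>{1..Suc n}. sgn_coeff n l * D1 (x l)\<bar> \<le> 2 * real n * K"
    by (rule abs_sgn_coeff_sum_le) (rule DK(2))
  have "\<bar>\<Sum>j\<in>{1..Suc n}. \<gamma> n t x (x j)\<bar> \<le> (\<Sum>j\<in>{1..Suc n}. 2 * real n * \<Gamma>bound t)"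
    by (intro order_trans[OF sum_abs] sum_mono abs_\<gamma>_le)
  then have 2: "\<bar>\<Sum>j\<in>{1..Suc n}. \<gamma> n t x (x j)\<bar> \<le> real (Suc n) * (2 * real n * \<Gamma>bound t)" by simp
  have "\<bar>real (Suc n) * \<gamma> n t x z\<bar> = real (Suc n) * \<bar>\<gamma> n t x z\<bar>" by (simp add: abs_mult)
  also have "\<dots> \<le> real (Suc n) * (2 * real n * \<Gamma>bound t)" by (intro mult_left_mono abs_\<gamma>_le) simp
  finally have 3: "\<bar>real (Suc n) * \<gamma> n t x z\<bar> \<le> real (Suc n) * (2 * real n * \<Gamma>bound t)" .
  show ?thesis unfolding Q0_def Qbound_def distrib_right using 1 2 3 by linarith
qed

lemma \<Gamma>_section: "\<Gamma> t \<sigma> \<in> borel_measurable S"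
proof -
  have "(\<lambda>p. gauss' t (snd p) \<sigma> * gauss t (snd p) (fst p)) \<in> borel_measurable (S \<Otimes>\<^sub>M M)"
    using measurable_pair_swap[OF gauss_measurable(2)[of t]] gaussian_space_measurable[OF G gauss_space(1)[of t \<sigma>]]
    by (intro borel_measurable_times measurable_compose[OF measurable_snd]) (simp_all add: case_prod_beta')
  then have "(\<lambda>\<tau>. \<integral>w. gauss' t w \<sigma> * gauss t w \<tau> \<partial>M) \<in> borel_measurable S"
    by (intro borel_measurable_lebesgue_integral) (simp add: case_prod_beta')
  then show ?thesis by (simp add: \<Gamma>_def[abs_def])
qed

lemma \<gamma>_section: "\<gamma> n t x \<in> borel_measurable S"
  unfolding \<gamma>_def[abs_def] by (intro borel_measurable_sum borel_measurable_times borel_measurable_const \<Gamma>_section)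

lemma Q_measurable: "Q n t \<in> borel_measurable (T (Suc (Suc n)))"
  unfolding Q_def[abs_def] Q0_def \<gamma>_def
  by (intro borel_measurable_diff borel_measurable_add borel_measurable_sum borel_measurable_times borel_measurable_const
      \<Gamma>_coord_measurable measurable_compose[OF coord_T D1m]) auto

lemma integrable_\<rho>:
  assumes "1 \<le> k" "t \<in> {0<..<1}"
  shows "integrable M (\<lambda>w. \<rho> k t w x)"
  by (rule uniformly_dominated(1)[OF assms(1) zero_le_one \<rho>_section \<rho>_bound_fn[OF _ window(2)[OF assms(2) in_window[OF assms(2)]]]])

text \<open>The Gaussian part of the signed drift is one member \<open>A\<close> of the Gaussian
  space, whose covariance with the Hamiltonian at \<open>\<tau>\<close> is
  \<open>\<gamma> n t x \<tau>\<close>. One application of \<open>gaussian_ibp\<close> thus treats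
  all replicas at once; the deterministic part \<open>D1\<close> passes through unchanged.\<close>

lemma expectation_drift_sum:
  assumes t: "t \<in> {0<..<1}"
  shows "expectation (\<lambda>w. \<rho> (Suc n) t w x * drift_sum n t w x)
    = expectation (\<lambda>w. \<rho> (Suc n) t w x * ((\<integral>z. (Q0 n t x - real (Suc n) * \<gamma> n t x z) * exp (hamiltonian t w z) \<partial>S) / Z t w))"
proof -
  note t01 = window(2)[OF t in_window[OF t]]
  have k1: "1 \<le> Suc n" by simp
  have c: "0 \<le> 2 * real n * \<kappa> t" using \<kappa>_ge_1[OF t] by simp
  define A where "A w = (\<Sum>l\<in>{1..Suc n}. sgn_coeff n l * gauss' t w (x l))" for w
  define DD where "DD = (\<Sum>l\<in>{1..Suc n}. sgn_coeff n l * D1 (x l))"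
  have A: "A \<in> \<V>"
    unfolding A_def[abs_def] by (rule gaussian_space_sum[OF G UV(1) _ gauss_space(1)]) simp
  have drift: "drift_sum n t w x = A w + DD" for w
  proof -
    have "hamiltonian' t w \<sigma> = gauss' t w \<sigma> + D1 \<sigma>" for \<sigma> by (simp add: hamiltonian'_def gauss'_def)
    then show ?thesis by (simp only: drift_sum_def A_def DD_def distrib_left sum.distrib)
  qed
  have ham: "gauss t w \<tau> + (D0 \<tau> + t * D1 \<tau>) = hamiltonian t w \<tau>" for w \<tau>
    by (simp add: gauss_def hamiltonian_def)
  have \<gamma>A: "expectation (\<lambda>w. A w * gauss t w \<tau>) = \<gamma> n t x \<tau>" for \<tau>
  proof -
    have "expectation (\<lambda>w. A w * gauss t w \<tau>) = expectation (\<lambda>w. \<Sum>l\<in>{1..Suc n}. sgn_coeff n l * (gauss' t w (x l) * gauss t w \<tau>))"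
      unfolding A_def sum_distrib_right by (simp only: mult.assoc)
    also have "\<dots> = (\<Sum>l\<in>{1..Suc n}. expectation (\<lambda>w. sgn_coeff n l * (gauss' t w (x l) * gauss t w \<tau>)))"
      by (rule Bochner_Integration.integral_sum) (intro integrable_mult_right gaussian_space_integrable_mult[OF G gauss_space])
    also have "\<dots> = \<gamma> n t x \<tau>" unfolding \<gamma>_def \<Gamma>_def by simp
    finally show ?thesis .
  qed
  have i\<rho>: "integrable M (\<lambda>w. \<rho> (Suc n) t w x)" by (rule integrable_\<rho>[OF k1 t])
  have sec: "(\<lambda>w. \<rho> (Suc n) t w x * drift_sum n t w x) \<in> borel_measurable M"
    by (intro borel_measurable_times \<rho>_section drift_sum_section)
  have id: "integrable M (\<lambda>w. \<rho> (Suc n) t w x * drift_sum n t w x)"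
    by (rule uniformly_dominated(1)[where h="\<lambda>w x. \<rho> (Suc n) t w x * drift_sum n t w x" and x=x, OF k1 c sec \<rho>_drift_sum_le[OF _ t]])
  have iA: "integrable M (\<lambda>w. A w * \<rho> (Suc n) t w x)"
  proof -
    have "A w * \<rho> (Suc n) t w x = \<rho> (Suc n) t w x * drift_sum n t w x - DD * \<rho> (Suc n) t w x" for w
      by (simp add: drift algebra_simps)
    then show ?thesis using id i\<rho> by simp
  qed
  have dm: "(\<lambda>\<tau>. D0 \<tau> + t * D1 \<tau>) \<in> borel_measurable S"
    by (intro borel_measurable_add borel_measurable_times borel_measurable_const D0m D1m)
  have good': "AE w in M. integrable S (\<lambda>\<tau>. exp (gauss t w \<tau> + (D0 \<tau> + t * D1 \<tau>)))"
    unfolding ham using AE_good by eventually_elim (rule integrable_exp_hamiltonian[OF _ t01])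
  have Cb: "\<bar>expectation (\<lambda>w. A w * gauss t w \<tau>)\<bar> \<le> 2 * real n * \<Gamma>bound t" for \<tau>
    unfolding \<gamma>A by (rule abs_\<gamma>_le)
  have ibp: "expectation (\<lambda>w. A w * \<rho> (Suc n) t w x) = expectation (\<lambda>w. \<rho> (Suc n) t w x * (\<Sum>l\<in>{1..Suc n}. \<gamma> n t x (x l))
     - real (Suc n) * (\<rho> (Suc n) t w x * (\<integral>\<tau>. \<gamma> n t x \<tau> * exp (hamiltonian t w \<tau>) \<partial>S) / Z t w))"
  proof -
    have fin: "finite {1..Suc n}" by simp
    note ibp0 = gaussian_ibp[OF G A S.prob_space_axioms gauss_measurable(2) gauss_space(2) dm Cb fin good', where x=x and m="Suc n"]
    note ibp1 = ibp0[unfolded ham \<gamma>A, folded Z_def, folded \<rho>_def]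
    show ?thesis by (rule ibp1[OF iA i\<rho>])
  qed
  let ?R = "\<lambda>w. \<rho> (Suc n) t w x * (\<Sum>l\<in>{1..Suc n}. \<gamma> n t x (x l))
     - real (Suc n) * (\<rho> (Suc n) t w x * (\<integral>\<tau>. \<gamma> n t x \<tau> * exp (hamiltonian t w \<tau>) \<partial>S) / Z t w)"
  have Wm: "(\<lambda>w. \<integral>\<tau>. \<gamma> n t x \<tau> * exp (hamiltonian t w \<tau>) \<partial>S) \<in> borel_measurable M"
  proof (rule S.borel_measurable_lebesgue_integral)
    have "(\<lambda>p. \<gamma> n t x (snd p) * exp (hamiltonian t (fst p) (snd p))) \<in> borel_measurable (M \<Otimes>\<^sub>M S)"
      using hamiltonian_measurable[of t]
      by (intro borel_measurable_times measurable_compose[OF measurable_snd \<gamma>_section] measurable_compose[OF _ borel_measurable_exp])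
        (simp add: case_prod_beta')
    then show "(\<lambda>(w, \<tau>). \<gamma> n t x \<tau> * exp (hamiltonian t w \<tau>)) \<in> borel_measurable (M \<Otimes>\<^sub>M S)" by (simp add: case_prod_beta')
  qed
  have Rm: "?R \<in> borel_measurable M"
    by (intro borel_measurable_diff borel_measurable_times borel_measurable_divide borel_measurable_const \<rho>_section Wm Z_measurable)
  have key: "(\<integral>z. (Q0 n t x - real (Suc n) * \<gamma> n t x z) * exp (hamiltonian t w z) \<partial>S)
      = Q0 n t x * Z t w - real (Suc n) * (\<integral>\<tau>. \<gamma> n t x \<tau> * exp (hamiltonian t w \<tau>) \<partial>S)"
    and Wle: "\<bar>\<integral>\<tau>. \<gamma> n t x \<tau> * exp (hamiltonian t w \<tau>) \<partial>S\<bar> \<le> 2 * real n * \<Gamma>bound t * Z t w" if w: "good w" for w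
  proof -
    note ie = integrable_exp_hamiltonian[OF w t01]
    have i\<gamma>: "integrable S (\<lambda>\<tau>. \<gamma> n t x \<tau> * exp (hamiltonian t w \<tau>))"
    proof (rule Bochner_Integration.integrable_bound[OF integrable_mult_right[OF ie, of "2 * real n * \<Gamma>bound t"]])
      show "(\<lambda>\<tau>. \<gamma> n t x \<tau> * exp (hamiltonian t w \<tau>)) \<in> borel_measurable S"
        by (intro borel_measurable_times \<gamma>_section borel_measurable_integrable[OF ie])
      show "AE \<tau> in S. norm (\<gamma> n t x \<tau> * exp (hamiltonian t w \<tau>)) \<le> norm (2 * real n * \<Gamma>bound t * exp (hamiltonian t w \<tau>))"
      proof (rule AE_I2)
        fix \<tau>
        have "\<bar>\<gamma> n t x \<tau>\<bar> \<le> \<bar>2 * real n * \<Gamma>bound t\<bar>" using abs_\<gamma>_le[of n t x \<tau>] by linarith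
        then show "norm (\<gamma> n t x \<tau> * exp (hamiltonian t w \<tau>)) \<le> norm (2 * real n * \<Gamma>bound t * exp (hamiltonian t w \<tau>))"
          by (simp add: abs_mult mult_right_mono)
      qed
    qed
    have "(\<integral>z. (Q0 n t x - real (Suc n) * \<gamma> n t x z) * exp (hamiltonian t w z) \<partial>S)
        = (\<integral>z. Q0 n t x * exp (hamiltonian t w z) - real (Suc n) * (\<gamma> n t x z * exp (hamiltonian t w z)) \<partial>S)"
      by (simp only: left_diff_distrib mult.assoc)
    also have "\<dots> = Q0 n t x * Z t w - real (Suc n) * (\<integral>\<tau>. \<gamma> n t x \<tau> * exp (hamiltonian t w \<tau>) \<partial>S)"
      unfolding Z_def by (subst Bochner_Integration.integral_diff) (auto intro!: integrable_mult_right ie i\<gamma>)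
    finally show "(\<integral>z. (Q0 n t x - real (Suc n) * \<gamma> n t x z) * exp (hamiltonian t w z) \<partial>S)
        = Q0 n t x * Z t w - real (Suc n) * (\<integral>\<tau>. \<gamma> n t x \<tau> * exp (hamiltonian t w \<tau>) \<partial>S)" .
    have "\<bar>\<integral>\<tau>. \<gamma> n t x \<tau> * exp (hamiltonian t w \<tau>) \<partial>S\<bar> \<le> (\<integral>\<tau>. \<bar>\<gamma> n t x \<tau> * exp (hamiltonian t w \<tau>)\<bar> \<partial>S)"
      by (rule integral_abs_bound)
    also have "\<dots> \<le> (\<integral>\<tau>. 2 * real n * \<Gamma>bound t * exp (hamiltonian t w \<tau>) \<partial>S)"
    proof (intro integral_mono integrable_abs i\<gamma> integrable_mult_right ie)
      show "\<bar>\<gamma> n t x \<tau> * exp (hamiltonian t w \<tau>)\<bar> \<le> 2 * real n * \<Gamma>bound t * exp (hamiltonian t w \<tau>)" for \<tau>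
        unfolding abs_mult[of "\<gamma> n t x \<tau>"] abs_exp_cancel by (intro mult_right_mono abs_\<gamma>_le) simp
    qed
    finally show "\<bar>\<integral>\<tau>. \<gamma> n t x \<tau> * exp (hamiltonian t w \<tau>) \<partial>S\<bar> \<le> 2 * real n * \<Gamma>bound t * Z t w" by (simp add: Z_def)
  qed
  have Ri: "integrable M ?R"
  proof (rule Bochner_Integration.integrable_bound[OF integrable_mult_right[OF i\<rho>, of "\<bar>\<Sum>l\<in>{1..Suc n}. \<gamma> n t x (x l)\<bar> + real (Suc n) * (2 * real n * \<Gamma>bound t)"] Rm])
    show "AE w in M. norm (?R w) \<le> norm ((\<bar>\<Sum>l\<in>{1..Suc n}. \<gamma> n t x (x l)\<bar> + real (Suc n) * (2 * real n * \<Gamma>bound t)) * \<rho> (Suc n) t w x)"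
      using AE_good
    proof eventually_elim
      case (elim w)
      define W where "W = (\<integral>\<tau>. \<gamma> n t x \<tau> * exp (hamiltonian t w \<tau>) \<partial>S)"
      define r where "r = \<rho> (Suc n) t w x"
      define g where "g = (\<Sum>l\<in>{1..Suc n}. \<gamma> n t x (x l))"
      note Zp = Z_pos[OF elim t01]
      have r0: "0 \<le> r" unfolding r_def by (rule \<rho>_le(1)[OF elim t01])
      have "\<bar>W\<bar> / Z t w \<le> 2 * real n * \<Gamma>bound t" using Wle[OF elim] Zp unfolding W_def by (simp add: divide_le_eq)
      then have "real (Suc n) * (r * (\<bar>W\<bar> / Z t w)) \<le> real (Suc n) * (r * (2 * real n * \<Gamma>bound t))"
        using r0 by (intro mult_left_mono) auto
      moreover have "\<bar>r * g - real (Suc n) * (r * W / Z t w)\<bar> \<le> \<bar>r * g\<bar> + \<bar>real (Suc n) * (r * W / Z t w)\<bar>"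
        by (rule abs_triangle_ineq4)
      moreover have "\<bar>r * g\<bar> = r * \<bar>g\<bar>" "\<bar>real (Suc n) * (r * W / Z t w)\<bar> = real (Suc n) * (r * (\<bar>W\<bar> / Z t w))"
        using r0 Zp by (simp_all add: abs_mult)
      ultimately have "\<bar>r * g - real (Suc n) * (r * W / Z t w)\<bar> \<le> r * \<bar>g\<bar> + real (Suc n) * (r * (2 * real n * \<Gamma>bound t))"
        by linarith
      also have "\<dots> = (\<bar>g\<bar> + real (Suc n) * (2 * real n * \<Gamma>bound t)) * r" by (simp only: distrib_left distrib_right mult_ac)
      also have "\<dots> \<le> \<bar>(\<bar>g\<bar> + real (Suc n) * (2 * real n * \<Gamma>bound t)) * r\<bar>" by (rule abs_ge_self)
      finally show ?case unfolding real_norm_def r_def g_def W_def .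
    qed
  qed
  have "expectation (\<lambda>w. \<rho> (Suc n) t w x * drift_sum n t w x)
     = expectation (\<lambda>w. A w * \<rho> (Suc n) t w x + DD * \<rho> (Suc n) t w x)"
    by (simp add: drift distrib_left distrib_right mult.commute)
  also have "\<dots> = expectation ?R + expectation (\<lambda>w. DD * \<rho> (Suc n) t w x)"
    unfolding ibp[symmetric] using iA i\<rho> by (intro Bochner_Integration.integral_add integrable_mult_right)
  also have "\<dots> = expectation (\<lambda>w. ?R w + DD * \<rho> (Suc n) t w x)"
    by (rule Bochner_Integration.integral_add[OF Ri integrable_mult_right[OF i\<rho>], symmetric])
  also have "\<dots> = expectation (\<lambda>w. \<rho> (Suc n) t w x * ((\<integral>z. (Q0 n t x - real (Suc n) * \<gamma> n t x z) * exp (hamiltonian t w z) \<partial>S) / Z t w))"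
  proof (rule integral_cong_AE)
    show "(\<lambda>w. ?R w + DD * \<rho> (Suc n) t w x) \<in> borel_measurable M"
      by (intro borel_measurable_add Rm borel_measurable_times borel_measurable_const \<rho>_section)
    have "(\<lambda>p. (Q0 n t x - real (Suc n) * \<gamma> n t x (snd p)) * exp (hamiltonian t (fst p) (snd p))) \<in> borel_measurable (M \<Otimes>\<^sub>M S)"
      using hamiltonian_measurable[of t]
      by (intro borel_measurable_times borel_measurable_diff borel_measurable_const measurable_compose[OF measurable_snd \<gamma>_section] measurable_compose[OF _ borel_measurable_exp])
        (simp add: case_prod_beta')
    then have "(\<lambda>(w, z). (Q0 n t x - real (Suc n) * \<gamma> n t x z) * exp (hamiltonian t w z)) \<in> borel_measurable (M \<Otimes>\<^sub>M S)"
      by (simp add: case_prod_beta')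
    then show "(\<lambda>w. \<rho> (Suc n) t w x * ((\<integral>z. (Q0 n t x - real (Suc n) * \<gamma> n t x z) * exp (hamiltonian t w z) \<partial>S) / Z t w)) \<in> borel_measurable M"
      by (intro borel_measurable_times borel_measurable_divide \<rho>_section Z_measurable S.borel_measurable_lebesgue_integral)
    show "AE w in M. ?R w + DD * \<rho> (Suc n) t w x
      = \<rho> (Suc n) t w x * ((\<integral>z. (Q0 n t x - real (Suc n) * \<gamma> n t x z) * exp (hamiltonian t w z) \<partial>S) / Z t w)"
      using AE_good
    proof eventually_elim
      case (elim w)
      define W where "W = (\<integral>\<tau>. \<gamma> n t x \<tau> * exp (hamiltonian t w \<tau>) \<partial>S)"
      define r where "r = \<rho> (Suc n) t w x"
      define g where "g = (\<Sum>l\<in>{1..Suc n}. \<gamma> n t x (x l))"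
      note Zp = Z_pos[OF elim t01]
      have "r * g - real (Suc n) * (r * W / Z t w) + DD * r = r * (((DD + g) * Z t w - real (Suc n) * W) / Z t w)"
        using Zp by (simp add: field_simps)
      then show ?case unfolding key[OF elim] unfolding Q0_def DD_def[symmetric] W_def[symmetric] r_def[symmetric] g_def[symmetric] .
    qed
  qed
  finally show ?thesis .
qed

text \<open>The two extra replicas have different origins: \<open>n + 1\<close> comes from
  differentiating the normalization, \<open>n + 2\<close> from integrating by parts against
  it.\<close>

lemma average_derivative:
  assumes n: "1 \<le> n" and t: "t \<in> {0<..<1}"
    and f: "f \<in> borel_measurable (T n)" and B: "\<And>x. \<bar>f x\<bar> \<le> B"
    and inv: "\<And>x x'. (\<And>l. l \<in> {1..n} \<Longrightarrow> x l = x' l) \<Longrightarrow> f x = f x'"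
  shows "((\<lambda>s. average n s f) has_real_derivative average (n + 2) t (\<lambda>x. f x * Q n t x)) (at t)"
proof -
  note t01 = window(2)[OF t in_window[OF t]]
  have B0: "0 \<le> B" using B[of undefined] by linarith
  \<comment> \<open>Dependence on the first \<open>n\<close> replicas only lets \<open>f\<close> be
    read, through restriction, as a function on any larger product.\<close>
  have fT: "f \<in> borel_measurable (T k)" if "n \<le> k" for k
  proof -
    have "(\<lambda>x. restrict x {1..n}) \<in> measurable (T k) (T n)"
      unfolding T_def using that by (intro measurable_restrict_subset) auto
    from measurable_compose[OF this f] have "(\<lambda>x. f (restrict x {1..n})) \<in> borel_measurable (T k)" .
    also have "(\<lambda>x. f (restrict x {1..n})) = f" by (intro ext inv) simp
    finally show ?thesis .
  qed
  have inv1: "f (x(Suc n := y)) = f x" and inv2: "f (x(Suc (Suc n) := y)) = f x" for x y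
    by (intro inv; simp)+
  have q0: "0 \<le> Qbound n t" using abs_Q_le[of n t undefined undefined] by linarith
  define u where "u x z = Q0 n t x - real (Suc n) * \<gamma> n t x z" for x z
  have ub: "\<bar>u x z\<bar> \<le> Qbound n t" for x z unfolding u_def by (rule abs_Q_le)
  have Qu: "Q n t (x(Suc (Suc n) := z)) = u x z" for x z
  proof -
    have \<gamma>e: "\<gamma> n t (x(Suc (Suc n) := z)) \<tau> = \<gamma> n t x \<tau>" for \<tau> unfolding \<gamma>_def by (intro sum.cong) auto
    have "(\<Sum>l\<in>{1..Suc n}. sgn_coeff n l * D1 ((x(Suc (Suc n) := z)) l)) = (\<Sum>l\<in>{1..Suc n}. sgn_coeff n l * D1 (x l))"
      "(\<Sum>j\<in>{1..Suc n}. \<gamma> n t x ((x(Suc (Suc n) := z)) j)) = (\<Sum>j\<in>{1..Suc n}. \<gamma> n t x (x j))"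
      by (intro sum.cong; auto)+
    then show ?thesis unfolding Q_def Q0_def u_def \<gamma>e by simp
  qed
  have E\<rho>: "\<bar>expectation (\<lambda>w. \<rho> (Suc (Suc n)) t w x)\<bar> \<le> 1 * bound_const (Suc (Suc n)) (Suc (Suc n) + 2)" for x
    by (rule order_trans[OF integral_abs_bound])
      (rule uniformly_dominated(2)[where h="\<lambda>w x. \<rho> (Suc (Suc n)) t w x" and x=x, OF _ zero_le_one \<rho>_section \<rho>_bound_fn[OF _ t01]], simp_all)
  have QB: "\<bar>f x * Q n t x\<bar> \<le> B * Qbound n t" for x
    unfolding abs_mult Q_def by (intro mult_mono B abs_Q_le B0) simp
  have fQ: "(\<lambda>x. f x * Q n t x) \<in> borel_measurable (T (Suc (Suc n)))"
    by (intro borel_measurable_times fT Q_measurable) simp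
  have "(\<integral>x. f x * expectation (\<lambda>w. \<rho>' n t w x) \<partial>T n)
     = (\<integral>x. f x * expectation (\<lambda>w. \<rho> (Suc n) t w x * drift_sum n t w x) \<partial>T (Suc n))"
    by (rule integral_\<rho>'_eq[OF n t fT B inv1]) simp
  also have "\<dots> = (\<integral>x. f x * expectation (\<lambda>w. \<rho> (Suc n) t w x * ((\<integral>z. u x z * exp (hamiltonian t w z) \<partial>S) / Z t w)) \<partial>T (Suc n))"
    unfolding expectation_drift_sum[OF t] u_def ..
  also have "\<dots> = (\<integral>x. f x * (\<integral>z. expectation (\<lambda>w. \<rho> (Suc (Suc n)) t w (x(Suc (Suc n) := z)) * u x z) \<partial>S) \<partial>T (Suc n))"
  proof -
    have "(\<integral>z. expectation (\<lambda>w. \<rho> (Suc (Suc n)) t w (x(Suc (Suc n) := z)) * u x z) \<partial>S)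
      = expectation (\<lambda>w. \<rho> (Suc n) t w x * ((\<integral>z. u x z * exp (hamiltonian t w z) \<partial>S) / Z t w))" for x
    proof (rule integral_swap_last[OF _ _ q0])
      have "(\<lambda>p. u x (snd p)) \<in> borel_measurable (M \<Otimes>\<^sub>M S)"
        unfolding u_def by (intro borel_measurable_diff borel_measurable_times borel_measurable_const measurable_compose[OF measurable_snd \<gamma>_section])
      then show "(\<lambda>(w, z). u x z) \<in> borel_measurable (M \<Otimes>\<^sub>M S)" by (simp add: case_prod_beta')
      show "\<bar>\<rho> (Suc (Suc n)) t w (x(Suc (Suc n) := y)) * u x y\<bar> \<le> Qbound n t * bound_fn (Suc (Suc n)) (Suc (Suc n) + 2) w (x(Suc (Suc n) := y))"
        if "good w" for w y
        using mult_mono[OF ub \<rho>_bound_fn[OF that t01] q0] by (simp add: abs_mult mult.commute)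
    qed simp
    then show ?thesis by simp
  qed
  also have "\<dots> = (\<integral>x. (\<integral>z. (f (x(Suc (Suc n) := z)) * Q n t (x(Suc (Suc n) := z))) * expectation (\<lambda>w. \<rho> (Suc (Suc n)) t w (x(Suc (Suc n) := z))) \<partial>S) \<partial>T (Suc n))"
    unfolding Qu inv2 by (simp add: mult_ac)
  also have "\<dots> = (\<integral>x. (f x * Q n t x) * expectation (\<lambda>w. \<rho> (Suc (Suc n)) t w x) \<partial>T (Suc (Suc n)))"
  proof (rule integral_T_Suc[symmetric])
    show "(\<lambda>x. f x * Q n t x * expectation (\<lambda>w. \<rho> (Suc (Suc n)) t w x)) \<in> borel_measurable (T (Suc (Suc n)))"
      by (intro borel_measurable_times[OF fQ] expectation_section_measurable \<rho>_measurable)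
    show "\<bar>f x * Q n t x * expectation (\<lambda>w. \<rho> (Suc (Suc n)) t w x)\<bar> \<le> (B * Qbound n t) * (1 * bound_const (Suc (Suc n)) (Suc (Suc n) + 2))" for x
      unfolding abs_mult[of "f x * Q n t x"] using B0 q0 by (intro mult_mono QB E\<rho>) auto
  qed
  also have "\<dots> = average (Suc (Suc n)) t (\<lambda>x. f x * Q n t x)"
    by (rule average_eq[OF _ t01 fQ QB, symmetric]) simp
  finally show ?thesis using average_DERIV[OF n t f B] by simp
qed

end

section \<open>Expansion of the covariance and of the drift\<close>

text \<open>The mean value inequality is used twice, for \<open>f'\<close> and then for
  \<open>f\<close> minus its linear part. This gives \<open>C\<close> where Taylor's formula has
  half of it, and it works with one-sided derivatives at the ends of the interval.\<close>

lemma taylor2_bound: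
  fixes f f' f'' :: "real \<Rightarrow> real"
  assumes d1: "\<And>x. x \<in> {-1..1} \<Longrightarrow> (f has_real_derivative f' x) (at x within {-1..1})"
    and d2: "\<And>x. x \<in> {-1..1} \<Longrightarrow> (f' has_real_derivative f'' x) (at x within {-1..1})"
    and C: "\<And>x. x \<in> {-1..1} \<Longrightarrow> \<bar>f'' x\<bar> \<le> C"
    and x: "x \<in> {-1..1}" and y: "y \<in> {-1..1}"
  shows "\<bar>f y - f x - f' x * (y - x)\<bar> \<le> C * (y - x)\<^sup>2"
proof -
  have C0: "0 \<le> C" using C[OF x] by linarith
  have lip: "\<bar>f' u - f' x\<bar> \<le> C * \<bar>u - x\<bar>" if u: "u \<in> {-1..1}" for u
    using field_differentiable_bound[of "{-1..1}" f' f'' C u x] d2 C x u by simp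
  define I where "I = {min x y..max x y}"
  have I: "I \<subseteq> {-1..1}" "convex I" "x \<in> I" "y \<in> I" using x y by (auto simp: I_def)
  have "norm ((f y - f' x * y) - (f x - f' x * x)) \<le> C * \<bar>y - x\<bar> * norm (y - x)"
  proof (rule field_differentiable_bound[OF I(2) _ _ I(4,3)])
    fix u assume u: "u \<in> I"
    show "((\<lambda>u. f u - f' x * u) has_real_derivative f' u - f' x) (at u within I)"
      using DERIV_subset[OF d1 I(1)] u I(1) by (auto intro!: derivative_eq_intros)
    have "\<bar>u - x\<bar> \<le> \<bar>y - x\<bar>" using u by (auto simp: I_def min_def max_def split: if_splits)
    then have "C * \<bar>u - x\<bar> \<le> C * \<bar>y - x\<bar>" using C0 by (rule mult_left_mono)
    then show "norm (f' u - f' x) \<le> C * \<bar>y - x\<bar>" using lip[of u] u I(1) by auto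
  qed
  moreover have "(f y - f' x * y) - (f x - f' x * x) = f y - f x - f' x * (y - x)" by (simp add: algebra_simps)
  ultimately show ?thesis by (simp add: power2_eq_square abs_mult[symmetric] mult.assoc)
qed

text \<open>Either root may vanish, so neither can be divided by. If \<open>u + v \<le> N\<close>,
  the sum of the roots has square at least \<open>N\<close> and the difference of squares is used.
  Otherwise the square of the difference is at most \<open>2 N - u - v\<close>, which is below
  \<open>u + v\<close>.\<close>

lemma sqrt_diff_bound:
  fixes N u v :: real
  assumes N: "0 < N" and u: "0 \<le> u" "u \<le> N" and v: "0 \<le> v" "v \<le> N"
  shows "(sqrt (N - u) - sqrt (N - v))\<^sup>2 \<le> 2 * (u\<^sup>2 + v\<^sup>2) / N"
proof -
  define a b where "a = sqrt (N - u)" and "b = sqrt (N - v)"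
  have ab: "0 \<le> a" "0 \<le> b" "a\<^sup>2 = N - u" "b\<^sup>2 = N - v" using u v by (auto simp: a_def b_def)
  have "(u - v)\<^sup>2 + (u + v)\<^sup>2 = 2 * (u\<^sup>2 + v\<^sup>2)" by (simp add: power2_eq_square algebra_simps)
  then have le: "(u - v)\<^sup>2 \<le> 2 * (u\<^sup>2 + v\<^sup>2)" "(u + v)\<^sup>2 \<le> 2 * (u\<^sup>2 + v\<^sup>2)"
    using zero_le_power2[of "u + v"] zero_le_power2[of "u - v"] by linarith+
  have "(a - b)\<^sup>2 * N \<le> 2 * (u\<^sup>2 + v\<^sup>2)"
  proof (cases "u + v \<le> N")
    case True
    have "N \<le> a\<^sup>2 + b\<^sup>2" using True ab by linarith
    also have "\<dots> \<le> (a + b)\<^sup>2" using ab by (simp add: power2_sum)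
    finally have "(a - b)\<^sup>2 * N \<le> (a - b)\<^sup>2 * (a + b)\<^sup>2" by (rule mult_left_mono) simp
    also have "\<dots> = (a\<^sup>2 - b\<^sup>2)\<^sup>2" by (simp add: power2_eq_square algebra_simps)
    also have "\<dots> = (u - v)\<^sup>2" unfolding ab by (simp add: power2_commute)
    finally show ?thesis using le by linarith
  next
    case False
    have "(a - b)\<^sup>2 \<le> a\<^sup>2 + b\<^sup>2" using ab by (simp add: power2_diff)
    also have "\<dots> \<le> u + v" using False ab by linarith
    finally have "(a - b)\<^sup>2 * N \<le> (u + v) * (u + v)" using False N u v by (intro mult_mono) auto
    then show ?thesis using le by (simp add: power2_eq_square)
  qed
  then show ?thesis using N by (simp add: a_def b_def le_divide_eq)
qed

text \<open>Here \<open>e, e'\<close> are the last coordinates, \<open>\<rho>\<close> is the overlap of the rescaled configurations and \<open>R\<close>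
  the overlap of the original ones.\<close>

lemma covariance_expansion:
  fixes \<xi> \<xi>1 \<xi>2 :: "real \<Rightarrow> real" and q C \<rho> R N e e' :: real
  assumes T1: "\<And>x y. x \<in> {-1..1} \<Longrightarrow> y \<in> {-1..1} \<Longrightarrow> \<bar>\<xi> y - \<xi> x - \<xi>1 x * (y - x)\<bar> \<le> C * (y - x)\<^sup>2"
    and T2: "\<And>x y. x \<in> {-1..1} \<Longrightarrow> y \<in> {-1..1} \<Longrightarrow> \<bar>\<xi>1 y - \<xi>1 x - \<xi>2 x * (y - x)\<bar> \<le> C * (y - x)\<^sup>2"
    and C: "\<And>x. x \<in> {-1..1} \<Longrightarrow> \<bar>\<xi>1 x\<bar> \<le> C" "\<And>x. x \<in> {-1..1} \<Longrightarrow> \<bar>\<xi>2 x\<bar> \<le> C"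
    and q: "q \<in> {-1..1}" and \<rho>: "\<rho> \<in> {-1..1}" and R: "R \<in> {-1..1}" and N: "0 < N"
    and e: "e\<^sup>2 \<le> N" "e'\<^sup>2 \<le> N"
    and RN: "N * R = sqrt (N - e\<^sup>2) * sqrt (N - e'\<^sup>2) * \<rho> + e * e'"
  shows "\<bar>(N * \<xi> R - (N - 1) * \<xi> \<rho> - e * e' * \<xi>1 q)
      - (\<xi> q - q * \<xi>1 q * (e\<^sup>2 + e'\<^sup>2) / 2
         + (\<rho> - q) * (\<xi>1 q - (e\<^sup>2 + e'\<^sup>2) / 2 * (q * \<xi>2 q + \<xi>1 q) + e * e' * \<xi>2 q))\<bar>
    \<le> 9 * C * ((e ^ 4 + e' ^ 4) / N) + 2 * C * ((1 + e\<^sup>2 + e'\<^sup>2) * (\<rho> - q)\<^sup>2)"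
proof -
  define u v where "u = e\<^sup>2" and "v = e'\<^sup>2"
  define s d where "s = sqrt (N - u) * sqrt (N - v)" and "d = sqrt (N - u) - sqrt (N - v)"
  have uv: "0 \<le> u" "u \<le> N" "0 \<le> v" "v \<le> N" using e by (auto simp: u_def v_def)
  have C0: "0 \<le> C" using C(1)[OF q] by linarith
  have \<rho>1: "\<bar>\<rho>\<bar> \<le> 1" using \<rho> by auto
  have ee: "\<bar>e * e'\<bar> \<le> (u + v) / 2"
    using sum_squares_bound[of "\<bar>e\<bar>" "\<bar>e'\<bar>"] by (simp add: u_def v_def abs_mult)
  \<comment> \<open>Polarization: a product of two roots is the mean of their squares minus half the
    square of their difference. The mean gives the terms in \<open>e^2 + e'^2\<close>; the
    difference is of order \<open>1 / N\<close> by \<open>sqrt_diff_bound\<close>.\<close>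
  have ds: "s - N = - u / 2 - v / 2 - d\<^sup>2 / 2"
  proof -
    have "d\<^sup>2 = 2 * N - u - v - 2 * s" using uv by (simp add: s_def d_def power2_diff)
    then show ?thesis by (simp add: field_simps)
  qed
  have d2: "d\<^sup>2 \<le> 2 * (u\<^sup>2 + v\<^sup>2) / N" unfolding d_def by (rule sqrt_diff_bound[OF N uv])
  have s_ge: "N - (u + v) \<le> s"
  proof (cases "u + v \<le> N")
    case True
    have "(N - (u + v))\<^sup>2 \<le> (N - u) * (N - v)"
    proof -
      have "(N - u) * (N - v) - (N - (u + v))\<^sup>2 = (u + v) * (N - (u + v)) + u * v"
        by (simp add: power2_eq_square algebra_simps)
      moreover have "0 \<le> (u + v) * (N - (u + v)) + u * v" using True uv by simp
      ultimately show ?thesis by linarith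
    qed
    then show ?thesis unfolding s_def real_sqrt_mult[symmetric] by (rule real_le_rsqrt)
  next
    case False
    have "0 \<le> s" using uv by (simp add: s_def)
    then show ?thesis using False by linarith
  qed
  have s_le: "s \<le> N"
    using ds uv zero_le_power2[of d] by linarith
  define \<Delta> where "\<Delta> = N * (R - \<rho>)"
  have \<Delta>: "\<Delta> = \<rho> * (s - N) + e * e'" using RN by (simp add: \<Delta>_def s_def u_def v_def algebra_simps)
  have "\<bar>\<rho> * (s - N)\<bar> \<le> 1 * (u + v)"
    unfolding abs_mult using \<rho>1 s_ge s_le by (intro mult_mono) auto
  then have \<Delta>b: "\<bar>\<Delta>\<bar> \<le> 2 * (u + v)" using ee uv unfolding \<Delta> by linarith
  have "\<bar>\<Delta>\<bar>\<^sup>2 \<le> (2 * (u + v))\<^sup>2" using \<Delta>b by (intro power_mono) auto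
  also have "\<dots> \<le> 8 * (u\<^sup>2 + v\<^sup>2)"
    using zero_le_power2[of "u - v"] by (simp add: power2_eq_square algebra_simps)
  finally have \<Delta>2: "\<Delta>\<^sup>2 \<le> 8 * (u\<^sup>2 + v\<^sup>2)" by simp
  have "N * (R - \<rho>)\<^sup>2 = \<Delta>\<^sup>2 / N" using N by (simp add: \<Delta>_def power2_eq_square)
  also have "\<dots> \<le> 8 * (u\<^sup>2 + v\<^sup>2) / N" using \<Delta>2 N by (simp add: divide_right_mono)
  finally have NR: "N * (R - \<rho>)\<^sup>2 \<le> 8 * (u\<^sup>2 + v\<^sup>2) / N" .
  \<comment> \<open>The four errors: \<open>t1\<close> is the remainder of \<xi> between
    \<open>\<rho>\<close> and \<open>R\<close>, multiplied by \<open>N\<close>; \<open>t2\<close> is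
    the contribution of \<open>d^2\<close>; \<open>t3\<close> and \<open>t4\<close> are the
    remainders of \<xi> and of its derivative at \<open>q\<close>.\<close>
  define t1 t2 t3 t4 where "t1 = N * (\<xi> R - \<xi> \<rho> - \<xi>1 \<rho> * (R - \<rho>))" and "t2 = - (\<xi>1 \<rho> * \<rho> * (d\<^sup>2 / 2))"
    and "t3 = \<xi> \<rho> - \<xi> q - \<xi>1 q * (\<rho> - q)" and "t4 = \<xi>1 \<rho> - \<xi>1 q - \<xi>2 q * (\<rho> - q)"
  have N\<Delta>: "N * (\<xi>1 \<rho> * (R - \<rho>)) = \<xi>1 \<rho> * \<Delta>" by (simp add: \<Delta>_def)
  \<comment> \<open>The last summand arises from expanding \<open>\<rho> * \<xi>1 \<rho>\<close> at
    \<open>q\<close>: its linear coefficient is \<open>q * \<xi>2 q + \<xi>1 q\<close>, and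
    \<open>\<rho> * t4\<close> together with the quadratic term is left over.\<close>
  have split: "(N * \<xi> R - (N - 1) * \<xi> \<rho> - e * e' * \<xi>1 q)
      - (\<xi> q - q * \<xi>1 q * (u + v) / 2
         + (\<rho> - q) * (\<xi>1 q - (u + v) / 2 * (q * \<xi>2 q + \<xi>1 q) + e * e' * \<xi>2 q))
      = t1 + t2 + t3 + e * e' * t4 - (u + v) / 2 * (\<rho> * t4 + \<xi>2 q * (\<rho> - q)\<^sup>2)"
  proof -
    have "t1 = N * \<xi> R - N * \<xi> \<rho> - N * (\<xi>1 \<rho> * (R - \<rho>))" by (simp add: t1_def algebra_simps)
    then have "t1 = N * \<xi> R - N * \<xi> \<rho> - \<xi>1 \<rho> * \<Delta>" unfolding N\<Delta> .
    then show ?thesis unfolding \<Delta> ds t2_def t3_def t4_def by (simp add: field_simps power2_eq_square)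
  qed
  have b1: "\<bar>t1\<bar> \<le> 8 * C * ((u\<^sup>2 + v\<^sup>2) / N)"
  proof -
    have "\<bar>t1\<bar> = N * \<bar>\<xi> R - \<xi> \<rho> - \<xi>1 \<rho> * (R - \<rho>)\<bar>" using N by (simp add: t1_def abs_mult)
    also have "\<dots> \<le> N * (C * (R - \<rho>)\<^sup>2)" using N by (intro mult_left_mono T1 \<rho> R) simp
    also have "\<dots> = C * (N * (R - \<rho>)\<^sup>2)" by simp
    also have "\<dots> \<le> C * (8 * (u\<^sup>2 + v\<^sup>2) / N)" by (rule mult_left_mono[OF NR C0])
    also have "\<dots> = 8 * C * ((u\<^sup>2 + v\<^sup>2) / N)" by (simp add: algebra_simps)
    finally show ?thesis .
  qed
  have b2: "\<bar>t2\<bar> \<le> C * ((u\<^sup>2 + v\<^sup>2) / N)"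
  proof -
    have "\<bar>t2\<bar> = \<bar>\<xi>1 \<rho>\<bar> * \<bar>\<rho>\<bar> * (d\<^sup>2 / 2)" by (simp add: t2_def abs_mult)
    also have "\<dots> \<le> (C * 1) * ((u\<^sup>2 + v\<^sup>2) / N)"
    proof (intro mult_mono)
      have "2 * (u\<^sup>2 + v\<^sup>2) / N = 2 * ((u\<^sup>2 + v\<^sup>2) / N)" by simp
      then show "d\<^sup>2 / 2 \<le> (u\<^sup>2 + v\<^sup>2) / N" using d2 by linarith
    qed (use C(1)[OF \<rho>] \<rho>1 C0 in auto)
    finally show ?thesis by simp
  qed
  have b3: "\<bar>t3\<bar> \<le> C * (\<rho> - q)\<^sup>2" and b4: "\<bar>t4\<bar> \<le> C * (\<rho> - q)\<^sup>2"
    unfolding t3_def t4_def by (intro T1 T2 q \<rho>)+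
  have D0: "0 \<le> C * (\<rho> - q)\<^sup>2" using C0 by simp
  have b5: "\<bar>e * e' * t4\<bar> \<le> (u + v) / 2 * (C * (\<rho> - q)\<^sup>2)"
    unfolding abs_mult[of _ t4] using ee b4 uv by (intro mult_mono) auto
  have "\<bar>\<rho> * t4\<bar> \<le> 1 * (C * (\<rho> - q)\<^sup>2)" unfolding abs_mult using \<rho>1 b4 by (intro mult_mono) auto
  moreover have "\<bar>\<xi>2 q * (\<rho> - q)\<^sup>2\<bar> \<le> C * (\<rho> - q)\<^sup>2" using C(2)[OF q] by (simp add: abs_mult mult_right_mono)
  ultimately have "\<bar>\<rho> * t4 + \<xi>2 q * (\<rho> - q)\<^sup>2\<bar> \<le> 2 * (C * (\<rho> - q)\<^sup>2)" by linarith
  then have "(u + v) / 2 * \<bar>\<rho> * t4 + \<xi>2 q * (\<rho> - q)\<^sup>2\<bar> \<le> (u + v) / 2 * (2 * (C * (\<rho> - q)\<^sup>2))"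
    using uv by (intro mult_left_mono) auto
  then have b6: "\<bar>(u + v) / 2 * (\<rho> * t4 + \<xi>2 q * (\<rho> - q)\<^sup>2)\<bar> \<le> (u + v) * (C * (\<rho> - q)\<^sup>2)"
    using uv by (simp add: abs_mult)
  define D where "D = C * (\<rho> - q)\<^sup>2"
  have "\<bar>t1 + t2 + t3 + e * e' * t4 - (u + v) / 2 * (\<rho> * t4 + \<xi>2 q * (\<rho> - q)\<^sup>2)\<bar>
      \<le> 8 * C * ((u\<^sup>2 + v\<^sup>2) / N) + C * ((u\<^sup>2 + v\<^sup>2) / N) + D + (u + v) / 2 * D + (u + v) * D"
    using b1 b2 b3 b5 b6 unfolding D_def[symmetric] by linarith
  also have "\<dots> \<le> 9 * C * ((u\<^sup>2 + v\<^sup>2) / N) + 2 * ((1 + u + v) * D)"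
  proof -
    have "0 \<le> (u + v) * D" using uv C0 unfolding D_def by (intro mult_nonneg_nonneg) auto
    moreover have "2 * ((1 + u + v) * D) = 2 * D + 2 * ((u + v) * D)" by (simp add: algebra_simps)
    moreover have "(u + v) / 2 * D = ((u + v) * D) / 2" by simp
    ultimately show ?thesis using D0 unfolding D_def[symmetric] by linarith
  qed
  finally show ?thesis
    unfolding split[symmetric] by (simp add: u_def v_def D_def power_mult[symmetric] mult_ac)
qed

text \<open>From \<open>(N - 1) * (c - 1) * (c + 1) = 1 - u\<close> the error equals
  \<open>- (1 - u)^2 / (2 (N - 1) (c + 1)^2)\<close>. The denominator is at least \<open>N\<close>
  because \<open>2 \<le> N\<close> and \<open>c \<ge> 0\<close>.\<close>

lemma drift_expansion:
  fixes N u c :: real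
  assumes N: "2 \<le> N" and u: "0 \<le> u" "u \<le> N" and c: "c = sqrt ((N - u) / (N - 1))"
  shows "\<bar>(N - 1) * (c - 1) - (1 - u) / 2\<bar> \<le> (1 + u\<^sup>2) / N"
proof -
  have c0: "0 \<le> c" and c2: "(N - 1) * c\<^sup>2 = N - u" using N u by (simp_all add: c)
  have 1: "(N - 1) * (c - 1) * (c + 1) = 1 - u" using c2 by (simp add: power2_eq_square algebra_simps)
  define \<delta> where "\<delta> = (N - 1) * (c - 1) - (1 - u) / 2"
  have "\<delta> * (2 * (N - 1) * (c + 1)\<^sup>2) = - ((1 - u)\<^sup>2)"
  proof -
    define k where "k = (N - 1) * (c - 1)"
    have "\<delta> * (2 * (c + 1)) = 2 * (k * (c + 1)) - (1 - u) * (c + 1)"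
      unfolding \<delta>_def k_def[symmetric] by (simp add: field_simps)
    then have "\<delta> * (2 * (c + 1)) = 2 * ((N - 1) * (c - 1) * (c + 1)) - (1 - u) * (c + 1)"
      unfolding k_def .
    also have "\<dots> = - ((1 - u) * (c - 1))" unfolding 1 by (simp add: algebra_simps)
    finally have "\<delta> * (2 * (c + 1)) = - ((1 - u) * (c - 1))" .
    then have "\<delta> * (2 * (c + 1)) * ((N - 1) * (c + 1)) = - ((1 - u) * ((N - 1) * (c - 1) * (c + 1)))" by simp
    then show ?thesis unfolding 1 by (simp add: power2_eq_square field_simps)
  qed
  then have eq: "\<bar>\<delta>\<bar> * (2 * (N - 1) * (c + 1)\<^sup>2) = (1 - u)\<^sup>2"
    using N by (metis (no_types, opaque_lifting) abs_minus_cancel abs_mult abs_of_nonneg abs_power2 diff_ge_0_iff_ge mult_nonneg_nonneg one_le_numeral order_trans zero_le_numeral zero_le_power2)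
  have "1 \<le> (c + 1)\<^sup>2" using c0 by (simp add: one_le_power)
  then have "N * 1 \<le> (2 * (N - 1)) * (c + 1)\<^sup>2" using N by (intro mult_mono) auto
  then have "\<bar>\<delta>\<bar> * N \<le> \<bar>\<delta>\<bar> * (2 * (N - 1) * (c + 1)\<^sup>2)" by (intro mult_left_mono) auto
  also have "\<dots> \<le> 1 + u\<^sup>2" unfolding eq using u by (simp add: power2_eq_square algebra_simps)
  finally show ?thesis using N by (simp add: \<delta>_def le_divide_eq)
qed

lemma sum_symmetric_square:
  fixes g :: "nat \<Rightarrow> nat \<Rightarrow> real"
  assumes "\<And>i j. g i j = g j i"
  shows "(\<Sum>i\<in>{1..n}. \<Sum>j\<in>{1..n}. g i j) = (\<Sum>i\<in>{1..n}. g i i) + 2 * (\<Sum>i\<in>{1..n}. \<Sum>j\<in>{i+1..n}. g i j)"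
proof (induction n)
  case (Suc n)
  have "(\<Sum>i\<in>{1..Suc n}. \<Sum>j\<in>{1..Suc n}. g i j)
    = (\<Sum>i\<in>{1..n}. \<Sum>j\<in>{1..n}. g i j) + 2 * (\<Sum>i\<in>{1..n}. g i (Suc n)) + g (Suc n) (Suc n)"
    using assms by (simp add: sum.distrib)
  moreover have "(\<Sum>i\<in>{1..Suc n}. \<Sum>j\<in>{i+1..Suc n}. g i j) = (\<Sum>i\<in>{1..n}. \<Sum>j\<in>{i+1..n}. g i j) + (\<Sum>i\<in>{1..n}. g i (Suc n))"
  proof -
    have "(\<Sum>j\<in>{i+1..Suc n}. g i j) = (\<Sum>j\<in>{i+1..n}. g i j) + g i (Suc n)" if "i \<in> {1..n}" for i
      using that by (simp add: sum.atLeast_Suc_atMost)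
    then have "(\<Sum>i\<in>{1..n}. \<Sum>j\<in>{i+1..Suc n}. g i j) = (\<Sum>i\<in>{1..n}. (\<Sum>j\<in>{i+1..n}. g i j) + g i (Suc n))"
      by (intro sum.cong) auto
    then show ?thesis by (simp add: sum.distrib)
  qed
  ultimately show ?case using Suc by simp
qed simp

section \<open>The sphere and the joint Gaussian space\<close>

text \<open>At the poles \<open>(eps N \<sigma>)\<^sup>2 = N\<close>, \<open>hat N \<sigma>\<close> is the junk value \<open>0\<close>, which is not on the smaller sphere.\<close>

definition good_sphere :: "nat \<Rightarrow> (nat \<Rightarrow> real) set" where
  "good_sphere N = {\<sigma> \<in> sphere_set N. (eps N \<sigma>)\<^sup>2 < real N}"

lemma space_vec_space: "space vec_space = UNIV"
  by (simp add: vec_space_def space_PiM)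

lemma coord_vec_space: "(\<lambda>\<sigma>. \<sigma> i) \<in> borel_measurable vec_space"
  unfolding vec_space_def by (rule measurable_component_singleton) simp

lemma eps_measurable: "eps N \<in> borel_measurable vec_space"
  unfolding eps_def by (rule coord_vec_space)

lemma sphere_set_measurable: "sphere_set N \<in> sets vec_space"
proof -
  note [measurable] = coord_vec_space
  have "{\<sigma> \<in> space vec_space. (\<forall>i. N \<le> i \<longrightarrow> \<sigma> i = 0) \<and> (\<Sum>i<N. (\<sigma> i)\<^sup>2) = real N} \<in> sets vec_space"
    by measurable
  then show ?thesis by (simp add: sphere_set_def space_vec_space)
qed

lemma good_sphere_measurable: "good_sphere N \<in> sets vec_space"
proof -
  note [measurable] = sphere_set_measurable eps_measurable
  have "{\<sigma> \<in> space vec_space. \<sigma> \<in> sphere_set N \<and> (eps N \<sigma>)\<^sup>2 < real N} \<in> sets vec_space"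
    by measurable
  then show ?thesis by (simp add: good_sphere_def space_vec_space)
qed

lemma hat_coord_measurable: "(\<lambda>\<sigma>. hat N \<sigma> i) \<in> borel_measurable vec_space"
proof -
  note [measurable] = coord_vec_space eps_measurable
  show ?thesis unfolding hat_def by measurable
qed

lemma hat_measurable: "hat N \<in> measurable vec_space vec_space"
proof -
  have "(\<lambda>\<sigma> i. hat N \<sigma> i) \<in> measurable vec_space (Pi\<^sub>M UNIV (\<lambda>_. borel))"
    by (rule measurable_PiM_single') (auto intro: hat_coord_measurable)
  then show ?thesis by (simp add: vec_space_def)
qed

lemma
  shows prob_space_sphere_measure: "prob_space (sphere_measure N)"
    and sets_sphere_measure: "sets (sphere_measure N) = sets vec_space"
    and AE_good_sphere: "2 \<le> N \<Longrightarrow> AE \<sigma> in sphere_measure N. \<sigma> \<in> good_sphere N"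
proof -
  define \<Phi> where "\<Phi> g i = (if i < N then sqrt (real N) * g i / sqrt (\<Sum>j<N. (g j)\<^sup>2) else 0)" for g :: "nat \<Rightarrow> real" and i
  let ?P = "Pi\<^sub>M {..<N} (\<lambda>_. std_normal_distribution)"
  have P: "prob_space ?P" by (intro prob_space_PiM prob_space_normal_density) simp
  interpret P: prob_space ?P by fact
  have S: "sphere_measure N = distr ?P vec_space \<Phi>" by (simp add: sphere_measure_def \<Phi>_def[abs_def])
  have c: "(\<lambda>g. g i) \<in> borel_measurable ?P" if "i < N" for i
    using measurable_component_singleton[of i "{..<N}" "\<lambda>_. std_normal_distribution"] that by simp
  have \<Phi>c: "(\<lambda>g. \<Phi> g i) \<in> borel_measurable ?P" for i
  proof (cases "i < N")
    case True
    have "(\<lambda>g. sqrt (real N) * g i / sqrt (\<Sum>j<N. (g j)\<^sup>2)) \<in> borel_measurable ?P"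
      by (intro borel_measurable_divide borel_measurable_times borel_measurable_const
         measurable_compose[OF _ borel_measurable_sqrt] borel_measurable_sum borel_measurable_power c) (use True in auto)
    then show ?thesis by (simp add: \<Phi>_def True)
  qed (simp add: \<Phi>_def)
  have \<Phi>m: "\<Phi> \<in> measurable ?P vec_space"
    unfolding vec_space_def by (rule measurable_PiM_single') (use \<Phi>c in auto)
  show "prob_space (sphere_measure N)" unfolding S by (rule P.prob_space_distr[OF \<Phi>m])
  show "sets (sphere_measure N) = sets vec_space" unfolding S by simp
  assume N: "2 \<le> N"
  \<comment> \<open>A single nonzero coordinate other than the last one suffices: it makes the norm
    positive and keeps the normalized last coordinate strictly below \<open>sqrt N\<close> in
    absolute value. Index 0 differs from \<open>N - 1\<close> because
    \<open>2 \<le> N\<close>.\<close>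
  have "AE x in std_normal_distribution. x \<noteq> 0"
    by (subst AE_density) (auto intro: AE_mp[OF AE_lborel_singleton])
  then have "AE g in ?P. g 0 \<noteq> 0"
    by (intro AE_PiM_component[where P="\<lambda>x. x \<noteq> 0"]) (use N in \<open>auto intro: prob_space_normal_density\<close>)
  then have "AE g in ?P. \<Phi> g \<in> good_sphere N"
  proof eventually_elim
    case (elim g)
    define s where "s = (\<Sum>j<N. (g j)\<^sup>2)"
    have "(g 0)\<^sup>2 + (g (N - 1))\<^sup>2 = (\<Sum>j\<in>{0, N - 1}. (g j)\<^sup>2)" using N by simp
    also have "\<dots> \<le> s" unfolding s_def by (rule sum_mono2) (use N in auto)
    finally have le: "(g 0)\<^sup>2 + (g (N - 1))\<^sup>2 \<le> s" .
    have g0: "0 < (g 0)\<^sup>2" using elim by simp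
    then have s: "0 < s" "(g (N - 1))\<^sup>2 < s" using le zero_le_power2[of "g (N - 1)"] by linarith+
    have sq: "(\<Phi> g i)\<^sup>2 = real N * (g i)\<^sup>2 / s" if "i < N" for i
      using that s by (simp add: \<Phi>_def s_def[symmetric] power_mult_distrib power_divide)
    have "(\<Sum>i<N. (\<Phi> g i)\<^sup>2) = (\<Sum>i<N. real N / s * (g i)\<^sup>2)"
      by (intro sum.cong) (auto simp: sq)
    also have "\<dots> = real N" unfolding sum_distrib_left[symmetric] s_def[symmetric] using s by simp
    finally have 1: "(\<Sum>i<N. (\<Phi> g i)\<^sup>2) = real N" .
    have "(\<Phi> g (N - 1))\<^sup>2 = real N * ((g (N - 1))\<^sup>2 / s)" using sq[of "N - 1"] N by simp
    also have "\<dots> < real N * 1" using s N by (intro mult_strict_left_mono) auto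
    finally show ?case using 1 by (simp add: good_sphere_def sphere_set_def eps_def \<Phi>_def)
  qed
  then show "AE \<sigma> in sphere_measure N. \<sigma> \<in> good_sphere N"
    unfolding S using good_sphere_measurable[of N]
    by (subst AE_distr_iff[OF \<Phi>m]) (simp_all add: space_vec_space)
qed

lemma good_sphereD:
  assumes "\<sigma> \<in> good_sphere N"
  shows "\<sigma> \<in> sphere_set N" "(eps N \<sigma>)\<^sup>2 < real N"
  using assms unfolding good_sphere_def by blast+

lemma hat_scale:
  assumes N: "2 \<le> N" and \<sigma>: "\<sigma> \<in> good_sphere N" and i: "i < N - 1"
  shows "\<sigma> i = sqrt ((real N - (eps N \<sigma>)\<^sup>2) / (real N - 1)) * hat N \<sigma> i"
proof -
  define c where "c = (real N - (eps N \<sigma>)\<^sup>2) / (real N - 1)"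
  have "0 < c" using good_sphereD(2)[OF \<sigma>] N by (simp add: c_def)
  then have "sqrt c \<noteq> 0" by simp
  then show ?thesis using i unfolding hat_def c_def[symmetric] by simp
qed

lemma sphere_sum_split:
  assumes "2 \<le> N" shows "(\<Sum>i<N. \<sigma> i * \<tau> i) = (\<Sum>i<N - 1. \<sigma> i * \<tau> i) + eps N \<sigma> * eps N \<tau>"
proof -
  obtain k where "N = Suc k" using assms by (cases N) auto
  then show ?thesis by (simp add: eps_def)
qed

lemma hat_in_sphere_set:
  assumes N: "2 \<le> N" and \<sigma>: "\<sigma> \<in> good_sphere N"
  shows "hat N \<sigma> \<in> sphere_set (N - 1)"
proof -
  define c where "c = (real N - (eps N \<sigma>)\<^sup>2) / (real N - 1)"
  have c: "0 < c" using good_sphereD(2)[OF \<sigma>] N by (simp add: c_def)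
  have "(\<Sum>i<N - 1. \<sigma> i * \<sigma> i) + eps N \<sigma> * eps N \<sigma> = real N"
    using good_sphereD(1)[OF \<sigma>] unfolding sphere_sum_split[OF N, symmetric] by (simp add: sphere_set_def power2_eq_square)
  moreover have "(\<Sum>i<N - 1. \<sigma> i * \<sigma> i) = (\<Sum>i<N - 1. c * (hat N \<sigma> i)\<^sup>2)"
  proof (intro sum.cong refl)
    fix i assume i: "i \<in> {..<N - 1}"
    have "\<sigma> i = sqrt c * hat N \<sigma> i" using hat_scale[OF N \<sigma>, of i] i by (simp add: c_def)
    then show "\<sigma> i * \<sigma> i = c * (hat N \<sigma> i)\<^sup>2" using c by (simp add: power2_eq_square)
  qed
  ultimately have "c * (\<Sum>i<N - 1. (hat N \<sigma> i)\<^sup>2) = real N - (eps N \<sigma>)\<^sup>2"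
    by (simp add: sum_distrib_left power2_eq_square)
  also have "\<dots> = c * (real N - 1)" using N by (simp add: c_def)
  finally have "(\<Sum>i<N - 1. (hat N \<sigma> i)\<^sup>2) = real (N - 1)" using c N by (simp add: of_nat_diff)
  then show ?thesis by (simp add: sphere_set_def hat_def)
qed

lemma overlap_commute: "overlap N \<sigma> \<tau> = overlap N \<tau> \<sigma>"
  by (simp add: overlap_def mult.commute)

lemma overlap_self: "1 \<le> N \<Longrightarrow> \<sigma> \<in> sphere_set N \<Longrightarrow> overlap N \<sigma> \<sigma> = 1"
  by (simp add: overlap_def sphere_set_def power2_eq_square)

text \<open>The Cauchy-Schwarz inequality, read off from the squared norms of the sum and the
  difference of the two vectors.\<close>

lemma overlap_range:
  assumes N: "1 \<le> N" and \<sigma>: "\<sigma> \<in> sphere_set N" and \<tau>: "\<tau> \<in> sphere_set N"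
  shows "overlap N \<sigma> \<tau> \<in> {-1..1}"
proof -
  have sq: "(\<Sum>i<N. \<sigma> i * \<sigma> i) = real N" "(\<Sum>i<N. \<tau> i * \<tau> i) = real N"
    using \<sigma> \<tau> by (simp_all add: sphere_set_def power2_eq_square)
  have "0 \<le> (\<Sum>i<N. (\<sigma> i - \<tau> i)\<^sup>2)" "0 \<le> (\<Sum>i<N. (\<sigma> i + \<tau> i)\<^sup>2)" by (intro sum_nonneg; simp)+
  moreover have "(\<Sum>i<N. (\<sigma> i - \<tau> i)\<^sup>2) = 2 * real N - 2 * (\<Sum>i<N. \<sigma> i * \<tau> i)"
    "(\<Sum>i<N. (\<sigma> i + \<tau> i)\<^sup>2) = 2 * real N + 2 * (\<Sum>i<N. \<sigma> i * \<tau> i)"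
  proof -
    have e: "(\<sigma> i - \<tau> i)\<^sup>2 = \<sigma> i * \<sigma> i + \<tau> i * \<tau> i - 2 * (\<sigma> i * \<tau> i)"
      "(\<sigma> i + \<tau> i)\<^sup>2 = \<sigma> i * \<sigma> i + \<tau> i * \<tau> i + 2 * (\<sigma> i * \<tau> i)" for i
      by (simp_all add: power2_eq_square algebra_simps)
    show "(\<Sum>i<N. (\<sigma> i - \<tau> i)\<^sup>2) = 2 * real N - 2 * (\<Sum>i<N. \<sigma> i * \<tau> i)"
      "(\<Sum>i<N. (\<sigma> i + \<tau> i)\<^sup>2) = 2 * real N + 2 * (\<Sum>i<N. \<sigma> i * \<tau> i)"
      unfolding e sum.distrib sum_subtractf sum_distrib_left[symmetric] sq by simp_all
  qed
  ultimately show ?thesis using N by (simp add: overlap_def le_divide_eq divide_le_eq)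
qed

lemma overlap_decomposition:
  assumes N: "2 \<le> N" and \<sigma>: "\<sigma> \<in> good_sphere N" and \<tau>: "\<tau> \<in> good_sphere N"
  shows "real N * overlap N \<sigma> \<tau> = sqrt (real N - (eps N \<sigma>)\<^sup>2) * sqrt (real N - (eps N \<tau>)\<^sup>2) * hatR2 N \<sigma> \<tau> + eps N \<sigma> * eps N \<tau>"
proof -
  define a b where "a = sqrt (real N - (eps N \<sigma>)\<^sup>2)" and "b = sqrt (real N - (eps N \<tau>)\<^sup>2)"
  define r where "r = sqrt (real N - 1)"
  have r: "r * r = real N - 1" "0 < r" using N by (simp_all add: r_def)
  have "(\<Sum>i<N - 1. \<sigma> i * \<tau> i) = (\<Sum>i<N - 1. a * b / (real N - 1) * (hat N \<sigma> i * hat N \<tau> i))"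
  proof (intro sum.cong refl)
    fix i assume i: "i \<in> {..<N - 1}"
    have "\<sigma> i = a / r * hat N \<sigma> i" "\<tau> i = b / r * hat N \<tau> i"
      using hat_scale[OF N \<sigma>, of i] hat_scale[OF N \<tau>, of i] i by (simp_all add: a_def b_def r_def real_sqrt_divide)
    then show "\<sigma> i * \<tau> i = a * b / (real N - 1) * (hat N \<sigma> i * hat N \<tau> i)"
      by (simp add: r(1)[symmetric])
  qed
  also have "\<dots> = a * b * hatR2 N \<sigma> \<tau>"
    unfolding sum_distrib_left[symmetric] using N by (simp add: hatR2_def overlap_def of_nat_diff)
  finally show ?thesis
    using sphere_sum_split[OF N, of \<sigma> \<tau>] N by (simp add: overlap_def a_def b_def)
qed

section \<open>Joint normality and covariances of the three independent sources\<close>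

text \<open>Characteristic functions determine the law. For variance 0 the comparison is with a
  point mass, otherwise with the standard normal law after rescaling, since \<open>normal_rv\<close>
  asks for a density only in the second case.\<close>

lemma (in prob_space) normal_rv_if_iexp:
  assumes X: "X \<in> borel_measurable M" and v: "0 \<le> v"
    and iexp: "\<And>s. (CLINT w|M. iexp (s * X w)) = complex_of_real (exp (- (s\<^sup>2 * v) / 2))"
  shows "normal_rv M X 0 v"
proof -
  note [measurable] = X
  have char: "char (distr M borel (\<lambda>w. c * X w)) s = complex_of_real (exp (- ((s * c)\<^sup>2 * v) / 2))" for c s
  proof -
    have "char (distr M borel (\<lambda>w. c * X w)) s = (CLINT w|M. iexp (s * (c * X w)))"
      unfolding char_def by (subst integral_distr) auto
    then show ?thesis using iexp[of "s * c"] by (simp add: mult.assoc)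
  qed
  show ?thesis
  proof (cases "v = 0")
    case True
    have "char (distr M borel X) = char (return borel 0)"
    proof
      fix s show "char (distr M borel X) s = char (return borel 0) s"
        using char[of 1 s] True by (simp add: char_def integral_return)
    qed
    moreover have "real_distribution (return borel 0)"
      by (simp add: real_distribution_def real_distribution_axioms_def prob_space_return)
    ultimately have "distr M borel X = return borel 0"
      by (intro Levy_uniqueness real_distribution_distr X)
    then have "AE x in distr M borel X. x = 0" by (simp only:) (simp add: AE_return)
    from AE_distrD[OF X this] show ?thesis using True X by (simp add: normal_rv_def)
  next
    case False
    then have v: "0 < v" using v by simp
    have "char (distr M borel (\<lambda>w. 1 / sqrt v * X w)) = char std_normal_distribution"
    proof
      fix s
      have "(s * (1 / sqrt v))\<^sup>2 * v = s\<^sup>2" using v by (simp add: power_divide)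
      then show "char (distr M borel (\<lambda>w. 1 / sqrt v * X w)) s = char std_normal_distribution s"
        unfolding char char_std_normal_distribution by simp
    qed
    then have "distr M borel (\<lambda>w. 1 / sqrt v * X w) = std_normal_distribution"
      by (intro Levy_uniqueness real_distribution_distr real_dist_normal_dist) simp_all
    then have "distr M lborel (\<lambda>w. (X w - 0) / sqrt v) = std_normal_distribution"
      by (simp add: distr_cong[OF refl sets_lborel])
    then have "distributed M lborel (\<lambda>w. (X w - 0) / sqrt v) (\<lambda>x. ennreal (std_normal_density x))"
      by (simp add: distributed_def)
    then have "distributed M lborel X (\<lambda>x. ennreal (normal_density 0 (sqrt v) x))"
      using normal_standard_normal_convert[of "sqrt v" X 0] v by simp
    then show ?thesis using v X by (simp add: normal_rv_def)
  qed
qed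

text \<open>The three random elements take values in different spaces. Composing them with real
  functions gives one family of real variables indexed by 0, 1, 2, whose generated events are among
  those declared independent.\<close>

lemma (in prob_space) indep3_iexp:
  assumes I: "indep3 M MX X MY Y MZ Z"
    and m: "\<phi> \<in> borel_measurable MX" "\<psi> \<in> borel_measurable MY" "\<eta> \<in> borel_measurable MZ"
  shows "(CLINT w|M. iexp (\<phi> (X w) + \<psi> (Y w) + \<eta> (Z w)))
    = (CLINT w|M. iexp (\<phi> (X w))) * (CLINT w|M. iexp (\<psi> (Y w))) * (CLINT w|M. iexp (\<eta> (Z w)))"
proof -
  have XYZ: "X \<in> measurable M MX" "Y \<in> measurable M MY" "Z \<in> measurable M MZ" using I by (simp_all add: indep3_def)
  define W where "W i = (\<lambda>w. if i = 0 then \<phi> (X w) else if i = 1 then \<psi> (Y w) else \<eta> (Z w))" for i :: nat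
  have c: "(\<lambda>w. \<phi> (X w)) \<in> borel_measurable M" "(\<lambda>w. \<psi> (Y w)) \<in> borel_measurable M" "(\<lambda>w. \<eta> (Z w)) \<in> borel_measurable M"
    by (rule measurable_compose[OF XYZ(1) m(1)] measurable_compose[OF XYZ(2) m(2)] measurable_compose[OF XYZ(3) m(3)])+
  have W: "W i \<in> borel_measurable M" for i using c by (simp add: W_def)
  have pre: "\<exists>B\<in>sets N. (\<lambda>w. g (U w)) -` A \<inter> space M = U -` B \<inter> space M"
    if "U \<in> measurable M N" "g \<in> borel_measurable N" "A \<in> sets borel" for U :: "'a \<Rightarrow> 'u" and N and g :: "'u \<Rightarrow> real" and A
    using that by (intro bexI[of _ "g -` A \<inter> space N"]) (auto dest: measurable_space intro: measurable_sets)
  have "indep_vars (\<lambda>_. borel) W {0, 1, 2}"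
    unfolding indep_vars_def2
  proof (intro conjI ballI W)
    show "indep_sets (\<lambda>i. {W i -` A \<inter> space M |A. A \<in> sets borel}) {0, 1, 2}"
    proof (rule indep_sets_mono_sets)
      show "indep_sets (\<lambda>i::nat. if i = 0 then {X -` A \<inter> space M | A. A \<in> sets MX}
                 else if i = 1 then {Y -` A \<inter> space M | A. A \<in> sets MY}
                 else {Z -` A \<inter> space M | A. A \<in> sets MZ}) {0, 1, 2}"
        using I by (simp add: indep3_def)
      fix i :: nat assume "i \<in> {0, 1, 2}"
      then consider "i = 0" | "i = 1" | "i = 2" by blast
      then show "{W i -` A \<inter> space M |A. A \<in> sets borel} \<subseteq> (if i = 0 then {X -` A \<inter> space M | A. A \<in> sets MX}
                 else if i = 1 then {Y -` A \<inter> space M | A. A \<in> sets MY}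
                 else {Z -` A \<inter> space M | A. A \<in> sets MZ})"
      proof cases
        case 1 then show ?thesis using pre[OF XYZ(1) m(1)] by (fastforce simp: W_def)
      next
        case 2 then show ?thesis using pre[OF XYZ(2) m(2)] by (fastforce simp: W_def)
      next
        case 3 then show ?thesis using pre[OF XYZ(3) m(3)] by (fastforce simp: W_def)
      qed
    qed
  qed
  from char_distr_sum[OF this, of 1]
  have "char (distr M borel (\<lambda>w. \<Sum>i\<in>{0, 1, 2}. W i w)) 1 = (\<Prod>i\<in>{0, 1, 2}. char (distr M borel (W i)) 1)" .
  moreover have "char (distr M borel U) 1 = (CLINT w|M. iexp (U w))" if "U \<in> borel_measurable M" for U
    unfolding char_def using that by (subst integral_distr) auto
  ultimately show ?thesis using W c by (simp add: W_def add.assoc mult.assoc)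
qed

text \<open>The linear span of the two processes and of \<open>z\<close>, with explicit coefficients
  so that variances can be computed as quadratic forms. It serves as the ambient Gaussian
  space.\<close>

definition joint_space :: "'a set \<Rightarrow> ('w \<Rightarrow> 'a \<Rightarrow> real) \<Rightarrow> 'b set \<Rightarrow> ('w \<Rightarrow> 'b \<Rightarrow> real) \<Rightarrow> ('w \<Rightarrow> real) \<Rightarrow> ('w \<Rightarrow> real) set" where
  "joint_space S X S' Y z = {W. \<exists>F c F' c' a. finite F \<and> F \<subseteq> S \<and> finite F' \<and> F' \<subseteq> S' \<and>
     W = (\<lambda>w. (\<Sum>x\<in>F. c x * X w x) + (\<Sum>y\<in>F'. c' y * Y w y) + a * z w)}"

lemma joint_spaceI:
  assumes "finite F" "F \<subseteq> S" "finite F'" "F' \<subseteq> S'"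
  shows "(\<lambda>w. (\<Sum>x\<in>F. c x * X w x) + (\<Sum>y\<in>F'. c' y * Y w y) + a * z w) \<in> joint_space S X S' Y z"
  using assms unfolding joint_space_def by blast

lemma sum_lincomb_union:
  fixes u v :: real
  assumes "finite F1" "finite F2"
  shows "u * (\<Sum>x\<in>F1. c1 x * f x) + v * (\<Sum>x\<in>F2. c2 x * f x)
    = (\<Sum>x\<in>F1 \<union> F2. (u * (if x \<in> F1 then c1 x else 0) + v * (if x \<in> F2 then c2 x else 0)) * f x)"
proof -
  have "(\<Sum>x\<in>F1. c1 x * f x) = (\<Sum>x\<in>F1 \<union> F2. (if x \<in> F1 then c1 x else 0) * f x)"
    "(\<Sum>x\<in>F2. c2 x * f x) = (\<Sum>x\<in>F1 \<union> F2. (if x \<in> F2 then c2 x else 0) * f x)"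
    using assms by (intro sum.mono_neutral_cong_left; auto)+
  then show ?thesis by (simp add: sum_distrib_left sum.distrib[symmetric] algebra_simps)
qed

lemma joint_space_lincomb:
  assumes "W1 \<in> joint_space S X S' Y z" "W2 \<in> joint_space S X S' Y z"
  shows "(\<lambda>w. u * W1 w + v * W2 w) \<in> joint_space S X S' Y z"
proof -
  obtain F1 c1 F1' c1' a1 where 1: "finite F1" "F1 \<subseteq> S" "finite F1'" "F1' \<subseteq> S'"
    "W1 = (\<lambda>w. (\<Sum>x\<in>F1. c1 x * X w x) + (\<Sum>y\<in>F1'. c1' y * Y w y) + a1 * z w)"
    using assms(1) unfolding joint_space_def by blast
  obtain F2 c2 F2' c2' a2 where 2: "finite F2" "F2 \<subseteq> S" "finite F2'" "F2' \<subseteq> S'"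
    "W2 = (\<lambda>w. (\<Sum>x\<in>F2. c2 x * X w x) + (\<Sum>y\<in>F2'. c2' y * Y w y) + a2 * z w)"
    using assms(2) unfolding joint_space_def by blast
  have "(\<lambda>w. u * W1 w + v * W2 w) = (\<lambda>w.
      (\<Sum>x\<in>F1 \<union> F2. (u * (if x \<in> F1 then c1 x else 0) + v * (if x \<in> F2 then c2 x else 0)) * X w x)
    + (\<Sum>x\<in>F1' \<union> F2'. (u * (if x \<in> F1' then c1' x else 0) + v * (if x \<in> F2' then c2' x else 0)) * Y w x)
    + (u * a1 + v * a2) * z w)"
    unfolding 1(5) 2(5) sum_lincomb_union[OF 1(1) 2(1), symmetric] sum_lincomb_union[OF 1(3) 2(3), symmetric]
    by (simp add: algebra_simps)
  also have "\<dots> \<in> joint_space S X S' Y z"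
    by (rule joint_spaceI) (use 1 2 in auto)
  finally show ?thesis .
qed

text \<open>By independence the characteristic function factors into three Gaussian ones, so the
  variances add.\<close>

lemma (in prob_space) joint_space_normal_rv:
  fixes X :: "'a \<Rightarrow> 's \<Rightarrow> real" and Y :: "'a \<Rightarrow> 't \<Rightarrow> real"
  assumes X: "centered_gaussian_process M X S C" and Y: "centered_gaussian_process M Y S' C'" and z: "normal_rv M z 0 1"
    and I: "indep3 M (Pi\<^sub>M UNIV (\<lambda>_. borel)) X (Pi\<^sub>M UNIV (\<lambda>_. borel)) Y borel z"
    and F: "finite F" "F \<subseteq> S" "finite F'" "F' \<subseteq> S'"
  shows "normal_rv M (\<lambda>w. (\<Sum>x\<in>F. c x * X w x) + (\<Sum>y\<in>F'. c' y * Y w y) + a * z w) 0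
    ((\<Sum>x\<in>F. \<Sum>y\<in>F. c x * c y * C x y) + (\<Sum>x\<in>F'. \<Sum>y\<in>F'. c' x * c' y * C' x y) + a\<^sup>2)"
proof -
  have nX: "normal_rv M (\<lambda>w. \<Sum>x\<in>F. c x * X w x) 0 (\<Sum>x\<in>F. \<Sum>y\<in>F. c x * c y * C x y)" for c
    using X F unfolding centered_gaussian_process_def by blast
  have nY: "normal_rv M (\<lambda>w. \<Sum>x\<in>F'. c x * Y w x) 0 (\<Sum>x\<in>F'. \<Sum>y\<in>F'. c x * c y * C' x y)" for c
    using Y F unfolding centered_gaussian_process_def by blast
  have eX: "(CLINT w|M. iexp (\<Sum>x\<in>F. s * c x * X w x)) = complex_of_real (exp (- (s\<^sup>2 * (\<Sum>x\<in>F. \<Sum>y\<in>F. c x * c y * C x y)) / 2))" for s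
    using normal_rv_iexp[OF nX[of "\<lambda>x. s * c x"]]
    by (simp add: sum_distrib_left power2_eq_square mult_ac)
  have eY: "(CLINT w|M. iexp (\<Sum>x\<in>F'. s * c' x * Y w x)) = complex_of_real (exp (- (s\<^sup>2 * (\<Sum>x\<in>F'. \<Sum>y\<in>F'. c' x * c' y * C' x y)) / 2))" for s
    using normal_rv_iexp[OF nY[of "\<lambda>x. s * c' x"]]
    by (simp add: sum_distrib_left power2_eq_square mult_ac)
  have ez: "(CLINT w|M. iexp (s * a * z w)) = complex_of_real (exp (- (s\<^sup>2 * a\<^sup>2) / 2))" for s
  proof -
    have zm: "z \<in> borel_measurable M" and D: "distributed M lborel z (\<lambda>x. ennreal (normal_density 0 1 x))"
      using z by (simp_all add: normal_rv_def)
    have "distr M borel z = std_normal_distribution"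
      using distributed_distr_eq_density[OF D] by (simp add: distr_cong[OF refl sets_lborel])
    moreover have "char (distr M borel z) (s * a) = (CLINT w|M. iexp (s * a * z w))"
      unfolding char_def using zm by (subst integral_distr) auto
    ultimately show ?thesis by (simp add: char_std_normal_distribution power_mult_distrib)
  qed
  have meas: "(\<lambda>x. \<Sum>i\<in>F. b i * x i) \<in> borel_measurable (Pi\<^sub>M UNIV (\<lambda>_. borel))" for F and b :: "'i \<Rightarrow> real"
    by (intro borel_measurable_sum borel_measurable_times borel_measurable_const measurable_component_singleton) simp
  show ?thesis
  proof (rule normal_rv_if_iexp)
    have "(\<lambda>w. a * z w) \<in> borel_measurable M"
      by (intro borel_measurable_times borel_measurable_const normal_rv_measurable[OF z])
    then show "(\<lambda>w. (\<Sum>x\<in>F. c x * X w x) + (\<Sum>y\<in>F'. c' y * Y w y) + a * z w) \<in> borel_measurable M"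
      by (intro borel_measurable_add normal_rv_measurable[OF nX] normal_rv_measurable[OF nY])
    show "0 \<le> (\<Sum>x\<in>F. \<Sum>y\<in>F. c x * c y * C x y) + (\<Sum>x\<in>F'. \<Sum>y\<in>F'. c' x * c' y * C' x y) + a\<^sup>2"
      using normal_rv_var_nonneg[OF nX[of c]] normal_rv_var_nonneg[OF nY[of c']] by simp
    fix s
    have "(CLINT w|M. iexp (s * ((\<Sum>x\<in>F. c x * X w x) + (\<Sum>y\<in>F'. c' y * Y w y) + a * z w)))
      = (CLINT w|M. iexp ((\<Sum>x\<in>F. s * c x * X w x) + (\<Sum>y\<in>F'. s * c' y * Y w y) + s * a * z w))"
      by (simp only: distrib_left sum_distrib_left mult.assoc)
    also have "\<dots> = (CLINT w|M. iexp (\<Sum>x\<in>F. s * c x * X w x)) * (CLINT w|M. iexp (\<Sum>x\<in>F'. s * c' x * Y w x)) * (CLINT w|M. iexp (s * a * z w))"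
      by (rule indep3_iexp[OF I meas meas, of "\<lambda>x. s * a * x"]) simp
    finally show "(CLINT w|M. iexp (s * ((\<Sum>x\<in>F. c x * X w x) + (\<Sum>y\<in>F'. c' y * Y w y) + a * z w)))
      = complex_of_real (exp (- (s\<^sup>2 * ((\<Sum>x\<in>F. \<Sum>y\<in>F. c x * c y * C x y) + (\<Sum>x\<in>F'. \<Sum>y\<in>F'. c' x * c' y * C' x y) + a\<^sup>2)) / 2))"
      unfolding eX eY ez of_real_mult[symmetric] exp_add[symmetric]
      by (simp add: algebra_simps add_divide_distrib)
  qed
qed

lemma (in prob_space) gaussian_space_joint:
  assumes X: "centered_gaussian_process M X S C" and Y: "centered_gaussian_process M Y S' C'" and z: "normal_rv M z 0 1"
    and I: "indep3 M (Pi\<^sub>M UNIV (\<lambda>_. borel)) X (Pi\<^sub>M UNIV (\<lambda>_. borel)) Y borel z"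
  shows "gaussian_space M (joint_space S X S' Y z)"
  unfolding gaussian_space_def
proof (intro conjI ballI allI joint_space_lincomb)
  fix W assume "W \<in> joint_space S X S' Y z"
  then obtain v where "normal_rv M W 0 v" unfolding joint_space_def using joint_space_normal_rv[OF X Y z I] by blast
  with normal_rv_power2[OF this] show "normal_rv M W 0 (\<integral>w. (W w)\<^sup>2 \<partial>M)" by simp
qed

text \<open>Every covariance is obtained by polarization from the variances of combinations of at
  most two sources. Where an index set is empty its coefficient function is left
  \<open>undefined\<close>.\<close>

lemma (in prob_space) joint_covariance:
  fixes X :: "'a \<Rightarrow> 's \<Rightarrow> real" and Y :: "'a \<Rightarrow> 't \<Rightarrow> real"
  assumes X: "centered_gaussian_process M X S C" and Y: "centered_gaussian_process M Y S' C'" and z: "normal_rv M z 0 1"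
    and I: "indep3 M (Pi\<^sub>M UNIV (\<lambda>_. borel)) X (Pi\<^sub>M UNIV (\<lambda>_. borel)) Y borel z"
  defines "J \<equiv> joint_space S X S' Y z"
  shows "x \<in> S \<Longrightarrow> (\<lambda>w. X w x) \<in> J" "y \<in> S' \<Longrightarrow> (\<lambda>w. Y w y) \<in> J" "z \<in> J"
    and "(\<And>x y. C x y = C y x) \<Longrightarrow> x \<in> S \<Longrightarrow> x' \<in> S \<Longrightarrow> expectation (\<lambda>w. X w x * X w x') = C x x'"
    and "(\<And>x y. C' x y = C' y x) \<Longrightarrow> y \<in> S' \<Longrightarrow> y' \<in> S' \<Longrightarrow> expectation (\<lambda>w. Y w y * Y w y') = C' y y'"
    and "x \<in> S \<Longrightarrow> y \<in> S' \<Longrightarrow> expectation (\<lambda>w. X w x * Y w y) = 0"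
    and "x \<in> S \<Longrightarrow> expectation (\<lambda>w. X w x * z w) = 0"
    and "y \<in> S' \<Longrightarrow> expectation (\<lambda>w. Y w y * z w) = 0"
    and "expectation (\<lambda>w. z w * z w) = 1"
proof -
  have G: "gaussian_space M J" unfolding J_def by (rule gaussian_space_joint[OF X Y z I])
  note var = normal_rv_power2[OF joint_space_normal_rv[OF X Y z I]]
  note mem = joint_spaceI[of _ S _ S' _ X _ Y _ z, folded J_def]
  have Xm: "(\<lambda>w. X w x) \<in> J" if "x \<in> S" for x using mem[of "{x}" "{}" "\<lambda>_. 1" undefined 0] that by simp
  have Ym: "(\<lambda>w. Y w x) \<in> J" if "x \<in> S'" for x using mem[of "{}" "{x}" undefined "\<lambda>_. 1" 0] that by simp
  have zm: "z \<in> J" using mem[of "{}" "{}" undefined undefined 1] by simp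
  have pol: "expectation (\<lambda>w. A w * B w) = (expectation (\<lambda>w. (A w + B w)\<^sup>2) - expectation (\<lambda>w. (A w)\<^sup>2) - expectation (\<lambda>w. (B w)\<^sup>2)) / 2"
    if "A \<in> J" "B \<in> J" for A B
    using gaussian_space_lincomb_power2[OF G that, of 1 1] by simp
  have X2: "expectation (\<lambda>w. (X w x)\<^sup>2) = C x x" if "x \<in> S" for x
    using var[of "{x}" "{}" "\<lambda>_. 1" undefined 0] that by simp
  have Y2: "expectation (\<lambda>w. (Y w x)\<^sup>2) = C' x x" if "x \<in> S'" for x
    using var[of "{}" "{x}" undefined "\<lambda>_. 1" 0] that by simp
  have z2: "expectation (\<lambda>w. (z w)\<^sup>2) = 1"
    using var[of "{}" "{}" undefined undefined 1] by simp
  show "x \<in> S \<Longrightarrow> (\<lambda>w. X w x) \<in> J" "y \<in> S' \<Longrightarrow> (\<lambda>w. Y w y) \<in> J" "z \<in> J"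
    using Xm Ym zm by blast+
  show "expectation (\<lambda>w. X w x * X w x') = C x x'" if sym: "\<And>x y. C x y = C y x" and x: "x \<in> S" "x' \<in> S"
  \<comment> \<open>The set \<open>{x, x'}\<close> has a single element when the points coincide, so
    the two-point combination would lose a term.\<close>
  proof (cases "x = x'")
    case True then show ?thesis using X2 x by (simp add: power2_eq_square)
  next
    case False
    have "expectation (\<lambda>w. (X w x + X w x')\<^sup>2) = C x x + C x' x' + 2 * C x x'"
      using var[of "{x, x'}" "{}" "\<lambda>_. 1" undefined 0] x False sym[of x' x] by simp
    then show ?thesis using pol[OF Xm[OF x(1)] Xm[OF x(2)]] X2[OF x(1)] X2[OF x(2)] by simp
  qed
  show "expectation (\<lambda>w. Y w y * Y w y') = C' y y'" if sym: "\<And>x y. C' x y = C' y x" and x: "y \<in> S'" "y' \<in> S'"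
  proof (cases "y = y'")
    case True then show ?thesis using Y2 x by (simp add: power2_eq_square)
  next
    case False
    have "expectation (\<lambda>w. (Y w y + Y w y')\<^sup>2) = C' y y + C' y' y' + 2 * C' y y'"
      using var[of "{}" "{y, y'}" undefined "\<lambda>_. 1" 0] x False sym[of y' y] by simp
    then show ?thesis using pol[OF Ym[OF x(1)] Ym[OF x(2)]] Y2[OF x(1)] Y2[OF x(2)] by simp
  qed
  show "expectation (\<lambda>w. X w x * Y w y) = 0" if "x \<in> S" "y \<in> S'"
    using var[of "{x}" "{y}" "\<lambda>_. 1" "\<lambda>_. 1" 0] that pol[OF Xm[OF that(1)] Ym[OF that(2)]] X2[OF that(1)] Y2[OF that(2)] by simp
  show "expectation (\<lambda>w. X w x * z w) = 0" if "x \<in> S"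
    using var[of "{x}" "{}" "\<lambda>_. 1" undefined 1] that pol[OF Xm[OF that] zm] X2[OF that] z2 by simp
  show "expectation (\<lambda>w. Y w y * z w) = 0" if "y \<in> S'"
    using var[of "{}" "{y}" undefined "\<lambda>_. 1" 1] that pol[OF Ym[OF that] zm] Y2[OF that] z2 by simp
  show "expectation (\<lambda>w. z w * z w) = 1" using z2 by (simp add: power2_eq_square)
qed

section \<open>The cavity interpolation\<close>

lemma hatR1_measurable: "hatR1 N \<in> borel_measurable vec_space"
  unfolding hatR1_def[abs_def] by (intro borel_measurable_divide borel_measurable_sum hat_coord_measurable borel_measurable_const)

text \<open>The magnetization is the overlap with the vector of ones, which lies on the smaller
  sphere.\<close>

lemma hatR1_range:
  assumes N: "2 \<le> N" and \<sigma>: "\<sigma> \<in> good_sphere N"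
  shows "\<bar>hatR1 N \<sigma>\<bar> \<le> 1"
proof -
  define one :: "nat \<Rightarrow> real" where "one i = (if i < N - 1 then 1 else 0)" for i
  have "one \<in> sphere_set (N - 1)" by (simp add: one_def sphere_set_def)
  from overlap_range[OF _ hat_in_sphere_set[OF N \<sigma>] this]
  have "overlap (N - 1) (hat N \<sigma>) one \<in> {-1..1}" using N by simp
  moreover have "overlap (N - 1) (hat N \<sigma>) one = hatR1 N \<sigma>"
    using N by (simp add: overlap_def hatR1_def one_def of_nat_diff)
  ultimately show ?thesis by auto
qed

lemma sum_hat_eq: "2 \<le> N \<Longrightarrow> (\<Sum>i<N - 1. hat N \<sigma> i) = (real N - 1) * hatR1 N \<sigma>"
  by (simp add: hatR1_def)

lemma hatR2_range:
  "2 \<le> N \<Longrightarrow> \<sigma> \<in> good_sphere N \<Longrightarrow> \<tau> \<in> good_sphere N \<Longrightarrow> hatR2 N \<sigma> \<tau> \<in> {-1..1}"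
  unfolding hatR2_def by (rule overlap_range[OF _ hat_in_sphere_set hat_in_sphere_set]) simp_all

definition scale :: "nat \<Rightarrow> (nat \<Rightarrow> real) \<Rightarrow> real" where
  "scale N \<sigma> = sqrt ((real N - (eps N \<sigma>)\<^sup>2) / (real N - 1))"

lemma scale_measurable: "scale N \<in> borel_measurable vec_space"
proof -
  note [measurable] = eps_measurable
  show ?thesis unfolding scale_def by measurable
qed

lemma abs_scale_minus_1_le:
  assumes N: "2 \<le> N" and \<sigma>: "\<sigma> \<in> good_sphere N"
  shows "\<bar>scale N \<sigma> - 1\<bar> \<le> 1"
proof -
  have "(real N - (eps N \<sigma>)\<^sup>2) / (real N - 1) \<le> 4"
    using N by (simp add: divide_le_eq)  (use zero_le_power2[of "eps N \<sigma>"] in linarith)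
  then have "scale N \<sigma> \<le> sqrt 4" unfolding scale_def by (rule real_sqrt_le_mono)
  moreover have "0 \<le> scale N \<sigma>" using good_sphereD(2)[OF \<sigma>] N by (simp add: scale_def)
  ultimately show ?thesis by simp
qed

section \<open>The cavity Hamiltonian as an instance of the interpolation\<close>

locale cavity_model = prob_space M
  for M :: "'w measure" +
  fixes N :: nat and HN HN1 :: "'w \<Rightarrow> (nat \<Rightarrow> real) \<Rightarrow> real" and z :: "'w \<Rightarrow> real"
    and \<xi> \<xi>1 :: "real \<Rightarrow> real" and \<beta> h q :: real
  assumes N: "2 \<le> N"
    and HNm: "(\<lambda>(w, \<sigma>). HN w \<sigma>) \<in> borel_measurable (M \<Otimes>\<^sub>M vec_space)"
    and HN1m: "(\<lambda>(w, \<sigma>). HN1 w \<sigma>) \<in> borel_measurable (M \<Otimes>\<^sub>M vec_space)"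
    and HNg: "centered_gaussian_process M HN (sphere_set N) (\<lambda>\<sigma> \<tau>. real N * \<xi> (overlap N \<sigma> \<tau>))"
    and HN1g: "centered_gaussian_process M HN1 (sphere_set (N - 1)) (\<lambda>\<sigma> \<tau>. (real N - 1) * \<xi> (overlap (N - 1) \<sigma> \<tau>))"
    and zn: "normal_rv M z 0 1"
    and indep: "indep3 M (Pi\<^sub>M UNIV (\<lambda>_. borel)) HN (Pi\<^sub>M UNIV (\<lambda>_. borel)) HN1 borel z"
    and xi1q: "0 \<le> \<xi>1 q"
begin

definition "b = bconst \<beta> h \<xi>1 q"

text \<open>Setting the ingredients to 0 outside \<open>good_sphere\<close> makes membership in the
  Gaussian space and the bounds by \<open>K\<close> hold at every point, as the interpolation
  demands; at a pole \<open>HN1\<close> would be evaluated off the smaller sphere, where nothing is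
  known about it. Gibbs averages do not change, since the complement of \<open>good_sphere\<close>
  is a null set.\<close>

definition "U w \<sigma> = (if \<sigma> \<in> good_sphere N then \<beta> * HN w \<sigma> else 0)"
definition "V w \<sigma> = (if \<sigma> \<in> good_sphere N then \<beta> * HN1 w (hat N \<sigma>) + (eps N \<sigma> * \<beta> * sqrt (\<xi>1 q)) * z w else 0)"
definition "D0 \<sigma> = (if \<sigma> \<in> good_sphere N then h * (\<Sum>i<N - 1. hat N \<sigma> i) + h * eps N \<sigma> - (1 / 2) * (eps N \<sigma>)\<^sup>2 * b else 0)"
definition "D1 \<sigma> = (if \<sigma> \<in> good_sphere N then h * (\<Sum>i<N - 1. hat N \<sigma> i) * (scale N \<sigma> - 1) + (1 / 2) * (eps N \<sigma>)\<^sup>2 * b else 0)"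
text \<open>The first bracket bounds the two variances and the second the two drifts, so their sum
  serves all four requirements. It grows with \<open>N\<close>, which is harmless because it affects
  integrability only.\<close>

definition "K = (\<beta>\<^sup>2 * (real N * \<bar>\<xi> 1\<bar>) + \<beta>\<^sup>2 * (real N * \<xi>1 q)) + (2 * \<bar>h\<bar> * real N + real N * \<bar>b\<bar>)"
definition "\<V> = joint_space (sphere_set N) HN (sphere_set (N - 1)) HN1 z"

lemmas cov = joint_covariance[OF HNg HN1g zn indep, folded \<V>_def]

lemma gaussian_\<V>: "gaussian_space M \<V>"
  unfolding \<V>_def by (rule gaussian_space_joint[OF HNg HN1g zn indep])

lemma cov_HN: "\<sigma> \<in> sphere_set N \<Longrightarrow> \<tau> \<in> sphere_set N \<Longrightarrow> expectation (\<lambda>w. HN w \<sigma> * HN w \<tau>) = real N * \<xi> (overlap N \<sigma> \<tau>)"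
  by (rule cov(4)) (simp_all add: overlap_commute)

lemma cov_HN1: "\<sigma> \<in> sphere_set (N - 1) \<Longrightarrow> \<tau> \<in> sphere_set (N - 1) \<Longrightarrow> expectation (\<lambda>w. HN1 w \<sigma> * HN1 w \<tau>) = (real N - 1) * \<xi> (overlap (N - 1) \<sigma> \<tau>)"
  by (rule cov(5)) (simp_all add: overlap_commute)

lemma zero_in_\<V>: "(\<lambda>w. 0) \<in> \<V>"
  using gaussian_space_lincomb[OF gaussian_\<V> cov(3) cov(3), of 0 0] by simp

lemma U_in_\<V>: "(\<lambda>w. U w \<sigma>) \<in> \<V>"
proof (cases "\<sigma> \<in> good_sphere N")
  case True
  note m = cov(1)[OF good_sphereD(1)[OF True]]
  show ?thesis using gaussian_space_lincomb[OF gaussian_\<V> m m, of \<beta> 0] True by (simp add: U_def)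
qed (simp add: U_def zero_in_\<V>)

lemma V_in_\<V>: "(\<lambda>w. V w \<sigma>) \<in> \<V>"
proof (cases "\<sigma> \<in> good_sphere N")
  case True
  show ?thesis using gaussian_space_lincomb[OF gaussian_\<V> cov(2)[OF hat_in_sphere_set[OF N True]] cov(3), of \<beta> "eps N \<sigma> * \<beta> * sqrt (\<xi>1 q)"] True
    by (simp add: V_def)
qed (simp add: V_def zero_in_\<V>)

lemma cov_U:
  assumes "\<sigma> \<in> good_sphere N" "\<tau> \<in> good_sphere N"
  shows "expectation (\<lambda>w. U w \<sigma> * U w \<tau>) = \<beta>\<^sup>2 * (real N * \<xi> (overlap N \<sigma> \<tau>))"
proof -
  have "expectation (\<lambda>w. U w \<sigma> * U w \<tau>) = expectation (\<lambda>w. \<beta>\<^sup>2 * (HN w \<sigma> * HN w \<tau>))"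
    using assms by (simp add: U_def power2_eq_square mult_ac)
  then show ?thesis using cov_HN assms good_sphereD(1) by simp
qed

lemma cov_V:
  assumes \<sigma>: "\<sigma> \<in> good_sphere N" and \<tau>: "\<tau> \<in> good_sphere N"
  shows "expectation (\<lambda>w. V w \<sigma> * V w \<tau>) = \<beta>\<^sup>2 * ((real N - 1) * \<xi> (hatR2 N \<sigma> \<tau>) + eps N \<sigma> * eps N \<tau> * \<xi>1 q)"
proof -
  define e where "e \<sigma> = eps N \<sigma> * \<beta> * sqrt (\<xi>1 q)" for \<sigma>
  note h\<sigma> = hat_in_sphere_set[OF N \<sigma>] and h\<tau> = hat_in_sphere_set[OF N \<tau>]
  note i = gaussian_space_integrable_mult[OF gaussian_\<V>]
  have eq: "V w \<sigma> * V w \<tau> = \<beta>\<^sup>2 * (HN1 w (hat N \<sigma>) * HN1 w (hat N \<tau>)) + \<beta> * e \<tau> * (HN1 w (hat N \<sigma>) * z w)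
      + \<beta> * e \<sigma> * (HN1 w (hat N \<tau>) * z w) + e \<sigma> * e \<tau> * (z w * z w)" for w
  proof -
    have "V w \<sigma> = \<beta> * HN1 w (hat N \<sigma>) + e \<sigma> * z w" "V w \<tau> = \<beta> * HN1 w (hat N \<tau>) + e \<tau> * z w"
      using \<sigma> \<tau> by (simp_all add: V_def e_def)
    then show ?thesis by (simp add: power2_eq_square algebra_simps)
  qed
  have ee: "e \<sigma> * e \<tau> = \<beta>\<^sup>2 * (eps N \<sigma> * eps N \<tau> * \<xi>1 q)"
    using xi1q by (simp add: e_def power2_eq_square)
  have ii: "integrable M (\<lambda>w. HN1 w (hat N \<sigma>) * HN1 w (hat N \<tau>))" "integrable M (\<lambda>w. HN1 w (hat N \<sigma>) * z w)"
    "integrable M (\<lambda>w. HN1 w (hat N \<tau>) * z w)" "integrable M (\<lambda>w. z w * z w)"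
    by (intro i cov h\<sigma> h\<tau>)+
  have "expectation (\<lambda>w. V w \<sigma> * V w \<tau>) = \<beta>\<^sup>2 * expectation (\<lambda>w. HN1 w (hat N \<sigma>) * HN1 w (hat N \<tau>)) + \<beta> * e \<tau> * expectation (\<lambda>w. HN1 w (hat N \<sigma>) * z w)
      + \<beta> * e \<sigma> * expectation (\<lambda>w. HN1 w (hat N \<tau>) * z w) + e \<sigma> * e \<tau> * expectation (\<lambda>w. z w * z w)"
    unfolding eq using ii by simp
  then show ?thesis
    unfolding cov_HN1[OF h\<sigma> h\<tau>] cov(8)[OF h\<sigma>] cov(8)[OF h\<tau>] cov(9) ee
    by (simp add: hatR2_def algebra_simps)
qed

lemma cov_UV: "expectation (\<lambda>w. U w \<sigma> * V w \<tau>) = 0"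
proof (cases "\<sigma> \<in> good_sphere N \<and> \<tau> \<in> good_sphere N")
  case True
  then have \<sigma>: "\<sigma> \<in> sphere_set N" and h\<tau>: "hat N \<tau> \<in> sphere_set (N - 1)"
    using good_sphereD(1) hat_in_sphere_set[OF N] by blast+
  note i = gaussian_space_integrable_mult[OF gaussian_\<V>]
  have ii: "integrable M (\<lambda>w. HN w \<sigma> * HN1 w (hat N \<tau>))" "integrable M (\<lambda>w. HN w \<sigma> * z w)"
    by (intro i cov \<sigma> h\<tau>)+
  have "expectation (\<lambda>w. U w \<sigma> * V w \<tau>) = expectation (\<lambda>w. \<beta>\<^sup>2 * (HN w \<sigma> * HN1 w (hat N \<tau>)) + \<beta> * (eps N \<tau> * \<beta> * sqrt (\<xi>1 q)) * (HN w \<sigma> * z w))"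
    using True by (simp add: U_def V_def power2_eq_square algebra_simps)
  also have "\<dots> = 0" using ii cov(6)[OF \<sigma> h\<tau>] cov(7)[OF \<sigma>] by simp
  finally show ?thesis .
qed (auto simp: U_def V_def)

lemma pair_sphere_measurable:
  "f \<in> borel_measurable (M \<Otimes>\<^sub>M vec_space) \<Longrightarrow> f \<in> borel_measurable (M \<Otimes>\<^sub>M sphere_measure N)"
  using sets_pair_measure_cong[OF refl sets_sphere_measure, of M N] by (simp cong: measurable_cong_sets)

lemma HN1_hat_measurable: "(\<lambda>(w, \<sigma>). HN1 w (hat N \<sigma>)) \<in> borel_measurable (M \<Otimes>\<^sub>M vec_space)"
proof -
  have "(\<lambda>p. (fst p, hat N (snd p))) \<in> measurable (M \<Otimes>\<^sub>M vec_space) (M \<Otimes>\<^sub>M vec_space)"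
    by (intro measurable_Pair measurable_fst measurable_compose[OF measurable_snd hat_measurable])
  from measurable_compose[OF this HN1m] show ?thesis by (simp add: case_prod_beta')
qed

lemma sum_hat_measurable: "(\<lambda>\<sigma>. \<Sum>i<N - 1. hat N \<sigma> i) \<in> borel_measurable vec_space"
  by (intro borel_measurable_sum hat_coord_measurable)

lemma drift_measurable: "D0 \<in> borel_measurable vec_space" "D1 \<in> borel_measurable vec_space"
proof -
  note [measurable] = good_sphere_measurable sum_hat_measurable eps_measurable scale_measurable
  show "D0 \<in> borel_measurable vec_space" "D1 \<in> borel_measurable vec_space"
    unfolding D0_def D1_def by measurable
qed

lemma pair_if_measurable:
  assumes "(\<lambda>p. f p) \<in> borel_measurable (M \<Otimes>\<^sub>M vec_space)"
  shows "(\<lambda>p. if snd p \<in> good_sphere N then f p else (0::real)) \<in> borel_measurable (M \<Otimes>\<^sub>M vec_space)"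
proof (rule measurable_If[OF assms])
  have "{p \<in> space (M \<Otimes>\<^sub>M vec_space). snd p \<in> good_sphere N} = snd -` good_sphere N \<inter> space (M \<Otimes>\<^sub>M vec_space)"
    by auto
  also have "\<dots> \<in> sets (M \<Otimes>\<^sub>M vec_space)"
    by (rule measurable_sets[OF measurable_snd good_sphere_measurable])
  finally show "{p \<in> space (M \<Otimes>\<^sub>M vec_space). snd p \<in> good_sphere N} \<in> sets (M \<Otimes>\<^sub>M vec_space)" .
qed simp

lemma U_measurable: "(\<lambda>(w, \<sigma>). U w \<sigma>) \<in> borel_measurable (M \<Otimes>\<^sub>M vec_space)"
proof -
  have "(\<lambda>p. \<beta> * HN (fst p) (snd p)) \<in> borel_measurable (M \<Otimes>\<^sub>M vec_space)"
    using HNm by (intro borel_measurable_times borel_measurable_const) (simp add: case_prod_beta')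
  from pair_if_measurable[OF this] show ?thesis by (simp add: U_def case_prod_beta')
qed

lemma V_measurable: "(\<lambda>(w, \<sigma>). V w \<sigma>) \<in> borel_measurable (M \<Otimes>\<^sub>M vec_space)"
proof -
  have "(\<lambda>p. \<beta> * HN1 (fst p) (hat N (snd p)) + (eps N (snd p) * \<beta> * sqrt (\<xi>1 q)) * z (fst p)) \<in> borel_measurable (M \<Otimes>\<^sub>M vec_space)"
    using HN1_hat_measurable
    by (intro borel_measurable_add borel_measurable_times borel_measurable_const measurable_compose[OF measurable_snd eps_measurable]
        measurable_compose[OF measurable_fst normal_rv_measurable[OF zn]]) (simp add: case_prod_beta')
  from pair_if_measurable[OF this] show ?thesis by (simp add: V_def case_prod_beta')
qed

lemma eps_le: "\<sigma> \<in> good_sphere N \<Longrightarrow> \<bar>eps N \<sigma>\<bar> \<le> real N"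
proof -
  assume \<sigma>: "\<sigma> \<in> good_sphere N"
  have "real N \<le> (real N)\<^sup>2" using N by (intro self_le_power) simp_all
  then have "\<bar>eps N \<sigma>\<bar>\<^sup>2 \<le> (real N)\<^sup>2" using good_sphereD(2)[OF \<sigma>] unfolding power2_abs by linarith
  then show ?thesis by (rule power2_le_imp_le) simp
qed

sublocale GI: gaussian_interpolation M "sphere_measure N" \<V> U V D0 D1 K
proof (intro gaussian_interpolation.intro gaussian_interpolation_axioms.intro prob_space_axioms prob_space_sphere_measure gaussian_\<V> U_in_\<V> V_in_\<V>
    pair_sphere_measurable U_measurable V_measurable)
  show "D0 \<in> borel_measurable (sphere_measure N)" "D1 \<in> borel_measurable (sphere_measure N)"
    using drift_measurable by (simp_all add: sets_sphere_measure cong: measurable_cong_sets)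
  have K0: "0 \<le> \<beta>\<^sup>2 * (real N * \<xi>1 q)" "0 \<le> 2 * \<bar>h\<bar> * real N + real N * \<bar>b\<bar>" "0 \<le> \<beta>\<^sup>2 * (real N * \<bar>\<xi> 1\<bar>)"
    using xi1q by simp_all
  fix \<sigma>
  show "expectation (\<lambda>w. (U w \<sigma>)\<^sup>2) \<le> K"
  proof (cases "\<sigma> \<in> good_sphere N")
    case True
    have "\<beta>\<^sup>2 * (real N * \<xi> 1) \<le> \<beta>\<^sup>2 * (real N * \<bar>\<xi> 1\<bar>)" by (intro mult_left_mono) auto
    moreover have "expectation (\<lambda>w. (U w \<sigma>)\<^sup>2) = \<beta>\<^sup>2 * (real N * \<xi> 1)"
      using cov_U[OF True True] overlap_self[OF _ good_sphereD(1)[OF True]] N by (simp add: power2_eq_square)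
    ultimately show ?thesis using K0 unfolding K_def by linarith
  next
    case False then show ?thesis using K0 by (simp add: U_def K_def)
  qed
  show "expectation (\<lambda>w. (V w \<sigma>)\<^sup>2) \<le> K"
  proof (cases "\<sigma> \<in> good_sphere N")
    case True
    have "hatR2 N \<sigma> \<sigma> = 1" unfolding hatR2_def using overlap_self[OF _ hat_in_sphere_set[OF N True]] N by simp
    then have "expectation (\<lambda>w. (V w \<sigma>)\<^sup>2) = \<beta>\<^sup>2 * ((real N - 1) * \<xi> 1) + \<beta>\<^sup>2 * ((eps N \<sigma>)\<^sup>2 * \<xi>1 q)"
      using cov_V[OF True True] by (simp add: power2_eq_square algebra_simps)
    also have "\<dots> \<le> \<beta>\<^sup>2 * (real N * \<bar>\<xi> 1\<bar>) + \<beta>\<^sup>2 * (real N * \<xi>1 q)"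
    proof (intro add_mono mult_left_mono mult_right_mono)
      have "(real N - 1) * \<xi> 1 \<le> (real N - 1) * \<bar>\<xi> 1\<bar>" using N by (intro mult_left_mono) auto
      also have "\<dots> \<le> real N * \<bar>\<xi> 1\<bar>" by (intro mult_right_mono) auto
      finally show "(real N - 1) * \<xi> 1 \<le> real N * \<bar>\<xi> 1\<bar>" .
    qed (use good_sphereD(2)[OF True] xi1q in auto)
    finally show ?thesis using K0 unfolding K_def by linarith
  next
    case False then show ?thesis using K0 by (simp add: V_def K_def)
  qed
  show "\<bar>D0 \<sigma>\<bar> \<le> K"
  proof (cases "\<sigma> \<in> good_sphere N")
    case True
    have s: "\<bar>(\<Sum>i<N - 1. hat N \<sigma> i)\<bar> \<le> real N * 1"
      unfolding sum_hat_eq[OF N] abs_mult using hatR1_range[OF N True] N by (intro mult_mono) auto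
    have 1: "\<bar>h * (\<Sum>i<N - 1. hat N \<sigma> i)\<bar> \<le> \<bar>h\<bar> * real N" using s unfolding abs_mult[of h] by (intro mult_left_mono) auto
    have 2: "\<bar>h * eps N \<sigma>\<bar> \<le> \<bar>h\<bar> * real N" unfolding abs_mult using eps_le[OF True] by (intro mult_left_mono) auto
    have 3: "\<bar>(1 / 2) * (eps N \<sigma>)\<^sup>2 * b\<bar> \<le> real N * \<bar>b\<bar>"
      unfolding abs_mult[of _ b] using good_sphereD(2)[OF True] by (intro mult_right_mono) auto
    have "\<bar>D0 \<sigma>\<bar> \<le> \<bar>h * (\<Sum>i<N - 1. hat N \<sigma> i)\<bar> + \<bar>h * eps N \<sigma>\<bar> + \<bar>(1 / 2) * (eps N \<sigma>)\<^sup>2 * b\<bar>"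
    proof -
      have "D0 \<sigma> = h * (\<Sum>i<N - 1. hat N \<sigma> i) + h * eps N \<sigma> - (1 / 2) * (eps N \<sigma>)\<^sup>2 * b" using True by (simp add: D0_def)
      then show ?thesis by linarith
    qed
    also have "\<dots> \<le> 2 * \<bar>h\<bar> * real N + real N * \<bar>b\<bar>" using 1 2 3 by linarith
    finally show ?thesis using K0 unfolding K_def by linarith
  next
    case False then show ?thesis using K0 by (simp add: D0_def K_def)
  qed
  show "\<bar>D1 \<sigma>\<bar> \<le> K"
  proof (cases "\<sigma> \<in> good_sphere N")
    case True
    have s: "\<bar>(\<Sum>i<N - 1. hat N \<sigma> i)\<bar> \<le> real N * 1"
      unfolding sum_hat_eq[OF N] abs_mult using hatR1_range[OF N True] N by (intro mult_mono) auto
    have "\<bar>h * (\<Sum>i<N - 1. hat N \<sigma> i)\<bar> \<le> \<bar>h\<bar> * real N" using s unfolding abs_mult[of h] by (intro mult_left_mono) auto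
    then have 1: "\<bar>h * (\<Sum>i<N - 1. hat N \<sigma> i) * (scale N \<sigma> - 1)\<bar> \<le> (\<bar>h\<bar> * real N) * 1"
      unfolding abs_mult[of _ "scale N \<sigma> - 1"] using abs_scale_minus_1_le[OF N True] by (intro mult_mono) auto
    have 3: "\<bar>(1 / 2) * (eps N \<sigma>)\<^sup>2 * b\<bar> \<le> real N * \<bar>b\<bar>"
      unfolding abs_mult[of _ b] using good_sphereD(2)[OF True] by (intro mult_right_mono) auto
    have "\<bar>D1 \<sigma>\<bar> \<le> \<bar>h * (\<Sum>i<N - 1. hat N \<sigma> i) * (scale N \<sigma> - 1)\<bar> + \<bar>(1 / 2) * (eps N \<sigma>)\<^sup>2 * b\<bar>"
    proof -
      have "D1 \<sigma> = h * (\<Sum>i<N - 1. hat N \<sigma> i) * (scale N \<sigma> - 1) + (1 / 2) * (eps N \<sigma>)\<^sup>2 * b" using True by (simp add: D1_def)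
      then show ?thesis by linarith
    qed
    also have "\<dots> \<le> \<bar>h\<bar> * real N + real N * \<bar>b\<bar>" using 1 3 by linarith
    also have "\<dots> \<le> 2 * \<bar>h\<bar> * real N + real N * \<bar>b\<bar>" by simp
    finally show ?thesis using K0 unfolding K_def by linarith
  next
    case False then show ?thesis using K0 by (simp add: D1_def K_def)
  qed
qed

text \<open>The mixed covariances vanish by independence. The term with
  \<open>eps N \<sigma> * eps N \<tau>\<close> is the covariance contributed by
  \<open>z\<close>.\<close>

lemma \<Gamma>_eq:
  assumes t: "t \<in> {0<..<1}"
  shows "GI.\<Gamma> t \<sigma> \<tau> = (if \<sigma> \<in> good_sphere N \<and> \<tau> \<in> good_sphere N then
    \<beta>\<^sup>2 / 2 * (real N * \<xi> (overlap N \<sigma> \<tau>) - (real N - 1) * \<xi> (hatR2 N \<sigma> \<tau>) - eps N \<sigma> * eps N \<tau> * \<xi>1 q) else 0)"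
proof -
  note i = gaussian_space_integrable_mult[OF gaussian_\<V>]
  define a c where "a = sqrt t" and "c = sqrt (1 - t)"
  have ac: "a \<noteq> 0" "c \<noteq> 0" using t by (auto simp: a_def c_def)
  have eq: "GI.gauss' t w \<sigma> * GI.gauss t w \<tau> = 1 / 2 * (U w \<sigma> * U w \<tau>) - 1 / 2 * (V w \<sigma> * V w \<tau>)
     + c / (2 * a) * (U w \<sigma> * V w \<tau>) - a / (2 * c) * (U w \<tau> * V w \<sigma>)" for w
    unfolding GI.gauss'_def GI.gauss_def a_def[symmetric] c_def[symmetric] using ac by (simp add: field_simps)
  have ii: "integrable M (\<lambda>w. U w \<sigma> * U w \<tau>)" "integrable M (\<lambda>w. V w \<sigma> * V w \<tau>)"
    "integrable M (\<lambda>w. U w \<sigma> * V w \<tau>)" "integrable M (\<lambda>w. U w \<tau> * V w \<sigma>)"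
    by (intro i U_in_\<V> V_in_\<V>)+
  have "GI.\<Gamma> t \<sigma> \<tau> = 1 / 2 * expectation (\<lambda>w. U w \<sigma> * U w \<tau>) - 1 / 2 * expectation (\<lambda>w. V w \<sigma> * V w \<tau>)"
    unfolding GI.\<Gamma>_def eq using ii cov_UV[of \<sigma> \<tau>] cov_UV[of \<tau> \<sigma>] by simp
  then show ?thesis
    using cov_U[of \<sigma> \<tau>] cov_V[of \<sigma> \<tau>] by (auto simp: U_def V_def algebra_simps)
qed

lemma Ht_eq_hamiltonian:
  assumes "\<sigma> \<in> good_sphere N"
  shows "Ht N \<beta> h \<xi>1 q HN HN1 z s w \<sigma> = GI.hamiltonian s w \<sigma>"
proof -
  \<comment> \<open>Sorts the Hamiltonian by its dependence on \<open>s\<close>: the part of the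
    drift constant in \<open>s\<close> is \<open>D0\<close>, the linear part is
    \<open>D1\<close>.\<close>
  have id: "u * \<beta> * A + v * \<beta> * B + h * S * (1 + s * (c - 1)) + h * e + v * e * y * \<beta> * x - p * (1 - s) * e\<^sup>2 * b
    = u * (\<beta> * A) + v * (\<beta> * B + e * \<beta> * x * y) + (h * S + h * e - p * e\<^sup>2 * b + s * (h * S * (c - 1) + p * e\<^sup>2 * b))"
    for u v A B S c e y x p :: real
    by (simp add: algebra_simps)
  show ?thesis
    unfolding Ht_def GI.hamiltonian_def U_def V_def D0_def D1_def scale_def[symmetric] b_def[symmetric] if_P[OF assms]
    by (rule id)
qed

lemma Ht_section:
  assumes w: "w \<in> space M"
  shows "Ht N \<beta> h \<xi>1 q HN HN1 z s w \<in> borel_measurable vec_space"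
proof -
  note [measurable] = sum_hat_measurable eps_measurable scale_measurable
  have [measurable]: "HN w \<in> borel_measurable vec_space" using measurable_Pair2[OF HNm w] by simp
  have [measurable]: "(\<lambda>\<sigma>. HN1 w (hat N \<sigma>)) \<in> borel_measurable vec_space" using measurable_Pair2[OF HN1_hat_measurable w] by simp
  show ?thesis unfolding Ht_def[abs_def] scale_def[symmetric] by measurable
qed

lemma AE_good_spheres: "AE x in GI.T k. \<forall>l\<in>{1..k}. x l \<in> good_sphere N"
  unfolding GI.T_def
  by (intro AE_finite_allI finite_atLeastAtMost AE_PiM_component prob_space_sphere_measure AE_good_sphere[OF N])

text \<open>The two Hamiltonians coincide on \<open>good_sphere\<close> only, so the integrals are
  compared almost everywhere, both in the partition function and on the product of the
  spheres.\<close>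

lemma nu_eq_average:
  assumes g: "g \<in> borel_measurable (GI.T k)"
  shows "nu M N (Ht N \<beta> h \<xi>1 q HN HN1 z s) k g = GI.average k s g"
  unfolding nu_def GI.average_def
proof (rule Bochner_Integration.integral_cong[OF refl])
  fix w assume w: "w \<in> space M"
  let ?H = "Ht N \<beta> h \<xi>1 q HN HN1 z s w"
  have Hm: "?H \<in> borel_measurable (sphere_measure N)"
    using Ht_section[OF w, of s] by (simp add: sets_sphere_measure cong: measurable_cong_sets)
  have hm: "GI.hamiltonian s w \<in> borel_measurable (sphere_measure N)"
    by (rule GI.section_measurable[OF GI.hamiltonian_measurable w])
  have Z: "(\<integral>x. exp (?H x) \<partial>sphere_measure N) = GI.Z s w"
    unfolding GI.Z_def
  proof (rule integral_cong_AE)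
    show "AE x in sphere_measure N. exp (?H x) = exp (GI.hamiltonian s w x)"
      using AE_good_sphere[OF N] by eventually_elim (simp add: Ht_eq_hamiltonian)
  qed (intro measurable_compose[OF _ borel_measurable_exp] Hm hm)+
  have eqT: "(\<integral>x. g x * exp (\<Sum>l\<in>{1..k}. ?H (x l)) \<partial>GI.T k) = (\<integral>x. g x * exp (\<Sum>l\<in>{1..k}. GI.hamiltonian s w (x l)) \<partial>GI.T k)"
  proof (rule integral_cong_AE)
    show "AE x in GI.T k. g x * exp (\<Sum>l\<in>{1..k}. ?H (x l)) = g x * exp (\<Sum>l\<in>{1..k}. GI.hamiltonian s w (x l))"
      using AE_good_spheres by eventually_elim (simp add: Ht_eq_hamiltonian)
  qed (intro borel_measurable_times g measurable_compose[OF _ borel_measurable_exp] borel_measurable_sum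
      measurable_compose[OF GI.coord_T Hm] measurable_compose[OF GI.coord_T hm]; assumption)+
  have "gibbs N ?H k g = (\<integral>x. g x * exp (\<Sum>l\<in>{1..k}. ?H (x l)) \<partial>GI.T k) / (\<integral>x. exp (?H x) \<partial>sphere_measure N) ^ k"
    by (simp only: gibbs_def GI.T_def)
  also have "\<dots> = (\<integral>x. g x * exp (\<Sum>l\<in>{1..k}. GI.hamiltonian s w (x l)) \<partial>GI.T k) / GI.Z s w ^ k"
    by (rule arg_cong2[where f="(/)", OF eqT]) (rule arg_cong[where f="\<lambda>c. c ^ k", OF Z])
  also have "\<dots> = (\<integral>x. g x * GI.\<rho> k s w x \<partial>GI.T k)"
    unfolding GI.\<rho>_def by simp
  finally show "gibbs N ?H k g = (\<integral>x. g x * GI.\<rho> k s w x \<partial>GI.T k)" .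
qed

end

section \<open>The averaging functional and the exchange of the two fresh replicas\<close>

locale cavity_derivative = cavity_model M N HN HN1 z \<xi> \<xi>1 \<beta> h q
  for M :: "'w measure" and N HN HN1 z \<xi> \<xi>1 \<beta> h q +
  fixes \<xi>2 :: "real \<Rightarrow> real" and C :: real and n :: nat and t :: real and f :: "(nat \<Rightarrow> nat \<Rightarrow> real) \<Rightarrow> real" and B :: real
  assumes T1: "\<And>x y. x \<in> {-1..1} \<Longrightarrow> y \<in> {-1..1} \<Longrightarrow> \<bar>\<xi> y - \<xi> x - \<xi>1 x * (y - x)\<bar> \<le> C * (y - x)\<^sup>2"
    and T2: "\<And>x y. x \<in> {-1..1} \<Longrightarrow> y \<in> {-1..1} \<Longrightarrow> \<bar>\<xi>1 y - \<xi>1 x - \<xi>2 x * (y - x)\<bar> \<le> C * (y - x)\<^sup>2"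
    and C: "\<And>x. x \<in> {-1..1} \<Longrightarrow> \<bar>\<xi>1 x\<bar> \<le> C" "\<And>x. x \<in> {-1..1} \<Longrightarrow> \<bar>\<xi>2 x\<bar> \<le> C"
    and q: "q \<in> {-1..1}"
    and n: "1 \<le> n" and t: "t \<in> {0<..<1}"
    and f: "f \<in> borel_measurable (GI.T n)" and B: "\<And>x. \<bar>f x\<bar> \<le> B"
    and inv: "\<And>x x'. (\<And>l. l \<in> {1..n} \<Longrightarrow> x l = x' l) \<Longrightarrow> f x = f x'"
begin

definition good_config :: "(nat \<Rightarrow> nat \<Rightarrow> real) \<Rightarrow> bool" where
  "good_config x \<longleftrightarrow> (\<forall>l\<in>{1..n + 2}. x l \<in> good_sphere N)"

text \<open>Quantities such as \<open>eps N\<close> are unbounded on the ambient space, so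
  boundedness is required on good configurations alone. On this class the functional
  \<open>\<Lambda>\<close> is linear.\<close>

definition admissible :: "((nat \<Rightarrow> nat \<Rightarrow> real) \<Rightarrow> real) \<Rightarrow> bool" where
  "admissible g \<longleftrightarrow> g \<in> borel_measurable (GI.T (n + 2)) \<and> (\<exists>b. \<forall>x. good_config x \<longrightarrow> \<bar>g x\<bar> \<le> b)"

definition \<Lambda> :: "((nat \<Rightarrow> nat \<Rightarrow> real) \<Rightarrow> real) \<Rightarrow> real" where
  "\<Lambda> g = nu M N (Ht N \<beta> h \<xi>1 q HN HN1 z t) (n + 2) (\<lambda>x. f x * g x)"

text \<open>After Fubini the random density enters only through its expectation, so
  \<open>\<Lambda>\<close> is an integral against a fixed deterministic weight.\<close>

definition weight :: "(nat \<Rightarrow> nat \<Rightarrow> real) \<Rightarrow> real" where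
  "weight x = expectation (\<lambda>w. GI.\<rho> (n + 2) t w x)"

lemma t01: "t \<in> {0..1}" using t by auto

lemma f_measurable: "f \<in> borel_measurable (GI.T (n + 2))"
proof -
  have "(\<lambda>x. restrict x {1..n}) \<in> measurable (GI.T (n + 2)) (GI.T n)"
    unfolding GI.T_def by (intro measurable_restrict_subset) auto
  from measurable_compose[OF this f] have "(\<lambda>x. f (restrict x {1..n})) \<in> borel_measurable (GI.T (n + 2))" .
  also have "(\<lambda>x. f (restrict x {1..n})) = f" by (intro ext inv) simp
  finally show ?thesis .
qed

lemma good_config_sets: "{x \<in> space (GI.T (n + 2)). good_config x} \<in> sets (GI.T (n + 2))"
proof -
  have "{x \<in> space (GI.T (n + 2)). x l \<in> good_sphere N} \<in> sets (GI.T (n + 2))" if "l \<in> {1..n + 2}" for l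
  proof -
    have "{x \<in> space (GI.T (n + 2)). x l \<in> good_sphere N} = (\<lambda>x. x l) -` good_sphere N \<inter> space (GI.T (n + 2))" by auto
    also have "\<dots> \<in> sets (GI.T (n + 2))"
      by (rule measurable_sets[OF GI.coord_T[OF that]]) (simp add: sets_sphere_measure good_sphere_measurable)
    finally show ?thesis .
  qed
  then show ?thesis unfolding good_config_def by (intro sets.sets_Collect_finite_All) auto
qed

lemma AE_good_config: "AE x in GI.T (n + 2). good_config x"
  using AE_good_spheres[of "n + 2"] unfolding good_config_def .

lemma weight_measurable: "weight \<in> borel_measurable (GI.T (n + 2))"
  unfolding weight_def by (rule GI.expectation_section_measurable[OF GI.\<rho>_measurable])

lemma abs_weight_le: "\<bar>weight x\<bar> \<le> 1 * GI.bound_const (n + 2) (n + 2 + 2)"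
  unfolding weight_def
  by (rule order_trans[OF integral_abs_bound])
    (rule GI.uniformly_dominated(2)[where h="\<lambda>w x. GI.\<rho> (n + 2) t w x" and x=x, OF _ zero_le_one GI.\<rho>_section GI.\<rho>_bound_fn[OF _ t01]], simp_all)

lemma
  assumes g: "admissible g"
  shows \<Lambda>_eq: "\<Lambda> g = (\<integral>x. (if good_config x then f x * g x else 0) * weight x \<partial>GI.T (n + 2))"
    and \<Lambda>_integrable: "integrable (GI.T (n + 2)) (\<lambda>x. (if good_config x then f x * g x else 0) * weight x)"
proof -
  obtain b where b: "\<And>x. good_config x \<Longrightarrow> \<bar>g x\<bar> \<le> b" and gm: "g \<in> borel_measurable (GI.T (n + 2))"
    using g unfolding admissible_def by blast
  interpret T: prob_space "GI.T (n + 2)" by (rule GI.prob_space_T)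
  have B0: "0 \<le> B" using B[of undefined] by linarith
  \<comment> \<open>Cutting \<open>g\<close> off outside the good configurations makes it bounded
    everywhere, as \<open>average_eq\<close> requires, and changes it on a null set only.\<close>
  let ?g = "\<lambda>x. if good_config x then f x * g x else 0"
  have fg: "(\<lambda>x. f x * g x) \<in> borel_measurable (GI.T (n + 2))" by (intro borel_measurable_times f_measurable gm)
  have m: "?g \<in> borel_measurable (GI.T (n + 2))"
    by (rule measurable_If[OF fg _ good_config_sets]) simp
  have bb: "\<bar>?g x\<bar> \<le> B * \<bar>b\<bar>" for x
  proof (cases "good_config x")
    case True
    then have "\<bar>g x\<bar> \<le> \<bar>b\<bar>" using b[of x] by linarith
    then show ?thesis using True B[of x] B0 by (simp add: abs_mult mult_mono)
  qed (use B0 in simp)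
  show i: "integrable (GI.T (n + 2)) (\<lambda>x. ?g x * weight x)"
  proof (rule T.integrable_const_bound)
    show "(\<lambda>x. ?g x * weight x) \<in> borel_measurable (GI.T (n + 2))" by (intro borel_measurable_times m weight_measurable)
    show "AE x in GI.T (n + 2). norm (?g x * weight x) \<le> (B * \<bar>b\<bar>) * (1 * GI.bound_const (n + 2) (n + 2 + 2))"
      unfolding real_norm_def abs_mult[of _ "weight _"] using B0 by (intro AE_I2 mult_mono bb abs_weight_le) auto
  qed
  have "\<Lambda> g = GI.average (n + 2) t (\<lambda>x. f x * g x)"
    unfolding \<Lambda>_def by (rule nu_eq_average[OF fg])
  also have "\<dots> = GI.average (n + 2) t ?g"
    unfolding GI.average_def
  proof (rule Bochner_Integration.integral_cong[OF refl])
    fix w assume w: "w \<in> space M"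
    have rm: "(\<lambda>x. GI.\<rho> (n + 2) t w x) \<in> borel_measurable (GI.T (n + 2))"
      using measurable_Pair2[OF GI.\<rho>_measurable w] by simp
    show "(\<integral>x. f x * g x * GI.\<rho> (n + 2) t w x \<partial>GI.T (n + 2)) = (\<integral>x. ?g x * GI.\<rho> (n + 2) t w x \<partial>GI.T (n + 2))"
    proof (rule integral_cong_AE)
      show "AE x in GI.T (n + 2). f x * g x * GI.\<rho> (n + 2) t w x = ?g x * GI.\<rho> (n + 2) t w x"
        using AE_good_config by eventually_elim simp
    qed (intro borel_measurable_times[OF fg rm] borel_measurable_times[OF m rm])+
  qed
  also have "\<dots> = (\<integral>x. ?g x * weight x \<partial>GI.T (n + 2))"
    unfolding weight_def by (rule GI.average_eq[OF _ t01 m bb]) simp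
  finally show "\<Lambda> g = (\<integral>x. ?g x * weight x \<partial>GI.T (n + 2))" .
qed

lemma admissible_add: "admissible g \<Longrightarrow> admissible g' \<Longrightarrow> admissible (\<lambda>x. g x + g' x)"
proof -
  assume "admissible g" "admissible g'"
  then obtain b b' where b: "\<And>x. good_config x \<Longrightarrow> \<bar>g x\<bar> \<le> b" "\<And>x. good_config x \<Longrightarrow> \<bar>g' x\<bar> \<le> b'"
    and m: "g \<in> borel_measurable (GI.T (n + 2))" "g' \<in> borel_measurable (GI.T (n + 2))"
    unfolding admissible_def by blast
  have "\<bar>g x + g' x\<bar> \<le> b + b'" if "good_config x" for x using b[OF that] by linarith
  then show ?thesis unfolding admissible_def using borel_measurable_add[OF m] by blast
qed

lemma admissible_cmult: "admissible g \<Longrightarrow> admissible (\<lambda>x. c * g x)"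
proof -
  assume "admissible g"
  then obtain b where b: "\<And>x. good_config x \<Longrightarrow> \<bar>g x\<bar> \<le> b" and m: "g \<in> borel_measurable (GI.T (n + 2))"
    unfolding admissible_def by blast
  have "\<bar>c * g x\<bar> \<le> \<bar>c\<bar> * b" if "good_config x" for x
    unfolding abs_mult using b[OF that] by (intro mult_left_mono) auto
  then show ?thesis unfolding admissible_def using borel_measurable_times[OF borel_measurable_const m] by blast
qed

lemma admissible_const: "admissible (\<lambda>x. c)"
  unfolding admissible_def by auto

lemma admissible_sum: "finite I \<Longrightarrow> (\<And>i. i \<in> I \<Longrightarrow> admissible (g i)) \<Longrightarrow> admissible (\<lambda>x. \<Sum>i\<in>I. g i x)"
proof (induction I rule: finite_induct)
  case empty then show ?case using admissible_const[of 0] by simp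
next
  case (insert i I) then show ?case using admissible_add[of "g i" "\<lambda>x. \<Sum>i\<in>I. g i x"] by simp
qed

lemma \<Lambda>_add: "admissible g \<Longrightarrow> admissible g' \<Longrightarrow> \<Lambda> (\<lambda>x. g x + g' x) = \<Lambda> g + \<Lambda> g'"
proof -
  assume g: "admissible g" "admissible g'"
  have "(if good_config x then f x * (g x + g' x) else 0) * weight x
    = (if good_config x then f x * g x else 0) * weight x + (if good_config x then f x * g' x else 0) * weight x" for x
    by (simp add: distrib_left distrib_right)
  then show ?thesis
    unfolding \<Lambda>_eq[OF g(1)] \<Lambda>_eq[OF g(2)] \<Lambda>_eq[OF admissible_add[OF g]]
    using Bochner_Integration.integral_add[OF \<Lambda>_integrable[OF g(1)] \<Lambda>_integrable[OF g(2)]] by simp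
qed

lemma \<Lambda>_cmult: "admissible g \<Longrightarrow> \<Lambda> (\<lambda>x. c * g x) = c * \<Lambda> g"
proof -
  assume g: "admissible g"
  have "(if good_config x then f x * (c * g x) else 0) * weight x = c * ((if good_config x then f x * g x else 0) * weight x)" for x
    by (simp add: mult.assoc mult.left_commute)
  then show ?thesis
    unfolding \<Lambda>_eq[OF g] \<Lambda>_eq[OF admissible_cmult[OF g]] by (simp only: integral_mult_right_zero)
qed

lemma \<Lambda>_sum: "finite I \<Longrightarrow> (\<And>i. i \<in> I \<Longrightarrow> admissible (g i)) \<Longrightarrow> \<Lambda> (\<lambda>x. \<Sum>i\<in>I. g i x) = (\<Sum>i\<in>I. \<Lambda> (g i))"
proof (induction I rule: finite_induct)
  case empty then show ?case using \<Lambda>_cmult[OF admissible_const, of 0 0] by simp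
next
  case (insert i I)
  then show ?case using \<Lambda>_add[of "g i" "\<lambda>x. \<Sum>i\<in>I. g i x"] admissible_sum[of I g] by simp
qed

lemma \<Lambda>_cong:
  assumes "admissible g" "admissible g'" "\<And>x. good_config x \<Longrightarrow> g x = g' x"
  shows "\<Lambda> g = \<Lambda> g'"
  unfolding \<Lambda>_eq[OF assms(1)] \<Lambda>_eq[OF assms(2)]
  by (rule Bochner_Integration.integral_cong[OF refl]) (simp add: assms(3))

definition exch :: "nat \<Rightarrow> nat" where
  "exch l = (if l = n + 1 then n + 2 else if l = n + 2 then n + 1 else l)"

lemma exch_exch: "exch (exch l) = l"
  by (simp add: exch_def)

text \<open>The restriction keeps the result inside the space of the product measure, whose points
  are extensional functions.\<close>

definition swap :: "(nat \<Rightarrow> nat \<Rightarrow> real) \<Rightarrow> nat \<Rightarrow> nat \<Rightarrow> real" where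
  "swap x = (\<lambda>l\<in>{1..n + 2}. x (exch l))"

lemma exch_range: "l \<in> {1..n + 2} \<Longrightarrow> exch l \<in> {1..n + 2}"
  by (auto simp: exch_def)

lemma swap_simps: "l \<in> {1..n} \<Longrightarrow> swap x l = x l" "swap x (n + 1) = x (n + 2)" "swap x (n + 2) = x (n + 1)"
  by (auto simp: swap_def exch_def)

lemma distr_swap: "distr (GI.T (n + 2)) (GI.T (n + 2)) swap = GI.T (n + 2)"
  unfolding GI.T_def swap_def[abs_def]
  by (rule distr_PiM_reindex[of "{1..n + 2}" "\<lambda>_. sphere_measure N" "exch" "{1..n + 2}"])
    (use exch_range prob_space_sphere_measure in \<open>auto intro: inj_on_inverseI[where g=exch] simp: exch_exch\<close>)

lemma swap_measurable: "swap \<in> measurable (GI.T (n + 2)) (GI.T (n + 2))"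
  unfolding GI.T_def swap_def[abs_def]
  by (intro measurable_restrict measurable_component_singleton exch_range)

lemma good_config_swap: "good_config (swap x) \<longleftrightarrow> good_config x"
proof -
  have "(\<forall>l\<in>{1..n + 2}. x (exch l) \<in> good_sphere N) \<longleftrightarrow> (\<forall>l\<in>{1..n + 2}. x l \<in> good_sphere N)"
    using exch_range by (metis exch_exch)
  then show ?thesis by (simp add: good_config_def swap_def)
qed

lemma weight_swap: "weight (swap x) = weight x"
proof -
  have "(\<Sum>l\<in>{1..n + 2}. GI.hamiltonian t w (swap x l)) = (\<Sum>l\<in>{1..n + 2}. GI.hamiltonian t w (x l))" for w
  proof -
    have "(\<Sum>l\<in>{1..n + 2}. GI.hamiltonian t w (swap x l)) = (\<Sum>l\<in>{1..n + 2}. GI.hamiltonian t w (x (exch l)))"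
      by (intro sum.cong) (simp_all add: swap_def)
    also have "\<dots> = (\<Sum>l\<in>{1..n + 2}. GI.hamiltonian t w (x l))"
      by (rule sum.reindex_bij_witness[of _ "exch" "exch"])
        (use exch_range exch_exch in auto)
    finally show ?thesis .
  qed
  then show ?thesis unfolding weight_def GI.\<rho>_def by simp
qed

text \<open>The product measure and the Gibbs density are symmetric under permutations of the
  replicas, and \<open>f\<close> does not see the two that are exchanged.\<close>

lemma \<Lambda>_swap:
  assumes g: "admissible g"
  shows "admissible (\<lambda>x. g (swap x))" "\<Lambda> (\<lambda>x. g (swap x)) = \<Lambda> g"
proof -
  have gm: "g \<in> borel_measurable (GI.T (n + 2))" using g by (simp add: admissible_def)
  show a: "admissible (\<lambda>x. g (swap x))"
    using g measurable_compose[OF swap_measurable gm] good_config_swap unfolding admissible_def by blast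
  have fs: "f (swap x) = f x" for x by (rule inv) (simp add: swap_simps)
  have "\<Lambda> g = (\<integral>x. (if good_config x then f x * g x else 0) * weight x \<partial>distr (GI.T (n + 2)) (GI.T (n + 2)) swap)"
    unfolding distr_swap by (rule \<Lambda>_eq[OF g])
  also have "\<dots> = (\<integral>x. (if good_config (swap x) then f (swap x) * g (swap x) else 0) * weight (swap x) \<partial>GI.T (n + 2))"
    by (rule integral_distr[OF swap_measurable]) (rule borel_measurable_integrable[OF \<Lambda>_integrable[OF g]])
  also have "\<dots> = \<Lambda> (\<lambda>x. g (swap x))"
    unfolding good_config_swap fs weight_swap by (rule \<Lambda>_eq[OF a, symmetric])
  finally show "\<Lambda> (\<lambda>x. g (swap x)) = \<Lambda> g" by simp
qed

lemma sphere_vec_measurable: "g \<in> borel_measurable vec_space \<Longrightarrow> g \<in> borel_measurable (sphere_measure N)"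
  by (simp add: sets_sphere_measure cong: measurable_cong_sets)

lemma sphere_vec_pair_measurable:
  "g \<in> borel_measurable (vec_space \<Otimes>\<^sub>M vec_space) \<Longrightarrow> g \<in> borel_measurable (sphere_measure N \<Otimes>\<^sub>M sphere_measure N)"
  using sets_pair_measure_cong[OF sets_sphere_measure sets_sphere_measure, of N N] by (simp cong: measurable_cong_sets)

lemma admissible_coord:
  assumes "l \<in> {1..n + 2}" "g \<in> borel_measurable (sphere_measure N)" "\<And>\<sigma>. \<sigma> \<in> good_sphere N \<Longrightarrow> \<bar>g \<sigma>\<bar> \<le> c"
  shows "admissible (\<lambda>x. g (x l))"
  unfolding admissible_def good_config_def
  using measurable_compose[OF GI.coord_T[OF assms(1)] assms(2)] assms(1,3) by blast

lemma admissible_pair: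
  assumes i: "i \<in> {1..n + 2}" and j: "j \<in> {1..n + 2}" and g: "(\<lambda>(\<sigma>, \<tau>). g \<sigma> \<tau>) \<in> borel_measurable (sphere_measure N \<Otimes>\<^sub>M sphere_measure N)"
    and b: "\<And>\<sigma> \<tau>. \<sigma> \<in> good_sphere N \<Longrightarrow> \<tau> \<in> good_sphere N \<Longrightarrow> \<bar>g \<sigma> \<tau>\<bar> \<le> c"
  shows "admissible (\<lambda>x. g (x i) (x j))"
proof -
  have "(\<lambda>x. g (x i) (x j)) \<in> borel_measurable (GI.T (n + 2))"
    using measurable_compose[OF measurable_Pair[OF GI.coord_T[OF i] GI.coord_T[OF j]] g] by simp
  moreover have "\<bar>g (x i) (x j)\<bar> \<le> c" if "good_config x" for x
    using that b i j unfolding good_config_def by blast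
  ultimately show ?thesis unfolding admissible_def by blast
qed

section \<open>Algebraic splitting of the derivative\<close>

definition "r = h * (1 - q)"
text \<open>The part of the covariance expansion that depends on one replica alone:
  \<open>\<beta>^2 / 2\<close> times \<open>- q * \<xi>1 q * e^2 / 2\<close>. The constants
  \<open>c2\<close> and \<open>c1\<close> are the zeroth order terms off and on the diagonal, and
  \<open>Y0\<close>, \<open>X0\<close> are the errors left after subtracting every explicit
  term.\<close>

definition \<phi> :: "(nat \<Rightarrow> real) \<Rightarrow> real" where "\<phi> \<sigma> = - (\<beta>\<^sup>2 * q * \<xi>1 q / 4) * (eps N \<sigma>)\<^sup>2"
definition "c2 = \<beta>\<^sup>2 / 2 * \<xi> q"
definition "c1 = h * r / 2 + \<beta>\<^sup>2 / 2 * \<xi> 1"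
definition "A1 \<sigma> = a1 N \<sigma> * (hatR1 N \<sigma> - r)"
definition "A2 \<sigma> \<tau> = a2 \<xi>1 \<xi>2 q N \<sigma> \<tau> * (hatR2 N \<sigma> \<tau> - q)"
definition "Y0 \<sigma> \<tau> = GI.\<Gamma> t \<sigma> \<tau> - \<beta>\<^sup>2 * A2 \<sigma> \<tau> - (c2 + \<phi> \<sigma> + \<phi> \<tau>)"
definition "X0 \<sigma> = D1 \<sigma> + GI.\<Gamma> t \<sigma> \<sigma> - h / 2 * A1 \<sigma> - (c1 + 2 * \<phi> \<sigma>)"

text \<open>Every expression in the derivative formula has this shape; it vanishes when both arguments are constant.\<close>

definition comb :: "((nat \<Rightarrow> real) \<Rightarrow> real) \<Rightarrow> ((nat \<Rightarrow> real) \<Rightarrow> (nat \<Rightarrow> real) \<Rightarrow> real) \<Rightarrow> (nat \<Rightarrow> nat \<Rightarrow> real) \<Rightarrow> real" where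
  "comb X Y x = (\<Sum>l\<in>{1..n}. X (x l)) - real n * X (x (n + 1))
     + 2 * (\<Sum>l\<in>{1..n}. \<Sum>l'\<in>{l + 1..n}. Y (x l) (x l'))
     - 2 * real n * (\<Sum>l\<in>{1..n}. Y (x l) (x (n + 1)))
     + real n * (real n + 1) * Y (x (n + 1)) (x (n + 2))"

lemma comb_add: "comb (\<lambda>\<sigma>. X \<sigma> + X' \<sigma>) (\<lambda>\<sigma> \<tau>. Y \<sigma> \<tau> + Y' \<sigma> \<tau>) x = comb X Y x + comb X' Y' x"
  unfolding comb_def sum.distrib by (simp add: algebra_simps)

text \<open>The coefficients of \<open>comb\<close> cancel all constants and all contributions of
  the first \<open>n\<close> replicas. What is left compares the two fresh replicas and changes sign
  under their exchange.\<close>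

lemma comb_coboundary:
  "comb (\<lambda>\<sigma>. k + 2 * p \<sigma>) (\<lambda>\<sigma> \<tau>. k' + p \<sigma> + p \<tau>) x = real n * (real n + 1) * (p (x (n + 2)) - p (x (n + 1)))"
proof -
  define s where "s = (\<Sum>l\<in>{1..n}. p (x l))"
  have "(\<Sum>i\<in>{1..n}. \<Sum>j\<in>{1..n}. k' + p (x i) + p (x j))
    = (\<Sum>i\<in>{1..n}. k' + p (x i) + p (x i)) + 2 * (\<Sum>i\<in>{1..n}. \<Sum>j\<in>{i+1..n}. k' + p (x i) + p (x j))"
    by (rule sum_symmetric_square[of "\<lambda>i j. k' + p (x i) + p (x j)"]) simp
  moreover have "(\<Sum>i\<in>{1..n}. \<Sum>j\<in>{1..n}. k' + p (x i) + p (x j)) = real n * (real n * k') + real n * s + real n * s"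
    by (simp add: sum.distrib s_def sum_distrib_left algebra_simps)
  moreover have "(\<Sum>i\<in>{1..n}. k' + p (x i) + p (x i)) = real n * k' + s + s" unfolding sum.distrib s_def by (simp only: sum_constant card_atLeastAtMost diff_Suc_1 add_diff_cancel_right' Suc_eq_plus1)
  ultimately have "2 * (\<Sum>i\<in>{1..n}. \<Sum>j\<in>{i+1..n}. k' + p (x i) + p (x j)) = real n * (real n * k') + 2 * real n * s - real n * k' - 2 * s"
    by linarith
  moreover have "(\<Sum>l\<in>{1..n}. k + 2 * p (x l)) = real n * k + 2 * s" unfolding s_def sum.distrib sum_distrib_left by simp
  moreover have "(\<Sum>l\<in>{1..n}. k' + p (x l) + p (x (n + 1))) = real n * k' + s + real n * p (x (n + 1))" by (simp add: sum.distrib s_def)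
  ultimately show ?thesis unfolding comb_def by (simp add: algebra_simps)
qed

lemma \<Gamma>_sym: "GI.\<Gamma> t \<sigma> \<tau> = GI.\<Gamma> t \<tau> \<sigma>"
  unfolding \<Gamma>_eq[OF t] hatR2_def by (simp add: overlap_commute mult.commute conj_commute)

definition "P x = (real n + 1) * (\<Sum>l\<in>{1..n}. GI.\<Gamma> t (x l) (x (n + 2)))"

lemma P_swap: "P (swap x) = (real n + 1) * (\<Sum>l\<in>{1..n}. GI.\<Gamma> t (x l) (x (n + 1)))"
proof -
  have "(\<Sum>l\<in>{1..n}. GI.\<Gamma> t (swap x l) (swap x (n + 2))) = (\<Sum>l\<in>{1..n}. GI.\<Gamma> t (x l) (x (n + 1)))"
    by (intro sum.cong refl) (simp only: swap_simps)
  then show ?thesis by (simp only: P_def)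
qed

text \<open>Integration by parts pairs the first \<open>n\<close> replicas with both
  \<open>n + 1\<close> and \<open>n + 2\<close>, whereas \<open>comb\<close> pairs them with
  \<open>n + 1\<close> only. The terms with \<open>P\<close> carry \<open>n + 1\<close> copies of
  these pairings from one index to the other; the remaining diagonal and double sums agree by
  symmetry of \<open>\<Gamma>\<close>.\<close>

lemma Q_eq: "GI.Q n t x = comb (\<lambda>\<sigma>. D1 \<sigma> + GI.\<Gamma> t \<sigma> \<sigma>) (GI.\<Gamma> t) x - P x + P (swap x)"
proof -
  have coeff: "(\<Sum>l\<in>{1..Suc n}. GI.sgn_coeff n l * u l) = (\<Sum>l\<in>{1..n}. u l) - real n * u (n + 1)" for u
  proof -
    have "(\<Sum>l\<in>{1..n}. GI.sgn_coeff n l * u l) = (\<Sum>l\<in>{1..n}. u l)" by (intro sum.cong) (auto simp: GI.sgn_coeff_def)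
    then show ?thesis by (simp add: GI.sgn_coeff_def)
  qed
  have \<gamma>: "GI.\<gamma> n t x \<tau> = (\<Sum>l\<in>{1..n}. GI.\<Gamma> t (x l) \<tau>) - real n * GI.\<Gamma> t (x (n + 1)) \<tau>" for \<tau>
    unfolding GI.\<gamma>_def coeff ..
  define sa where "sa = (\<Sum>l\<in>{1..n}. GI.\<Gamma> t (x l) (x (n + 1)))"
  define sb where "sb = (\<Sum>l\<in>{1..n}. GI.\<Gamma> t (x l) (x (n + 2)))"
  define sd where "sd = (\<Sum>l\<in>{1..n}. GI.\<Gamma> t (x l) (x l))"
  define s2 where "s2 = (\<Sum>l\<in>{1..n}. \<Sum>l'\<in>{l + 1..n}. GI.\<Gamma> t (x l) (x l'))"
  define d where "d = (\<Sum>l\<in>{1..n}. D1 (x l))"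
  have "(\<Sum>j\<in>{1..n}. \<Sum>l\<in>{1..n}. GI.\<Gamma> t (x l) (x j)) = sd + 2 * s2"
  proof -
    have "(\<Sum>j\<in>{1..n}. \<Sum>l\<in>{1..n}. GI.\<Gamma> t (x j) (x l)) = sd + 2 * s2"
      unfolding sd_def s2_def by (rule sum_symmetric_square[of "\<lambda>i j. GI.\<Gamma> t (x i) (x j)"]) (rule \<Gamma>_sym)
    then show ?thesis by (subst sum.swap)
  qed
  moreover have "(\<Sum>j\<in>{1..n}. real n * GI.\<Gamma> t (x (n + 1)) (x j)) = real n * sa"
    unfolding sa_def sum_distrib_left by (intro sum.cong refl arg_cong[where f="\<lambda>u. real n * u"] \<Gamma>_sym)
  ultimately have "(\<Sum>j\<in>{1..n}. GI.\<gamma> n t x (x j)) = sd + 2 * s2 - real n * sa"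
    unfolding \<gamma> sum_subtractf by simp
  moreover have "(\<Sum>j\<in>{1..Suc n}. GI.\<gamma> n t x (x j)) = (\<Sum>j\<in>{1..n}. GI.\<gamma> n t x (x j)) + GI.\<gamma> n t x (x (n + 1))" by simp
  moreover have "GI.\<gamma> n t x (x (n + 1)) = sa - real n * GI.\<Gamma> t (x (n + 1)) (x (n + 1))" unfolding \<gamma> sa_def ..
  moreover have "GI.\<gamma> n t x (x (n + 2)) = sb - real n * GI.\<Gamma> t (x (n + 1)) (x (n + 2))" unfolding \<gamma> sb_def ..
  moreover have "(\<Sum>l\<in>{1..Suc n}. GI.sgn_coeff n l * D1 (x l)) = d - real n * D1 (x (n + 1))" unfolding coeff d_def ..
  ultimately have "GI.Q n t x = (d - real n * D1 (x (n + 1)))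
     + ((sd + 2 * s2 - real n * sa) + (sa - real n * GI.\<Gamma> t (x (n + 1)) (x (n + 1))))
     - real (Suc n) * (sb - real n * GI.\<Gamma> t (x (n + 1)) (x (n + 2)))"
    unfolding GI.Q_def GI.Q0_def by simp
  moreover have "comb (\<lambda>\<sigma>. D1 \<sigma> + GI.\<Gamma> t \<sigma> \<sigma>) (GI.\<Gamma> t) x = (d + sd) - real n * (D1 (x (n + 1)) + GI.\<Gamma> t (x (n + 1)) (x (n + 1)))
     + 2 * s2 - 2 * real n * sa + real n * (real n + 1) * GI.\<Gamma> t (x (n + 1)) (x (n + 2))"
    unfolding comb_def sum.distrib sa_def sd_def s2_def d_def ..
  moreover have "P x = (real n + 1) * sb" "P (swap x) = (real n + 1) * sa" unfolding P_swap unfolding P_def sa_def sb_def by (rule refl)+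
  ultimately show ?thesis by (simp add: algebra_simps)
qed

text \<open>Chosen so that \<open>F x - F (swap x)\<close> collects both antisymmetric leftovers:
  the one from \<open>P\<close> and the one from \<open>comb_coboundary\<close>.\<close>

definition "F x = real n * (real n + 1) * \<phi> (x (n + 2)) - P x"

lemma Q_split: "GI.Q n t x = comb (\<lambda>\<sigma>. h / 2 * A1 \<sigma>) (\<lambda>\<sigma> \<tau>. \<beta>\<^sup>2 * A2 \<sigma> \<tau>) x + comb X0 Y0 x + (F x - F (swap x))"
proof -
  have X: "(\<lambda>\<sigma>. D1 \<sigma> + GI.\<Gamma> t \<sigma> \<sigma>) = (\<lambda>\<sigma>. (h / 2 * A1 \<sigma> + X0 \<sigma>) + (c1 + 2 * \<phi> \<sigma>))"
    by (simp add: X0_def)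
  have Y: "GI.\<Gamma> t = (\<lambda>\<sigma> \<tau>. (\<beta>\<^sup>2 * A2 \<sigma> \<tau> + Y0 \<sigma> \<tau>) + (c2 + \<phi> \<sigma> + \<phi> \<tau>))"
    by (intro ext) (simp add: Y0_def)
  have "comb (\<lambda>\<sigma>. D1 \<sigma> + GI.\<Gamma> t \<sigma> \<sigma>) (GI.\<Gamma> t) x
    = comb (\<lambda>\<sigma>. (h / 2 * A1 \<sigma> + X0 \<sigma>) + (c1 + 2 * \<phi> \<sigma>)) (\<lambda>\<sigma> \<tau>. (\<beta>\<^sup>2 * A2 \<sigma> \<tau> + Y0 \<sigma> \<tau>) + (c2 + \<phi> \<sigma> + \<phi> \<tau>)) x"
    by (rule arg_cong2[where f="\<lambda>X Y. comb X Y x", OF X Y])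
  also have "\<dots> = comb (\<lambda>\<sigma>. h / 2 * A1 \<sigma>) (\<lambda>\<sigma> \<tau>. \<beta>\<^sup>2 * A2 \<sigma> \<tau>) x + comb X0 Y0 x
     + real n * (real n + 1) * (\<phi> (x (n + 2)) - \<phi> (x (n + 1)))"
    unfolding comb_add[of "\<lambda>\<sigma>. h / 2 * A1 \<sigma> + X0 \<sigma>" "\<lambda>\<sigma>. c1 + 2 * \<phi> \<sigma>" "\<lambda>\<sigma> \<tau>. \<beta>\<^sup>2 * A2 \<sigma> \<tau> + Y0 \<sigma> \<tau>" "\<lambda>\<sigma> \<tau>. c2 + \<phi> \<sigma> + \<phi> \<tau>"]
      comb_add[of "\<lambda>\<sigma>. h / 2 * A1 \<sigma>" X0 "\<lambda>\<sigma> \<tau>. \<beta>\<^sup>2 * A2 \<sigma> \<tau>" Y0] comb_coboundary ..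
  finally show ?thesis unfolding Q_eq F_def swap_simps by (simp add: algebra_simps)
qed

section \<open>Estimates of the remainder\<close>

text \<open>All terms except one cancel exactly, leaving
  \<open>h * hatR1 N \<sigma> * \<delta>\<close> with the error \<delta> of
  \<open>drift_expansion\<close>. No error comes from the diagonal of the covariance, since both
  self-overlaps equal 1.\<close>

lemma abs_X0_le:
  assumes \<sigma>: "\<sigma> \<in> good_sphere N"
  shows "\<bar>X0 \<sigma>\<bar> \<le> \<bar>h\<bar> * ((1 + (eps N \<sigma>) ^ 4) / real N)"
proof -
  define u where "u = (eps N \<sigma>)\<^sup>2"
  have u: "0 \<le> u" "u \<le> real N" using good_sphereD(2)[OF \<sigma>] by (simp_all add: u_def)
  define \<delta> where "\<delta> = (real N - 1) * (scale N \<sigma> - 1) - (1 - u) / 2"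
  have \<delta>: "\<bar>\<delta>\<bar> \<le> (1 + u\<^sup>2) / real N"
    unfolding \<delta>_def using N u by (intro drift_expansion) (simp_all add: scale_def u_def)
  have ov: "overlap N \<sigma> \<sigma> = 1" "hatR2 N \<sigma> \<sigma> = 1"
    unfolding hatR2_def using overlap_self[OF _ good_sphereD(1)[OF \<sigma>]] overlap_self[OF _ hat_in_sphere_set[OF N \<sigma>]] N by simp_all
  have \<Gamma>: "GI.\<Gamma> t \<sigma> \<sigma> = \<beta>\<^sup>2 / 2 * (\<xi> 1 - u * \<xi>1 q)"
    unfolding \<Gamma>_eq[OF t] using \<sigma> ov by (simp add: u_def power2_eq_square algebra_simps)
  have D: "D1 \<sigma> = h * hatR1 N \<sigma> * ((real N - 1) * (scale N \<sigma> - 1)) + u * b / 2"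
    using \<sigma> unfolding D1_def sum_hat_eq[OF N] by (simp add: u_def)
  \<comment> \<open>Here \<open>b\<close> matches the coefficients of \<open>u\<close>: its part
    \<open>h * r\<close> cancels the centring of the magnetization, and
    \<open>\<beta>^2 * (1 - q) * \<xi>1 q\<close> minus the diagonal term
    \<open>\<beta>^2 * \<xi>1 q\<close> leaves \<open>- \<beta>^2 * q * \<xi>1 q\<close>, which is
    what \<open>2 * \<phi>\<close> requires.\<close>
  have b: "b = h * r + \<beta>\<^sup>2 * (1 - q) * \<xi>1 q" by (simp add: b_def bconst_def r_def power2_eq_square)
  have "X0 \<sigma> = h * hatR1 N \<sigma> * \<delta>"
    unfolding X0_def D \<Gamma> b A1_def a1_def c1_def \<phi>_def \<delta>_def u_def[symmetric] by (simp add: field_simps)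
  then have "\<bar>X0 \<sigma>\<bar> = \<bar>h\<bar> * (\<bar>hatR1 N \<sigma>\<bar> * \<bar>\<delta>\<bar>)" by (simp add: abs_mult)
  also have "\<dots> \<le> \<bar>h\<bar> * (1 * ((1 + u\<^sup>2) / real N))"
    using hatR1_range[OF N \<sigma>] \<delta> by (intro mult_left_mono mult_mono) auto
  finally show ?thesis by (simp add: u_def power_mult[symmetric])
qed

text \<open>\<open>Y0\<close> is \<open>\<beta>^2 / 2\<close> times the error of
  \<open>covariance_expansion\<close>; the linear coefficient there is twice \<open>a2\<close>, so
  it is absorbed by \<open>\<beta>^2 * A2\<close>.\<close>

lemma abs_Y0_le:
  assumes \<sigma>: "\<sigma> \<in> good_sphere N" and \<tau>: "\<tau> \<in> good_sphere N"
  shows "\<bar>Y0 \<sigma> \<tau>\<bar> \<le> \<beta>\<^sup>2 * C * (5 * (((eps N \<sigma>) ^ 4 + (eps N \<tau>) ^ 4) / real N)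
    + (1 + (eps N \<sigma>)\<^sup>2 + (eps N \<tau>)\<^sup>2) * (hatR2 N \<sigma> \<tau> - q)\<^sup>2)"
proof -
  define e e' \<rho> where "e = eps N \<sigma>" and "e' = eps N \<tau>" and "\<rho> = hatR2 N \<sigma> \<tau>"
  define br where "br = (real N * \<xi> (overlap N \<sigma> \<tau>) - (real N - 1) * \<xi> \<rho> - e * e' * \<xi>1 q)
      - (\<xi> q - q * \<xi>1 q * (e\<^sup>2 + e'\<^sup>2) / 2 + (\<rho> - q) * (\<xi>1 q - (e\<^sup>2 + e'\<^sup>2) / 2 * (q * \<xi>2 q + \<xi>1 q) + e * e' * \<xi>2 q))"
  have C0: "0 \<le> C" using C(1)[OF q] by linarith
  have "\<bar>br\<bar> \<le> 9 * C * ((e ^ 4 + e' ^ 4) / real N) + 2 * C * ((1 + e\<^sup>2 + e'\<^sup>2) * (\<rho> - q)\<^sup>2)"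
    unfolding br_def
  proof (rule covariance_expansion[OF T1 T2 C q])
    show "\<rho> \<in> {-1..1}" unfolding \<rho>_def by (rule hatR2_range[OF N \<sigma> \<tau>])
    show "overlap N \<sigma> \<tau> \<in> {-1..1}" using overlap_range[OF _ good_sphereD(1)[OF \<sigma>] good_sphereD(1)[OF \<tau>]] N by simp
    show "real N * overlap N \<sigma> \<tau> = sqrt (real N - e\<^sup>2) * sqrt (real N - e'\<^sup>2) * \<rho> + e * e'"
      unfolding e_def e'_def \<rho>_def by (rule overlap_decomposition[OF N \<sigma> \<tau>])
    show "e\<^sup>2 \<le> real N" "e'\<^sup>2 \<le> real N" using good_sphereD(2)[OF \<sigma>] good_sphereD(2)[OF \<tau>] by (simp_all add: e_def e'_def)
  qed (use N in simp_all)
  \<comment> \<open>Rounding 9 up to 10 keeps the constant integral after halving.\<close>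
  also have "\<dots> \<le> 10 * C * ((e ^ 4 + e' ^ 4) / real N) + 2 * C * ((1 + e\<^sup>2 + e'\<^sup>2) * (\<rho> - q)\<^sup>2)"
    using C0 by (intro add_mono mult_right_mono) auto
  finally have br: "\<bar>br\<bar> \<le> 10 * C * ((e ^ 4 + e' ^ 4) / real N) + 2 * C * ((1 + e\<^sup>2 + e'\<^sup>2) * (\<rho> - q)\<^sup>2)" .
  have "Y0 \<sigma> \<tau> = \<beta>\<^sup>2 / 2 * br"
    unfolding Y0_def \<Gamma>_eq[OF t] A2_def a2_def c2_def \<phi>_def br_def e_def[symmetric] e'_def[symmetric] \<rho>_def[symmetric]
    using \<sigma> \<tau> by (simp add: field_simps)
  then have "\<bar>Y0 \<sigma> \<tau>\<bar> = \<bar>\<beta>\<^sup>2 / 2\<bar> * \<bar>br\<bar>" by (simp only: abs_mult)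
  then have "\<bar>Y0 \<sigma> \<tau>\<bar> = \<beta>\<^sup>2 / 2 * \<bar>br\<bar>" by simp
  also have "\<dots> \<le> \<beta>\<^sup>2 / 2 * (10 * C * ((e ^ 4 + e' ^ 4) / real N) + 2 * C * ((1 + e\<^sup>2 + e'\<^sup>2) * (\<rho> - q)\<^sup>2))"
    by (intro mult_left_mono br) simp
  also have "\<dots> = \<beta>\<^sup>2 * C * (5 * ((e ^ 4 + e' ^ 4) / real N) + (1 + e\<^sup>2 + e'\<^sup>2) * (\<rho> - q)\<^sup>2)"
    by (simp add: algebra_simps)
  finally show ?thesis by (simp only: e_def e'_def \<rho>_def)
qed

text \<open>The diagonal part has \<open>2 n\<close> terms counted with coefficients. The three
  groups of pairs contribute at most \<open>2 n^2\<close> each: the first because fewer than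
  \<open>n^2\<close> pairs carry the factor 2, the last because
  \<open>n + 1 \<le> 2 n\<close>.\<close>

lemma abs_comb_le:
  assumes X: "\<And>l. l \<in> {1..n + 1} \<Longrightarrow> \<bar>X (x l)\<bar> \<le> bx"
    and Y: "\<And>i j. i \<in> {1..n + 2} \<Longrightarrow> j \<in> {1..n + 2} \<Longrightarrow> i \<noteq> j \<Longrightarrow> \<bar>Y (x i) (x j)\<bar> \<le> by'"
  shows "\<bar>comb X Y x\<bar> \<le> 2 * real n * bx + 6 * (real n)\<^sup>2 * by'"
proof -
  have by0: "0 \<le> by'" using Y[of "n + 1" "n + 2"] by (simp add: order_trans[OF abs_ge_zero])
  have 1: "\<bar>\<Sum>l\<in>{1..n}. X (x l)\<bar> \<le> real n * bx"
  proof -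
    have "\<bar>\<Sum>l\<in>{1..n}. X (x l)\<bar> \<le> (\<Sum>l\<in>{1..n}. bx)" by (intro order_trans[OF sum_abs] sum_mono X) auto
    then show ?thesis by simp
  qed
  have 2: "\<bar>real n * X (x (n + 1))\<bar> \<le> real n * bx" unfolding abs_mult by (simp add: mult_left_mono X)
  have inner: "\<bar>\<Sum>l'\<in>{l + 1..n}. Y (x l) (x l')\<bar> \<le> real n * by'" if "l \<in> {1..n}" for l
  proof -
    have "\<bar>\<Sum>l'\<in>{l + 1..n}. Y (x l) (x l')\<bar> \<le> (\<Sum>l'\<in>{l + 1..n}. by')"
      using that by (intro order_trans[OF sum_abs] sum_mono Y) auto
    also have "\<dots> = real (n - l) * by'" by simp
    also have "\<dots> \<le> real n * by'" by (intro mult_right_mono by0) simp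
    finally show ?thesis .
  qed
  have 3: "\<bar>\<Sum>l\<in>{1..n}. \<Sum>l'\<in>{l + 1..n}. Y (x l) (x l')\<bar> \<le> (real n)\<^sup>2 * by'"
  proof -
    have "\<bar>\<Sum>l\<in>{1..n}. \<Sum>l'\<in>{l + 1..n}. Y (x l) (x l')\<bar> \<le> (\<Sum>l\<in>{1..n}. real n * by')"
      by (intro order_trans[OF sum_abs] sum_mono inner)
    then show ?thesis by (simp add: power2_eq_square mult.assoc)
  qed
  have 4: "\<bar>2 * real n * (\<Sum>l\<in>{1..n}. Y (x l) (x (n + 1)))\<bar> \<le> 2 * ((real n)\<^sup>2 * by')"
  proof -
    have "\<bar>\<Sum>l\<in>{1..n}. Y (x l) (x (n + 1))\<bar> \<le> (\<Sum>l\<in>{1..n}. by')"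
      by (intro order_trans[OF sum_abs] sum_mono Y) auto
    then have "\<bar>\<Sum>l\<in>{1..n}. Y (x l) (x (n + 1))\<bar> \<le> real n * by'" by simp
    then have "2 * real n * \<bar>\<Sum>l\<in>{1..n}. Y (x l) (x (n + 1))\<bar> \<le> 2 * real n * (real n * by')" by (intro mult_left_mono) auto
    then show ?thesis by (simp add: abs_mult power2_eq_square mult.assoc)
  qed
  have 5: "\<bar>real n * (real n + 1) * Y (x (n + 1)) (x (n + 2))\<bar> \<le> 2 * ((real n)\<^sup>2 * by')"
  proof -
    have "\<bar>real n * (real n + 1) * Y (x (n + 1)) (x (n + 2))\<bar> = real n * (real n + 1) * \<bar>Y (x (n + 1)) (x (n + 2))\<bar>" by (simp add: abs_mult)
    also have "\<dots> \<le> real n * (real n + 1) * by'" by (intro mult_left_mono Y) auto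
    also have "\<dots> \<le> real n * (real n + real n) * by'" using n by (intro mult_right_mono mult_left_mono by0) auto
    finally show ?thesis by (simp add: power2_eq_square mult.assoc)
  qed
  show ?thesis unfolding comb_def using 1 2 3 4 5 by linarith
qed

text \<open>The bound is claimed on the full spheres, poles included, while the estimates of
  \<open>X0\<close> and \<open>Y0\<close> hold for good configurations only; the value 0 settles the
  rest.\<close>

definition R :: "(nat \<Rightarrow> nat \<Rightarrow> real) \<Rightarrow> real" where
  "R x = (if good_config x then comb X0 Y0 x else 0)"

lemma C_nonneg: "0 \<le> C"
  using C(1)[OF q] by linarith

text \<open>In \<open>L\<close> the summand \<open>2 n\<close> comes from the diagonal terms and
  \<open>30 n^2 C\<close> from the factor \<open>6 n^2\<close> of \<open>abs_comb_le\<close> times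
  the 5 of \<open>abs_Y0_le\<close>. Neither \<open>N\<close> nor \<open>t\<close> enters.\<close>

lemma R_bound:
  defines "L \<equiv> 2 * real n + 30 * (real n)\<^sup>2 * C"
  shows "\<bar>R x\<bar> \<le> L / real N * (\<beta>\<^sup>2 + \<bar>h\<bar>) * (1 + (\<Sum>l\<in>{1..n + 2}. (eps N (x l)) ^ 4))
     + L * \<beta>\<^sup>2 * (\<Sum>l\<in>{1..n + 2}. \<Sum>l'\<in>{1..n + 2} - {l}. (1 + (eps N (x l))\<^sup>2) * (hatR2 N (x l) (x l') - q)\<^sup>2)"
proof -
  define E where "E = 1 + (\<Sum>l\<in>{1..n + 2}. (eps N (x l)) ^ 4)"
  define D where "D = (\<Sum>l\<in>{1..n + 2}. \<Sum>l'\<in>{1..n + 2} - {l}. (1 + (eps N (x l))\<^sup>2) * (hatR2 N (x l) (x l') - q)\<^sup>2)"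
  have e0: "0 \<le> (eps N (x l)) ^ 4" for l by (simp add: zero_le_even_power)
  have E0: "0 \<le> E" unfolding E_def by (intro add_nonneg_nonneg sum_nonneg e0) auto
  have D0: "0 \<le> D" unfolding D_def by (intro sum_nonneg mult_nonneg_nonneg) auto
  have L0: "0 \<le> L" "2 * real n \<le> L" "30 * (real n)\<^sup>2 * C \<le> L" using C_nonneg by (simp_all add: L_def)
  have "\<bar>R x\<bar> \<le> L / real N * (\<beta>\<^sup>2 + \<bar>h\<bar>) * E + L * \<beta>\<^sup>2 * D"
  proof (cases "good_config x")
    case False
    then show ?thesis using L0 E0 D0 by (simp add: R_def)
  next
    case True
    then have g: "x l \<in> good_sphere N" if "l \<in> {1..n + 2}" for l using that by (simp add: good_config_def)
    have eE: "1 + (eps N (x l)) ^ 4 \<le> E" if "l \<in> {1..n + 2}" for l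
      unfolding E_def using member_le_sum[OF that, of "\<lambda>l. (eps N (x l)) ^ 4"] e0 by simp
    have eE2: "(eps N (x i)) ^ 4 + (eps N (x j)) ^ 4 \<le> E" if ij: "i \<in> {1..n + 2}" "j \<in> {1..n + 2}" "i \<noteq> j" for i j
    proof -
      have "(\<Sum>l\<in>{i, j}. (eps N (x l)) ^ 4) \<le> (\<Sum>l\<in>{1..n + 2}. (eps N (x l)) ^ 4)"
        by (rule sum_mono2) (use ij e0 in auto)
      then show ?thesis using ij by (simp add: E_def)
    qed
    \<comment> \<open>The double sum runs over ordered pairs: \<open>(i, j)\<close> supplies the
      square of the last coordinate of replica \<open>i\<close>, and \<open>(j, i)\<close> that of
      replica \<open>j\<close>.\<close>
    have DD: "(1 + (eps N (x i))\<^sup>2 + (eps N (x j))\<^sup>2) * (hatR2 N (x i) (x j) - q)\<^sup>2 \<le> D"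
      if ij: "i \<in> {1..n + 2}" "j \<in> {1..n + 2}" "i \<noteq> j" for i j
    proof -
      define G where "G l = (\<Sum>l'\<in>{1..n + 2} - {l}. (1 + (eps N (x l))\<^sup>2) * (hatR2 N (x l) (x l') - q)\<^sup>2)" for l
      have G0: "0 \<le> G l" for l unfolding G_def by (intro sum_nonneg mult_nonneg_nonneg) auto
      have Gi: "(1 + (eps N (x i))\<^sup>2) * (hatR2 N (x i) (x j) - q)\<^sup>2 \<le> G i" if "i \<in> {1..n + 2}" "j \<in> {1..n + 2}" "i \<noteq> j" for i j
        unfolding G_def using that by (intro member_le_sum[of j]) auto
      have "G i + G j = (\<Sum>l\<in>{i, j}. G l)" using ij by simp
      also have "\<dots> \<le> D" unfolding D_def G_def[symmetric] by (rule sum_mono2) (use ij G0 in auto)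
      finally have "G i + G j \<le> D" .
      moreover have "hatR2 N (x j) (x i) = hatR2 N (x i) (x j)" unfolding hatR2_def by (rule overlap_commute)
      moreover have "(1 + (eps N (x i))\<^sup>2 + (eps N (x j))\<^sup>2) * (hatR2 N (x i) (x j) - q)\<^sup>2
        \<le> (1 + (eps N (x i))\<^sup>2) * (hatR2 N (x i) (x j) - q)\<^sup>2 + (1 + (eps N (x j))\<^sup>2) * (hatR2 N (x i) (x j) - q)\<^sup>2"
        by (simp add: algebra_simps)
      ultimately show ?thesis using Gi[OF ij] Gi[of j i] ij by fastforce
    qed
    have N0: "0 < real N" using N by simp
    have "\<bar>comb X0 Y0 x\<bar> \<le> 2 * real n * (\<bar>h\<bar> * (E / real N)) + 6 * (real n)\<^sup>2 * (\<beta>\<^sup>2 * C * (5 * (E / real N) + D))"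
    proof (rule abs_comb_le)
      fix l assume l: "l \<in> {1..n + 1}"
      have "\<bar>h\<bar> * ((1 + (eps N (x l)) ^ 4) / real N) \<le> \<bar>h\<bar> * (E / real N)"
        using eE[of l] l N0 by (intro mult_left_mono divide_right_mono) auto
      then show "\<bar>X0 (x l)\<bar> \<le> \<bar>h\<bar> * (E / real N)" using abs_X0_le[OF g, of l] l by fastforce
    next
      fix i j assume ij: "i \<in> {1..n + 2}" "j \<in> {1..n + 2}" "i \<noteq> j"
      have "\<beta>\<^sup>2 * C * (5 * (((eps N (x i)) ^ 4 + (eps N (x j)) ^ 4) / real N) + (1 + (eps N (x i))\<^sup>2 + (eps N (x j))\<^sup>2) * (hatR2 N (x i) (x j) - q)\<^sup>2)
        \<le> \<beta>\<^sup>2 * C * (5 * (E / real N) + D)"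
        using C_nonneg N0 by (intro mult_left_mono add_mono divide_right_mono eE2[OF ij] DD[OF ij]) auto
      then show "\<bar>Y0 (x i) (x j)\<bar> \<le> \<beta>\<^sup>2 * C * (5 * (E / real N) + D)"
        using abs_Y0_le[OF g[OF ij(1)] g[OF ij(2)]] by linarith
    qed
    also have "\<dots> = 2 * real n * (\<bar>h\<bar> * (E / real N)) + (30 * (real n)\<^sup>2 * C * (\<beta>\<^sup>2 * (E / real N)) + 6 * (real n)\<^sup>2 * C * (\<beta>\<^sup>2 * D))"
      by (simp add: algebra_simps)
    also have "\<dots> \<le> L * (\<bar>h\<bar> * (E / real N)) + (L * (\<beta>\<^sup>2 * (E / real N)) + L * (\<beta>\<^sup>2 * D))"
    proof (intro add_mono mult_right_mono)
      have "6 * (real n)\<^sup>2 * C \<le> 30 * (real n)\<^sup>2 * C" using C_nonneg by (intro mult_right_mono) auto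
      then show "6 * (real n)\<^sup>2 * C \<le> L" using L0 by linarith
    qed (use L0 E0 D0 N0 in auto)
    also have "\<dots> = L / real N * (\<beta>\<^sup>2 + \<bar>h\<bar>) * E + L * \<beta>\<^sup>2 * D" by (simp add: algebra_simps add_divide_distrib)
    finally show ?thesis using True by (simp add: R_def)
  qed
  then show ?thesis unfolding E_def D_def .
qed

section \<open>Admissibility of all terms and the derivative formula\<close>

lemma A1_measurable: "A1 \<in> borel_measurable vec_space"
  unfolding A1_def[abs_def] a1_def
  by (intro borel_measurable_times borel_measurable_diff borel_measurable_power borel_measurable_const eps_measurable hatR1_measurable)

lemma A2_measurable: "(\<lambda>(\<sigma>, \<tau>). A2 \<sigma> \<tau>) \<in> borel_measurable (vec_space \<Otimes>\<^sub>M vec_space)"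
proof -
  have e: "(\<lambda>p. eps N (fst p)) \<in> borel_measurable (vec_space \<Otimes>\<^sub>M vec_space)" "(\<lambda>p. eps N (snd p)) \<in> borel_measurable (vec_space \<Otimes>\<^sub>M vec_space)"
    by (rule measurable_compose[OF measurable_fst eps_measurable] measurable_compose[OF measurable_snd eps_measurable])+
  have h: "(\<lambda>p. hat N (fst p) i) \<in> borel_measurable (vec_space \<Otimes>\<^sub>M vec_space)" "(\<lambda>p. hat N (snd p) i) \<in> borel_measurable (vec_space \<Otimes>\<^sub>M vec_space)" for i
    by (rule measurable_compose[OF measurable_fst hat_coord_measurable] measurable_compose[OF measurable_snd hat_coord_measurable])+
  have "(\<lambda>p. A2 (fst p) (snd p)) \<in> borel_measurable (vec_space \<Otimes>\<^sub>M vec_space)"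
    unfolding A2_def a2_def hatR2_def overlap_def
    by (intro borel_measurable_times borel_measurable_diff borel_measurable_add borel_measurable_divide borel_measurable_power borel_measurable_sum borel_measurable_const e h)
  then show ?thesis by (simp add: case_prod_beta')
qed

lemma admissible_A1: "l \<in> {1..n + 2} \<Longrightarrow> admissible (\<lambda>x. A1 (x l))"
proof (rule admissible_coord)
  fix \<sigma> assume \<sigma>: "\<sigma> \<in> good_sphere N"
  have "\<bar>a1 N \<sigma>\<bar> \<le> 1 + real N" using good_sphereD(2)[OF \<sigma>] zero_le_power2[of "eps N \<sigma>"] unfolding a1_def by linarith
  moreover have "\<bar>hatR1 N \<sigma> - r\<bar> \<le> 1 + \<bar>r\<bar>" using hatR1_range[OF N \<sigma>] by linarith
  ultimately show "\<bar>A1 \<sigma>\<bar> \<le> (1 + real N) * (1 + \<bar>r\<bar>)" unfolding A1_def abs_mult by (intro mult_mono) auto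
qed (simp_all add: sphere_vec_measurable A1_measurable)

lemma admissible_A2: "i \<in> {1..n + 2} \<Longrightarrow> j \<in> {1..n + 2} \<Longrightarrow> admissible (\<lambda>x. A2 (x i) (x j))"
proof (rule admissible_pair)
  fix \<sigma> \<tau> assume \<sigma>: "\<sigma> \<in> good_sphere N" and \<tau>: "\<tau> \<in> good_sphere N"
  define e e' where "e = eps N \<sigma>" and "e' = eps N \<tau>"
  have 1: "\<bar>e\<^sup>2 + e'\<^sup>2\<bar> \<le> 2 * real N" using good_sphereD(2)[OF \<sigma>] good_sphereD(2)[OF \<tau>] by (simp add: e_def e'_def)
  have tri: "\<bar>y\<bar> \<le> Y \<Longrightarrow> \<bar>w\<bar> \<le> W \<Longrightarrow> \<bar>(x - y + w) / 2\<bar> \<le> \<bar>x\<bar> + Y + W" for x y w Y W :: real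
  proof -
    assume "\<bar>y\<bar> \<le> Y" "\<bar>w\<bar> \<le> W"
    then have "\<bar>x - y + w\<bar> \<le> \<bar>x\<bar> + Y + W" by linarith
    moreover have "\<bar>(x - y + w) / 2\<bar> \<le> \<bar>x - y + w\<bar>" unfolding abs_divide by simp
    ultimately show ?thesis by (rule order_trans[rotated])
  qed
  have 2: "\<bar>e * e'\<bar> \<le> real N * real N" unfolding abs_mult e_def e'_def by (intro mult_mono eps_le \<sigma> \<tau>) auto
  have "\<bar>(1 / 2) * (e\<^sup>2 + e'\<^sup>2) * (q * \<xi>2 q + \<xi>1 q)\<bar> \<le> real N * \<bar>q * \<xi>2 q + \<xi>1 q\<bar>"
    unfolding abs_mult[of _ "q * \<xi>2 q + \<xi>1 q"] using 1 by (intro mult_right_mono) auto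
  moreover have "\<bar>e * e' * \<xi>2 q\<bar> \<le> real N * real N * \<bar>\<xi>2 q\<bar>"
    unfolding abs_mult[of _ "\<xi>2 q"] by (intro mult_right_mono 2) auto
  ultimately have "\<bar>a2 \<xi>1 \<xi>2 q N \<sigma> \<tau>\<bar> \<le> \<bar>\<xi>1 q\<bar> + real N * \<bar>q * \<xi>2 q + \<xi>1 q\<bar> + real N * real N * \<bar>\<xi>2 q\<bar>"
    unfolding a2_def e_def[symmetric] e'_def[symmetric] by (rule tri)
  moreover have "\<bar>hatR2 N \<sigma> \<tau> - q\<bar> \<le> 2" using hatR2_range[OF N \<sigma> \<tau>] q by auto
  ultimately show "\<bar>A2 \<sigma> \<tau>\<bar> \<le> (\<bar>\<xi>1 q\<bar> + real N * \<bar>q * \<xi>2 q + \<xi>1 q\<bar> + real N * real N * \<bar>\<xi>2 q\<bar>) * 2"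
    unfolding A2_def abs_mult by (intro mult_mono) auto
qed (simp_all only: sphere_vec_pair_measurable A2_measurable)

lemma admissible_\<Gamma>: "i \<in> {1..n + 2} \<Longrightarrow> j \<in> {1..n + 2} \<Longrightarrow> admissible (\<lambda>x. GI.\<Gamma> t (x i) (x j))"
  by (rule admissible_pair[OF _ _ GI.\<Gamma>_measurable GI.abs_\<Gamma>_le])

lemma admissible_\<phi>: "l \<in> {1..n + 2} \<Longrightarrow> admissible (\<lambda>x. \<phi> (x l))"
  unfolding \<phi>_def
proof (rule admissible_cmult, rule admissible_coord)
  show "(\<lambda>\<sigma>. (eps N \<sigma>)\<^sup>2) \<in> borel_measurable (sphere_measure N)"
    by (intro sphere_vec_measurable borel_measurable_power eps_measurable)
  show "\<bar>(eps N \<sigma>)\<^sup>2\<bar> \<le> real N" if "\<sigma> \<in> good_sphere N" for \<sigma>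
    using good_sphereD(2)[OF that] by simp
qed

lemma admissible_diff: "admissible g \<Longrightarrow> admissible g' \<Longrightarrow> admissible (\<lambda>x. g x - g' x)"
  using admissible_add[OF _ admissible_cmult[of g' "-1"], of g] by simp

lemma \<Lambda>_diff: "admissible g \<Longrightarrow> admissible g' \<Longrightarrow> \<Lambda> (\<lambda>x. g x - g' x) = \<Lambda> g - \<Lambda> g'"
  using \<Lambda>_add[OF _ admissible_cmult[of g' "-1"], of g] \<Lambda>_cmult[of g' "-1"] by simp

lemma admissible_D1: "l \<in> {1..n + 2} \<Longrightarrow> admissible (\<lambda>x. D1 (x l))"
  by (rule admissible_coord[OF _ GI.D1m GI.DK(2)])

lemma admissible_X0: "l \<in> {1..n + 2} \<Longrightarrow> admissible (\<lambda>x. X0 (x l))"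
  unfolding X0_def
  by (intro admissible_diff admissible_add admissible_cmult admissible_D1 admissible_\<Gamma> admissible_A1 admissible_\<phi> admissible_const)

lemma admissible_Y0: "i \<in> {1..n + 2} \<Longrightarrow> j \<in> {1..n + 2} \<Longrightarrow> admissible (\<lambda>x. Y0 (x i) (x j))"
  unfolding Y0_def
  by (intro admissible_diff admissible_add admissible_cmult admissible_\<Gamma> admissible_A2 admissible_\<phi> admissible_const)

lemma
  assumes X: "\<And>l. l \<in> {1..n + 2} \<Longrightarrow> admissible (\<lambda>x. X (x l))"
    and Y: "\<And>i j. i \<in> {1..n + 2} \<Longrightarrow> j \<in> {1..n + 2} \<Longrightarrow> admissible (\<lambda>x. Y (x i) (x j))"
  shows admissible_comb: "admissible (comb X Y)"
    and \<Lambda>_comb: "\<Lambda> (comb X Y) = (\<Sum>l\<in>{1..n}. \<Lambda> (\<lambda>x. X (x l))) - real n * \<Lambda> (\<lambda>x. X (x (n + 1)))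
     + 2 * (\<Sum>l\<in>{1..n}. \<Sum>l'\<in>{l + 1..n}. \<Lambda> (\<lambda>x. Y (x l) (x l')))
     - 2 * real n * (\<Sum>l\<in>{1..n}. \<Lambda> (\<lambda>x. Y (x l) (x (n + 1))))
     + real n * (real n + 1) * \<Lambda> (\<lambda>x. Y (x (n + 1)) (x (n + 2)))"
proof -
  have X1: "admissible (\<lambda>x. X (x l))" if "l \<in> {1..n}" for l using X[of l] that by simp
  have X2: "admissible (\<lambda>x. X (x (n + 1)))" by (rule X) simp
  have Y1: "admissible (\<lambda>x. Y (x l) (x l'))" if "l \<in> {1..n}" "l' \<in> {l + 1..n}" for l l' using Y[of l l'] that by simp
  have Y2: "admissible (\<lambda>x. Y (x l) (x (n + 1)))" if "l \<in> {1..n}" for l by (rule Y) (use that in auto)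
  have Y3: "admissible (\<lambda>x. Y (x (n + 1)) (x (n + 2)))" by (rule Y) simp_all
  have f: "finite {1..n}" "finite {l + 1..n}" for l by simp_all
  have S1: "admissible (\<lambda>x. \<Sum>l\<in>{1..n}. X (x l))" by (intro admissible_sum f X1)
  have S2i: "admissible (\<lambda>x. \<Sum>l'\<in>{l + 1..n}. Y (x l) (x l'))" if "l \<in> {1..n}" for l by (intro admissible_sum f Y1 that)
  have S2: "admissible (\<lambda>x. \<Sum>l\<in>{1..n}. \<Sum>l'\<in>{l + 1..n}. Y (x l) (x l'))" by (intro admissible_sum f S2i)
  have S3: "admissible (\<lambda>x. \<Sum>l\<in>{1..n}. Y (x l) (x (n + 1)))" by (intro admissible_sum f Y2)
  note c = admissible_cmult
  show "admissible (comb X Y)"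
    unfolding comb_def[abs_def] by (intro admissible_diff admissible_add c S1 S2 S3 X2 Y3)
  have "\<Lambda> (\<lambda>x. \<Sum>l\<in>{1..n}. \<Sum>l'\<in>{l + 1..n}. Y (x l) (x l')) = (\<Sum>l\<in>{1..n}. \<Lambda> (\<lambda>x. \<Sum>l'\<in>{l + 1..n}. Y (x l) (x l')))"
    by (intro \<Lambda>_sum f S2i)
  also have "\<dots> = (\<Sum>l\<in>{1..n}. \<Sum>l'\<in>{l + 1..n}. \<Lambda> (\<lambda>x. Y (x l) (x l')))"
    by (intro sum.cong refl \<Lambda>_sum f Y1)
  finally have L2: "\<Lambda> (\<lambda>x. \<Sum>l\<in>{1..n}. \<Sum>l'\<in>{l + 1..n}. Y (x l) (x l')) = (\<Sum>l\<in>{1..n}. \<Sum>l'\<in>{l + 1..n}. \<Lambda> (\<lambda>x. Y (x l) (x l')))" .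
  have L1: "\<Lambda> (\<lambda>x. \<Sum>l\<in>{1..n}. X (x l)) = (\<Sum>l\<in>{1..n}. \<Lambda> (\<lambda>x. X (x l)))" by (intro \<Lambda>_sum f X1)
  have L3: "\<Lambda> (\<lambda>x. \<Sum>l\<in>{1..n}. Y (x l) (x (n + 1))) = (\<Sum>l\<in>{1..n}. \<Lambda> (\<lambda>x. Y (x l) (x (n + 1))))" by (intro \<Lambda>_sum f Y2)
  have "\<Lambda> (comb X Y) = \<Lambda> (\<lambda>x. \<Sum>l\<in>{1..n}. X (x l)) - \<Lambda> (\<lambda>x. real n * X (x (n + 1)))
     + \<Lambda> (\<lambda>x. 2 * (\<Sum>l\<in>{1..n}. \<Sum>l'\<in>{l + 1..n}. Y (x l) (x l')))
     - \<Lambda> (\<lambda>x. 2 * real n * (\<Sum>l\<in>{1..n}. Y (x l) (x (n + 1))))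
     + \<Lambda> (\<lambda>x. real n * (real n + 1) * Y (x (n + 1)) (x (n + 2)))"
    unfolding comb_def[abs_def]
    by (subst \<Lambda>_add \<Lambda>_diff, (intro admissible_diff admissible_add c S1 S2 S3 X2 Y3)+)+ (rule refl)
  then show "\<Lambda> (comb X Y) = (\<Sum>l\<in>{1..n}. \<Lambda> (\<lambda>x. X (x l))) - real n * \<Lambda> (\<lambda>x. X (x (n + 1)))
     + 2 * (\<Sum>l\<in>{1..n}. \<Sum>l'\<in>{l + 1..n}. \<Lambda> (\<lambda>x. Y (x l) (x l')))
     - 2 * real n * (\<Sum>l\<in>{1..n}. \<Lambda> (\<lambda>x. Y (x l) (x (n + 1))))
     + real n * (real n + 1) * \<Lambda> (\<lambda>x. Y (x (n + 1)) (x (n + 2)))"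
    unfolding \<Lambda>_cmult[OF S2] \<Lambda>_cmult[OF S3] \<Lambda>_cmult[OF X2] \<Lambda>_cmult[OF Y3] L1 L2 L3 .
qed

lemma admissible_comb_A: "admissible (comb (\<lambda>\<sigma>. h / 2 * A1 \<sigma>) (\<lambda>\<sigma> \<tau>. \<beta>\<^sup>2 * A2 \<sigma> \<tau>))"
  by (intro admissible_comb admissible_cmult admissible_A1 admissible_A2)

lemma admissible_comb_0: "admissible (comb X0 Y0)"
  by (intro admissible_comb admissible_X0 admissible_Y0)

lemma admissible_F: "admissible F"
proof -
  have m: "l \<in> {1..n} \<Longrightarrow> l \<in> {1..n + 2}" "n + 2 \<in> {1..n + 2}" for l by auto
  show ?thesis unfolding F_def[abs_def] P_def
    by (intro admissible_diff admissible_cmult admissible_sum finite_atLeastAtMost admissible_\<phi> admissible_\<Gamma> m)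
qed

text \<open>The antisymmetric part \<open>F x - F (swap x)\<close> has mean zero because the
  functional is invariant under \<open>swap\<close>.\<close>

lemma \<Lambda>_Q: "\<Lambda> (GI.Q n t) = \<Lambda> (comb (\<lambda>\<sigma>. h / 2 * A1 \<sigma>) (\<lambda>\<sigma> \<tau>. \<beta>\<^sup>2 * A2 \<sigma> \<tau>)) + \<Lambda> (comb X0 Y0)"
proof -
  note a = admissible_add[OF admissible_comb_A admissible_comb_0]
  note d = admissible_diff[OF admissible_F \<Lambda>_swap(1)[OF admissible_F]]
  have "GI.Q n t = (\<lambda>x. comb (\<lambda>\<sigma>. h / 2 * A1 \<sigma>) (\<lambda>\<sigma> \<tau>. \<beta>\<^sup>2 * A2 \<sigma> \<tau>) x + comb X0 Y0 x + (F x - F (swap x)))"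
    by (rule ext) (rule Q_split)
  then show ?thesis
    unfolding \<Lambda>_add[OF admissible_comb_A admissible_comb_0, symmetric]
    by (simp only: \<Lambda>_add[OF a d] \<Lambda>_diff[OF admissible_F \<Lambda>_swap(1)[OF admissible_F]] \<Lambda>_swap(2)[OF admissible_F] diff_self add_0_right)
qed

lemma R_measurable_T: "R \<in> borel_measurable (GI.T (n + 2))"
  unfolding R_def[abs_def]
  by (rule measurable_If[OF _ _ good_config_sets]) (use admissible_comb_0 in \<open>simp_all add: admissible_def\<close>)

lemma \<Lambda>_R: "\<Lambda> R = \<Lambda> (comb X0 Y0)"
proof (rule \<Lambda>_cong[OF _ admissible_comb_0])
  have "\<exists>b. \<forall>x. good_config x \<longrightarrow> \<bar>comb X0 Y0 x\<bar> \<le> b" using admissible_comb_0 by (simp add: admissible_def)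
  then show "admissible R" using R_measurable_T by (auto simp: admissible_def R_def)
qed (simp add: R_def)

lemma sets_T: "sets (GI.T k) = sets (Pi\<^sub>M {1..k} (\<lambda>_. vec_space))"
  unfolding GI.T_def by (intro sets_PiM_cong refl sets_sphere_measure)

lemma R_measurable: "R \<in> borel_measurable (Pi\<^sub>M {1..n + 2} (\<lambda>_. vec_space))"
  using R_measurable_T unfolding measurable_cong_sets[OF sets_T refl] .

text \<open>\<open>average_derivative\<close> gives the mean of \<open>f * Q\<close>;
  \<open>\<Lambda>_Q\<close> discards its antisymmetric part, and linearity distributes the mean
  over the explicit terms. Replacing \<open>comb X0 Y0\<close> by \<open>R\<close> changes it
  outside the good configurations only.\<close>

theorem nu_derivative:
  "((\<lambda>s. nu M N (Ht N \<beta> h \<xi>1 q HN HN1 z s) n f) has_real_derivative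
     (h / 2 * (\<Sum>l\<in>{1..n}. \<Lambda> (\<lambda>x. A1 (x l))) - real n * h / 2 * \<Lambda> (\<lambda>x. A1 (x (n + 1)))
      + 2 * \<beta>\<^sup>2 * (\<Sum>l\<in>{1..n}. \<Sum>l'\<in>{l + 1..n}. \<Lambda> (\<lambda>x. A2 (x l) (x l')))
      - 2 * real n * \<beta>\<^sup>2 * (\<Sum>l\<in>{1..n}. \<Lambda> (\<lambda>x. A2 (x l) (x (n + 1))))
      + real n * (real n + 1) * \<beta>\<^sup>2 * \<Lambda> (\<lambda>x. A2 (x (n + 1)) (x (n + 2)))
      + \<Lambda> R)) (at t)"
proof -
  have "((\<lambda>s. GI.average n s f) has_real_derivative GI.average (n + 2) t (\<lambda>x. f x * GI.Q n t x)) (at t)"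
    by (rule GI.average_derivative[OF n t f B inv])
  moreover have Qm: "GI.Q n t \<in> borel_measurable (GI.T (n + 2))" using GI.Q_measurable[of n t] by simp
  have "GI.average (n + 2) t (\<lambda>x. f x * GI.Q n t x) = \<Lambda> (GI.Q n t)"
    unfolding \<Lambda>_def by (rule nu_eq_average[symmetric]) (rule borel_measurable_times[OF f_measurable Qm])
  moreover have "(\<lambda>s. nu M N (Ht N \<beta> h \<xi>1 q HN HN1 z s) n f) = (\<lambda>s. GI.average n s f)"
    by (rule ext) (rule nu_eq_average[OF f])
  moreover have "\<Lambda> (comb (\<lambda>\<sigma>. h / 2 * A1 \<sigma>) (\<lambda>\<sigma> \<tau>. \<beta>\<^sup>2 * A2 \<sigma> \<tau>))
    = h / 2 * (\<Sum>l\<in>{1..n}. \<Lambda> (\<lambda>x. A1 (x l))) - real n * h / 2 * \<Lambda> (\<lambda>x. A1 (x (n + 1)))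
      + 2 * \<beta>\<^sup>2 * (\<Sum>l\<in>{1..n}. \<Sum>l'\<in>{l + 1..n}. \<Lambda> (\<lambda>x. A2 (x l) (x l')))
      - 2 * real n * \<beta>\<^sup>2 * (\<Sum>l\<in>{1..n}. \<Lambda> (\<lambda>x. A2 (x l) (x (n + 1))))
      + real n * (real n + 1) * \<beta>\<^sup>2 * \<Lambda> (\<lambda>x. A2 (x (n + 1)) (x (n + 2)))"
  proof -
    have 1: "\<Lambda> (\<lambda>x. h / 2 * A1 (x l)) = h / 2 * \<Lambda> (\<lambda>x. A1 (x l))" if "l \<in> {1..n + 2}" for l
      by (rule \<Lambda>_cmult[OF admissible_A1[OF that]])
    have 2: "\<Lambda> (\<lambda>x. \<beta>\<^sup>2 * A2 (x i) (x j)) = \<beta>\<^sup>2 * \<Lambda> (\<lambda>x. A2 (x i) (x j))" if "i \<in> {1..n + 2}" "j \<in> {1..n + 2}" for i j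
      by (rule \<Lambda>_cmult[OF admissible_A2[OF that]])
    have s1: "(\<Sum>l\<in>{1..n}. \<Lambda> (\<lambda>x. h / 2 * A1 (x l))) = h / 2 * (\<Sum>l\<in>{1..n}. \<Lambda> (\<lambda>x. A1 (x l)))"
      unfolding sum_distrib_left by (intro sum.cong refl 1) auto
    have s2: "(\<Sum>l\<in>{1..n}. \<Sum>l'\<in>{l + 1..n}. \<Lambda> (\<lambda>x. \<beta>\<^sup>2 * A2 (x l) (x l'))) = \<beta>\<^sup>2 * (\<Sum>l\<in>{1..n}. \<Sum>l'\<in>{l + 1..n}. \<Lambda> (\<lambda>x. A2 (x l) (x l')))"
      unfolding sum_distrib_left by (intro sum.cong refl 2) auto
    have s3: "(\<Sum>l\<in>{1..n}. \<Lambda> (\<lambda>x. \<beta>\<^sup>2 * A2 (x l) (x (n + 1)))) = \<beta>\<^sup>2 * (\<Sum>l\<in>{1..n}. \<Lambda> (\<lambda>x. A2 (x l) (x (n + 1))))"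
      unfolding sum_distrib_left by (intro sum.cong refl 2) auto
    have 3: "\<Lambda> (\<lambda>x. h / 2 * A1 (x (n + 1))) = h / 2 * \<Lambda> (\<lambda>x. A1 (x (n + 1)))" by (rule 1) simp
    have 4: "\<Lambda> (\<lambda>x. \<beta>\<^sup>2 * A2 (x (n + 1)) (x (n + 2))) = \<beta>\<^sup>2 * \<Lambda> (\<lambda>x. A2 (x (n + 1)) (x (n + 2)))" by (rule 2) simp_all
    have comb: "\<Lambda> (comb (\<lambda>\<sigma>. h / 2 * A1 \<sigma>) (\<lambda>\<sigma> \<tau>. \<beta>\<^sup>2 * A2 \<sigma> \<tau>)) = (\<Sum>l\<in>{1..n}. \<Lambda> (\<lambda>x. h / 2 * A1 (x l))) - real n * \<Lambda> (\<lambda>x. h / 2 * A1 (x (n + 1)))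
     + 2 * (\<Sum>l\<in>{1..n}. \<Sum>l'\<in>{l + 1..n}. \<Lambda> (\<lambda>x. \<beta>\<^sup>2 * A2 (x l) (x l')))
     - 2 * real n * (\<Sum>l\<in>{1..n}. \<Lambda> (\<lambda>x. \<beta>\<^sup>2 * A2 (x l) (x (n + 1))))
     + real n * (real n + 1) * \<Lambda> (\<lambda>x. \<beta>\<^sup>2 * A2 (x (n + 1)) (x (n + 2)))"
      by (intro \<Lambda>_comb admissible_cmult admissible_A1 admissible_A2)
    show ?thesis
      unfolding comb s1 s2 s3 3 4 by simp
  qed
  ultimately show ?thesis unfolding \<Lambda>_R using \<Lambda>_Q by (simp only:)
qed

end

theorem theorem1:
  fixes \<xi> \<xi>1 \<xi>2 \<xi>3 :: "real \<Rightarrow> real" and \<beta> h q :: real and n :: nat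
  assumes d1: "\<And>x. x \<in> {-1..1} \<Longrightarrow> (\<xi> has_real_derivative \<xi>1 x) (at x within {-1..1})"
    and d2: "\<And>x. x \<in> {-1..1} \<Longrightarrow> (\<xi>1 has_real_derivative \<xi>2 x) (at x within {-1..1})"
    and d3: "\<And>x. x \<in> {-1..1} \<Longrightarrow> (\<xi>2 has_real_derivative \<xi>3 x) (at x within {-1..1})"
    and c3: "continuous_on {-1..1} \<xi>3"
    and beta: "\<beta> > 0" and hnz: "h \<noteq> 0"
    and q: "0 \<le> q" "q < 1"
    and qeq: "h\<^sup>2 + \<beta>\<^sup>2 * \<xi>1 q = q / (1 - q)\<^sup>2"
    and quniq: "\<And>q'. 0 \<le> q' \<Longrightarrow> q' < 1 \<Longrightarrow> h\<^sup>2 + \<beta>\<^sup>2 * \<xi>1 q' = q' / (1 - q')\<^sup>2 \<Longrightarrow> q' = q"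
    and xi1q: "\<xi>1 q \<ge> 0"
    and n: "n \<ge> 1"
  shows "\<exists>L. \<forall>(N::nat) (t::real) (M::'w measure) HN HN1 z (f :: (nat \<Rightarrow> nat \<Rightarrow> real) \<Rightarrow> real).
     N \<ge> 2 \<and> 0 < t \<and> t < 1 \<and> prob_space M
     \<and> (\<lambda>(w, \<sigma>). HN w \<sigma>) \<in> borel_measurable (M \<Otimes>\<^sub>M vec_space)
     \<and> (\<lambda>(w, \<sigma>). HN1 w \<sigma>) \<in> borel_measurable (M \<Otimes>\<^sub>M vec_space)
     \<and> centered_gaussian_process M HN (sphere_set N)
         (\<lambda>\<sigma> \<tau>. real N * \<xi> (overlap N \<sigma> \<tau>))
     \<and> centered_gaussian_process M HN1 (sphere_set (N - 1))
         (\<lambda>\<sigma> \<tau>. (real N - 1) * \<xi> (overlap (N - 1) \<sigma> \<tau>))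
     \<and> normal_rv M z 0 1
     \<and> indep3 M (Pi\<^sub>M UNIV (\<lambda>_. borel)) HN (Pi\<^sub>M UNIV (\<lambda>_. borel)) HN1 borel z
     \<and> f \<in> borel_measurable (Pi\<^sub>M {1..n} (\<lambda>_. vec_space))
     \<and> (\<exists>B. \<forall>\<sigma>. \<bar>f \<sigma>\<bar> \<le> B)
     \<and> (\<forall>\<sigma> \<sigma>'. (\<forall>l\<in>{1..n}. \<sigma> l = \<sigma>' l) \<longrightarrow> f \<sigma> = f \<sigma>')
     \<longrightarrow>
     (let H = (\<lambda>s. Ht N \<beta> h \<xi>1 q HN HN1 z s);
          r = h * (1 - q);
          \<nu> = (\<lambda>g. nu M N (H t) (n + 2) g)
      in \<exists>R :: (nat \<Rightarrow> nat \<Rightarrow> real) \<Rightarrow> real.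
           R \<in> borel_measurable (Pi\<^sub>M {1..n + 2} (\<lambda>_. vec_space))
         \<and> (\<forall>\<sigma>. (\<forall>l\<in>{1..n + 2}. \<sigma> l \<in> sphere_set N) \<longrightarrow>
              \<bar>R \<sigma>\<bar> \<le> L / real N * (\<beta>\<^sup>2 + \<bar>h\<bar>) * (1 + (\<Sum>l\<in>{1..n + 2}. (eps N (\<sigma> l)) ^ 4))
                 + L * \<beta>\<^sup>2 * (\<Sum>l\<in>{1..n + 2}. \<Sum>l'\<in>{1..n + 2} - {l}.
                      (1 + (eps N (\<sigma> l))\<^sup>2) * (hatR2 N (\<sigma> l) (\<sigma> l') - q)\<^sup>2))
         \<and> ((\<lambda>s. nu M N (H s) n f) has_real_derivative
              (h / 2 * (\<Sum>l\<in>{1..n}. \<nu> (\<lambda>\<sigma>. f \<sigma> * a1 N (\<sigma> l) * (hatR1 N (\<sigma> l) - r)))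
               - real n * h / 2 * \<nu> (\<lambda>\<sigma>. f \<sigma> * a1 N (\<sigma> (n + 1)) * (hatR1 N (\<sigma> (n + 1)) - r))
               + 2 * \<beta>\<^sup>2 * (\<Sum>l\<in>{1..n}. \<Sum>l'\<in>{l + 1..n}.
                    \<nu> (\<lambda>\<sigma>. f \<sigma> * a2 \<xi>1 \<xi>2 q N (\<sigma> l) (\<sigma> l') * (hatR2 N (\<sigma> l) (\<sigma> l') - q)))
               - 2 * real n * \<beta>\<^sup>2 * (\<Sum>l\<in>{1..n}.
                    \<nu> (\<lambda>\<sigma>. f \<sigma> * a2 \<xi>1 \<xi>2 q N (\<sigma> l) (\<sigma> (n + 1))
                          * (hatR2 N (\<sigma> l) (\<sigma> (n + 1)) - q)))
               + real n * (real n + 1) * \<beta>\<^sup>2 *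
                    \<nu> (\<lambda>\<sigma>. f \<sigma> * a2 \<xi>1 \<xi>2 q N (\<sigma> (n + 1)) (\<sigma> (n + 2))
                          * (hatR2 N (\<sigma> (n + 1)) (\<sigma> (n + 2)) - q))
               + \<nu> (\<lambda>\<sigma>. f \<sigma> * R \<sigma>)))
            (at t))"
proof -
  have cont: "continuous_on {-1..1} g" if "\<And>x. x \<in> {-1..1} \<Longrightarrow> (g has_real_derivative g' x) (at x within {-1..1})" for g g' :: "real \<Rightarrow> real"
    using that by (intro DERIV_continuous_on) auto
  have bd: "\<exists>c. \<forall>x\<in>{-1..1}. \<bar>g x\<bar> \<le> c" if "continuous_on {-1..1} g" for g :: "real \<Rightarrow> real"
    using compact_imp_bounded[OF compact_continuous_image[OF that compact_Icc]] by (auto simp: bounded_iff)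
  obtain C1 C2 C3 where C123: "\<forall>x\<in>{-1..1}. \<bar>\<xi>1 x\<bar> \<le> C1" "\<forall>x\<in>{-1..1}. \<bar>\<xi>2 x\<bar> \<le> C2" "\<forall>x\<in>{-1..1}. \<bar>\<xi>3 x\<bar> \<le> C3"
    using bd[OF cont[OF d2]] bd[OF cont[OF d3]] bd[OF c3] by blast
  \<comment> \<open>One constant for all three derivatives on the compact interval of possible
    overlaps. The bound on the third derivative is what makes the Taylor estimate \<open>T2\<close>
    of \<xi>1 available.\<close>
  define C where "C = max C1 (max C2 C3)"
  have C: "\<bar>\<xi>1 x\<bar> \<le> C" "\<bar>\<xi>2 x\<bar> \<le> C" "\<bar>\<xi>3 x\<bar> \<le> C" if "x \<in> {-1..1}" for x
    using C123[rule_format, OF that] by (auto simp: C_def)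
  note T1 = taylor2_bound[OF d1 d2 C(2)] and T2 = taylor2_bound[OF d2 d3 C(3)]
  show ?thesis
  \<comment> \<open>The constant is fixed before \<open>N\<close>, \<open>t\<close>, the probability
    space and \<open>f\<close> are introduced; it depends on \<open>n\<close> and on the bounds for
    the derivatives of \<xi> alone.\<close>
  proof (rule exI[of _ "2 * real n + 30 * (real n)\<^sup>2 * C"], intro allI impI, elim conjE)
    fix N :: nat and t :: real and M :: "'w measure" and HN HN1 z and f :: "(nat \<Rightarrow> nat \<Rightarrow> real) \<Rightarrow> real"
    assume N: "2 \<le> N" and t: "0 < t" "t < 1" and M: "prob_space M"
      and HNm: "(\<lambda>(w, \<sigma>). HN w \<sigma>) \<in> borel_measurable (M \<Otimes>\<^sub>M vec_space)"
      and HN1m: "(\<lambda>(w, \<sigma>). HN1 w \<sigma>) \<in> borel_measurable (M \<Otimes>\<^sub>M vec_space)"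
      and HNg: "centered_gaussian_process M HN (sphere_set N) (\<lambda>\<sigma> \<tau>. real N * \<xi> (overlap N \<sigma> \<tau>))"
      and HN1g: "centered_gaussian_process M HN1 (sphere_set (N - 1)) (\<lambda>\<sigma> \<tau>. (real N - 1) * \<xi> (overlap (N - 1) \<sigma> \<tau>))"
      and zn: "normal_rv M z 0 1"
      and indep: "indep3 M (Pi\<^sub>M UNIV (\<lambda>_. borel)) HN (Pi\<^sub>M UNIV (\<lambda>_. borel)) HN1 borel z"
      and f: "f \<in> borel_measurable (Pi\<^sub>M {1..n} (\<lambda>_. vec_space))"
      and B: "\<exists>B. \<forall>\<sigma>. \<bar>f \<sigma>\<bar> \<le> B"
      and inv: "\<forall>\<sigma> \<sigma>'. (\<forall>l\<in>{1..n}. \<sigma> l = \<sigma>' l) \<longrightarrow> f \<sigma> = f \<sigma>'"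
    obtain B where B: "\<And>\<sigma>. \<bar>f \<sigma>\<bar> \<le> B" using B by blast
    have model: "cavity_model M N HN HN1 z \<xi> \<xi>1 q"
      by (intro cavity_model.intro cavity_model_axioms.intro M N HNm HN1m HNg HN1g zn indep xi1q)
    interpret cavity_model M N HN HN1 z \<xi> \<xi>1 \<beta> h q by (rule model)
    have f': "f \<in> borel_measurable (GI.T n)"
      using f unfolding GI.T_def measurable_cong_sets[OF sets_PiM_cong[OF refl sets_sphere_measure] refl] .
    interpret cavity_derivative M N HN HN1 z \<xi> \<xi>1 \<beta> h q \<xi>2 C n t f B
    proof (intro cavity_derivative.intro cavity_derivative_axioms.intro model)
      show "f x = f x'" if "\<And>l. l \<in> {1..n} \<Longrightarrow> x l = x' l" for x x' using inv that by blast
    qed (use T1 T2 C q n t f' B in auto)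
    have A: "(\<lambda>\<sigma>. f \<sigma> * a1 N (\<sigma> l) * (hatR1 N (\<sigma> l) - h * (1 - q))) = (\<lambda>\<sigma>. f \<sigma> * A1 (\<sigma> l))"
      "(\<lambda>\<sigma>. f \<sigma> * a2 \<xi>1 \<xi>2 q N (\<sigma> l) (\<sigma> l') * (hatR2 N (\<sigma> l) (\<sigma> l') - q)) = (\<lambda>\<sigma>. f \<sigma> * A2 (\<sigma> l) (\<sigma> l'))" for l l'
      by (simp_all only: A1_def A2_def r_def mult.assoc)
    show "let H = (\<lambda>s. Ht N \<beta> h \<xi>1 q HN HN1 z s);
          r = h * (1 - q);
          \<nu> = (\<lambda>g. nu M N (H t) (n + 2) g)
      in \<exists>R :: (nat \<Rightarrow> nat \<Rightarrow> real) \<Rightarrow> real.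
           R \<in> borel_measurable (Pi\<^sub>M {1..n + 2} (\<lambda>_. vec_space))
         \<and> (\<forall>\<sigma>. (\<forall>l\<in>{1..n + 2}. \<sigma> l \<in> sphere_set N) \<longrightarrow>
              \<bar>R \<sigma>\<bar> \<le> (2 * real n + 30 * (real n)\<^sup>2 * C) / real N * (\<beta>\<^sup>2 + \<bar>h\<bar>) * (1 + (\<Sum>l\<in>{1..n + 2}. (eps N (\<sigma> l)) ^ 4))
                 + (2 * real n + 30 * (real n)\<^sup>2 * C) * \<beta>\<^sup>2 * (\<Sum>l\<in>{1..n + 2}. \<Sum>l'\<in>{1..n + 2} - {l}.
                      (1 + (eps N (\<sigma> l))\<^sup>2) * (hatR2 N (\<sigma> l) (\<sigma> l') - q)\<^sup>2))
         \<and> ((\<lambda>s. nu M N (H s) n f) has_real_derivative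
              (h / 2 * (\<Sum>l\<in>{1..n}. \<nu> (\<lambda>\<sigma>. f \<sigma> * a1 N (\<sigma> l) * (hatR1 N (\<sigma> l) - r)))
               - real n * h / 2 * \<nu> (\<lambda>\<sigma>. f \<sigma> * a1 N (\<sigma> (n + 1)) * (hatR1 N (\<sigma> (n + 1)) - r))
               + 2 * \<beta>\<^sup>2 * (\<Sum>l\<in>{1..n}. \<Sum>l'\<in>{l + 1..n}.
                    \<nu> (\<lambda>\<sigma>. f \<sigma> * a2 \<xi>1 \<xi>2 q N (\<sigma> l) (\<sigma> l') * (hatR2 N (\<sigma> l) (\<sigma> l') - q)))
               - 2 * real n * \<beta>\<^sup>2 * (\<Sum>l\<in>{1..n}.
                    \<nu> (\<lambda>\<sigma>. f \<sigma> * a2 \<xi>1 \<xi>2 q N (\<sigma> l) (\<sigma> (n + 1))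
                          * (hatR2 N (\<sigma> l) (\<sigma> (n + 1)) - q)))
               + real n * (real n + 1) * \<beta>\<^sup>2 *
                    \<nu> (\<lambda>\<sigma>. f \<sigma> * a2 \<xi>1 \<xi>2 q N (\<sigma> (n + 1)) (\<sigma> (n + 2))
                          * (hatR2 N (\<sigma> (n + 1)) (\<sigma> (n + 2)) - q))
               + \<nu> (\<lambda>\<sigma>. f \<sigma> * R \<sigma>)))
            (at t)"
      unfolding Let_def A
      using R_measurable R_bound nu_derivative[unfolded \<Lambda>_def] by blast
  qed
qed

end
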